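(* Let $d\ge 4$ be an integer, let $\Omega\subset\mathbb{R}^d$ be an open bounded domain, let $a,b>0$ be two fixed numbers, and let $\mathcal{E}_{a,b}:H_0^1(\Omega)\to\mathbb{R}$ be the functional $$\mathcal{E}_{a,b}(u)=\frac{a}{2}\|u\|^2+\frac{b}{4}\|u\|^4-\frac{1}{2^*}\|u\|_{2^*}^{2^*}.$$ Then the following statements hold: (i) $\mathcal{E}_{a,b}$ is sequentially weakly lower semicontinuous on $H_0^1(\Omega)$ if and only if $a^{\frac{d-4}{2}}b\ge \mathtt{L}_d$. (ii) $\mathcal{E}_{a,b}$ satisfies the Palais-Smale condition on $H_0^1(\Omega)$ whenever $a^{\frac{d-4}{2}}b>\mathtt{PS}_d$. (iii) $\mathcal{E}_{a,b}$ is convex on $H_0^1(\Omega)$ whenever $a^{\frac{d-4}{2}}b\ge \mathtt{C}_d$. In addition, $\mathcal{E}_{a,b}$ is strictly convex on $H_0^1(\Omega)$ whenever $a^{\frac{d-4}{2}}b>\mathtt{C}_d$.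
   Context: Here $2^*=\frac{2d}{d-2}$ is the critical Sobolev exponent; $H_0^1(\Omega)$ is the usual Sobolev space of real-valued functions with norm $\|u\|=\left(\int_\Omega|\nabla u|^2\right)^{1/2}$, and $\|u\|_q=\left(\int_\Omega|u|^q\right)^{1/q}$ is the $L^q(\Omega)$ norm. The sharp Sobolev constant is $$\mathtt{S}_d=\inf_{u\in H_0^1(\Omega)\setminus\{0\}}\frac{\|u\|^2}{\|u\|_{2^*}^2},$$ which depends only on $d$ (not on $\Omega$). The constants are, for $d>4$, $$\mathtt{L}_d=\frac{4(d-4)^{\frac{d-4}{2}}}{d^{\frac{d-2}{2}}\mathtt{S}_d^{\frac d2}},\qquad \mathtt{PS}_d=\frac{2(d-4)^{\frac{d-4}{2}}}{(d-2)^{\frac{d-2}{2}}\mathtt{S}_d^{\frac d2}},\qquad \mathtt{C}_d=\frac{2(d-4)^{\frac{d-4}{2}}(d+2)^{\frac{d-2}{2}}}{(d-2)^{d-2}\mathtt{S}_d^{\frac d2}},$$ and, for $d=4$, $\mathtt{L}_4=\mathtt{PS}_4=\frac{1}{\mathtt{S}_4^2}$, $\mathtt{C}_4=\frac{3}{\mathtt{S}_4^2}$. The functional $\mathcal{E}_{a,b}$ is the energy functional associated with the problem $-\left(a+b\int_\Omega|\nabla u|^2\right)\Delta u=|u|^{2^*-2}u$ in $\Omega$, $u=0$ on $\partial\Omega$. Sequential weak lower semicontinuity means: $u_n\rightharpoonup u$ weakly in $H_0^1(\Omega)$ implies $\mathcal{E}_{a,b}(u)\le\liminf_{n\to\infty}\mathcal{E}_{a,b}(u_n)$.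 The Palais-Smale condition means: every sequence $\{u_n\}\subset H_0^1(\Omega)$ such that $\mathcal{E}_{a,b}(u_n)\to c$ for some $c\in\mathbb{R}$ and $\mathcal{E}_{a,b}'(u_n)\to0$ in the dual of $H_0^1(\Omega)$ has a subsequence converging strongly in $H_0^1(\Omega)$. *)

theory Defs
  imports "HOL-Analysis.Analysis"
begin

section \<open>Test functions\<close>

definition gradient :: "(real ^ 'n \<Rightarrow> real) \<Rightarrow> real ^ 'n \<Rightarrow> real ^ 'n" where
  "gradient f x = (\<chi> i. frechet_derivative f (at x) (axis i 1))"

primrec Ck :: "nat \<Rightarrow> (real ^ 'n \<Rightarrow> real) \<Rightarrow> bool" where
  "Ck 0 f \<longleftrightarrow> continuous_on UNIV f"
| "Ck (Suc k) f \<longleftrightarrow> (\<forall>x. f differentiable (at x)) \<and> (\<forall>i. Ck k (\<lambda>x. gradient f x $ i))"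

text \<open>$C_c^\infty(\Omega)$, with functions on $\Omega$ identified with their extensions by zero.\<close>

definition test_functions :: "(real ^ 'n) set \<Rightarrow> (real ^ 'n \<Rightarrow> real) set" where
  "test_functions \<Omega> = {\<phi>. (\<forall>k. Ck k \<phi>)
     \<and> compact (closure {x. \<phi> x \<noteq> 0}) \<and> closure {x. \<phi> x \<noteq> 0} \<subseteq> \<Omega>}"


section \<open>The space $H_0^1(\Omega)$\<close>

text \<open>
  Elements of the function spaces are represented by total functions on the whole of
  $\mathbb{R}^n$. Everything below depends only on the almost-everywhere class of their
  restrictions to \<open>\<Omega>\<close>; equality of elements is therefore \<open>ae_eq \<Omega>\<close>, never \<open>=\<close>.
\<close>

definition ae_eq :: "(real ^ 'n) set \<Rightarrow> (real ^ 'n \<Rightarrow> real) \<Rightarrow> (real ^ 'n \<Rightarrow> real) \<Rightarrow> bool" where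
  "ae_eq \<Omega> u v \<longleftrightarrow> (AE x in lebesgue_on \<Omega>. u x = v x)"

definition square_integrable :: "(real ^ 'n) set \<Rightarrow> (real ^ 'n \<Rightarrow> 'b::euclidean_space) \<Rightarrow> bool" where
  "square_integrable \<Omega> f \<longleftrightarrow> f \<in> borel_measurable (lebesgue_on \<Omega>)
     \<and> integrable (lebesgue_on \<Omega>) (\<lambda>x. (norm (f x))\<^sup>2)"

definition has_weak_gradient ::
  "(real ^ 'n) set \<Rightarrow> (real ^ 'n \<Rightarrow> real) \<Rightarrow> (real ^ 'n \<Rightarrow> real ^ 'n) \<Rightarrow> bool" where
  "has_weak_gradient \<Omega> u g \<longleftrightarrow> square_integrable \<Omega> u \<and> square_integrable \<Omega> g
     \<and> (\<forall>\<phi>\<in>test_functions \<Omega>. \<forall>i.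
          (LINT x|lebesgue_on \<Omega>. u x * gradient \<phi> x $ i) = - (LINT x|lebesgue_on \<Omega>. g x $ i * \<phi> x))"

definition H1 :: "(real ^ 'n) set \<Rightarrow> (real ^ 'n \<Rightarrow> real) set" where
  "H1 \<Omega> = {u. \<exists>g. has_weak_gradient \<Omega> u g}"

text \<open>The weak gradient is unique up to null sets, so the choice is immaterial under integrals.\<close>

definition weak_gradient :: "(real ^ 'n) set \<Rightarrow> (real ^ 'n \<Rightarrow> real) \<Rightarrow> real ^ 'n \<Rightarrow> real ^ 'n" where
  "weak_gradient \<Omega> u = (SOME g. has_weak_gradient \<Omega> u g)"

definition H1_norm :: "(real ^ 'n) set \<Rightarrow> (real ^ 'n \<Rightarrow> real) \<Rightarrow> real" where
  "H1_norm \<Omega> u = sqrt ((LINT x|lebesgue_on \<Omega>. (u x)\<^sup>2)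
     + (LINT x|lebesgue_on \<Omega>. (norm (weak_gradient \<Omega> u x))\<^sup>2))"

definition H01 :: "(real ^ 'n) set \<Rightarrow> (real ^ 'n \<Rightarrow> real) set" where
  "H01 \<Omega> = {u \<in> H1 \<Omega>. \<exists>\<phi>. (\<forall>n::nat. \<phi> n \<in> test_functions \<Omega>)
     \<and> (\<lambda>n. H1_norm \<Omega> (\<lambda>x. u x - \<phi> n x)) \<longlonglongrightarrow> 0}"

definition H01_norm :: "(real ^ 'n) set \<Rightarrow> (real ^ 'n \<Rightarrow> real) \<Rightarrow> real" where
  "H01_norm \<Omega> u = sqrt (LINT x|lebesgue_on \<Omega>. (norm (weak_gradient \<Omega> u x))\<^sup>2)"

definition Lq_norm :: "(real ^ 'n) set \<Rightarrow> real \<Rightarrow> (real ^ 'n \<Rightarrow> real) \<Rightarrow> real" where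
  "Lq_norm \<Omega> q u = (LINT x|lebesgue_on \<Omega>. \<bar>u x\<bar> powr q) powr (1 / q)"


section \<open>Topological and variational notions on $H_0^1(\Omega)$\<close>

text \<open>
  Functionals on $H_0^1(\Omega)$ are total functions of which only the values on \<open>H01 \<Omega>\<close> matter.
  The bound makes dual elements respect \<open>ae_eq\<close>.
\<close>

definition H01_dual :: "(real ^ 'n) set \<Rightarrow> ((real ^ 'n \<Rightarrow> real) \<Rightarrow> real) set" where
  "H01_dual \<Omega> = {f. (\<forall>u\<in>H01 \<Omega>. \<forall>v\<in>H01 \<Omega>. f (\<lambda>x. u x + v x) = f u + f v)
     \<and> (\<forall>u\<in>H01 \<Omega>. \<forall>c. f (\<lambda>x. c * u x) = c * f u)
     \<and> (\<exists>C. \<forall>u\<in>H01 \<Omega>. \<bar>f u\<bar> \<le> C * H01_norm \<Omega> u)}"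

definition dual_norm :: "(real ^ 'n) set \<Rightarrow> ((real ^ 'n \<Rightarrow> real) \<Rightarrow> real) \<Rightarrow> real" where
  "dual_norm \<Omega> f = Sup {\<bar>f v\<bar> | v. v \<in> H01 \<Omega> \<and> H01_norm \<Omega> v \<le> 1}"

definition weakly_converges ::
  "(real ^ 'n) set \<Rightarrow> (nat \<Rightarrow> real ^ 'n \<Rightarrow> real) \<Rightarrow> (real ^ 'n \<Rightarrow> real) \<Rightarrow> bool" where
  "weakly_converges \<Omega> U u \<longleftrightarrow> (\<forall>n. U n \<in> H01 \<Omega>) \<and> u \<in> H01 \<Omega>
     \<and> (\<forall>f\<in>H01_dual \<Omega>. (\<lambda>n. f (U n)) \<longlonglongrightarrow> f u)"

definition strongly_converges ::
  "(real ^ 'n) set \<Rightarrow> (nat \<Rightarrow> real ^ 'n \<Rightarrow> real) \<Rightarrow> (real ^ 'n \<Rightarrow> real) \<Rightarrow> bool" where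
  "strongly_converges \<Omega> U u \<longleftrightarrow> (\<forall>n. U n \<in> H01 \<Omega>) \<and> u \<in> H01 \<Omega>
     \<and> (\<lambda>n. H01_norm \<Omega> (\<lambda>x. U n x - u x)) \<longlonglongrightarrow> 0"

definition seq_weakly_lsc :: "(real ^ 'n) set \<Rightarrow> ((real ^ 'n \<Rightarrow> real) \<Rightarrow> real) \<Rightarrow> bool" where
  "seq_weakly_lsc \<Omega> F \<longleftrightarrow>
     (\<forall>U u. weakly_converges \<Omega> U u \<longrightarrow> ereal (F u) \<le> liminf (\<lambda>n. ereal (F (U n))))"

text \<open>\<open>L\<close> is the Frechet derivative of \<open>F\<close> at \<open>u\<close>.\<close>

definition H01_has_derivative ::
  "(real ^ 'n) set \<Rightarrow> ((real ^ 'n \<Rightarrow> real) \<Rightarrow> real) \<Rightarrow> ((real ^ 'n \<Rightarrow> real) \<Rightarrow> real)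
     \<Rightarrow> (real ^ 'n \<Rightarrow> real) \<Rightarrow> bool" where
  "H01_has_derivative \<Omega> F L u \<longleftrightarrow> L \<in> H01_dual \<Omega>
     \<and> (\<forall>\<epsilon>>0. \<exists>\<delta>>0. \<forall>v\<in>H01 \<Omega>. H01_norm \<Omega> v < \<delta> \<longrightarrow>
          \<bar>F (\<lambda>x. u x + v x) - F u - L v\<bar> \<le> \<epsilon> * H01_norm \<Omega> v)"

text \<open>\<open>L n\<close> plays the role of $F'(u_n)$, which is unique on \<open>H01 \<Omega>\<close>.\<close>

definition palais_smale :: "(real ^ 'n) set \<Rightarrow> ((real ^ 'n \<Rightarrow> real) \<Rightarrow> real) \<Rightarrow> bool" where
  "palais_smale \<Omega> F \<longleftrightarrow>
     (\<forall>U L c. (\<forall>n. U n \<in> H01 \<Omega>) \<and> (\<lambda>n. F (U n)) \<longlonglongrightarrow> c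
         \<and> (\<forall>n. H01_has_derivative \<Omega> F (L n) (U n)) \<and> (\<lambda>n. dual_norm \<Omega> (L n)) \<longlonglongrightarrow> 0
       \<longrightarrow> (\<exists>r u. strict_mono (r :: nat \<Rightarrow> nat) \<and> strongly_converges \<Omega> (\<lambda>k. U (r k)) u))"

definition convex_functional :: "(real ^ 'n) set \<Rightarrow> ((real ^ 'n \<Rightarrow> real) \<Rightarrow> real) \<Rightarrow> bool" where
  "convex_functional \<Omega> F \<longleftrightarrow> (\<forall>u\<in>H01 \<Omega>. \<forall>v\<in>H01 \<Omega>. \<forall>t. 0 \<le> t \<and> t \<le> 1 \<longrightarrow>
     F (\<lambda>x. (1 - t) * u x + t * v x) \<le> (1 - t) * F u + t * F v)"

definition strictly_convex_functional ::
  "(real ^ 'n) set \<Rightarrow> ((real ^ 'n \<Rightarrow> real) \<Rightarrow> real) \<Rightarrow> bool" where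
  "strictly_convex_functional \<Omega> F \<longleftrightarrow>
     (\<forall>u\<in>H01 \<Omega>. \<forall>v\<in>H01 \<Omega>. \<forall>t. \<not> ae_eq \<Omega> u v \<and> 0 < t \<and> t < 1 \<longrightarrow>
        F (\<lambda>x. (1 - t) * u x + t * v x) < (1 - t) * F u + t * F v)"


section \<open>Constants and the energy functional\<close>

definition crit_exp :: "nat \<Rightarrow> real" where
  "crit_exp d = 2 * real d / (real d - 2)"

definition sobolev_const :: "(real ^ 'n) set \<Rightarrow> real" where
  "sobolev_const \<Omega> = Inf {(H01_norm \<Omega> u)\<^sup>2 / (Lq_norm \<Omega> (crit_exp CARD('n)) u)\<^sup>2 | u.
     u \<in> H01 \<Omega> \<and> \<not> ae_eq \<Omega> u (\<lambda>_. 0)}"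

text \<open>
  In the constants below, \<open>S\<close> is the Sobolev constant. The case \<open>d = 4\<close> is separate because
  \<open>0 powr 0 = 0\<close>.
\<close>

definition L_const :: "nat \<Rightarrow> real \<Rightarrow> real" where
  "L_const d S = (if d = 4 then 1 / S\<^sup>2
     else 4 * (real d - 4) powr ((real d - 4) / 2)
          / (real d powr ((real d - 2) / 2) * S powr (real d / 2)))"

definition PS_const :: "nat \<Rightarrow> real \<Rightarrow> real" where
  "PS_const d S = (if d = 4 then 1 / S\<^sup>2
     else 2 * (real d - 4) powr ((real d - 4) / 2)
          / ((real d - 2) powr ((real d - 2) / 2) * S powr (real d / 2)))"

definition C_const :: "nat \<Rightarrow> real \<Rightarrow> real" where
  "C_const d S = (if d = 4 then 3 / S\<^sup>2
     else 2 * (real d - 4) powr ((real d - 4) / 2) * (real d + 2) powr ((real d - 2) / 2)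
          / ((real d - 2) powr (real d - 2) * S powr (real d / 2)))"

definition energy :: "(real ^ 'n) set \<Rightarrow> real \<Rightarrow> real \<Rightarrow> (real ^ 'n \<Rightarrow> real) \<Rightarrow> real" where
  "energy \<Omega> a b u = a / 2 * (H01_norm \<Omega> u)\<^sup>2 + b / 4 * (H01_norm \<Omega> u) ^ 4
     - 1 / crit_exp CARD('n) * Lq_norm \<Omega> (crit_exp CARD('n)) u powr crit_exp CARD('n)"

end

theory Submission
  imports Defs "HOL-Library.Diagonal_Subsequence"
begin

text \<open>
  Everything rests on the inequality $a+\beta\sigma\ge\kappa\sigma^{2/(d-2)}$ with
  $\sigma=\|u\|^2$: by the weighted arithmetic--geometric mean inequality it holds for all
  $\sigma\ge0$ exactly when $a^{(d-4)/2}\beta$ reaches a threshold, and the choices of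
  $(\beta,\kappa)$ made by the three parts produce $L_d$, $PS_d$ and $C_d$.

  (i) If $u_n\rightharpoonup u$ with bounded norms, Rellich's theorem gives almost everywhere
  convergence of a subsequence, and the Brezis--Lieb lemma gives
  $E(u_n)\ge E(u)+E(u_n-u)+o(1)$, where $E(u_n-u)\ge0$ by Sobolev's inequality. Below the
  threshold a near optimal test function for $S_d$ has a multiple of negative energy; its
  copies rescaled into disjoint sets have the same energy and tend weakly to $0$.

  (ii) A Palais--Smale sequence is bounded. Along a subsequence with weak limit $u$, testing the
  derivative with $w_n=u_n-u$ and using the Brezis--Lieb lemma gives
  $\|w_n\|^2\,(a+b\|w_n\|^2-S_d^{-2^*/2}\|w_n\|^{2^*-2})\le o(1)$.

  (iii) The second derivative of $E$ at $u$ in direction $w$ is at least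
  $\|w\|^2\,(a+b\|u\|^2-(2^*-1)S_d^{-2^*/2}\|u\|^{2^*-2})$.
\<close>

section \<open>Smooth functions and bumps\<close>

text \<open>The embedding of \<open>H01\<close> into the space with critical exponent p =
  \<open>crit_exp\<close> is not compact: along u_n = u + w_n the integral of |w_n|^p may survive
  although w_n tends weakly to 0. What survives is never identified. Brezis-Lieb separates it from
  u, and Sobolev's inequality with the sharp constant K = S^(-p/2) bounds it by K \<sigma>^(1 +
  2/(d-2)), where \<sigma> = ||w_n||^2. After division by \<sigma> only the scalar inequality
  remains. Its data come from the order of differentiation: the energy, written as \<sigma>/2 times
  a bracket, gives \<beta> = b/2 and \<kappa> = 2K/p, whence the factor 2 between L_d and its
  threshold; the derivative gives \<beta> = b and \<kappa> = K; the second derivative gives \<beta>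
  = b and \<kappa> = (p-1)K. In dimension 4 the exponent 2/(d-2) is 1 and p = 4, so the scalar
  inequality is linear and coefficients are compared directly.\<close>

definition smooth :: "(real ^ 'n \<Rightarrow> real) \<Rightarrow> bool" where
  "smooth f \<longleftrightarrow> (\<forall>k. Ck k f)"

section \<open>Calculus of \<open>gradient\<close> and closure properties of
  \<open>Ck\<close>\<close>

lemma gradient_eq:
  assumes "(f has_derivative f') (at x)"
  shows "gradient f x = (\<chi> i. f' (axis i 1))"
  unfolding gradient_def using frechet_derivative_at[OF assms] by simp

lemma has_derivative_gradient:
  assumes "f differentiable (at x)"
  shows "(f has_derivative (\<lambda>h. gradient f x \<bullet> h)) (at x)"
proof -
  obtain f' where f': "(f has_derivative f') (at x)"
    using assms differentiable_def by blast
  have lin: "linear f'"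
    using f' by (rule has_derivative_linear)
  have "f' h = gradient f x \<bullet> h" for h
  proof -
    have "f' h = f' (\<Sum>i\<in>UNIV. h $ i *\<^sub>R axis i 1)"
      using basis_expansion[of h] by (simp add: scalar_mult_eq_scaleR)
    also have "\<dots> = (\<Sum>i\<in>UNIV. h $ i * f' (axis i 1))"
      by (simp add: linear_sum[OF lin] linear_cmul[OF lin])
    finally show ?thesis
      by (simp add: gradient_eq[OF f'] inner_vec_def mult.commute)
  qed
  then have "f' = (\<lambda>h. gradient f x \<bullet> h)" by auto
  with f' show ?thesis by simp
qed

text \<open>\<open>Ck (Suc k)\<close> asks for differentiability and for regularity of the partial
  derivatives, not for continuity of the function itself; the base case therefore passes through
  continuity of differentiable functions.\<close>

lemma Ck_Suc_imp_Ck: "Ck (Suc k) f \<Longrightarrow> Ck k f"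
proof (induction k arbitrary: f)
  case 0
  then show ?case
    by (auto intro!: continuous_at_imp_continuous_on differentiable_imp_continuous_within)
next
  case (Suc k)
  have "Ck k (\<lambda>x. gradient f x $ i)" for i
    using Suc.prems by (intro Suc.IH) simp
  with Suc.prems show ?case by simp
qed

lemma Ck_const: "Ck k (\<lambda>x. c)"
proof (induction k arbitrary: c)
  case (Suc k)
  have "gradient (\<lambda>x::real^'a. c) x $ i = 0" for x i
    by (subst gradient_eq[OF has_derivative_const]) simp
  then show ?case using Suc[of 0] by simp
qed simp

lemma gradient_add:
  assumes "f differentiable (at x)" "g differentiable (at x)"
  shows "gradient (\<lambda>x. f x + g x) x = gradient f x + gradient g x"
  by (subst gradient_eq[OF has_derivative_add[OF assms[THEN has_derivative_gradient]]])
    (simp add: vec_eq_iff inner_axis)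

lemma gradient_mult:
  assumes "f differentiable (at x)" "g differentiable (at x)"
  shows "gradient (\<lambda>x. f x * g x) x = f x *\<^sub>R gradient g x + g x *\<^sub>R gradient f x"
  by (subst gradient_eq[OF has_derivative_mult[OF assms[THEN has_derivative_gradient]]])
    (simp add: vec_eq_iff inner_axis algebra_simps)

lemma gradient_cmult:
  assumes "f differentiable (at x)"
  shows "gradient (\<lambda>x. c * f x) x = c *\<^sub>R gradient f x"
  by (subst gradient_eq[OF has_derivative_mult_right[OF has_derivative_gradient[OF assms]]])
    (simp add: vec_eq_iff inner_axis algebra_simps)

lemma gradient_affine:
  fixes f :: "real ^ 'n \<Rightarrow> real"
  assumes "f differentiable (at (c *\<^sub>R x + v))"
  shows "gradient (\<lambda>x. f (c *\<^sub>R x + v)) x = c *\<^sub>R gradient f (c *\<^sub>R x + v)"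
proof -
  have "((\<lambda>x. c *\<^sub>R x + v) has_derivative (\<lambda>h. c *\<^sub>R h)) (at x)"
    by (auto intro!: derivative_eq_intros)
  from gradient_eq[OF has_derivative_compose[OF this has_derivative_gradient[OF assms]]]
  show ?thesis by (simp add: vec_eq_iff inner_axis)
qed

lemma differentiable_affine:
  fixes f :: "real ^ 'n \<Rightarrow> real"
  assumes "\<forall>x. f differentiable (at x)"
  shows "(\<lambda>x. f (c *\<^sub>R x + v)) differentiable (at x)"
  using differentiable_compose[of f "\<lambda>x. c *\<^sub>R x + v" x UNIV] assms by auto

lemma Ck_add: "Ck k f \<Longrightarrow> Ck k g \<Longrightarrow> Ck k (\<lambda>x. f x + g x)"
proof (induction k arbitrary: f g)
  case (Suc k)
  have "gradient (\<lambda>x. f x + g x) x = gradient f x + gradient g x" for x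
    using Suc.prems by (intro gradient_add) auto
  with Suc show ?case by simp
qed (auto intro: continuous_intros)

lemma Ck_mult: "Ck k f \<Longrightarrow> Ck k g \<Longrightarrow> Ck k (\<lambda>x. f x * g x)"
proof (induction k arbitrary: f g)
  case (Suc k)
  have "gradient (\<lambda>x. f x * g x) x = f x *\<^sub>R gradient g x + g x *\<^sub>R gradient f x" for x
    using Suc.prems by (intro gradient_mult) auto
  moreover have "Ck k f" "Ck k g"
    using Suc.prems by (auto intro: Ck_Suc_imp_Ck)
  ultimately show ?case using Suc by (auto intro!: Ck_add)
qed (auto intro: continuous_intros)

lemma Ck_affine: "Ck k f \<Longrightarrow> Ck k (\<lambda>x. f (c *\<^sub>R x + v))"
proof (induction k arbitrary: f)
  case 0
  then have "continuous_on UNIV f" by simp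
  then have "continuous_on UNIV (\<lambda>x. f (c *\<^sub>R x + v))"
    by (rule continuous_on_compose2) (auto intro!: continuous_intros)
  then show ?case by simp
next
  case (Suc k)
  have "gradient (\<lambda>x. f (c *\<^sub>R x + v)) x = c *\<^sub>R gradient f (c *\<^sub>R x + v)" for x
    using Suc.prems by (intro gradient_affine) auto
  moreover have "Ck k (\<lambda>x. c * gradient f (c *\<^sub>R x + v) $ i)" for i
    using Suc by (intro Ck_mult Ck_const Suc.IH) auto
  ultimately show ?case using Suc.prems
    by (auto intro: differentiable_affine)
qed

lemma Ck_prod: "finite I \<Longrightarrow> (\<And>i. i \<in> I \<Longrightarrow> Ck k (f i)) \<Longrightarrow> Ck k (\<lambda>x. \<Prod>i\<in>I. f i x)"
  by (induction I rule: finite_induct) (auto intro: Ck_mult Ck_const)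

section \<open>Smooth cutoff functions on boxes\<close>

text \<open>The family is closed under differentiation, so \<open>flat 1\<close> is a smooth function on the
  line that is flat at \<open>0\<close>.\<close>

definition flat :: "real poly \<Rightarrow> real \<Rightarrow> real" where
  "flat p t = (if t > 0 then poly p (1 / t) * exp (- (1 / t)) else 0)"

lemma tendsto_poly_mult_exp_minus: "((\<lambda>x::real. poly p x * exp (- x)) \<longlongrightarrow> 0) at_top"
proof -
  have "((\<lambda>x::real. \<Sum>i\<le>degree p. coeff p i * (x ^ i / exp x)) \<longlongrightarrow> (\<Sum>i\<le>degree p. coeff p i * 0)) at_top"
    by (intro tendsto_intros tendsto_power_div_exp_0)
  then show ?thesis
    by (simp add: poly_altdef sum_distrib_right sum_divide_distrib exp_minus field_simps)
qed

text \<open>For t > 0 the derivative of p(1/t) exp(-1/t) is (1/t)^2 (p - p')(1/t) exp(-1/t), and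
  \<open>[:0, 0, 1:]\<close> is the polynomial X^2; this keeps the family closed under
  differentiation. At 0 the exponential beats every power of 1/t.\<close>

lemma flat_has_derivative:
  "(flat p has_real_derivative flat ([:0, 0, 1:] * (p - pderiv p)) t) (at t)"
proof (cases t "0::real" rule: linorder_cases)
  case less
  have "(flat p has_real_derivative 0) (at t) \<longleftrightarrow> ((\<lambda>_. 0) has_real_derivative 0) (at t)"
    using less by (intro DERIV_cong_ev refl eventually_mono[OF eventually_nhds_in_open[of "{..<0}"]])
      (auto simp: flat_def)
  then show ?thesis using less by (simp add: flat_def)
next
  case greater
  let ?d = "flat ([:0, 0, 1:] * (p - pderiv p)) t"
  have "((\<lambda>t. poly p (1 / t) * exp (- (1 / t))) has_real_derivative ?d) (at t)"
    using greater
    by (auto intro!: derivative_eq_intros DERIV_chain2[OF poly_DERIV] simp: flat_def field_simps power2_eq_square)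
  moreover have "(flat p has_real_derivative ?d) (at t)
      \<longleftrightarrow> ((\<lambda>t. poly p (1 / t) * exp (- (1 / t))) has_real_derivative ?d) (at t)"
    using greater
    by (intro DERIV_cong_ev refl eventually_mono[OF eventually_nhds_in_open[of "{0<..}"]])
      (auto simp: flat_def)
  ultimately show ?thesis by simp
next
  case equal
  have lim: "((\<lambda>h. flat q h) \<longlongrightarrow> 0) (at_right 0)" for q
  proof -
    have "((\<lambda>h. poly q (inverse h) * exp (- inverse h)) \<longlongrightarrow> 0) (at_right 0)"
      by (rule filterlim_compose[OF tendsto_poly_mult_exp_minus filterlim_inverse_at_top_right])
    then show ?thesis
      by (rule Lim_transform_eventually)
        (auto simp: eventually_at_filter flat_def field_simps inverse_eq_divide)
  qed
  \<comment> \<open>Dividing by h multiplies the polynomial in 1/h by X, which is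
    \<open>pCons 0 p\<close>, so for h > 0 the difference quotient is again a member of the
    family.\<close>
  have "((\<lambda>h. flat p h / h) \<longlongrightarrow> 0) (at_right 0)"
    using lim[of "pCons 0 p"] by (rule Lim_transform_eventually)
      (auto simp: eventually_at_filter flat_def)
  moreover have "((\<lambda>h. flat p h / h) \<longlongrightarrow> 0) (at_left 0)"
    by (rule tendsto_eventually) (auto simp: eventually_at_filter flat_def)
  ultimately have "((\<lambda>h. flat p h / h) \<longlongrightarrow> 0) (at 0)"
    by (simp add: filterlim_split_at)
  then show ?thesis using equal by (simp add: DERIV_def flat_def)
qed

text \<open>The polynomial stays arbitrary in the induction because each derivative replaces it. The
  affine argument admits both signs of c, as the two opposite faces of a box require.\<close>

lemma Ck_flat_coordinate: "Ck k (\<lambda>x. flat p (c * x $ i + e))"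
proof (induction k arbitrary: p)
  case 0
  have "continuous_on UNIV (flat p)"
    by (rule DERIV_continuous_on) (auto intro: has_field_derivative_at_within flat_has_derivative)
  then have "continuous_on UNIV (\<lambda>x::real^'a. flat p (c * x $ i + e))"
    by (rule continuous_on_compose2) (auto intro!: continuous_intros)
  then show ?case by simp
next
  case (Suc k)
  let ?q = "[:0, 0, 1:] * (p - pderiv p)"
  have aff: "((\<lambda>x::real^'a. c * x $ i + e) has_derivative (\<lambda>h. c * h $ i)) (at x)" for x
    by (auto intro!: derivative_eq_intros bounded_linear.has_derivative[OF bounded_linear_vec_nth])
  have der: "((\<lambda>x::real^'a. flat p (c * x $ i + e))
      has_derivative (\<lambda>h. flat ?q (c * x $ i + e) * (c * h $ i))) (at x)" for x
    using has_derivative_compose[OF aff flat_has_derivative[of p, unfolded has_field_derivative_def]]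
    by simp
  have "gradient (\<lambda>x::real^'a. flat p (c * x $ i + e)) x $ j
      = (if i = j then c else 0) * flat ?q (c * x $ i + e)" for x j
    by (subst gradient_eq[OF der]) (auto simp: axis_def)
  then show ?case
    using der by (auto simp: differentiable_def intro!: Ck_mult Ck_const Suc simp del: mult_pCons_left)
qed

text \<open>Each coordinate contributes one flat factor per face, so for m > 0 the product is
  positive exactly on the open box. The parameter m steepens the factors: exp(-1/(m t)) tends to 1
  for every t > 0, and the bumps tend to the indicator of the box.\<close>

definition bump :: "real \<Rightarrow> real ^ 'n \<Rightarrow> real ^ 'n \<Rightarrow> real ^ 'n \<Rightarrow> real" where
  "bump m a b x = (\<Prod>i\<in>UNIV. flat 1 (m * (x $ i - a $ i)) * flat 1 (m * (b $ i - x $ i)))"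

lemma smooth_bump: "smooth (bump m a b)"
proof -
  have "Ck k (\<lambda>x. \<Prod>i\<in>UNIV. flat 1 (m * x $ i + (- m * a $ i)) * flat 1 ((- m) * x $ i + m * b $ i))" for k
    by (intro Ck_prod Ck_mult Ck_flat_coordinate) auto
  then show ?thesis
    by (simp add: smooth_def bump_def[abs_def] algebra_simps)
qed

lemma bump_bounds: "0 \<le> bump m a b x" "bump m a b x \<le> 1"
  by (auto simp: bump_def flat_def intro!: prod_nonneg prod_le_1 mult_le_one)

lemma bump_pos_iff: "m > 0 \<Longrightarrow> bump m a b x > 0 \<longleftrightarrow> x \<in> box a b"
proof -
  assume m: "m > 0"
  have "bump m a b x \<noteq> 0 \<longleftrightarrow> x \<in> box a b"
    using m by (auto simp: bump_def flat_def mem_box_cart zero_less_mult_iff split: if_splits)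
  then show ?thesis using bump_bounds(1)[of m a b x] by linarith
qed

lemma bump_tendsto_indicator: "(\<lambda>k. bump (real (Suc k)) a b x) \<longlonglongrightarrow> indicator (box a b) x"
proof (cases "x \<in> box a b")
  case True
  have f: "(\<lambda>k. flat 1 (real (Suc k) * t)) \<longlonglongrightarrow> 1" if "t > 0" for t
  proof -
    have "(\<lambda>k. exp (- (inverse (real (Suc k)) * (1 / t)))) \<longlonglongrightarrow> exp (- (0 * (1 / t)))"
      by (intro tendsto_intros LIMSEQ_inverse_real_of_nat)
    then show ?thesis using that by (simp add: flat_def field_simps add_pos_nonneg)
  qed
  have "(\<lambda>k. bump (real (Suc k)) a b x) \<longlonglongrightarrow> (\<Prod>i\<in>(UNIV::'a set). 1 * 1)"
    unfolding bump_def by (intro tendsto_prod tendsto_mult f) (use True in \<open>auto simp: mem_box_cart\<close>)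
  then show ?thesis using True by simp
next
  case False
  then have "bump (real (Suc k)) a b x = 0" for k
    using bump_pos_iff[of "real (Suc k)" a b x] bump_bounds(1)[of "real (Suc k)" a b x] by simp
  then show ?thesis using False by simp
qed

section \<open>The space of square integrable functions\<close>

text \<open>Kept for an arbitrary measure and Euclidean values, so that functions and gradients, on
  \<Omega> with \<open>lebesgue_on\<close> and on the whole space with \<open>lborel\<close>, are
  covered by one development.\<close>

definition L2 :: "'a measure \<Rightarrow> ('a \<Rightarrow> 'b::euclidean_space) \<Rightarrow> bool" where
  "L2 M f \<longleftrightarrow> f \<in> borel_measurable M \<and> integrable M (\<lambda>x. (norm (f x))\<^sup>2)"

definition L2_norm :: "'a measure \<Rightarrow> ('a \<Rightarrow> 'b::euclidean_space) \<Rightarrow> real" where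
  "L2_norm M f = sqrt (LINT x|M. (norm (f x))\<^sup>2)"

lemma L2_measurable [measurable_dest]: "L2 M f \<Longrightarrow> f \<in> borel_measurable M"
  and L2_integrable: "L2 M f \<Longrightarrow> integrable M (\<lambda>x. (norm (f x))\<^sup>2)"
  by (auto simp: L2_def)

lemma L2_norm_nonneg [simp]: "L2_norm M f \<ge> 0"
  by (simp add: L2_norm_def)

lemma L2_norm_power2: "(L2_norm M f)\<^sup>2 = (LINT x|M. (norm (f x))\<^sup>2)"
  by (simp add: L2_norm_def)

lemma integrable_power2_iff_nn:
  assumes [measurable]: "f \<in> borel_measurable M"
  shows "integrable M (\<lambda>x. (norm (f x))\<^sup>2) \<longleftrightarrow> (\<integral>\<^sup>+x. ennreal ((norm (f x))\<^sup>2) \<partial>M) < \<infinity>"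
  by (subst integrable_iff_bounded) simp

lemma L2_inner_integrable:
  assumes "L2 M f" "L2 M g"
  shows "integrable M (\<lambda>x. f x \<bullet> g x)"
proof (rule Bochner_Integration.integrable_bound)
  show "integrable M (\<lambda>x. (norm (f x))\<^sup>2 + (norm (g x))\<^sup>2)"
    using assms by (intro Bochner_Integration.integrable_add L2_integrable)
  show "(\<lambda>x. f x \<bullet> g x) \<in> borel_measurable M"
    using assms by measurable
  have "\<bar>f x \<bullet> g x\<bar> \<le> (norm (f x))\<^sup>2 + (norm (g x))\<^sup>2" for x
    using Cauchy_Schwarz_ineq2[of "f x" "g x"] sum_squares_bound[of "norm (f x)" "norm (g x)"]
      mult_nonneg_nonneg[OF norm_ge_zero norm_ge_zero, of "f x" "g x"]
    by linarith
  then show "AE x in M. norm (f x \<bullet> g x) \<le> norm ((norm (f x))\<^sup>2 + (norm (g x))\<^sup>2)" by simp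
qed

lemma L2_cmult: "L2 M f \<Longrightarrow> L2 M (\<lambda>x. c *\<^sub>R f x)"
  by (auto simp: L2_def power_mult_distrib)

lemma L2_cmult_real: "L2 M f \<Longrightarrow> L2 M (\<lambda>x. c * f x :: real)"
  using L2_cmult[of M f c] by simp

lemma L2_add:
  assumes "L2 M f" "L2 M g"
  shows "L2 M (\<lambda>x. f x + g x)"
proof -
  have "integrable M (\<lambda>x. (norm (f x))\<^sup>2 + (norm (g x))\<^sup>2 + 2 * (f x \<bullet> g x))"
    using assms by (intro Bochner_Integration.integrable_add L2_integrable
        L2_inner_integrable integrable_mult_right)
  moreover have "(norm (f x + g x))\<^sup>2 = (norm (f x))\<^sup>2 + (norm (g x))\<^sup>2 + 2 * (f x \<bullet> g x)" for x
    by (simp add: power2_norm_eq_inner inner_add_left inner_add_right inner_commute)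
  ultimately show ?thesis
    using assms by (auto simp: L2_def)
qed

lemma L2_uminus: "L2 M f \<Longrightarrow> L2 M (\<lambda>x. - f x)"
  by (auto simp: L2_def)

lemma L2_diff: "L2 M f \<Longrightarrow> L2 M g \<Longrightarrow> L2 M (\<lambda>x. f x - g x)"
  using L2_add[of M f "\<lambda>x. - g x"] L2_uminus[of M g] by simp

lemma L2_norm_cmult: "L2_norm M (\<lambda>x. c *\<^sub>R f x) = \<bar>c\<bar> * L2_norm M f"
  by (simp add: L2_norm_def power_mult_distrib real_sqrt_mult)

lemma L2_norm_minus_commute: "L2_norm M (\<lambda>x. f x - g x) = L2_norm M (\<lambda>x. g x - f x)"
  by (simp add: L2_norm_def norm_minus_commute)

lemma L2_norm_cong_AE:
  assumes "L2 M f" "L2 M g" "AE x in M. f x = g x"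
  shows "L2_norm M f = L2_norm M g"
  unfolding L2_norm_def using assms
  by (intro arg_cong[where f=sqrt] integral_cong_AE) (auto simp: L2_def)

lemma L2_norm_power2_add:
  assumes "L2 M f" "L2 M g"
  shows "(L2_norm M (\<lambda>x. f x + g x))\<^sup>2
    = (L2_norm M f)\<^sup>2 + 2 * (LINT x|M. f x \<bullet> g x) + (L2_norm M g)\<^sup>2"
proof -
  have "(norm (f x + g x))\<^sup>2 = (norm (f x))\<^sup>2 + 2 * (f x \<bullet> g x) + (norm (g x))\<^sup>2" for x
    by (simp add: power2_norm_eq_inner inner_add_left inner_add_right inner_commute)
  then show ?thesis
    using assms by (simp add: L2_norm_power2 L2_inner_integrable L2_integrable)
qed

text \<open>A quadratic in t that is nowhere negative has nonpositive discriminant; B = 0 is the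
  degenerate case in which the quadratic is affine and its slope must vanish.\<close>

lemma discriminant_nonpos:
  fixes A B C :: real
  assumes "\<And>t. A + 2 * t * C + t\<^sup>2 * B \<ge> 0" "A \<ge> 0" "B \<ge> 0"
  shows "\<bar>C\<bar> \<le> sqrt A * sqrt B"
proof -
  have "C\<^sup>2 \<le> A * B"
  proof (cases "B = 0")
    case True
    have "C = 0"
    proof (rule ccontr)
      assume "C \<noteq> 0"
      \<comment> \<open>At this t the affine function takes the value A - (A + 1) = -1.\<close>
      with True assms(1)[of "- (A + 1) / (2 * C)"] show False by (simp add: field_simps)
    qed
    then show ?thesis using True by simp
  next
    case False
    then have "B > 0" using assms by simp
    \<comment> \<open>Evaluation at the minimiser t = -C/B.\<close>
    have "A + 2 * (- C / B) * C + (- C / B)\<^sup>2 * B \<ge> 0" by (rule assms)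
    then have "(A + 2 * (- C / B) * C + (- C / B)\<^sup>2 * B) * B \<ge> 0" using \<open>B > 0\<close> by simp
    also have "(A + 2 * (- C / B) * C + (- C / B)\<^sup>2 * B) * B = A * B - C\<^sup>2"
      using False by (simp add: power2_eq_square field_simps)
    finally show ?thesis by simp
  qed
  then have "sqrt (C\<^sup>2) \<le> sqrt (A * B)" by (rule real_sqrt_le_mono)
  then show ?thesis by (simp add: real_sqrt_mult)
qed

lemma L2_Cauchy_Schwarz:
  assumes "L2 M f" "L2 M g"
  shows "\<bar>LINT x|M. f x \<bullet> g x\<bar> \<le> L2_norm M f * L2_norm M g"
proof -
  have "(L2_norm M f)\<^sup>2 + 2 * t * (LINT x|M. f x \<bullet> g x) + t\<^sup>2 * (L2_norm M g)\<^sup>2 \<ge> 0" for t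
  proof -
    have "(L2_norm M (\<lambda>x. f x + t *\<^sub>R g x))\<^sup>2
      = (L2_norm M f)\<^sup>2 + 2 * t * (LINT x|M. f x \<bullet> g x) + t\<^sup>2 * (L2_norm M g)\<^sup>2"
      using assms by (subst L2_norm_power2_add)
        (auto intro: L2_cmult simp: L2_norm_cmult power_mult_distrib)
    then show ?thesis by (metis zero_le_power2)
  qed
  from discriminant_nonpos[OF this] show ?thesis by simp
qed

lemma L2_norm_triangle:
  assumes "L2 M f" "L2 M g"
  shows "L2_norm M (\<lambda>x. f x + g x) \<le> L2_norm M f + L2_norm M g"
proof (rule power2_le_imp_le)
  show "(L2_norm M (\<lambda>x. f x + g x))\<^sup>2 \<le> (L2_norm M f + L2_norm M g)\<^sup>2"
    using L2_Cauchy_Schwarz[OF assms] by (simp add: L2_norm_power2_add[OF assms] power2_sum)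
qed simp

lemma L2_norm_triangle_diff:
  assumes "L2 M f" "L2 M g" "L2 M h"
  shows "L2_norm M (\<lambda>x. f x - h x) \<le> L2_norm M (\<lambda>x. f x - g x) + L2_norm M (\<lambda>x. g x - h x)"
  using L2_norm_triangle[of M "\<lambda>x. f x - g x" "\<lambda>x. g x - h x"] assms by (simp add: L2_diff)

lemma L2_inner_tendsto:
  assumes "\<And>n. L2 M (f n)" "L2 M g" "L2 M h" "(\<lambda>n. L2_norm M (\<lambda>x. f n x - g x)) \<longlonglongrightarrow> 0"
  shows "(\<lambda>n. LINT x|M. f n x \<bullet> h x) \<longlonglongrightarrow> (LINT x|M. g x \<bullet> h x)"
proof -
  have "(\<lambda>n. (LINT x|M. f n x \<bullet> h x) - (LINT x|M. g x \<bullet> h x)) \<longlonglongrightarrow> 0"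
  proof (rule Lim_null_comparison[OF _ tendsto_mult_left_zero[OF assms(4)]])
    have "(LINT x|M. f n x \<bullet> h x) - (LINT x|M. g x \<bullet> h x) = (LINT x|M. (f n x - g x) \<bullet> h x)" for n
      using assms by (simp add: inner_diff_left L2_inner_integrable)
    then show "\<forall>\<^sub>F n in sequentially. norm ((LINT x|M. f n x \<bullet> h x) - (LINT x|M. g x \<bullet> h x))
        \<le> L2_norm M (\<lambda>x. f n x - g x) * L2_norm M h"
      using L2_Cauchy_Schwarz[OF L2_diff[OF assms(1,2)] assms(3)] by simp
  qed
  then show ?thesis by (simp add: LIM_zero_iff)
qed

lemma L2_norm_eq_0_iff:
  assumes "L2 M f"
  shows "L2_norm M f = 0 \<longleftrightarrow> (AE x in M. f x = 0)"
  using integral_nonneg_eq_0_iff_AE[OF L2_integrable[OF assms]] by (simp add: L2_norm_def)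

lemma L2_nn_integral:
  assumes "L2 M f"
  shows "(\<integral>\<^sup>+x. ennreal ((norm (f x))\<^sup>2) \<partial>M) = ennreal ((L2_norm M f)\<^sup>2)"
  using nn_integral_eq_integral[OF L2_integrable[OF assms]] by (simp add: L2_norm_power2)

lemma L2_tendsto_AE_subseq:
  assumes "\<And>n. L2 M (f n)" "L2 M g" "(\<lambda>n. L2_norm M (\<lambda>x. f n x - g x)) \<longlonglongrightarrow> 0"
  shows "\<exists>r::nat\<Rightarrow>nat. strict_mono r \<and> (AE x in M. (\<lambda>n. f (r n) x) \<longlonglongrightarrow> g x)"
proof -
  have "(\<lambda>n. LINT x|M. norm ((norm (f n x - g x))\<^sup>2)) \<longlonglongrightarrow> 0"
    using tendsto_power[OF assms(3), of 2] by (simp add: L2_norm_power2)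
  from tendsto_L1_AE_subseq[OF L2_integrable[OF L2_diff[OF assms(1,2)]] this] obtain r where r: "strict_mono r"
    "AE x in M. (\<lambda>n. (norm (f (r n) x - g x))\<^sup>2) \<longlonglongrightarrow> 0"
    by auto
  have "(\<lambda>n. f (r n) x) \<longlonglongrightarrow> g x" if "(\<lambda>n. (norm (f (r n) x - g x))\<^sup>2) \<longlonglongrightarrow> 0" for x
    using tendsto_real_sqrt[OF that] by (simp add: LIM_zero_iff tendsto_norm_zero_iff)
  with r show ?thesis by auto
qed

text \<open>Riesz-Fischer. A subsequence with rapidly shrinking distances converges almost
  everywhere, and Fatou's lemma bounds the distance of f n to the pointwise limit by the Cauchy
  bound, which gives both square integrability and convergence.\<close>

theorem L2_complete:
  fixes f :: "nat \<Rightarrow> 'a \<Rightarrow> 'b::euclidean_space"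
  assumes L2: "\<And>n. L2 M (f n)"
    and Cauchy: "\<And>e. e > 0 \<Longrightarrow> \<exists>N. \<forall>m\<ge>N. \<forall>n\<ge>N. L2_norm M (\<lambda>x. f m x - f n x) < e"
  obtains g where "L2 M g" "(\<lambda>n. L2_norm M (\<lambda>x. f n x - g x)) \<longlonglongrightarrow> 0"
proof -
  have [measurable]: "f n \<in> borel_measurable M" for n using L2 by (rule L2_measurable)
  \<comment> \<open>The rate 1/8 leaves room for the weight 4^k below: 4^k (1/64)^k = (1/16)^k is
    dominated by the summable (1/2)^k.\<close>
  have "\<exists>N. \<forall>m\<ge>N. \<forall>n\<ge>N. L2_norm M (\<lambda>x. f m x - f n x) < (1/8) ^ k" for k
    by (rule Cauchy) simp
  then obtain N where N: "\<And>k m n. m \<ge> N k \<Longrightarrow> n \<ge> N k \<Longrightarrow> L2_norm M (\<lambda>x. f m x - f n x) < (1/8) ^ k"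
    by metis
  \<comment> \<open>Summing all earlier thresholds makes r k and r (Suc k) both at least N k; the
    summand k forces r to infinity.\<close>
  define r where "r k = (\<Sum>j\<le>k. N j) + k" for k
  have r: "r k \<ge> N k" "r (Suc k) \<ge> N k" "r k \<ge> k" for k
    using member_le_sum[of k "{..k}" N] by (auto simp: r_def)
  define h where "h k x = (norm (f (r (Suc k)) x - f (r k) x))\<^sup>2" for k x
  have [measurable]: "h k \<in> borel_measurable M" for k unfolding h_def[abs_def] by measurable
  have nnh: "(\<integral>\<^sup>+x. ennreal (4 ^ k * h k x) \<partial>M) \<le> ennreal ((1/2) ^ k)" for k
  proof -
    have "(\<integral>\<^sup>+x. ennreal (4 ^ k * h k x) \<partial>M) = ennreal (4 ^ k) * (\<integral>\<^sup>+x. ennreal (h k x) \<partial>M)"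
      by (simp add: ennreal_mult h_def nn_integral_cmult)
    also have "(\<integral>\<^sup>+x. ennreal (h k x) \<partial>M) = ennreal ((L2_norm M (\<lambda>x. f (r (Suc k)) x - f (r k) x))\<^sup>2)"
      unfolding h_def by (rule L2_nn_integral[OF L2_diff[OF L2 L2]])
    also have "ennreal (4 ^ k) * \<dots> = ennreal (4 ^ k * (L2_norm M (\<lambda>x. f (r (Suc k)) x - f (r k) x))\<^sup>2)"
      by (simp add: ennreal_mult)
    also have "\<dots> \<le> ennreal ((1/2) ^ k)"
    proof (rule ennreal_leI)
      have "(L2_norm M (\<lambda>x. f (r (Suc k)) x - f (r k) x))\<^sup>2 \<le> ((1/8) ^ k)\<^sup>2"
        using N[OF r(2) r(1)] by (intro power_mono) (auto simp: less_imp_le)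
      also have "\<dots> = (1/64) ^ k" by (simp add: power2_eq_square flip: power_mult_distrib)
      finally have "4 ^ k * (L2_norm M (\<lambda>x. f (r (Suc k)) x - f (r k) x))\<^sup>2 \<le> 4 ^ k * (1/64) ^ k"
        by simp
      also have "\<dots> = (1/16) ^ k" by (simp flip: power_mult_distrib)
      also have "\<dots> \<le> (1/2) ^ k" by (intro power_mono) auto
      finally show "4 ^ k * (L2_norm M (\<lambda>x. f (r (Suc k)) x - f (r k) x))\<^sup>2 \<le> (1/2) ^ k" .
    qed
    finally show ?thesis .
  qed
  have "(\<integral>\<^sup>+x. (\<Sum>k. ennreal (4 ^ k * h k x)) \<partial>M) = (\<Sum>k. \<integral>\<^sup>+x. ennreal (4 ^ k * h k x) \<partial>M)"
    by (intro nn_integral_suminf) simp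
  also have "\<dots> \<le> (\<Sum>k. ennreal ((1/2) ^ k))"
    by (intro suminf_le nnh) auto
  also have "\<dots> = ennreal (\<Sum>k. (1/2) ^ k)"
    by (intro suminf_ennreal2) auto
  finally have "(\<integral>\<^sup>+x. (\<Sum>k. ennreal (4 ^ k * h k x)) \<partial>M) \<noteq> \<infinity>"
    by (auto simp: top_unique)
  then have ae: "AE x in M. (\<Sum>k. ennreal (4 ^ k * h k x)) \<noteq> \<infinity>"
    by (intro nn_integral_PInf_AE) auto
  have conv: "convergent (\<lambda>k. f (r k) x)" if "(\<Sum>k. ennreal (4 ^ k * h k x)) \<noteq> \<infinity>" for x
  proof -
    have sm: "summable (\<lambda>k. 4 ^ k * h k x)"
      using that by (intro summable_suminf_not_top) (auto simp: h_def)
    \<comment> \<open>Finiteness of the weighted sum bounds h k x by C / 4^k, so the norms of the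
      increments are dominated by a geometric sequence of ratio 1/2.\<close>
    then have "Bseq (\<lambda>k. 4 ^ k * h k x)"
      by (intro convergent_imp_Bseq convergentI[OF summable_LIMSEQ_zero])
    then obtain C where C: "C > 0" "\<And>k. norm (4 ^ k * h k x) \<le> C" by (auto elim: BseqE)
    have half: "((1/2::real) ^ k)\<^sup>2 = (1/4) ^ k" for k
      by (simp add: power2_eq_square flip: power_mult_distrib)
    have "norm (f (r (Suc k)) x - f (r k) x) \<le> sqrt C * (1/2) ^ k" for k
    proof (rule power2_le_imp_le)
      have "h k x \<le> C * (1/4) ^ k"
        using C(2)[of k] by (simp add: h_def field_simps power_one_over)
      then show "(norm (f (r (Suc k)) x - f (r k) x))\<^sup>2 \<le> (sqrt C * (1/2) ^ k)\<^sup>2"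
        using C(1) half by (simp add: h_def power_mult_distrib)
    qed (use C in auto)
    then have "summable (\<lambda>k. f (r (Suc k)) x - f (r k) x)"
      by (intro summable_comparison_test'[OF summable_mult[OF summable_geometric[of "1/2::real"]], of 0]) auto
    then have "convergent (\<lambda>n. \<Sum>k<n. f (r (Suc k)) x - f (r k) x)"
      by (simp add: summable_iff_convergent)
    then have "convergent (\<lambda>n. (f (r n) x - f (r 0) x) + f (r 0) x)"
      unfolding sum_lessThan_telescope[of "\<lambda>k. f (r k) x"] by (rule convergent_add[OF _ convergent_const])
    then show ?thesis by simp
  qed
  define g where "g x = lim (\<lambda>k. f (r k) x)" for x
  have [measurable]: "g \<in> borel_measurable M"
    unfolding g_def by measurable
  have lim: "AE x in M. (\<lambda>k. f (r k) x) \<longlonglongrightarrow> g x"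
    using ae by eventually_elim (simp add: g_def convergent_LIMSEQ_iff[symmetric] conv)
  have fatou: "(\<integral>\<^sup>+x. ennreal ((norm (f n x - g x))\<^sup>2) \<partial>M) \<le> ennreal (((1/8) ^ j)\<^sup>2)" if "n \<ge> N j" for n j
  proof -
    have "(\<integral>\<^sup>+x. ennreal ((norm (f n x - g x))\<^sup>2) \<partial>M)
        = (\<integral>\<^sup>+x. liminf (\<lambda>k. ennreal ((norm (f n x - f (r k) x))\<^sup>2)) \<partial>M)"
      using lim by (intro nn_integral_cong_AE, eventually_elim)
        (auto intro!: lim_imp_Liminf[symmetric] tendsto_intros)
    also have "\<dots> \<le> liminf (\<lambda>k. \<integral>\<^sup>+x. ennreal ((norm (f n x - f (r k) x))\<^sup>2) \<partial>M)"
      by (intro nn_integral_liminf) simp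
    also have "\<dots> \<le> limsup (\<lambda>k. \<integral>\<^sup>+x. ennreal ((norm (f n x - f (r k) x))\<^sup>2) \<partial>M)"
      by (intro Liminf_le_Limsup) simp
    also have "\<dots> \<le> ennreal (((1/8) ^ j)\<^sup>2)"
    proof (intro Limsup_bounded eventually_sequentiallyI[of "N j"])
      fix k assume "N j \<le> k"
      then have "L2_norm M (\<lambda>x. f n x - f (r k) x) < (1/8) ^ j"
        using that r(3)[of k] by (intro N) auto
      then show "(\<integral>\<^sup>+x. ennreal ((norm (f n x - f (r k) x))\<^sup>2) \<partial>M) \<le> ennreal (((1/8) ^ j)\<^sup>2)"
        by (subst L2_nn_integral[OF L2_diff[OF L2 L2]]) (auto intro!: ennreal_leI power_mono)
    qed
    finally show ?thesis .
  qed
  have L2d: "L2 M (\<lambda>x. f n x - g x)" if "n \<ge> N j" for n j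
    using fatou[OF that] by (auto simp: L2_def integrable_power2_iff_nn intro: le_less_trans)
  \<comment> \<open>g is written as the difference of two square integrable functions, since Fatou's
    lemma speaks only of f n - g.\<close>
  have "L2 M (\<lambda>x. f (N 0) x - (f (N 0) x - g x))"
    by (intro L2_diff L2 L2d[of 0]) simp
  then have L2g: "L2 M g" by simp
  have small: "L2_norm M (\<lambda>x. f n x - g x) \<le> (1/8) ^ j" if "n \<ge> N j" for n j
    using fatou[OF that] L2_nn_integral[OF L2d[OF that]] by (simp add: power2_le_iff_abs_le)
  have "(\<lambda>n. L2_norm M (\<lambda>x. f n x - g x)) \<longlonglongrightarrow> 0"
  proof (rule LIMSEQ_I)
    fix e :: real assume "e > 0"
    then obtain j where "(1/8) ^ j < e" using real_arch_pow_inv[of e "1/8"] by auto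
    then have "\<forall>n\<ge>N j. norm (L2_norm M (\<lambda>x. f n x - g x) - 0) < e"
      using small[of j] by (auto intro: le_less_trans)
    then show "\<exists>no. \<forall>n\<ge>no. norm (L2_norm M (\<lambda>x. f n x - g x) - 0) < e" ..
  qed
  with L2g that show ?thesis by blast
qed

section \<open>Test functions\<close>

lemma smooth_differentiable: "smooth f \<Longrightarrow> f differentiable (at x)"
  unfolding smooth_def using Ck.simps(2)[of 0 f] by blast

lemma smooth_continuous_on: "smooth f \<Longrightarrow> continuous_on S f"
  using Ck.simps(1)[of f] unfolding smooth_def by (meson continuous_on_subset subset_UNIV)

lemma smooth_continuous_on_gradient:
  assumes "smooth f"
  shows "continuous_on S (gradient f)"
proof -
  have "continuous_on UNIV (\<lambda>x. gradient f x $ i)" for i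
    using assms Ck.simps(2)[of 0 f] unfolding smooth_def by (metis Ck.simps(1))
  then have "continuous_on UNIV (\<lambda>x. \<chi> i. gradient f x $ i)"
    by (rule continuous_on_vec_lambda)
  then show ?thesis by (auto intro: continuous_on_subset)
qed

lemma smooth_add: "smooth f \<Longrightarrow> smooth g \<Longrightarrow> smooth (\<lambda>x. f x + g x)"
  and smooth_mult: "smooth f \<Longrightarrow> smooth g \<Longrightarrow> smooth (\<lambda>x. f x * g x)"
  and smooth_cmult: "smooth f \<Longrightarrow> smooth (\<lambda>x. c * f x)"
  and smooth_affine: "smooth f \<Longrightarrow> smooth (\<lambda>x. f (t *\<^sub>R x + v))"
  by (auto simp: smooth_def intro: Ck_add Ck_mult Ck_const Ck_affine)

lemma test_functionI:
  assumes "smooth f" "compact K" "K \<subseteq> \<Omega>" "\<And>x. x \<notin> K \<Longrightarrow> f x = 0"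
  shows "f \<in> test_functions \<Omega>"
proof -
  have "closure {x. f x \<noteq> 0} \<subseteq> K"
    using assms by (intro closure_minimal compact_imp_closed) auto
  moreover from this have "compact (closure {x. f x \<noteq> 0})"
    using compact_Int_closed[OF assms(2) closed_closure, of "{x. f x \<noteq> 0}"] by (simp add: Int_absorb1)
  ultimately show ?thesis
    using assms by (auto simp: test_functions_def smooth_def)
qed

lemma gradient_eq_0_outside:
  assumes "closed K" "\<And>x. x \<notin> K \<Longrightarrow> f x = 0" "x \<notin> K"
  shows "gradient f x = 0"
proof -
  have "(f has_derivative (\<lambda>_. 0)) (at x)"
    by (rule has_derivative_transform_within_open[of "\<lambda>_. 0" _ x UNIV "- K"])
      (use assms in auto)
  then show ?thesis by (simp add: gradient_eq vec_eq_iff)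
qed

lemma test_functionE:
  assumes "f \<in> test_functions \<Omega>"
  obtains K where "compact K" "K \<subseteq> \<Omega>" "\<And>x. x \<notin> K \<Longrightarrow> f x = 0" "\<And>x. x \<notin> K \<Longrightarrow> gradient f x = 0"
proof
  let ?K = "closure {x. f x \<noteq> 0}"
  show "compact ?K" "?K \<subseteq> \<Omega>" using assms by (auto simp: test_functions_def)
  show *: "f x = 0" if "x \<notin> ?K" for x using that closure_subset[of "{x. f x \<noteq> 0}"] by auto
  show "gradient f x = 0" if "x \<notin> ?K" for x
    using gradient_eq_0_outside[OF closed_closure * that] by simp
qed

lemma test_function_smooth: "f \<in> test_functions \<Omega> \<Longrightarrow> smooth f"
  by (simp add: test_functions_def smooth_def)

lemma test_function_mono: "\<Omega> \<subseteq> \<Omega>' \<Longrightarrow> f \<in> test_functions \<Omega> \<Longrightarrow> f \<in> test_functions \<Omega>'"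
  by (auto simp: test_functions_def)

lemma test_function_add:
  assumes "f \<in> test_functions \<Omega>" "g \<in> test_functions \<Omega>"
  shows "(\<lambda>x. f x + g x) \<in> test_functions \<Omega>"
proof -
  obtain K where K: "compact K" "K \<subseteq> \<Omega>" "\<And>x. x \<notin> K \<Longrightarrow> f x = 0"
    using assms(1) by (rule test_functionE) blast
  obtain L where L: "compact L" "L \<subseteq> \<Omega>" "\<And>x. x \<notin> L \<Longrightarrow> g x = 0"
    using assms(2) by (rule test_functionE) blast
  show ?thesis using K L assms
    by (intro test_functionI[of _ "K \<union> L"] smooth_add compact_Un) (auto intro: test_function_smooth)
qed

lemma test_function_cmult:
  assumes "f \<in> test_functions \<Omega>"
  shows "(\<lambda>x. c * f x) \<in> test_functions \<Omega>"
proof -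
  obtain K where "compact K" "K \<subseteq> \<Omega>" "\<And>x. x \<notin> K \<Longrightarrow> f x = 0"
    using assms(1) by (rule test_functionE) blast
  then show ?thesis using assms
    by (intro test_functionI[of _ K] smooth_cmult) (auto intro: test_function_smooth)
qed

lemma test_function_zero: "(\<lambda>_. 0) \<in> test_functions \<Omega>"
  by (rule test_functionI[of _ "{}"]) (auto simp: smooth_def Ck_const)

lemma gradient_test_add:
  assumes "f \<in> test_functions \<Omega>" "g \<in> test_functions \<Omega>"
  shows "gradient (\<lambda>x. f x + g x) x = gradient f x + gradient g x"
  using assms by (intro gradient_add smooth_differentiable test_function_smooth)

lemma gradient_test_cmult:
  assumes "f \<in> test_functions \<Omega>"
  shows "gradient (\<lambda>x. c * f x) x = c *\<^sub>R gradient f x"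
  using assms by (intro gradient_cmult smooth_differentiable test_function_smooth)

lemma compact_support_integrable:
  fixes f :: "'a::euclidean_space \<Rightarrow> 'b::euclidean_space"
  assumes "continuous_on UNIV f" "compact K" "\<And>x. x \<notin> K \<Longrightarrow> f x = 0"
  shows "integrable lborel f"
proof -
  have "integrable lborel (\<lambda>x. indicator K x *\<^sub>R f x)"
    using assms by (intro borel_integrable_compact) (auto intro: continuous_on_subset)
  moreover have "(\<lambda>x. indicator K x *\<^sub>R f x) = f"
    using assms(3) by (auto simp: fun_eq_iff indicator_def)
  ultimately show ?thesis by simp
qed

lemma compact_support_bounded:
  fixes f :: "'a::euclidean_space \<Rightarrow> 'b::real_normed_vector"
  assumes "continuous_on UNIV f" "compact K" "\<And>x. x \<notin> K \<Longrightarrow> f x = 0"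
  obtains B where "B \<ge> 0" "\<And>x. norm (f x) \<le> B"
proof -
  have "compact (f ` K)" using assms by (auto intro: compact_continuous_image continuous_on_subset)
  then obtain B where B: "\<And>y. y \<in> f ` K \<Longrightarrow> norm y \<le> B"
    using compact_imp_bounded bounded_iff by metis
  have "norm (f x) \<le> max B 0" for x
    using B[of "f x"] assms(3)[of x] by (cases "x \<in> K") (auto intro: max.coboundedI1)
  then show ?thesis using that[of "max B 0"] by simp
qed

text \<open>Translations and dilations act on the whole space with \<open>lborel\<close>, whereas
  the norms live on \<open>lebesgue_on\<close>; for Borel functions that vanish off \<Omega> the two
  integrals agree.\<close>

lemma
  fixes f :: "'a::euclidean_space \<Rightarrow> 'b::euclidean_space"
  assumes "\<Omega> \<in> sets borel" "f \<in> borel_measurable borel" "\<And>x. x \<notin> \<Omega> \<Longrightarrow> f x = 0"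
  shows integral_lebesgue_on_eq_lborel: "integral\<^sup>L (lebesgue_on \<Omega>) f = integral\<^sup>L lborel f"
    and integrable_lebesgue_on_iff_lborel: "integrable (lebesgue_on \<Omega>) f \<longleftrightarrow> integrable lborel f"
proof -
  have [simp]: "\<Omega> \<in> sets lebesgue" using assms(1) by simp
  have eq: "(\<lambda>x. indicator \<Omega> x *\<^sub>R f x) = f"
    using assms(3) by (auto simp: fun_eq_iff indicator_def)
  show "integral\<^sup>L (lebesgue_on \<Omega>) f = integral\<^sup>L lborel f"
    using assms(2) by (subst integral_restrict_space) (simp_all add: eq integral_completion)
  show "integrable (lebesgue_on \<Omega>) f \<longleftrightarrow> integrable lborel f"
    using assms(2) by (subst integrable_restrict_space) (simp_all add: eq integrable_completion)
qed

lemma borel_imp_lebesgue_on: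
  "f \<in> borel_measurable borel \<Longrightarrow> f \<in> borel_measurable (lebesgue_on S)"
  by (intro measurable_restrict_space1 measurable_completion) simp

lemma
  assumes "f \<in> test_functions \<Omega>"
  shows test_function_borel [measurable_dest]: "f \<in> borel_measurable borel"
    and gradient_borel: "gradient f \<in> borel_measurable borel"
  using smooth_continuous_on[OF test_function_smooth[OF assms]]
    smooth_continuous_on_gradient[OF test_function_smooth[OF assms]]
  by (auto intro!: borel_measurable_continuous_onI)

lemma
  assumes "open \<Omega>" "f \<in> test_functions \<Omega>"
  shows test_function_L2: "L2 lborel f" "L2 (lebesgue_on \<Omega>) f"
    and gradient_L2: "L2 lborel (gradient f)" "L2 (lebesgue_on \<Omega>) (gradient f)"
    and gradient_L2_norm: "L2_norm (lebesgue_on \<Omega>) (gradient f) = L2_norm lborel (gradient f)"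
proof -
  obtain K where K: "compact K" "K \<subseteq> \<Omega>" "\<And>x. x \<notin> K \<Longrightarrow> f x = 0" "\<And>x. x \<notin> K \<Longrightarrow> gradient f x = 0"
    using assms(2) by (rule test_functionE) blast
  note s = test_function_smooth[OF assms(2)]
  note [measurable] = test_function_borel[OF assms(2)] gradient_borel[OF assms(2)]
  have \<Omega>: "\<Omega> \<in> sets borel" using assms by simp
  show l: "L2 lborel f" "L2 lborel (gradient f)" unfolding L2_def
    using K s smooth_continuous_on smooth_continuous_on_gradient
    by (auto intro!: compact_support_integrable[of _ K] continuous_intros)
  have off: "f x = 0" "gradient f x = 0" if "x \<notin> \<Omega>" for x
    using K that by auto
  show "L2 (lebesgue_on \<Omega>) f" "L2 (lebesgue_on \<Omega>) (gradient f)" unfolding L2_def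
    using l off by (auto simp: integrable_lebesgue_on_iff_lborel[OF \<Omega>] L2_def intro!: borel_imp_lebesgue_on)
  show "L2_norm (lebesgue_on \<Omega>) (gradient f) = L2_norm lborel (gradient f)" unfolding L2_norm_def
    using off by (simp add: integral_lebesgue_on_eq_lborel[OF \<Omega>])
qed

section \<open>Translation and integration by parts on the whole space\<close>

lemma
  fixes f :: "'a::euclidean_space \<Rightarrow> 'b::euclidean_space"
  assumes [measurable]: "f \<in> borel_measurable borel"
  shows lborel_integral_shift: "(LINT x|lborel. f (x + c)) = integral\<^sup>L lborel f"
    and lborel_integrable_shift: "integrable lborel (\<lambda>x. f (x + c)) \<longleftrightarrow> integrable lborel f"
proof -
  have eq: "lborel = distr lborel borel (\<lambda>x. x + c)"
    using lborel_distr_plus[of c, symmetric] by (simp add: add.commute[of _ c] cong: distr_cong)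
  show "(LINT x|lborel. f (x + c)) = integral\<^sup>L lborel f"
    by (subst (2) eq) (simp add: integral_distr)
  show "integrable lborel (\<lambda>x. f (x + c)) \<longleftrightarrow> integrable lborel f"
    by (subst (2) eq) (simp add: integrable_distr_eq)
qed

lemma gradient_mean_value:
  assumes "smooth f" "\<And>x. norm (gradient f x) \<le> B"
  shows "\<bar>f (x + h) - f x\<bar> \<le> B * norm h"
proof -
  have "norm (f (x + h) - f x) \<le> B * norm (x + h - x)"
  proof (rule differentiable_bound[of UNIV f "\<lambda>x h. gradient f x \<bullet> h"])
    show "onorm (\<lambda>h. gradient f y \<bullet> h) \<le> B" for y
    proof (rule onorm_le)
      fix k
      have "\<bar>gradient f y \<bullet> k\<bar> \<le> norm (gradient f y) * norm k" by (rule Cauchy_Schwarz_ineq2)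
      also have "\<dots> \<le> B * norm k" by (intro mult_right_mono assms) simp
      finally show "norm (gradient f y \<bullet> k) \<le> B * norm k" by simp
    qed
  qed (use assms in \<open>auto intro!: has_derivative_gradient smooth_differentiable\<close>)
  then show ?thesis by simp
qed

text \<open>Translation invariance makes the integral of every difference quotient vanish.\<close>

lemma integral_gradient_eq_0:
  fixes f :: "real ^ 'n \<Rightarrow> real"
  assumes "f \<in> test_functions \<Omega>"
  shows "(LINT x|lborel. gradient f x $ i) = 0"
proof -
  obtain K where K: "compact K" "\<And>x. x \<notin> K \<Longrightarrow> f x = 0" "\<And>x. x \<notin> K \<Longrightarrow> gradient f x = 0"
    using assms by (rule test_functionE) blast
  note s = test_function_smooth[OF assms]
  note [measurable] = test_function_borel[OF assms] gradient_borel[OF assms]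
  obtain B where B: "B \<ge> 0" "\<And>x. norm (gradient f x) \<le> B"
    by (rule compact_support_bounded[OF smooth_continuous_on_gradient[OF s] K(1,3)]) auto
  define t where "t n = inverse (real (Suc n))" for n
  have t: "0 < t n" "t n \<le> 1" for n by (auto simp: t_def inverse_eq_divide)
  have t0: "t \<longlonglongrightarrow> 0" unfolding t_def by (rule LIMSEQ_inverse_real_of_nat)
  define q where "q n x = (f (x + t n *\<^sub>R axis i 1) - f x) / t n" for n x
  have int: "integrable lborel f"
    by (rule compact_support_integrable[OF smooth_continuous_on[OF s] K(1,2)])
  have q0: "integral\<^sup>L lborel (q n) = 0" for n
  proof -
    have "integral\<^sup>L lborel (\<lambda>x. f (x + t n *\<^sub>R axis i 1) - f x) = 0"
      using int by (subst Bochner_Integration.integral_diff) (auto simp: lborel_integral_shift lborel_integrable_shift)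
    then show ?thesis by (simp add: q_def[abs_def])
  qed
  have "(\<lambda>n. integral\<^sup>L lborel (q n)) \<longlonglongrightarrow> (LINT x|lborel. gradient f x $ i)"
  proof (rule integral_dominated_convergence)
    \<comment> \<open>The steps t n are at most 1, so the unit neighbourhood of K contains the
      supports of all difference quotients and carries the dominating function.\<close>
    let ?K = "{x + y |x y. x \<in> K \<and> y \<in> cball (0::real^'n) 1}"
    have cK: "compact ?K" by (intro compact_sums K compact_cball)
    then have mK [measurable]: "?K \<in> sets borel" by (intro borel_closed compact_imp_closed)
    show "q n \<in> borel_measurable lborel" for n unfolding q_def[abs_def] by measurable
    show "(\<lambda>x. gradient f x $ i) \<in> borel_measurable lborel"
      using smooth_continuous_on_gradient[OF s, of UNIV]
      by (auto intro!: borel_measurable_continuous_onI continuous_intros)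
    show "integrable lborel (\<lambda>x. B * indicator ?K x)"
      using mK emeasure_compact_finite[OF cK]
      by (intro integrable_mult_right integrable_real_indicator) simp_all
    show "AE x in lborel. (\<lambda>n. q n x) \<longlonglongrightarrow> gradient f x $ i"
    proof (rule AE_I2)
      fix x
      have "((\<lambda>s. f (x + s *\<^sub>R axis i 1)) has_derivative (\<lambda>s. gradient f x \<bullet> (s *\<^sub>R axis i 1))) (at 0)"
        by (rule has_derivative_compose[of "\<lambda>s. x + s *\<^sub>R axis i 1" _ 0 UNIV f])
          (auto intro!: derivative_eq_intros has_derivative_gradient smooth_differentiable s)
      then have "((\<lambda>s. f (x + s *\<^sub>R axis i 1)) has_real_derivative (gradient f x $ i)) (at 0)"
        by (simp add: has_field_derivative_def inner_axis mult_commute_abs)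
      then have "((\<lambda>h. (f (x + h *\<^sub>R axis i 1) - f x) / h) \<longlongrightarrow> gradient f x $ i) (at 0)"
        by (simp add: DERIV_def)
      moreover have "filterlim t (at 0) sequentially"
        using t0 t by (auto simp: filterlim_at intro!: always_eventually) (metis less_irrefl)
      ultimately show "(\<lambda>n. q n x) \<longlonglongrightarrow> gradient f x $ i"
        unfolding q_def by (rule filterlim_compose)
    qed
    show "AE x in lborel. norm (q n x) \<le> B * indicator ?K x" for n
    proof (rule AE_I2)
      fix x
      have "\<bar>f (x + t n *\<^sub>R axis i 1) - f x\<bar> \<le> B * t n"
        using gradient_mean_value[OF s B(2), of x "t n *\<^sub>R axis i 1"] t[of n] by simp
      then have 1: "\<bar>q n x\<bar> \<le> B" using t[of n] by (simp add: q_def field_simps)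
      have "q n x = 0" if "x \<notin> ?K"
      proof -
        have "x \<notin> K" using that by (force intro: exI[of _ x] exI[of _ 0])
        moreover have "x + t n *\<^sub>R axis i 1 \<notin> K"
        proof
          assume "x + t n *\<^sub>R axis i 1 \<in> K"
          moreover have "- t n *\<^sub>R axis i 1 \<in> cball (0::real^'n) 1" using t[of n] by simp
          moreover have "x = (x + t n *\<^sub>R axis i 1) + - t n *\<^sub>R axis i 1" by simp
          ultimately show False using that by blast
        qed
        ultimately show ?thesis by (simp add: q_def K)
      qed
      with 1 B(1) show "norm (q n x) \<le> B * indicator ?K x" by (auto simp: indicator_def)
    qed
  qed
  then have "(\<lambda>n. 0) \<longlonglongrightarrow> (LINT x|lborel. gradient f x $ i)" by (simp add: q0)
  then show ?thesis by (simp add: LIMSEQ_const_iff)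
qed

text \<open>The gradient of the product f g integrates to zero.\<close>

lemma integration_by_parts_test:
  assumes "f \<in> test_functions \<Omega>" "g \<in> test_functions \<Omega>"
  shows "(LINT x|lborel. f x * gradient g x $ i) = - (LINT x|lborel. gradient f x $ i * g x)"
proof -
  obtain K where K: "compact K" "K \<subseteq> \<Omega>" "\<And>x. x \<notin> K \<Longrightarrow> f x = 0" "\<And>x. x \<notin> K \<Longrightarrow> gradient f x = 0"
    using assms(1) by (rule test_functionE) blast
  note s = test_function_smooth[OF assms(1)] test_function_smooth[OF assms(2)]
  note c = s[THEN smooth_continuous_on] s[THEN smooth_continuous_on_gradient]
  have "(\<lambda>x. f x * g x) \<in> test_functions \<Omega>"
    using K s by (intro test_functionI[of _ K] smooth_mult) auto
  from integral_gradient_eq_0[OF this, of i]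
  have "(LINT x|lborel. f x * gradient g x $ i + gradient f x $ i * g x) = 0"
    using s by (simp add: gradient_mult smooth_differentiable mult.commute)
  moreover have "integrable lborel (\<lambda>x. f x * gradient g x $ i)" "integrable lborel (\<lambda>x. gradient f x $ i * g x)"
    using K c by (auto intro!: compact_support_integrable[of _ K] continuous_intros)
  ultimately show ?thesis by simp
qed

lemma test_function_bump:
  assumes "box a b \<subseteq> cbox c d" "cbox c d \<subseteq> \<Omega>" "m > 0"
  shows "bump m a b \<in> test_functions \<Omega>"
proof (rule test_functionI[OF smooth_bump compact_cbox assms(2)])
  fix x assume "x \<notin> cbox c d"
  then have "\<not> bump m a b x > 0" using assms by (auto simp: bump_pos_iff)
  then show "bump m a b x = 0" using bump_bounds(1)[of m a b x] by simp
qed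

section \<open>The fundamental lemma of the calculus of variations\<close>

text \<open>Boxes form an intersection-stable generator of the Borel sets, so by Dynkin's argument F
  integrates to zero over every Borel set. The vanishing total integral carries complements
  through.\<close>

lemma box_integrals_zero_imp_AE_zero:
  fixes F :: "'a::euclidean_space \<Rightarrow> real"
  assumes int: "integrable lborel F"
    and box: "\<And>a b. (LINT x:box a b|lborel. F x) = 0"
    and total: "integral\<^sup>L lborel F = 0"
  shows "AE x in lborel. F x = 0"
proof (rule sigma_finite_measure.density_zero[OF sigma_finite_lborel int])
  have stable: "Int_stable (range (\<lambda>(a, b). box a b :: 'a set))"
    by (auto simp: Int_stable_def box_Int_box)
  have sub: "range (\<lambda>(a, b). box a b :: 'a set) \<subseteq> Pow UNIV" by simp
  fix A assume "A \<in> sets (lborel :: 'a measure)"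
  then have "A \<in> sigma_sets UNIV (range (\<lambda>(a, b). box a b))"
    by (simp add: borel_eq_box sets_measure_of)
  then show "(LINT x:A|lborel. F x) = 0"
  proof (induction rule: sigma_sets_induct_disjoint[OF stable sub, consumes 1, case_names basic empty compl union])
    case (compl A)
    then have A: "A \<in> sets lborel" by (simp add: borel_eq_box sets_measure_of)
    have "(LINT x:UNIV - A|lborel. F x) = (LINT x|lborel. F x - indicator A x *\<^sub>R F x)"
      unfolding set_lebesgue_integral_def by (intro Bochner_Integration.integral_cong) (auto simp: indicator_def)
    also have "\<dots> = 0"
      using compl(2) total int integrable_mult_indicator[OF A int]
      by (simp add: set_lebesgue_integral_def)
    finally show ?case .
  next
    case (union A)
    then have A: "A i \<in> sets lborel" for i by (auto simp: borel_eq_box sets_measure_of)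
    have "(LINT x:\<Union> (range A)|lborel. F x) = (\<Sum>i. LINT x:A i|lborel. F x)"
      using A union(1) integrable_mult_indicator[OF _ int, of "\<Union> (range A)"]
      by (intro lebesgue_integral_countable_add) (auto simp: disjoint_family_on_def set_integrable_def)
    with union(3) show ?case by simp
  qed (use box in \<open>auto simp: set_lebesgue_integral_def\<close>)
qed

text \<open>Bumps converge to indicators of boxes, so f integrates to zero over every box inside a
  closed box contained in \<Omega>. Dynkin's argument makes f vanish almost everywhere there, and
  countably many such closed boxes exhaust \<Omega>.\<close>

theorem fundamental_lemma:
  fixes f :: "real ^ 'n \<Rightarrow> real"
  assumes "open \<Omega>" and L2: "L2 (lebesgue_on \<Omega>) f"
    and zero: "\<And>\<phi>. \<phi> \<in> test_functions \<Omega> \<Longrightarrow> (LINT x|lebesgue_on \<Omega>. f x * \<phi> x) = 0"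
  shows "AE x in lebesgue_on \<Omega>. f x = 0"
proof -
  have \<Omega> [simp]: "\<Omega> \<in> sets lebesgue" using assms(1) by simp
  define g where "g x = indicator \<Omega> x *\<^sub>R f x" for x
  have "g \<in> borel_measurable (completion lborel)"
    using L2_measurable[OF L2] borel_measurable_restrict_space_iff[of \<Omega> lebesgue f]
    unfolding g_def[abs_def] by simp
  \<comment> \<open>Boxes generate only the Borel sets, so the Lebesgue measurable g is exchanged
    for a Borel version.\<close>
  from completion_ex_borel_measurable_real[OF this] obtain g' where
    g' [measurable]: "g' \<in> borel_measurable lborel" and gg': "AE x in lborel. g x = g' x" by blast
  have gg'': "AE x in lebesgue. g x = g' x" using gg' by (rule AE_completion)
  have ae_box: "AE x in lebesgue. x \<in> cbox c d \<longrightarrow> g x = 0" if cd: "cbox c d \<subseteq> \<Omega>" for c d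
  proof -
    \<comment> \<open>f is only square integrable on \<Omega>, which may have infinite measure here;
      on a closed box |f| is dominated by f^2 + 1, and both terms are integrable there.\<close>
    have fint: "integrable (lebesgue_on \<Omega>) (\<lambda>x. (f x)\<^sup>2 + indicator (cbox c d) x)"
    proof (intro Bochner_Integration.integrable_add)
      show "integrable (lebesgue_on \<Omega>) (\<lambda>x. (f x)\<^sup>2)" using L2_integrable[OF L2] by simp
      show "integrable (lebesgue_on \<Omega>) (indicat_real (cbox c d))"
        using cd by (subst integrable_lebesgue_on_iff_lborel)
          (use assms(1) in \<open>auto simp: indicator_def intro!: integrable_real_indicator emeasure_lborel_cbox_finite\<close>)
    qed
    have dom: "norm (f x * s) \<le> (f x)\<^sup>2 + indicator (cbox c d) x"
      if "0 \<le> s" "s \<le> 1" "x \<notin> cbox c d \<Longrightarrow> s = 0" for x s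
    proof -
      have "\<bar>f x\<bar> \<le> (f x)\<^sup>2 + 1"
        using sum_squares_bound[of "\<bar>f x\<bar>" 1] by simp
      moreover have "\<bar>f x\<bar> * s \<le> \<bar>f x\<bar>" using that by (simp add: mult_left_le)
      ultimately show ?thesis using that by (auto simp: indicator_def abs_mult)
    qed
    have box0: "(LINT x|lebesgue_on \<Omega>. f x * indicator (box a b) x) = 0" if ab: "box a b \<subseteq> box c d" for a b
    proof -
      have ab': "box a b \<subseteq> cbox c d" using ab box_subset_cbox by blast
      have m [measurable]: "bump (real (Suc n)) a b \<in> borel_measurable (lebesgue_on \<Omega>)" for n
        by (intro borel_imp_lebesgue_on test_function_borel[OF test_function_bump[OF ab' cd]]) simp
      have mi [measurable]: "(\<lambda>x. indicator (box a b) x :: real) \<in> borel_measurable (lebesgue_on \<Omega>)"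
        by (intro borel_imp_lebesgue_on) simp
      note [measurable] = L2_measurable[OF L2]
      have "(\<lambda>n. LINT x|lebesgue_on \<Omega>. f x * bump (real (Suc n)) a b x)
        \<longlonglongrightarrow> (LINT x|lebesgue_on \<Omega>. f x * indicator (box a b) x)"
      proof (rule integral_dominated_convergence[OF _ _ fint])
        show "AE x in lebesgue_on \<Omega>. (\<lambda>n. f x * bump (real (Suc n)) a b x) \<longlonglongrightarrow> f x * indicator (box a b) x"
          by (intro AE_I2 tendsto_intros bump_tendsto_indicator)
        show "AE x in lebesgue_on \<Omega>. norm (f x * bump (real (Suc n)) a b x) \<le> (f x)\<^sup>2 + indicator (cbox c d) x" for n
        proof (intro AE_I2 dom bump_bounds)
          fix x assume "x \<notin> cbox c d"
          then have "\<not> bump (real (Suc n)) a b x > 0" using ab' by (subst bump_pos_iff) auto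
          then show "bump (real (Suc n)) a b x = 0"
            using bump_bounds(1)[of "real (Suc n)" a b x] by simp
        qed
      qed measurable
      moreover have "(LINT x|lebesgue_on \<Omega>. f x * bump (real (Suc n)) a b x) = 0" for n
        by (intro zero test_function_bump[OF ab' cd]) simp
      ultimately show ?thesis by (simp add: LIMSEQ_const_iff)
    qed
    \<comment> \<open>Cutting off at the box reduces integrals over arbitrary boxes to boxes inside
      it and supplies integrability on the whole space.\<close>
    define F where "F x = indicator (box c d) x * g' x" for x
    have [measurable]: "F \<in> borel_measurable lborel" unfolding F_def[abs_def] by measurable
    have cd_box: "box c d \<subseteq> \<Omega>" using cd box_subset_cbox[of c d] by blast
    have toF: "(LINT x|lebesgue_on \<Omega>. f x * indicator (box a b) x)
        = (LINT x|lborel. indicator (box a b) x *\<^sub>R F x)"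
      if "box a b \<subseteq> box c d" for a b
    proof -
      have "(LINT x|lebesgue_on \<Omega>. f x * indicator (box a b) x)
          = (LINT x|lebesgue. indicator (box a b) x *\<^sub>R g x)"
        by (subst integral_restrict_space) (auto intro!: Bochner_Integration.integral_cong simp: g_def indicator_def)
      also have "\<dots> = (LINT x|lebesgue. indicator (box a b) x *\<^sub>R F x)"
      proof (rule integral_cong_AE)
        show "(\<lambda>x. indicator (box a b) x *\<^sub>R g x) \<in> borel_measurable lebesgue"
          using \<open>g \<in> borel_measurable (completion lborel)\<close>
          by (intro borel_measurable_scaleR borel_measurable_indicator) auto
        show "(\<lambda>x. indicator (box a b) x *\<^sub>R F x) \<in> borel_measurable lebesgue"
          by (intro measurable_completion) measurable
        show "AE x in lebesgue. indicator (box a b) x *\<^sub>R g x = indicator (box a b) x *\<^sub>R F x"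
          using gg'' by eventually_elim (use that in \<open>auto simp: F_def indicator_def\<close>)
      qed
      also have "\<dots> = (LINT x|lborel. indicator (box a b) x *\<^sub>R F x)"
        by (intro integral_completion) measurable
      finally show ?thesis .
    qed
    have "AE x in lborel. F x = 0"
    proof (rule box_integrals_zero_imp_AE_zero)
      have "integrable (lebesgue_on \<Omega>) (\<lambda>x. f x * indicator (box c d) x)"
      proof (rule Bochner_Integration.integrable_bound[OF fint])
        show "(\<lambda>x. f x * indicator (box c d) x) \<in> borel_measurable (lebesgue_on \<Omega>)"
          by (intro borel_measurable_times L2_measurable[OF L2] borel_imp_lebesgue_on) auto
        have "norm (f x * indicator (box c d) x) \<le> (f x)\<^sup>2 + indicator (cbox c d) x" for x
          using box_subset_cbox[of c d] by (intro dom) (auto simp: indicator_def)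
        then show "AE x in lebesgue_on \<Omega>. norm (f x * indicator (box c d) x)
            \<le> norm ((f x)\<^sup>2 + indicat_real (cbox c d) x)"
          by (intro AE_I2) (auto simp: indicator_def)
      qed
      then have "integrable lebesgue (\<lambda>x. indicator \<Omega> x *\<^sub>R (f x * indicator (box c d) x))"
        by (subst (asm) integrable_restrict_space) auto
      moreover have "F \<in> borel_measurable lebesgue" by (intro measurable_completion) simp
      moreover have "AE x in lebesgue. indicator \<Omega> x *\<^sub>R (f x * indicator (box c d) x) = F x"
        using gg'' by eventually_elim (auto simp: F_def g_def indicator_def)
      ultimately have "integrable lebesgue F"
        using integrable_cong_AE_imp by blast
      then show "integrable lborel F" by (simp add: integrable_completion)
      have 0: "(LINT x|lborel. indicator (box a b) x *\<^sub>R F x) = 0" if "box a b \<subseteq> box c d" for a b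
        using toF[OF that] box0[OF that] by simp
      have eq: "indicator (box c d) x *\<^sub>R F x = F x" for x by (simp add: F_def indicator_def)
      show "integral\<^sup>L lborel F = 0" using 0[of c d] by (simp only: eq order_refl)
      show "(LINT x:box a b|lborel. F x) = 0" for a b
      proof -
        obtain a' b' where ab': "box a b \<inter> box c d = box a' b'" using box_Int_box by blast
        have "(LINT x:box a b|lborel. F x) = (LINT x|lborel. indicator (box a' b') x *\<^sub>R F x)"
          unfolding set_lebesgue_integral_def ab'[symmetric]
          by (intro Bochner_Integration.integral_cong) (auto simp: F_def indicator_def)
        also have "\<dots> = 0" using ab' by (intro 0) auto
        finally show ?thesis .
      qed
    qed
    then have "AE x in lebesgue. F x = 0" by (rule AE_completion)
    moreover have "AE x in lebesgue. x \<notin> cbox c d - box c d"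
      by (intro AE_completion AE_not_in null_sets_cbox_Diff_box)
    ultimately show ?thesis using gg''
      by eventually_elim (auto simp: F_def)
  qed
  obtain \<D> where \<D>: "countable \<D>" "\<D> \<subseteq> Pow \<Omega>" "\<And>X. X \<in> \<D> \<Longrightarrow> \<exists>a b. X = cbox a b" "\<Union>\<D> = \<Omega>"
    using open_countable_Union_open_cbox[OF assms(1)] by metis
  have "AE x in lebesgue. \<forall>X\<in>\<D>. x \<in> X \<longrightarrow> g x = 0"
    unfolding AE_ball_countable[OF \<D>(1)]
  proof
    fix X assume X: "X \<in> \<D>"
    then obtain a b where ab: "X = cbox a b" using \<D>(3) by blast
    moreover have "X \<subseteq> \<Omega>" using \<D>(2) X by auto
    ultimately show "AE x in lebesgue. x \<in> X \<longrightarrow> g x = 0" using ae_box by simp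
  qed
  then have "AE x in lebesgue. x \<in> \<Omega> \<longrightarrow> f x = 0"
    by eventually_elim (use \<D>(4) in \<open>fastforce simp: g_def indicator_def\<close>)
  then show ?thesis by (subst AE_restrict_space_iff) auto
qed

section \<open>Structure of $H_0^1(\Omega)$\<close>

lemma square_integrable_eq_L2: "square_integrable \<Omega> f = L2 (lebesgue_on \<Omega>) f"
  by (simp add: square_integrable_def L2_def)

lemma
  assumes "has_weak_gradient \<Omega> u g"
  shows has_weak_gradient_L2: "L2 (lebesgue_on \<Omega>) u"
    and has_weak_gradient_L2': "L2 (lebesgue_on \<Omega>) g"
  using assms by (auto simp: has_weak_gradient_def square_integrable_eq_L2)

lemma L2_component:
  assumes "L2 M g"
  shows "L2 M (\<lambda>x. g x $ i)"
proof -
  have "(\<lambda>x. g x $ i) \<in> borel_measurable M"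
    using measurable_compose[OF L2_measurable[OF assms], of "\<lambda>y. y $ i" borel]
      borel_measurable_continuous_onI[of "\<lambda>y. y $ i"] by (simp add: continuous_on_component)
  moreover have "integrable M (\<lambda>x. (norm (g x $ i))\<^sup>2)"
  proof (rule Bochner_Integration.integrable_bound[OF L2_integrable[OF assms]])
    show "(\<lambda>x. (norm (g x $ i))\<^sup>2) \<in> borel_measurable M" using calculation by simp
    show "AE x in M. norm ((norm (g x $ i))\<^sup>2) \<le> norm ((norm (g x))\<^sup>2)"
      by (intro AE_I2) (simp add: abs_le_square_iff[symmetric] Finite_Cartesian_Product.norm_nth_le)
  qed
  ultimately show ?thesis by (simp add: L2_def)
qed

lemma L2_mult_integrable:
  fixes f g :: "'a \<Rightarrow> real"
  assumes "L2 M f" "L2 M g"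
  shows "integrable M (\<lambda>x. f x * g x)"
  using L2_inner_integrable[OF assms] by simp

lemma has_weak_gradient_integrable:
  assumes "open \<Omega>" "has_weak_gradient \<Omega> u g" "\<phi> \<in> test_functions \<Omega>"
  shows "integrable (lebesgue_on \<Omega>) (\<lambda>x. u x * gradient \<phi> x $ i)"
    and "integrable (lebesgue_on \<Omega>) (\<lambda>x. g x $ i * \<phi> x)"
  using L2_mult_integrable[OF has_weak_gradient_L2[OF assms(2)] L2_component[OF gradient_L2(2)[OF assms(1,3)]]]
    L2_mult_integrable[OF L2_component[OF has_weak_gradient_L2'[OF assms(2)]] test_function_L2(2)[OF assms(1,3)]]
  by auto

lemma has_weak_gradient_add:
  assumes "open \<Omega>" "has_weak_gradient \<Omega> u g" "has_weak_gradient \<Omega> v h"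
  shows "has_weak_gradient \<Omega> (\<lambda>x. u x + v x) (\<lambda>x. g x + h x)"
  using assms has_weak_gradient_integrable[OF assms(1,2)] has_weak_gradient_integrable[OF assms(1,3)]
  by (auto simp: has_weak_gradient_def square_integrable_eq_L2 L2_add distrib_right)

lemma has_weak_gradient_cmult:
  assumes "has_weak_gradient \<Omega> u g"
  shows "has_weak_gradient \<Omega> (\<lambda>x. c * u x) (\<lambda>x. c *\<^sub>R g x)"
  using assms by (auto simp: has_weak_gradient_def square_integrable_eq_L2 L2_cmult L2_cmult_real mult.assoc)

lemma has_weak_gradient_diff:
  assumes "open \<Omega>" "has_weak_gradient \<Omega> u g" "has_weak_gradient \<Omega> v h"
  shows "has_weak_gradient \<Omega> (\<lambda>x. u x - v x) (\<lambda>x. g x - h x)"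
  using has_weak_gradient_add[OF assms(1,2) has_weak_gradient_cmult[OF assms(3), of "-1"]] by simp

text \<open>Both gradients pair equally with every test function, so the fundamental lemma applies
  to each component of the difference.\<close>

lemma has_weak_gradient_unique:
  assumes "open \<Omega>" "has_weak_gradient \<Omega> u g" "has_weak_gradient \<Omega> u h"
  shows "AE x in lebesgue_on \<Omega>. g x = h x"
proof -
  have L2: "L2 (lebesgue_on \<Omega>) (\<lambda>x. g x - h x)"
    using assms by (intro L2_diff has_weak_gradient_L2')
  have "AE x in lebesgue_on \<Omega>. (g x - h x) $ i = 0" for i
  proof (rule fundamental_lemma[OF assms(1) L2_component[OF L2]])
    fix \<phi> assume \<phi>: "\<phi> \<in> test_functions \<Omega>"
    have "(LINT x|lebesgue_on \<Omega>. g x $ i * \<phi> x) = (LINT x|lebesgue_on \<Omega>. h x $ i * \<phi> x)"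
      using assms(2,3) \<phi> by (auto simp: has_weak_gradient_def)
    then show "(LINT x|lebesgue_on \<Omega>. (g x - h x) $ i * \<phi> x) = 0"
      using has_weak_gradient_integrable(2)[OF assms(1,2) \<phi>] has_weak_gradient_integrable(2)[OF assms(1,3) \<phi>]
      by (simp add: left_diff_distrib)
  qed
  then have "AE x in lebesgue_on \<Omega>. \<forall>i\<in>UNIV. (g x - h x) $ i = 0"
    by (intro AE_finite_allI) auto
  then show ?thesis by eventually_elim (simp add: vec_eq_iff)
qed

lemma has_weak_gradient_test:
  assumes "open \<Omega>" "\<phi> \<in> test_functions \<Omega>"
  shows "has_weak_gradient \<Omega> \<phi> (gradient \<phi>)"
  unfolding has_weak_gradient_def square_integrable_eq_L2
proof (intro conjI ballI allI test_function_L2 gradient_L2 assms)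
  fix \<psi> i assume \<psi>: "\<psi> \<in> test_functions \<Omega>"
  obtain K where K: "K \<subseteq> \<Omega>" "\<And>x. x \<notin> K \<Longrightarrow> \<phi> x = 0" "\<And>x. x \<notin> K \<Longrightarrow> gradient \<phi> x = 0"
    using assms(2) by (rule test_functionE) blast
  have comp: "(\<lambda>x. gradient \<eta> x $ i) \<in> borel_measurable borel" if "\<eta> \<in> test_functions \<Omega>" for \<eta>
    using smooth_continuous_on_gradient[OF test_function_smooth[OF that]]
    by (intro borel_measurable_continuous_onI continuous_on_component)
  have off: "\<phi> x = 0" "gradient \<phi> x = 0" if "x \<notin> \<Omega>" for x using K that by auto
  have "\<Omega> \<in> sets borel" using assms(1) by simp
  then show "(LINT x|lebesgue_on \<Omega>. \<phi> x * gradient \<psi> x $ i) = - (LINT x|lebesgue_on \<Omega>. gradient \<phi> x $ i * \<psi> x)"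
    using off integration_by_parts_test[OF assms(2) \<psi>, of i] comp[OF \<psi>] comp[OF assms(2)]
      test_function_borel[OF \<psi>] test_function_borel[OF assms(2)]
    by (subst (1 2) integral_lebesgue_on_eq_lborel) (auto intro: borel_measurable_times)
qed

text \<open>Keeps an explicit gradient next to the approximating test functions. The norm in the
  definition of \<open>H01\<close> refers to a gradient picked by choice for each difference u -
  \<phi> n; here linear operations can be performed on the gradients themselves.\<close>

definition H01_gradient :: "(real ^ 'n) set \<Rightarrow> (real ^ 'n \<Rightarrow> real) \<Rightarrow> (real ^ 'n \<Rightarrow> real ^ 'n) \<Rightarrow> bool" where
  "H01_gradient \<Omega> u g \<longleftrightarrow> has_weak_gradient \<Omega> u g \<and> (\<exists>\<phi>. (\<forall>n::nat. \<phi> n \<in> test_functions \<Omega>)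
     \<and> (\<lambda>n. L2_norm (lebesgue_on \<Omega>) (\<lambda>x. u x - \<phi> n x)) \<longlonglongrightarrow> 0
     \<and> (\<lambda>n. L2_norm (lebesgue_on \<Omega>) (\<lambda>x. g x - gradient (\<phi> n) x)) \<longlonglongrightarrow> 0)"

lemma weak_gradient_AE:
  assumes "open \<Omega>" "has_weak_gradient \<Omega> u g"
  shows "AE x in lebesgue_on \<Omega>. weak_gradient \<Omega> u x = g x"
    and has_weak_gradient_weak_gradient: "has_weak_gradient \<Omega> u (weak_gradient \<Omega> u)"
proof -
  show "has_weak_gradient \<Omega> u (weak_gradient \<Omega> u)"
    unfolding weak_gradient_def using assms(2) by (rule someI[of "has_weak_gradient \<Omega> u"])
  from has_weak_gradient_unique[OF assms(1) this assms(2)]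
  show "AE x in lebesgue_on \<Omega>. weak_gradient \<Omega> u x = g x" .
qed

lemma weak_gradient_L2_norm:
  assumes "open \<Omega>" "has_weak_gradient \<Omega> u g"
  shows "L2_norm (lebesgue_on \<Omega>) (weak_gradient \<Omega> u) = L2_norm (lebesgue_on \<Omega>) g"
  using assms by (intro L2_norm_cong_AE weak_gradient_AE)
    (auto intro: has_weak_gradient_L2' has_weak_gradient_weak_gradient)

lemma H01_norm_eq: "H01_norm \<Omega> u = L2_norm (lebesgue_on \<Omega>) (weak_gradient \<Omega> u)"
  by (simp add: H01_norm_def L2_norm_def)

lemma H1_norm_eq: "H1_norm \<Omega> u = sqrt ((L2_norm (lebesgue_on \<Omega>) u)\<^sup>2 + (H01_norm \<Omega> u)\<^sup>2)"
  by (simp add: H1_norm_def H01_norm_eq L2_norm_power2)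

lemma tendsto_sqrt_sum_squares_iff:
  "((\<lambda>n. sqrt ((a n)\<^sup>2 + (b n)\<^sup>2)) \<longlonglongrightarrow> 0) \<longleftrightarrow> (a \<longlonglongrightarrow> 0) \<and> (b \<longlonglongrightarrow> 0)"
proof safe
  assume *: "(\<lambda>n. sqrt ((a n)\<^sup>2 + (b n)\<^sup>2)) \<longlonglongrightarrow> 0"
  show "a \<longlonglongrightarrow> 0" "b \<longlonglongrightarrow> 0"
    by (rule Lim_null_comparison[OF _ *]; simp add: real_le_rsqrt)+
next
  assume "a \<longlonglongrightarrow> 0" "b \<longlonglongrightarrow> 0"
  then have "(\<lambda>n. sqrt ((a n)\<^sup>2 + (b n)\<^sup>2)) \<longlonglongrightarrow> sqrt (0\<^sup>2 + 0\<^sup>2)"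
    by (intro tendsto_intros)
  then show "(\<lambda>n. sqrt ((a n)\<^sup>2 + (b n)\<^sup>2)) \<longlonglongrightarrow> 0" by simp
qed

lemma H01_iff_gradient:
  assumes "open \<Omega>"
  shows "u \<in> H01 \<Omega> \<longleftrightarrow> (\<exists>g. H01_gradient \<Omega> u g)"
    and "has_weak_gradient \<Omega> u g \<Longrightarrow> u \<in> H01 \<Omega> \<longleftrightarrow> H01_gradient \<Omega> u g"
proof -
  have *: "u \<in> H01 \<Omega> \<longleftrightarrow> H01_gradient \<Omega> u g" if g: "has_weak_gradient \<Omega> u g" for g
  proof -
    have "H01_norm \<Omega> (\<lambda>x. u x - \<phi> x) = L2_norm (lebesgue_on \<Omega>) (\<lambda>x. g x - gradient \<phi> x)"
      if "\<phi> \<in> test_functions \<Omega>" for \<phi>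
      unfolding H01_norm_eq using assms that g
      by (intro weak_gradient_L2_norm has_weak_gradient_diff has_weak_gradient_test)
    then show ?thesis using g
      by (auto simp: H01_def H1_def H01_gradient_def H1_norm_eq tendsto_sqrt_sum_squares_iff)
  qed
  then show "has_weak_gradient \<Omega> u g \<Longrightarrow> u \<in> H01 \<Omega> \<longleftrightarrow> H01_gradient \<Omega> u g" .
  show "u \<in> H01 \<Omega> \<longleftrightarrow> (\<exists>g. H01_gradient \<Omega> u g)"
  proof
    assume u: "u \<in> H01 \<Omega>"
    then obtain g where "has_weak_gradient \<Omega> u g" by (auto simp: H01_def H1_def)
    with u * show "\<exists>g. H01_gradient \<Omega> u g" by blast
  qed (use * in \<open>auto simp: H01_gradient_def\<close>)
qed

lemma H01_weak_gradient:
  assumes "open \<Omega>" "u \<in> H01 \<Omega>"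
  shows "has_weak_gradient \<Omega> u (weak_gradient \<Omega> u)"
  using assms by (auto simp: H01_def H1_def intro: has_weak_gradient_weak_gradient)

lemma
  assumes "open \<Omega>" "u \<in> H01 \<Omega>"
  shows H01_L2: "L2 (lebesgue_on \<Omega>) u"
    and weak_gradient_L2: "L2 (lebesgue_on \<Omega>) (weak_gradient \<Omega> u)"
  using H01_weak_gradient[OF assms] by (auto intro: has_weak_gradient_L2 has_weak_gradient_L2')

lemma H01_gradient_add:
  assumes "open \<Omega>" "H01_gradient \<Omega> u g" "H01_gradient \<Omega> v h"
  shows "H01_gradient \<Omega> (\<lambda>x. u x + v x) (\<lambda>x. g x + h x)"
proof -
  let ?M = "lebesgue_on \<Omega>"
  obtain \<phi> where \<phi>: "\<And>n::nat. \<phi> n \<in> test_functions \<Omega>" "(\<lambda>n. L2_norm ?M (\<lambda>x. u x - \<phi> n x)) \<longlonglongrightarrow> 0"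
     "(\<lambda>n. L2_norm ?M (\<lambda>x. g x - gradient (\<phi> n) x)) \<longlonglongrightarrow> 0"
    using assms(2) by (auto simp: H01_gradient_def)
  obtain \<psi> where \<psi>: "\<And>n::nat. \<psi> n \<in> test_functions \<Omega>" "(\<lambda>n. L2_norm ?M (\<lambda>x. v x - \<psi> n x)) \<longlonglongrightarrow> 0"
     "(\<lambda>n. L2_norm ?M (\<lambda>x. h x - gradient (\<psi> n) x)) \<longlonglongrightarrow> 0"
    using assms(3) by (auto simp: H01_gradient_def)
  have w: "has_weak_gradient \<Omega> u g" "has_weak_gradient \<Omega> v h"
    using assms by (auto simp: H01_gradient_def)
  note L = w[THEN has_weak_gradient_L2] w[THEN has_weak_gradient_L2']
    test_function_L2(2)[OF assms(1)] gradient_L2(2)[OF assms(1)]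
  have "L2_norm ?M (\<lambda>x. u x + v x - (\<phi> n x + \<psi> n x))
      \<le> L2_norm ?M (\<lambda>x. u x - \<phi> n x) + L2_norm ?M (\<lambda>x. v x - \<psi> n x)" for n
    using L2_norm_triangle[of ?M "\<lambda>x. u x - \<phi> n x" "\<lambda>x. v x - \<psi> n x"] L \<phi>(1) \<psi>(1)
    by (simp add: L2_diff algebra_simps)
  then have 1: "(\<lambda>n. L2_norm ?M (\<lambda>x. u x + v x - (\<phi> n x + \<psi> n x))) \<longlonglongrightarrow> 0"
    by (intro Lim_null_comparison[OF _ tendsto_add_zero[OF \<phi>(2) \<psi>(2)]]) simp
  have "L2_norm ?M (\<lambda>x. g x + h x - (gradient (\<phi> n) x + gradient (\<psi> n) x))
      \<le> L2_norm ?M (\<lambda>x. g x - gradient (\<phi> n) x) + L2_norm ?M (\<lambda>x. h x - gradient (\<psi> n) x)" for n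
    using L2_norm_triangle[of ?M "\<lambda>x. g x - gradient (\<phi> n) x" "\<lambda>x. h x - gradient (\<psi> n) x"] L \<phi>(1) \<psi>(1)
    by (simp add: L2_diff algebra_simps)
  then have 2: "(\<lambda>n. L2_norm ?M (\<lambda>x. g x + h x - (gradient (\<phi> n) x + gradient (\<psi> n) x))) \<longlonglongrightarrow> 0"
    by (intro Lim_null_comparison[OF _ tendsto_add_zero[OF \<phi>(3) \<psi>(3)]]) simp
  show ?thesis unfolding H01_gradient_def
    using 1 2 \<phi>(1) \<psi>(1) assms(1) w
    by (intro conjI has_weak_gradient_add exI[of _ "\<lambda>n x. \<phi> n x + \<psi> n x"])
      (auto intro: test_function_add simp: gradient_test_add[OF \<phi>(1) \<psi>(1)])
qed

lemma H01_gradient_cmult: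
  assumes "open \<Omega>" "H01_gradient \<Omega> u g"
  shows "H01_gradient \<Omega> (\<lambda>x. c * u x) (\<lambda>x. c *\<^sub>R g x)"
proof -
  let ?M = "lebesgue_on \<Omega>"
  obtain \<phi> where \<phi>: "\<And>n::nat. \<phi> n \<in> test_functions \<Omega>" "(\<lambda>n. L2_norm ?M (\<lambda>x. u x - \<phi> n x)) \<longlonglongrightarrow> 0"
     "(\<lambda>n. L2_norm ?M (\<lambda>x. g x - gradient (\<phi> n) x)) \<longlonglongrightarrow> 0"
    using assms(2) by (auto simp: H01_gradient_def)
  have 1: "(\<lambda>n. L2_norm ?M (\<lambda>x. c * u x - c * \<phi> n x)) \<longlonglongrightarrow> 0"
    using tendsto_mult_right_zero[OF \<phi>(2), of "\<bar>c\<bar>"] L2_norm_cmult[of ?M c "\<lambda>x. u x - \<phi> _ x"]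
    by (simp add: right_diff_distrib)
  have 2: "(\<lambda>n. L2_norm ?M (\<lambda>x. c *\<^sub>R g x - c *\<^sub>R gradient (\<phi> n) x)) \<longlonglongrightarrow> 0"
    using tendsto_mult_right_zero[OF \<phi>(3), of "\<bar>c\<bar>"] L2_norm_cmult[of ?M c "\<lambda>x. g x - gradient (\<phi> _) x"]
    by (simp add: scaleR_right_diff_distrib)
  show ?thesis unfolding H01_gradient_def
    using 1 2 \<phi>(1) assms
    by (intro conjI has_weak_gradient_cmult exI[of _ "\<lambda>n x. c * \<phi> n x"])
      (auto intro: test_function_cmult simp: gradient_test_cmult[OF \<phi>(1)] H01_gradient_def)
qed

lemma H01_gradient_test:
  assumes "open \<Omega>" "\<phi> \<in> test_functions \<Omega>"
  shows "H01_gradient \<Omega> \<phi> (gradient \<phi>)"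
  unfolding H01_gradient_def using assms
  by (intro conjI has_weak_gradient_test exI[of _ "\<lambda>_. \<phi>"]) (auto simp: L2_norm_def)

lemma H01_gradient_weak_gradient:
  "open \<Omega> \<Longrightarrow> u \<in> H01 \<Omega> \<Longrightarrow> H01_gradient \<Omega> u (weak_gradient \<Omega> u)"
  using H01_iff_gradient(2) H01_weak_gradient by blast

lemma H01_gradientD:
  assumes "open \<Omega>" "H01_gradient \<Omega> u g"
  shows "u \<in> H01 \<Omega>" "AE x in lebesgue_on \<Omega>. weak_gradient \<Omega> u x = g x"
    "H01_norm \<Omega> u = L2_norm (lebesgue_on \<Omega>) g"
  using assms H01_iff_gradient(1)[OF assms(1), of u] weak_gradient_AE(1)[OF assms(1), of u g]
    weak_gradient_L2_norm[OF assms(1), of u g]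
  by (auto simp: H01_gradient_def H01_norm_eq)

section \<open>Linear structure, inner product and closedness of $H_0^1$\<close>

context
  fixes \<Omega> :: "(real ^ 'n) set"
  assumes open_\<Omega>: "open \<Omega>"
begin

lemma H01_add: "u \<in> H01 \<Omega> \<Longrightarrow> v \<in> H01 \<Omega> \<Longrightarrow> (\<lambda>x. u x + v x) \<in> H01 \<Omega>"
  using H01_iff_gradient(1)[OF open_\<Omega>] H01_gradient_add[OF open_\<Omega>] by metis

lemma H01_cmult: "u \<in> H01 \<Omega> \<Longrightarrow> (\<lambda>x. c * u x) \<in> H01 \<Omega>"
  using H01_iff_gradient(1)[OF open_\<Omega>] H01_gradient_cmult[OF open_\<Omega>] by metis

lemma H01_diff: "u \<in> H01 \<Omega> \<Longrightarrow> v \<in> H01 \<Omega> \<Longrightarrow> (\<lambda>x. u x - v x) \<in> H01 \<Omega>"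
  using H01_add[of u "\<lambda>x. (-1) * v x"] H01_cmult[of v "-1"] by simp

lemma H01_test: "\<phi> \<in> test_functions \<Omega> \<Longrightarrow> \<phi> \<in> H01 \<Omega>"
  using H01_gradient_test[OF open_\<Omega>] H01_gradientD(1)[OF open_\<Omega>] by blast

lemma H01_zero: "(\<lambda>_. 0) \<in> H01 \<Omega>"
  by (rule H01_test[OF test_function_zero])

lemma H01_sum: "finite A \<Longrightarrow> (\<And>i. i \<in> A \<Longrightarrow> u i \<in> H01 \<Omega>) \<Longrightarrow> (\<lambda>x. \<Sum>i\<in>A. c i * u i x) \<in> H01 \<Omega>"
proof (induction A rule: finite_induct)
  case (insert i A)
  then have "(\<lambda>x. c i * u i x + (\<Sum>j\<in>A. c j * u j x)) \<in> H01 \<Omega>"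
    by (intro H01_add H01_cmult) auto
  with insert show ?case by simp
qed (simp add: H01_zero)

lemma H01_norm_test: "\<phi> \<in> test_functions \<Omega> \<Longrightarrow> H01_norm \<Omega> \<phi> = L2_norm lborel (gradient \<phi>)"
  using H01_gradientD(3)[OF open_\<Omega> H01_gradient_test[OF open_\<Omega>]] gradient_L2_norm[OF open_\<Omega>] by simp

lemma H01_norm_cmult: "u \<in> H01 \<Omega> \<Longrightarrow> H01_norm \<Omega> (\<lambda>x. c * u x) = \<bar>c\<bar> * H01_norm \<Omega> u"
  using H01_gradientD(3)[OF open_\<Omega> H01_gradient_cmult[OF open_\<Omega> H01_gradient_weak_gradient[OF open_\<Omega>]], of u c]
  by (simp add: L2_norm_cmult H01_norm_eq)

definition ip :: "(real ^ 'n \<Rightarrow> real) \<Rightarrow> (real ^ 'n \<Rightarrow> real) \<Rightarrow> real" where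
  "ip u v = (LINT x|lebesgue_on \<Omega>. weak_gradient \<Omega> u x \<bullet> weak_gradient \<Omega> v x)"

lemma ip_eq:
  assumes "H01_gradient \<Omega> u g" "H01_gradient \<Omega> v h"
  shows "ip u v = (LINT x|lebesgue_on \<Omega>. g x \<bullet> h x)"
proof -
  have "L2 (lebesgue_on \<Omega>) (weak_gradient \<Omega> u)" "L2 (lebesgue_on \<Omega>) (weak_gradient \<Omega> v)"
    "L2 (lebesgue_on \<Omega>) g" "L2 (lebesgue_on \<Omega>) h"
    using assms H01_gradientD(1)[OF open_\<Omega>] weak_gradient_L2[OF open_\<Omega>] has_weak_gradient_L2'
    unfolding H01_gradient_def by blast+
  note m = this[THEN L2_measurable]
  show ?thesis unfolding ip_def
  proof (rule integral_cong_AE)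
    show "AE x in lebesgue_on \<Omega>. weak_gradient \<Omega> u x \<bullet> weak_gradient \<Omega> v x = g x \<bullet> h x"
      using H01_gradientD(2)[OF open_\<Omega> assms(1)] H01_gradientD(2)[OF open_\<Omega> assms(2)]
      by eventually_elim simp
  qed (use m in auto)
qed

lemma ip_commute: "ip u v = ip v u"
  by (simp add: ip_def inner_commute)

lemma ip_self: "ip u u = (H01_norm \<Omega> u)\<^sup>2"
  by (simp add: ip_def H01_norm_eq L2_norm_power2 power2_norm_eq_inner)

lemma ip_add_left:
  assumes "u \<in> H01 \<Omega>" "v \<in> H01 \<Omega>" "w \<in> H01 \<Omega>"
  shows "ip (\<lambda>x. u x + v x) w = ip u w + ip v w"
proof -
  note g = assms[THEN H01_gradient_weak_gradient[OF open_\<Omega>]]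
  note L = assms[THEN weak_gradient_L2[OF open_\<Omega>]]
  show ?thesis
    using ip_eq[OF H01_gradient_add[OF open_\<Omega> g(1,2)] g(3)] L
    by (simp add: ip_def inner_add_left L2_inner_integrable)
qed

lemma ip_cmult_left:
  assumes "u \<in> H01 \<Omega>" "v \<in> H01 \<Omega>"
  shows "ip (\<lambda>x. c * u x) v = c * ip u v"
  using ip_eq[OF H01_gradient_cmult[OF open_\<Omega>] ] assms[THEN H01_gradient_weak_gradient[OF open_\<Omega>]]
  by (simp add: ip_def)

lemma ip_add_right: "u \<in> H01 \<Omega> \<Longrightarrow> v \<in> H01 \<Omega> \<Longrightarrow> w \<in> H01 \<Omega> \<Longrightarrow> ip w (\<lambda>x. u x + v x) = ip w u + ip w v"
  using ip_add_left[of u v w] by (simp add: ip_commute)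

lemma ip_cmult_right: "u \<in> H01 \<Omega> \<Longrightarrow> v \<in> H01 \<Omega> \<Longrightarrow> ip v (\<lambda>x. c * u x) = c * ip v u"
  using ip_cmult_left[of u v c] by (simp add: ip_commute)

lemma ip_diff_left:
  assumes "u \<in> H01 \<Omega>" "v \<in> H01 \<Omega>" "w \<in> H01 \<Omega>"
  shows "ip (\<lambda>x. u x - v x) w = ip u w - ip v w"
  using ip_add_left[OF assms(1) H01_cmult[OF assms(2), of "-1"] assms(3)] ip_cmult_left[OF assms(2,3), of "-1"]
  by simp

lemma ip_diff_right: "u \<in> H01 \<Omega> \<Longrightarrow> v \<in> H01 \<Omega> \<Longrightarrow> w \<in> H01 \<Omega> \<Longrightarrow> ip w (\<lambda>x. u x - v x) = ip w u - ip w v"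
  using ip_diff_left[of u v w] by (simp add: ip_commute)

lemma H01_norm_nonneg [simp]: "H01_norm \<Omega> u \<ge> 0"
  by (simp add: H01_norm_eq)

lemma ip_Cauchy_Schwarz:
  "u \<in> H01 \<Omega> \<Longrightarrow> v \<in> H01 \<Omega> \<Longrightarrow> \<bar>ip u v\<bar> \<le> H01_norm \<Omega> u * H01_norm \<Omega> v"
  unfolding ip_def H01_norm_eq by (intro L2_Cauchy_Schwarz weak_gradient_L2 open_\<Omega>)

lemma H01_norm_power2_add:
  assumes "u \<in> H01 \<Omega>" "v \<in> H01 \<Omega>"
  shows "(H01_norm \<Omega> (\<lambda>x. u x + v x))\<^sup>2 = (H01_norm \<Omega> u)\<^sup>2 + 2 * ip u v + (H01_norm \<Omega> v)\<^sup>2"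
  using assms by (simp add: ip_self[symmetric] ip_add_left ip_add_right H01_add ip_commute[of v u])

lemma H01_norm_power2_diff:
  assumes "u \<in> H01 \<Omega>" "v \<in> H01 \<Omega>"
  shows "(H01_norm \<Omega> (\<lambda>x. u x - v x))\<^sup>2 = (H01_norm \<Omega> u)\<^sup>2 - 2 * ip u v + (H01_norm \<Omega> v)\<^sup>2"
  using assms by (simp add: ip_self[symmetric] ip_diff_left ip_diff_right H01_diff ip_commute[of v u])

lemma H01_norm_triangle:
  assumes "u \<in> H01 \<Omega>" "v \<in> H01 \<Omega>"
  shows "H01_norm \<Omega> (\<lambda>x. u x + v x) \<le> H01_norm \<Omega> u + H01_norm \<Omega> v"
proof (rule power2_le_imp_le)
  show "(H01_norm \<Omega> (\<lambda>x. u x + v x))\<^sup>2 \<le> (H01_norm \<Omega> u + H01_norm \<Omega> v)\<^sup>2"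
    using ip_Cauchy_Schwarz[OF assms] by (simp add: H01_norm_power2_add[OF assms] power2_sum)
qed simp

lemma H01_norm_minus_commute: "u \<in> H01 \<Omega> \<Longrightarrow> v \<in> H01 \<Omega> \<Longrightarrow>
  H01_norm \<Omega> (\<lambda>x. u x - v x) = H01_norm \<Omega> (\<lambda>x. v x - u x)"
  using H01_norm_cmult[of "\<lambda>x. u x - v x" "-1"] by (simp add: H01_diff)

lemma H01_norm_triangle_diff:
  assumes "u \<in> H01 \<Omega>" "v \<in> H01 \<Omega>"
  shows "H01_norm \<Omega> (\<lambda>x. u x - v x) \<le> H01_norm \<Omega> u + H01_norm \<Omega> v"
  using H01_norm_triangle[OF assms(1) H01_cmult[OF assms(2), of "-1"]] H01_norm_cmult[OF assms(2), of "-1"]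
  by simp

lemma H01_approx:
  assumes "u \<in> H01 \<Omega>"
  obtains \<phi> where "\<And>n::nat. \<phi> n \<in> test_functions \<Omega>"
    "(\<lambda>n. L2_norm (lebesgue_on \<Omega>) (\<lambda>x. u x - \<phi> n x)) \<longlonglongrightarrow> 0"
    "(\<lambda>n. H01_norm \<Omega> (\<lambda>x. u x - \<phi> n x)) \<longlonglongrightarrow> 0"
  using assms by (auto simp: H01_def H1_norm_eq tendsto_sqrt_sum_squares_iff)

lemma H01_approx_within:
  assumes "u \<in> H01 \<Omega>" "e > 0"
  obtains \<phi> where "\<phi> \<in> test_functions \<Omega>" "L2_norm (lebesgue_on \<Omega>) (\<lambda>x. u x - \<phi> x) < e"
    "H01_norm \<Omega> (\<lambda>x. u x - \<phi> x) < e"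
proof -
  obtain \<phi> where \<phi>: "\<And>n::nat. \<phi> n \<in> test_functions \<Omega>"
    "(\<lambda>n. L2_norm (lebesgue_on \<Omega>) (\<lambda>x. u x - \<phi> n x)) \<longlonglongrightarrow> 0"
    "(\<lambda>n. H01_norm \<Omega> (\<lambda>x. u x - \<phi> n x)) \<longlonglongrightarrow> 0" using H01_approx[OF assms(1)] by blast
  have "\<forall>\<^sub>F n in sequentially. L2_norm (lebesgue_on \<Omega>) (\<lambda>x. u x - \<phi> n x) < e
      \<and> H01_norm \<Omega> (\<lambda>x. u x - \<phi> n x) < e"
    using order_tendstoD(2)[OF \<phi>(2) assms(2)] order_tendstoD(2)[OF \<phi>(3) assms(2)]
    by eventually_elim simp
  then obtain n where "L2_norm (lebesgue_on \<Omega>) (\<lambda>x. u x - \<phi> n x) < e"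
    "H01_norm \<Omega> (\<lambda>x. u x - \<phi> n x) < e" by (auto simp: eventually_sequentially)
  with \<phi>(1) that show ?thesis by blast
qed

text \<open>The gradients converge in L2 by completeness, and the defining identity of a weak
  gradient survives the limit because it pairs with fixed test functions. In the \<open>H01\<close>
  norm only the Cauchy property is assumed: the gradient of v is an output.\<close>

theorem H01_closed:
  assumes u: "\<And>n. u n \<in> H01 \<Omega>" and v: "L2 (lebesgue_on \<Omega>) v"
    and L: "(\<lambda>n. L2_norm (lebesgue_on \<Omega>) (\<lambda>x. u n x - v x)) \<longlonglongrightarrow> 0"
    and C: "\<And>e. e > 0 \<Longrightarrow> \<exists>N. \<forall>m\<ge>N. \<forall>n\<ge>N. H01_norm \<Omega> (\<lambda>x. u m x - u n x) < e"
  shows "v \<in> H01 \<Omega>" "(\<lambda>n. H01_norm \<Omega> (\<lambda>x. u n x - v x)) \<longlonglongrightarrow> 0"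
proof -
  let ?M = "lebesgue_on \<Omega>" and ?D = "\<lambda>n. weak_gradient \<Omega> (u n)"
  have D: "H01_gradient \<Omega> (u n) (?D n)" for n
    using u by (intro H01_gradient_weak_gradient open_\<Omega>)
  have w: "has_weak_gradient \<Omega> (u n) (?D n)" for n using D by (simp add: H01_gradient_def)
  have norm_diff: "H01_norm \<Omega> (\<lambda>x. u m x - u n x) = L2_norm ?M (\<lambda>x. ?D m x - ?D n x)" for m n
    unfolding H01_norm_eq by (intro weak_gradient_L2_norm has_weak_gradient_diff w open_\<Omega>)
  obtain g where g: "L2 ?M g" "(\<lambda>n. L2_norm ?M (\<lambda>x. ?D n x - g x)) \<longlonglongrightarrow> 0"
    by (rule L2_complete[of ?M ?D, OF weak_gradient_L2[OF open_\<Omega> u] C[unfolded norm_diff]])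
  have compo: "(\<lambda>n. L2_norm ?M (\<lambda>x. ?D n x $ i - g x $ i)) \<longlonglongrightarrow> 0" for i
  proof (rule Lim_null_comparison[OF _ g(2)])
    have "L2_norm ?M (\<lambda>x. ?D n x $ i - g x $ i) \<le> L2_norm ?M (\<lambda>x. ?D n x - g x)" for n
      unfolding L2_norm_def
    proof (intro real_sqrt_le_mono integral_mono)
      have *: "L2 ?M (\<lambda>x. ?D n x - g x)" by (intro L2_diff weak_gradient_L2 open_\<Omega> u g)
      show "integrable ?M (\<lambda>x. (norm (?D n x $ i - g x $ i))\<^sup>2)"
        using L2_integrable[OF L2_component[OF *, of i]] by simp
      show "integrable ?M (\<lambda>x. (norm (?D n x - g x))\<^sup>2)" by (rule L2_integrable[OF *])
      show "(norm (?D n x $ i - g x $ i))\<^sup>2 \<le> (norm (?D n x - g x))\<^sup>2" for x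
        using component_le_norm_cart[of "?D n x - g x" i] by (intro power_mono) auto
    qed
    then show "\<forall>\<^sub>F n in sequentially. norm (L2_norm ?M (\<lambda>x. ?D n x $ i - g x $ i)) \<le> L2_norm ?M (\<lambda>x. ?D n x - g x)"
      by simp
  qed
  have hg: "has_weak_gradient \<Omega> v g"
    unfolding has_weak_gradient_def square_integrable_eq_L2
  proof (intro conjI ballI allI g v)
    fix \<phi> i assume \<phi>: "\<phi> \<in> test_functions \<Omega>"
    have 1: "(\<lambda>n. LINT x|?M. u n x \<bullet> gradient \<phi> x $ i) \<longlonglongrightarrow> (LINT x|?M. v x \<bullet> gradient \<phi> x $ i)"
      by (intro L2_inner_tendsto H01_L2 L2_component gradient_L2 \<phi> open_\<Omega> u v L)
    have 2: "(\<lambda>n. LINT x|?M. ?D n x $ i \<bullet> \<phi> x) \<longlonglongrightarrow> (LINT x|?M. g x $ i \<bullet> \<phi> x)"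
      by (intro L2_inner_tendsto L2_component weak_gradient_L2 test_function_L2 \<phi> open_\<Omega> u g compo)
    have 3: "(LINT x|?M. u n x * gradient \<phi> x $ i) = - (LINT x|?M. ?D n x $ i * \<phi> x)" for n
      using w \<phi> by (simp add: has_weak_gradient_def)
    show "(LINT x|?M. v x * gradient \<phi> x $ i) = - (LINT x|?M. g x $ i * \<phi> x)"
      using LIMSEQ_unique[OF 1[unfolded inner_real_def 3] tendsto_minus[OF 2[unfolded inner_real_def]]] .
  qed
  have nd: "H01_norm \<Omega> (\<lambda>x. u n x - v x) = L2_norm ?M (\<lambda>x. ?D n x - g x)" for n
    unfolding H01_norm_eq by (intro weak_gradient_L2_norm has_weak_gradient_diff w hg open_\<Omega>)
  then show "(\<lambda>n. H01_norm \<Omega> (\<lambda>x. u n x - v x)) \<longlonglongrightarrow> 0" using g(2) by simp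
  \<comment> \<open>Test functions that approximate u n up to 1/(n+1) also approximate v, so v lies
    in the closure of the test functions.\<close>
  have "\<exists>\<phi>. \<phi> \<in> test_functions \<Omega> \<and> L2_norm ?M (\<lambda>x. u n x - \<phi> x) < inverse (real (Suc n))
      \<and> H01_norm \<Omega> (\<lambda>x. u n x - \<phi> x) < inverse (real (Suc n))" for n
    using H01_approx_within[OF u[of n], of "inverse (real (Suc n))"] by (metis inverse_positive_iff_positive of_nat_0_less_iff zero_less_Suc)
  then obtain \<phi> where \<phi>: "\<And>n. \<phi> n \<in> test_functions \<Omega>"
    "\<And>n. L2_norm ?M (\<lambda>x. u n x - \<phi> n x) < inverse (real (Suc n))"
    "\<And>n. H01_norm \<Omega> (\<lambda>x. u n x - \<phi> n x) < inverse (real (Suc n))" by metis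
  have nd': "H01_norm \<Omega> (\<lambda>x. u n x - \<phi> n x) = L2_norm ?M (\<lambda>x. ?D n x - gradient (\<phi> n) x)" for n
    unfolding H01_norm_eq by (intro weak_gradient_L2_norm has_weak_gradient_diff w has_weak_gradient_test \<phi> open_\<Omega>)
  have 1: "(\<lambda>n. L2_norm ?M (\<lambda>x. v x - \<phi> n x)) \<longlonglongrightarrow> 0"
  proof (rule Lim_null_comparison[OF _ tendsto_add_zero[OF L LIMSEQ_inverse_real_of_nat]])
    have "L2_norm ?M (\<lambda>x. v x - \<phi> n x) \<le> L2_norm ?M (\<lambda>x. u n x - v x) + inverse (real (Suc n))" for n
      using L2_norm_triangle_diff[OF v H01_L2[OF open_\<Omega> u] test_function_L2(2)[OF open_\<Omega> \<phi>(1)], of n n]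
        \<phi>(2)[of n] L2_norm_minus_commute[of ?M v "u n"] by simp
    then show "\<forall>\<^sub>F n in sequentially. norm (L2_norm ?M (\<lambda>x. v x - \<phi> n x))
        \<le> L2_norm ?M (\<lambda>x. u n x - v x) + inverse (real (Suc n))" by simp
  qed
  have 2: "(\<lambda>n. L2_norm ?M (\<lambda>x. g x - gradient (\<phi> n) x)) \<longlonglongrightarrow> 0"
  proof (rule Lim_null_comparison[OF _ tendsto_add_zero[OF g(2) LIMSEQ_inverse_real_of_nat]])
    have "L2_norm ?M (\<lambda>x. g x - gradient (\<phi> n) x) \<le> L2_norm ?M (\<lambda>x. ?D n x - g x) + inverse (real (Suc n))" for n
      using L2_norm_triangle_diff[OF g(1) weak_gradient_L2[OF open_\<Omega> u] gradient_L2(2)[OF open_\<Omega> \<phi>(1)], of n n]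
        \<phi>(3)[of n] L2_norm_minus_commute[of ?M g "?D n"] by (simp add: nd')
    then show "\<forall>\<^sub>F n in sequentially. norm (L2_norm ?M (\<lambda>x. g x - gradient (\<phi> n) x))
        \<le> L2_norm ?M (\<lambda>x. ?D n x - g x) + inverse (real (Suc n))" by simp
  qed
  have "H01_gradient \<Omega> v g"
    unfolding H01_gradient_def using hg \<phi>(1) 1 2 by blast
  then show "v \<in> H01 \<Omega>" by (rule H01_gradientD(1)[OF open_\<Omega>])
qed

end

section \<open>Gagliardo's inequality\<close>

text \<open>Slice integrals are not known to be finite beforehand, so powers are taken in
  \<open>ennreal\<close> with infinity fixed; for w > 0 the map is monotone and multiplicative
  there.\<close>

definition epow :: "real \<Rightarrow> ennreal \<Rightarrow> ennreal" where
  "epow w x = (if x = top then top else ennreal (enn2real x powr w))"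

lemma epow_ennreal: "a \<ge> 0 \<Longrightarrow> epow w (ennreal a) = ennreal (a powr w)"
  by (simp add: epow_def)

lemma epow_top [simp]: "epow w top = top"
  by (simp add: epow_def)

lemma epow_mono: "w > 0 \<Longrightarrow> x \<le> y \<Longrightarrow> epow w x \<le> epow w y"
  by (cases x; cases y) (auto simp: epow_ennreal top_unique intro!: ennreal_leI powr_mono2)

lemma epow_zero: "w > 0 \<Longrightarrow> epow w 0 = 0"
  using epow_ennreal[of 0 w] by simp

lemma epow_eq_0_iff: "w > 0 \<Longrightarrow> epow w x = 0 \<longleftrightarrow> x = 0"
  by (cases x) (auto simp: epow_ennreal)

lemma epow_mult: "w > 0 \<Longrightarrow> epow w (x * y) = epow w x * epow w y"
  by (cases x; cases y)
    (auto simp: epow_ennreal ennreal_mult[symmetric] powr_mult ennreal_mult_top ennreal_top_mult epow_zero)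

lemma measurable_epow [measurable]: "epow w \<in> borel_measurable borel"
  unfolding epow_def by measurable

text \<open>Arithmetic-geometric mean inequality; an infinite value makes the right-hand side
  infinite.\<close>

lemma prod_epow_le_mean:
  assumes "finite C" "C \<noteq> {}"
  shows "(\<Prod>c\<in>C. epow (1 / card C) (g c)) \<le> ennreal (1 / card C) * (\<Sum>c\<in>C. g c)"
proof (cases "\<exists>c\<in>C. g c = top")
  case True
  then obtain c where c: "c \<in> C" "g c = top" by blast
  then have "g c \<le> (\<Sum>c\<in>C. g c)" using assms by (intro member_le_sum) auto
  then have s: "(\<Sum>c\<in>C. g c) = top" using c by (simp add: top_unique)
  show ?thesis unfolding s using assms by (simp add: ennreal_mult_top card_gt_0_iff)
next
  case False
  define h where "h c = enn2real (g c)" for c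
  have g: "g c = ennreal (h c)" if "c \<in> C" for c using False that by (auto simp: h_def less_top)
  have h: "h c \<ge> 0" for c by (simp add: h_def)
  have "(\<Prod>c\<in>C. epow (1 / card C) (g c)) = ennreal (\<Prod>c\<in>C. h c powr (1 / card C))"
    by (simp add: g epow_ennreal h prod_ennreal)
  also have "(\<Prod>c\<in>C. h c powr (1 / card C)) = (\<Prod>c\<in>C. h c) powr (1 / card C)"
    by (intro prod_powr_distrib[symmetric] h)
  also have "ennreal \<dots> \<le> ennreal (\<Sum>c\<in>C. h c / card C)"
    using assms h by (intro ennreal_leI arith_geom_mean) auto
  also have "(\<Sum>c\<in>C. h c / card C) = 1 / card C * (\<Sum>c\<in>C. h c)"
    by (simp add: sum_divide_distrib)
  also have "ennreal \<dots> = ennreal (1 / card C) * (\<Sum>c\<in>C. g c)"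
    by (subst ennreal_mult) (auto simp: h g sum_nonneg sum_ennreal)
  finally show ?thesis .
qed

text \<open>Hoelder's inequality with equal exponents: each factor is normalised to integral 1 and
  the arithmetic-geometric mean inequality is applied pointwise. The degenerate cases are a
  vanishing integral, where the left side is 0, and otherwise an infinite one, where the right side
  is infinite.\<close>

theorem nn_integral_Holder_prod:
  assumes C: "finite C" "C \<noteq> {}" and [measurable]: "\<And>c. c \<in> C \<Longrightarrow> G c \<in> borel_measurable M"
  shows "(\<integral>\<^sup>+x. (\<Prod>c\<in>C. epow (1 / card C) (G c x)) \<partial>M)
    \<le> (\<Prod>c\<in>C. epow (1 / card C) (\<integral>\<^sup>+x. G c x \<partial>M))"
proof -
  define m where "m = card C"
  define A where "A c = (\<integral>\<^sup>+x. G c x \<partial>M)" for c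
  have m: "m > 0" using C by (simp add: m_def card_gt_0_iff)
  then have w: "1 / real m > 0" by simp
  consider c where "c \<in> C" "A c = 0" | "\<forall>c\<in>C. A c \<noteq> 0" "\<exists>c\<in>C. A c = top"
    | "\<forall>c\<in>C. A c \<noteq> 0 \<and> A c \<noteq> top" by blast
  then show ?thesis
  proof cases
    case 1
    then have "AE x in M. G c x = 0" by (simp add: A_def nn_integral_0_iff_AE)
    then have "AE x in M. (\<Prod>c\<in>C. epow (1 / card C) (G c x)) = 0"
      by eventually_elim (use 1 C w epow_zero in \<open>auto simp: m_def intro!: prod_zero bexI[of _ c]\<close>)
    then have "(\<integral>\<^sup>+x. (\<Prod>c\<in>C. epow (1 / card C) (G c x)) \<partial>M) = (\<integral>\<^sup>+x. 0 \<partial>M)"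
      by (rule nn_integral_cong_AE)
    then show ?thesis by simp
  next
    case 2
    then obtain c where c: "c \<in> C" "A c = top" by blast
    have "(\<Prod>c\<in>C - {c}. epow (1 / m) (A c)) \<noteq> 0"
      using C 2 w by (simp add: epow_eq_0_iff)
    then have "(\<Prod>c\<in>C. epow (1 / m) (A c)) = top"
      using C c by (simp add: prod.remove[of C c] ennreal_top_mult)
    then show ?thesis by (simp add: m_def A_def)
  next
    case 3
    define a where "a c = enn2real (A c)" for c
    have A: "A c = ennreal (a c)" and a: "a c > 0" if "c \<in> C" for c
      using 3 that by (auto simp: a_def enn2real_positive_iff less_top zero_less_iff_neq_zero)
    define H where "H c x = ennreal (1 / a c) * G c x" for c x
    have [measurable]: "H c \<in> borel_measurable M" if "c \<in> C" for c
      using that unfolding H_def[abs_def] by measurable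
    have GH: "G c x = A c * H c x" if "c \<in> C" for c x
    proof -
      have "ennreal (a c) * ennreal (1 / a c) = 1"
        using a[OF that] by (simp flip: ennreal_mult)
      then show ?thesis by (simp add: H_def A[OF that] mult.assoc[symmetric])
    qed
    have intH: "(\<integral>\<^sup>+x. H c x \<partial>M) = 1" if "c \<in> C" for c
    proof -
      have "(\<integral>\<^sup>+x. H c x \<partial>M) = ennreal (1 / a c) * A c"
        using that by (simp add: H_def nn_integral_cmult A_def)
      then show ?thesis using a[OF that] by (simp add: A[OF that] flip: ennreal_mult)
    qed
    have "(\<integral>\<^sup>+x. (\<Prod>c\<in>C. epow (1 / m) (G c x)) \<partial>M)
        = (\<integral>\<^sup>+x. (\<Prod>c\<in>C. epow (1 / m) (A c)) * (\<Prod>c\<in>C. epow (1 / m) (H c x)) \<partial>M)"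
      by (simp add: GH epow_mult[OF w] prod.distrib)
    also have "\<dots> \<le> (\<integral>\<^sup>+x. (\<Prod>c\<in>C. epow (1 / m) (A c)) * (ennreal (1 / m) * (\<Sum>c\<in>C. H c x)) \<partial>M)"
      unfolding m_def by (intro nn_integral_mono mult_left_mono prod_epow_le_mean C) auto
    also have "\<dots> = (\<Prod>c\<in>C. epow (1 / m) (A c)) * (ennreal (1 / m) * (\<Sum>c\<in>C. \<integral>\<^sup>+x. H c x \<partial>M))"
      by (simp add: nn_integral_cmult nn_integral_sum)
    also have "(\<Sum>c\<in>C. \<integral>\<^sup>+x. H c x \<partial>M) = ennreal (real m)"
      by (simp add: intH m_def ennreal_of_nat_eq_real_of_nat)
    also have "ennreal (1 / m) * ennreal (real m) = 1" using m by (simp flip: ennreal_mult)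
    finally show ?thesis by (simp add: m_def A_def)
  qed
qed

text \<open>Integrates out the coordinates in B and reads the others off x. The result is a function
  on the whole space that does not depend on the coordinates in B, so statements for different B
  live on the same space.\<close>

definition pint :: "'a set \<Rightarrow> ('a::euclidean_space \<Rightarrow> ennreal) \<Rightarrow> 'a \<Rightarrow> ennreal" where
  "pint B f x = (\<integral>\<^sup>+z. f ((\<Sum>b\<in>B. z b *\<^sub>R b) + (\<Sum>b\<in>Basis - B. (x \<bullet> b) *\<^sub>R b)) \<partial>(\<Pi>\<^sub>M b\<in>B. lborel))"

interpretation lborel_product: product_sigma_finite "\<lambda>_::'a. lborel :: real measure"
  by unfold_locales

lemma pint_measurable [measurable]:
  assumes [measurable]: "f \<in> borel_measurable borel" and "finite B"
  shows "pint B f \<in> borel_measurable borel"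
proof -
  interpret finite_product_sigma_finite "\<lambda>_. lborel :: real measure" B
    using \<open>finite B\<close> by unfold_locales
  show ?thesis unfolding pint_def by measurable
qed

lemma pint_empty: "pint {} f x = f x"
  by (simp add: pint_def PiM_empty nn_integral_count_space_finite euclidean_representation)

lemma pint_Basis:
  fixes f :: "'a::euclidean_space \<Rightarrow> ennreal"
  assumes [measurable]: "f \<in> borel_measurable borel"
  shows "pint Basis f x = (\<integral>\<^sup>+x. f x \<partial>lborel)"
proof -
  have "(\<integral>\<^sup>+x. f x \<partial>lborel)
      = (\<integral>\<^sup>+x. f x \<partial>distr (\<Pi>\<^sub>M b\<in>Basis. lborel) borel (\<lambda>z. \<Sum>b\<in>Basis. z b *\<^sub>R b))"
    using lborel_eq[where 'a='a] by (rule arg_cong)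
  then show ?thesis by (simp add: pint_def nn_integral_distr)
qed

lemma pint_insert:
  assumes [measurable]: "f \<in> borel_measurable borel"
    and "finite B" "B \<subseteq> Basis" "c \<in> Basis" "c \<notin> B"
  shows "pint (insert c B) f x = (\<integral>\<^sup>+s. pint B f (x + (s - x \<bullet> c) *\<^sub>R c) \<partial>lborel)"
proof -
  have "pint (insert c B) f x = (\<integral>\<^sup>+s. \<integral>\<^sup>+z. f ((\<Sum>b\<in>insert c B. (z(c := s)) b *\<^sub>R b)
      + (\<Sum>b\<in>Basis - insert c B. (x \<bullet> b) *\<^sub>R b)) \<partial>(\<Pi>\<^sub>M b\<in>B. lborel) \<partial>lborel)"
    unfolding pint_def using assms by (intro lborel_product.product_nn_integral_insert_rev) auto
  also have "\<dots> = (\<integral>\<^sup>+s. pint B f (x + (s - x \<bullet> c) *\<^sub>R c) \<partial>lborel)"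
    unfolding pint_def
  proof (intro nn_integral_cong arg_cong[of _ _ f])
    fix s :: real and z
    have "(\<Sum>b\<in>insert c B. (z(c := s)) b *\<^sub>R b) = s *\<^sub>R c + (\<Sum>b\<in>B. z b *\<^sub>R b)"
      using assms by (simp) (rule sum.cong, auto)
    moreover have "(\<Sum>b\<in>Basis - B. ((x + (s - x \<bullet> c) *\<^sub>R c) \<bullet> b) *\<^sub>R b)
        = ((x + (s - x \<bullet> c) *\<^sub>R c) \<bullet> c) *\<^sub>R c + (\<Sum>b\<in>Basis - insert c B. ((x + (s - x \<bullet> c) *\<^sub>R c) \<bullet> b) *\<^sub>R b)"
      using assms by (subst sum.remove[of _ c]) (auto intro!: sum.cong)
    moreover have "(\<Sum>b\<in>Basis - insert c B. ((x + (s - x \<bullet> c) *\<^sub>R c) \<bullet> b) *\<^sub>R b)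
        = (\<Sum>b\<in>Basis - insert c B. (x \<bullet> b) *\<^sub>R b)"
      using assms by (intro sum.cong refl) (auto simp: inner_add_left inner_Basis)
    ultimately show "(\<Sum>b\<in>insert c B. (z(c := s)) b *\<^sub>R b) + (\<Sum>b\<in>Basis - insert c B. (x \<bullet> b) *\<^sub>R b)
        = (\<Sum>b\<in>B. z b *\<^sub>R b) + (\<Sum>b\<in>Basis - B. ((x + (s - x \<bullet> c) *\<^sub>R c) \<bullet> b) *\<^sub>R b)"
      using assms by (simp add: inner_add_left)
  qed
  finally show ?thesis .
qed

lemma pint_indep:
  assumes "B \<subseteq> Basis" "c \<in> B"
  shows "pint B f (x + r *\<^sub>R c) = pint B f x"
proof -
  have "(\<Sum>b\<in>Basis - B. ((x + r *\<^sub>R c) \<bullet> b) *\<^sub>R b) = (\<Sum>b\<in>Basis - B. (x \<bullet> b) *\<^sub>R b)"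
    using assms by (intro sum.cong refl) (auto simp: inner_add_left inner_Basis)
  then show ?thesis by (simp add: pint_def)
qed

text \<open>Induction over the coordinates already integrated. When coordinate c is added, the
  factor b = c does not depend on it and leaves the integral, and the remaining DIM - 1 factors
  carry exactly the exponents 1/(DIM - 1) that Hoelder's inequality requires.\<close>

lemma pint_prod_le:
  fixes F :: "'a::euclidean_space \<Rightarrow> ennreal"
  defines "w \<equiv> 1 / real (DIM('a) - 1)"
  assumes [measurable]: "F \<in> borel_measurable borel"
    and dim: "DIM('a) \<ge> 2" and "finite B" "B \<subseteq> Basis"
  shows "pint B (\<lambda>x. \<Prod>b\<in>Basis. epow w (pint {b} F x)) x \<le> (\<Prod>b\<in>Basis. epow w (pint (insert b B) F x))"
  using assms(4,5)
proof (induction B arbitrary: x rule: finite_induct)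
  case empty
  then show ?case by (simp add: pint_empty)
next
  case (insert c B)
  let ?x = "\<lambda>s. x + (s - x \<bullet> c) *\<^sub>R c" and ?\<Phi> = "\<lambda>x. \<Prod>b\<in>Basis. epow w (pint {b} F x)"
  have c: "c \<in> Basis" "B \<subseteq> Basis" using insert by auto
  have w: "w = 1 / card (Basis - {c})" using c by (simp add: w_def)
  have card: "card (Basis - {c}) \<noteq> 0" using c dim by simp
  then have ne: "Basis - {c} \<noteq> {}" by (metis card.empty)
  have "pint (insert c B) ?\<Phi> x = (\<integral>\<^sup>+s. pint B ?\<Phi> (?x s) \<partial>lborel)"
    using insert c by (intro pint_insert) auto
  also have "\<dots> \<le> (\<integral>\<^sup>+s. (\<Prod>b\<in>Basis. epow w (pint (insert b B) F (?x s))) \<partial>lborel)"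
    by (intro nn_integral_mono insert.IH c)
  also have "\<dots> = (\<integral>\<^sup>+s. epow w (pint (insert c B) F x)
      * (\<Prod>b\<in>Basis - {c}. epow w (pint (insert b B) F (?x s))) \<partial>lborel)"
    using c by (intro nn_integral_cong) (simp add: prod.remove[of Basis c] pint_indep)
  also have "\<dots> = epow w (pint (insert c B) F x)
      * (\<integral>\<^sup>+s. (\<Prod>b\<in>Basis - {c}. epow w (pint (insert b B) F (?x s))) \<partial>lborel)"
    using insert.hyps by (intro nn_integral_cmult) measurable
  also have "\<dots> \<le> epow w (pint (insert c B) F x)
      * (\<Prod>b\<in>Basis - {c}. epow w (\<integral>\<^sup>+s. pint (insert b B) F (?x s) \<partial>lborel))"
    unfolding w using insert.hyps ne by (intro mult_left_mono nn_integral_Holder_prod) (auto, measurable)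
  also have "\<dots> = epow w (pint (insert c B) F x)
      * (\<Prod>b\<in>Basis - {c}. epow w (pint (insert b (insert c B)) F x))"
  proof (intro arg_cong2[of _ _ _ _ "(*)"] prod.cong refl arg_cong[of _ _ "epow w"])
    fix b assume "b \<in> Basis - {c}"
    then show "(\<integral>\<^sup>+s. pint (insert b B) F (?x s) \<partial>lborel) = pint (insert b (insert c B)) F x"
      using insert c by (subst pint_insert[symmetric]) (auto simp: insert_commute)
  qed
  also have "\<dots> = (\<Prod>b\<in>Basis. epow w (pint (insert b (insert c B)) F x))"
    using c by (simp add: prod.remove[of Basis c])
  finally show ?case .
qed

text \<open>The case in which all coordinates are integrated, where every factor on the right
  becomes the full integral of F. It is the Loomis-Whitney inequality for the line integrals of a
  single function.\<close>

theorem gagliardo: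
  fixes F :: "'a::euclidean_space \<Rightarrow> ennreal"
  assumes [measurable]: "F \<in> borel_measurable borel" and "DIM('a) \<ge> 2"
  shows "(\<integral>\<^sup>+x. (\<Prod>b\<in>Basis. epow (1 / real (DIM('a) - 1)) (\<integral>\<^sup>+s. F (x + (s - x \<bullet> b) *\<^sub>R b) \<partial>lborel)) \<partial>lborel)
    \<le> epow (1 / real (DIM('a) - 1)) (\<integral>\<^sup>+x. F x \<partial>lborel) ^ DIM('a)"
proof -
  have 1: "pint {b} F x = (\<integral>\<^sup>+s. F (x + (s - x \<bullet> b) *\<^sub>R b) \<partial>lborel)" if "b \<in> Basis" for b x
    using that pint_insert[of F "{}" b x] by (simp add: pint_empty)
  have "pint Basis (\<lambda>x. \<Prod>b\<in>Basis. epow (1 / real (DIM('a) - 1)) (pint {b} F x)) 0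
    \<le> (\<Prod>b\<in>Basis. epow (1 / real (DIM('a) - 1)) (pint (insert b Basis) F 0))"
    using assms(2) by (intro pint_prod_le) auto
  also have "\<dots> = epow (1 / real (DIM('a) - 1)) (\<integral>\<^sup>+x. F x \<partial>lborel) ^ DIM('a)"
    by (simp add: insert_absorb pint_Basis)
  finally show ?thesis by (simp add: pint_Basis 1 cong: prod.cong)
qed

section \<open>The Gagliardo--Nirenberg--Sobolev inequality\<close>

lemma powr_power': "n > 0 \<Longrightarrow> (x powr u) ^ n = (x::real) powr (real n * u)"
  by (cases "x = 0") (auto simp: powr_power)

text \<open>With q = p - 1 this is |t|^(p-2) t, the nonlinearity of the equation, and up to the
  factor p the derivative of |t|^p.\<close>

definition sgn_powr :: "real \<Rightarrow> real \<Rightarrow> real" where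
  "sgn_powr q t = \<bar>t\<bar> powr q * sgn t"

lemma abs_powr_tendsto_0: "q > 0 \<Longrightarrow> ((\<lambda>h::real. \<bar>h\<bar> powr q) \<longlongrightarrow> 0) (at 0)"
  using tendsto_powr'[of "\<lambda>h::real. \<bar>h\<bar>" 0 "at 0" "\<lambda>_. q" q]
  by (simp add: tendsto_rabs_zero)

lemma has_real_derivative_abs_powr:
  assumes p: "p > 1"
  shows "((\<lambda>t. \<bar>t\<bar> powr p) has_real_derivative p * sgn_powr (p - 1) t) (at t)"
proof (cases t "0::real" rule: linorder_cases)
  case less
  have "((\<lambda>t. (- t) powr p) has_real_derivative p * sgn_powr (p - 1) t) (at t)"
    using less by (auto intro!: derivative_eq_intros simp: sgn_powr_def powr_diff field_simps)
  moreover have "\<forall>\<^sub>F x in nhds t. \<bar>x\<bar> powr p = (- x) powr p"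
    using less by (intro eventually_mono[OF eventually_nhds_in_open[of "{..<0}"]]) auto
  ultimately show ?thesis by (subst DERIV_cong_ev[OF refl _ refl])
next
  case greater
  have "((\<lambda>t. t powr p) has_real_derivative p * sgn_powr (p - 1) t) (at t)"
    using greater by (auto intro!: derivative_eq_intros simp: sgn_powr_def powr_diff field_simps)
  moreover have "\<forall>\<^sub>F x in nhds t. \<bar>x\<bar> powr p = x powr p"
    using greater by (intro eventually_mono[OF eventually_nhds_in_open[of "{0<..}"]]) auto
  ultimately show ?thesis by (subst DERIV_cong_ev[OF refl _ refl])
next
  case equal
  have "((\<lambda>h::real. \<bar>h\<bar> powr p / h) \<longlongrightarrow> 0) (at 0)"
  proof (rule Lim_null_comparison[OF _ abs_powr_tendsto_0[of "p - 1"]])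
    have "norm (\<bar>h\<bar> powr p / h) \<le> \<bar>h\<bar> powr (p - 1)" if "h \<noteq> 0" for h :: real
      using that by (simp add: powr_diff)
    then show "\<forall>\<^sub>F h in at 0. norm (\<bar>h\<bar> powr p / h) \<le> \<bar>h\<bar> powr (p - 1)"
      by (simp add: eventually_at_filter)
  qed (use p in simp)
  then show ?thesis using equal by (simp add: DERIV_def sgn_powr_def)
qed

lemma has_real_derivative_sgn_powr:
  assumes q: "q > 1"
  shows "(sgn_powr q has_real_derivative q * \<bar>t\<bar> powr (q - 1)) (at t)"
proof (cases t "0::real" rule: linorder_cases)
  case less
  have "((\<lambda>t. - ((- t) powr q)) has_real_derivative q * \<bar>t\<bar> powr (q - 1)) (at t)"
    using less by (auto intro!: derivative_eq_intros simp: powr_diff field_simps)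
  moreover have "\<forall>\<^sub>F x in nhds t. sgn_powr q x = - ((- x) powr q)"
    using less by (intro eventually_mono[OF eventually_nhds_in_open[of "{..<0}"]]) (auto simp: sgn_powr_def)
  ultimately show ?thesis by (subst DERIV_cong_ev[OF refl _ refl])
next
  case greater
  have "((\<lambda>t. t powr q) has_real_derivative q * \<bar>t\<bar> powr (q - 1)) (at t)"
    using greater by (auto intro!: derivative_eq_intros simp: powr_diff field_simps)
  moreover have "\<forall>\<^sub>F x in nhds t. sgn_powr q x = x powr q"
    using greater by (intro eventually_mono[OF eventually_nhds_in_open[of "{0<..}"]]) (auto simp: sgn_powr_def)
  ultimately show ?thesis by (subst DERIV_cong_ev[OF refl _ refl])
next
  case equal
  have "((\<lambda>h::real. sgn_powr q h / h) \<longlongrightarrow> 0) (at 0)"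
  proof (rule Lim_null_comparison[OF _ abs_powr_tendsto_0[of "q - 1"]])
    have "norm (sgn_powr q h / h) \<le> \<bar>h\<bar> powr (q - 1)" if "h \<noteq> 0" for h :: real
      using that by (simp add: powr_diff sgn_powr_def abs_mult abs_sgn_eq)
    then show "\<forall>\<^sub>F h in at 0. norm (sgn_powr q h / h) \<le> \<bar>h\<bar> powr (q - 1)"
      by (simp add: eventually_at_filter)
  qed (use q in simp)
  then show ?thesis using equal by (simp add: DERIV_def sgn_powr_def)
qed

lemma continuous_on_abs_powr: "q > 0 \<Longrightarrow> continuous_on S (\<lambda>t::real. \<bar>t\<bar> powr q)"
  by (intro continuous_on_powr' continuous_intros) auto

lemma continuous_on_sgn_powr: "q > 1 \<Longrightarrow> continuous_on S (sgn_powr q)"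
  by (rule DERIV_continuous_on) (auto intro: has_field_derivative_at_within has_real_derivative_sgn_powr)

lemma measurable_sgn_powr [measurable]: "sgn_powr q \<in> borel_measurable borel"
  unfolding sgn_powr_def[abs_def] by measurable

text \<open>The fundamental theorem of calculus on the line through x in direction b, started
  outside the support. A power of |u| is taken so that the resulting inequality closes with the L2
  norm of the gradient.\<close>

lemma abs_powr_le_line_integral:
  fixes u :: "real ^ 'n \<Rightarrow> real"
  assumes u: "u \<in> test_functions \<Omega>" and g: "g > 2" and b: "b \<in> Basis"
  shows "ennreal (\<bar>u x\<bar> powr g)
    \<le> (\<integral>\<^sup>+s. ennreal (g * \<bar>u (x + (s - x \<bullet> b) *\<^sub>R b)\<bar> powr (g - 1)
        * norm (gradient u (x + (s - x \<bullet> b) *\<^sub>R b))) \<partial>lborel)"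
proof -
  define y where "y s = x + (s - x \<bullet> b) *\<^sub>R b" for s
  define h where "h s = \<bar>u (y s)\<bar> powr g" for s
  define h' where "h' s = g * sgn_powr (g - 1) (u (y s)) * (gradient u (y s) \<bullet> b)" for s
  note s = test_function_smooth[OF u]
  obtain K where K: "compact K" "\<And>x. x \<notin> K \<Longrightarrow> u x = 0"
    using u by (rule test_functionE) blast
  then obtain R where R: "\<And>y. y \<in> K \<Longrightarrow> norm y \<le> R"
    using compact_imp_bounded bounded_iff by metis
  have yb: "y s \<bullet> b = s" for s using b by (simp add: y_def inner_add_left)
  \<comment> \<open>The b-coordinate of y a is a, so |a| > R places y a outside the support, while a
    does not exceed the b-coordinate of x.\<close>
  define a where "a = min (x \<bullet> b) (- \<bar>R\<bar> - 1)"
  have "norm (y a) > R"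
    using Basis_le_norm[OF b, of "y a"] by (auto simp: yb a_def)
  then have ha: "h a = 0" using K R g by (force simp: h_def)
  have hx: "h (x \<bullet> b) = \<bar>u x\<bar> powr g" by (simp add: h_def y_def)
  have uy: "((\<lambda>s. u (y s)) has_real_derivative (gradient u (y s) \<bullet> b)) (at s)" for s
  proof -
    have "(y has_derivative (\<lambda>r. r *\<^sub>R b)) (at s)"
      unfolding y_def by (auto intro!: derivative_eq_intros)
    from has_derivative_compose[OF this has_derivative_gradient[OF smooth_differentiable[OF s]]]
    show ?thesis by (simp add: has_field_derivative_def mult_commute_abs)
  qed
  have der: "(h has_real_derivative h' s) (at s)" for s
    unfolding h_def[abs_def] h'_def
    using DERIV_chain2[OF has_real_derivative_abs_powr[of g "u (y s)"] uy] g by simp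
  have cy: "continuous_on UNIV y" unfolding y_def[abs_def] by (intro continuous_intros)
  have cont: "continuous_on UNIV h'"
    unfolding h'_def using g
    by (intro continuous_intros continuous_on_compose2[OF continuous_on_sgn_powr[of "g - 1" UNIV]]
        continuous_on_compose2[OF smooth_continuous_on[OF s, of UNIV] cy]
        continuous_on_compose2[OF smooth_continuous_on_gradient[OF s, of UNIV] cy]) auto
  have [measurable]: "h' \<in> borel_measurable borel" using cont by (rule borel_measurable_continuous_onI)
  have ax: "a \<le> x \<bullet> b" by (simp add: a_def)
  have FTC: "(LINT s|lborel. h' s * indicator {a..x \<bullet> b} s) = h (x \<bullet> b) - h a"
    using cont ax der by (intro integral_FTC_Icc_real) (auto simp: continuous_on_eq_continuous_at)
  have "ennreal (\<bar>u x\<bar> powr g) = ennreal (norm (LINT s|lborel. h' s * indicator {a..x \<bullet> b} s))"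
    by (simp add: FTC ha hx)
  also have "\<dots> \<le> (\<integral>\<^sup>+s. ennreal (norm (h' s * indicator {a..x \<bullet> b} s)) \<partial>lborel)"
  proof (rule integral_norm_bound_ennreal)
    have "integrable lborel (\<lambda>s. indicator {a..x \<bullet> b} s *\<^sub>R h' s)"
      using cont by (intro borel_integrable_compact) (auto intro: continuous_on_subset)
    then show "integrable lborel (\<lambda>s. h' s * indicator {a..x \<bullet> b} s)" by (simp add: mult.commute)
  qed
  also have "\<dots> \<le> (\<integral>\<^sup>+s. ennreal (g * \<bar>u (y s)\<bar> powr (g - 1) * norm (gradient u (y s))) \<partial>lborel)"
  proof (intro nn_integral_mono ennreal_leI)
    fix s :: real
    have "\<bar>gradient u (y s) \<bullet> b\<bar> \<le> norm (gradient u (y s))"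
      using Cauchy_Schwarz_ineq2[of "gradient u (y s)" b] b by simp
    moreover have "\<bar>sgn_powr (g - 1) (u (y s))\<bar> \<le> \<bar>u (y s)\<bar> powr (g - 1)"
      by (simp add: sgn_powr_def abs_mult abs_sgn_eq)
    ultimately have "\<bar>h' s\<bar> \<le> g * \<bar>u (y s)\<bar> powr (g - 1) * norm (gradient u (y s))"
      unfolding h'_def abs_mult using g by (intro mult_mono) auto
    then show "norm (h' s * indicator {a..x \<bullet> b} s) \<le> g * \<bar>u (y s)\<bar> powr (g - 1) * norm (gradient u (y s))"
      using g by (auto simp: indicator_def)
  qed
  finally show ?thesis by (simp add: y_def)
qed

text \<open>The value is the power g of |u| for which g d/(d-1) and 2(g-1) both equal the critical
  exponent. It doubles as the constant of the inequality because differentiating |u|^g produces the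
  factor g.\<close>

definition gns_const :: "nat \<Rightarrow> real" where
  "gns_const d = 2 * (real d - 1) / (real d - 2)"

text \<open>Gagliardo's inequality for the line integrals of g |u|^(g-1) |grad u|, followed by
  Cauchy-Schwarz, gives A^((d-1)/d) <= g A^(1/2) G for the integral A of |u|^p. As A is finite by
  compact support, A^(1/2) can be divided out when A > 0.\<close>

theorem gagliardo_nirenberg_sobolev:
  fixes u :: "real ^ 'n \<Rightarrow> real"
  assumes d: "CARD('n) \<ge> 3" and u: "u \<in> test_functions \<Omega>"
  shows "(LINT x|lborel. \<bar>u x\<bar> powr crit_exp CARD('n)) powr (1 / crit_exp CARD('n))
    \<le> gns_const CARD('n) * L2_norm lborel (gradient u)"
proof -
  define d where "d = real CARD('n)"
  define p where "p = crit_exp CARD('n)"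
  define g where "g = gns_const CARD('n)"
  define w where "w = 1 / real (CARD('n) - 1)"
  have d3: "d \<ge> 3" using assms(1) by (simp add: d_def)
  have p: "p = 2 * d / (d - 2)" by (simp add: p_def crit_exp_def d_def)
  have g: "g = 2 * (d - 1) / (d - 2)" by (simp add: g_def gns_const_def d_def)
  have w: "w = 1 / (d - 1)" using assms(1) by (simp add: w_def d_def of_nat_diff)
  have p1: "p > 1" "p > 0" using d3 by (auto simp: p field_simps)
  have g2: "g > 2" using d3 by (simp add: g field_simps)
  have w0: "w > 0" using d3 by (simp add: w)
  have "g * (d - 2) = 2 * (d - 1)" "w * (d - 1) = 1" using d3 by (simp_all add: g w)
  then have "(g * w * d * (d - 2)) * (d - 1) = (2 * d) * (d - 1)" by algebra
  then have "g * w * d * (d - 2) = 2 * d" using d3 by simp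
  then have "g * w * d = p" using d3 by (simp add: p eq_divide_eq)
  moreover have "(g - 1) * 2 = p" "1 / p + 1 / 2 = (d - 1) / d"
    using d3 by (auto simp: p g field_simps)
  ultimately have exps: "g * w * d = p" "(g - 1) * 2 = p" "1 / p + 1 / 2 = (d - 1) / d" by auto
  obtain K where K: "compact K" "\<And>x. x \<notin> K \<Longrightarrow> u x = 0"
    using u by (rule test_functionE) blast
  note s = test_function_smooth[OF u]
  note cu = smooth_continuous_on[OF s, of UNIV] and cg = smooth_continuous_on_gradient[OF s, of UNIV]
  note [measurable] = test_function_borel[OF u] gradient_borel[OF u]
  have cpow: "continuous_on UNIV (\<lambda>x. \<bar>u x\<bar> powr q)" if "q > 0" for q
    using that by (intro continuous_on_compose2[OF continuous_on_abs_powr[of q UNIV] cu]) auto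
  define A where "A = (LINT x|lborel. \<bar>u x\<bar> powr p)"
  have intA: "integrable lborel (\<lambda>x. \<bar>u x\<bar> powr p)"
    using K p1 by (intro compact_support_integrable[of _ K] cpow) auto
  have A0: "A \<ge> 0" by (simp add: A_def)
  have sq: "(\<bar>t\<bar> powr (g - 1))\<^sup>2 = \<bar>t\<bar> powr p" for t :: real
  proof -
    have "(g - 1) + (g - 1) = p" using exps(2) by simp
    then show ?thesis by (simp only: power2_eq_square powr_add[symmetric])
  qed
  have L2u: "L2 lborel (\<lambda>x. \<bar>u x\<bar> powr (g - 1))"
    unfolding L2_def using intA by (simp add: sq)
  have L2n: "L2_norm lborel (\<lambda>x. \<bar>u x\<bar> powr (g - 1)) = sqrt A"
    unfolding L2_norm_def by (simp add: sq A_def)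
  have L2g: "L2 lborel (\<lambda>x. norm (gradient u x))"
    using gradient_L2(1)[OF open_UNIV test_function_mono[OF subset_UNIV u]] by (simp add: L2_def)
  define G where "G = L2_norm lborel (gradient u)"
  have L2ng: "L2_norm lborel (\<lambda>x. norm (gradient u x)) = G" by (simp add: G_def L2_norm_def)
  define F where "F x = ennreal (g * \<bar>u x\<bar> powr (g - 1) * norm (gradient u x))" for x
  have [measurable]: "F \<in> borel_measurable borel" unfolding F_def[abs_def] by measurable
  define I where "I = (LINT x|lborel. \<bar>u x\<bar> powr (g - 1) * norm (gradient u x))"
  have I0: "I \<ge> 0" by (simp add: I_def)
  have intF: "(\<integral>\<^sup>+x. F x \<partial>lborel) = ennreal (g * I)"
  proof -
    have "(\<integral>\<^sup>+x. F x \<partial>lborel) = (\<integral>\<^sup>+x. ennreal (g * (\<bar>u x\<bar> powr (g - 1) * norm (gradient u x))) \<partial>lborel)"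
      by (simp add: F_def mult.assoc)
    also have "\<dots> = ennreal (LINT x|lborel. g * (\<bar>u x\<bar> powr (g - 1) * norm (gradient u x)))"
      using L2_mult_integrable[OF L2u L2g] g2 by (intro nn_integral_eq_integral) auto
    finally show ?thesis by (simp add: I_def)
  qed
  have I: "I \<le> sqrt A * G"
    using L2_Cauchy_Schwarz[OF L2u L2g] by (simp add: I_def L2n L2ng)
  have "ennreal A = (\<integral>\<^sup>+x. ennreal (\<bar>u x\<bar> powr p) \<partial>lborel)"
    unfolding A_def using intA by (intro nn_integral_eq_integral[symmetric]) auto
  also have "\<dots> \<le> (\<integral>\<^sup>+x. (\<Prod>b\<in>Basis. epow w (\<integral>\<^sup>+s. F (x + (s - x \<bullet> b) *\<^sub>R b) \<partial>lborel)) \<partial>lborel)"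
  proof (intro nn_integral_mono)
    fix x
    \<comment> \<open>Raising the line estimate to the power w and multiplying over all d directions
      produces |u|^(g w d) = |u|^p.\<close>
    have "ennreal (\<bar>u x\<bar> powr p) = (\<Prod>b\<in>(Basis::(real^'n) set). epow w (ennreal (\<bar>u x\<bar> powr g)))"
    proof -
      have "(\<bar>u x\<bar> powr (g * w)) ^ CARD('n) = \<bar>u x\<bar> powr p"
        by (simp add: powr_power' exps(1)[symmetric] d_def mult.commute)
      then show ?thesis by (simp add: epow_ennreal powr_powr ennreal_power)
    qed
    also have "\<dots> \<le> (\<Prod>b\<in>Basis. epow w (\<integral>\<^sup>+s. F (x + (s - x \<bullet> b) *\<^sub>R b) \<partial>lborel))"
      unfolding F_def by (intro prod_mono_ennreal epow_mono w0 abs_powr_le_line_integral[OF u g2])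
    finally show "ennreal (\<bar>u x\<bar> powr p) \<le> (\<Prod>b\<in>Basis. epow w (\<integral>\<^sup>+s. F (x + (s - x \<bullet> b) *\<^sub>R b) \<partial>lborel))" .
  qed
  also have "\<dots> \<le> epow w (\<integral>\<^sup>+x. F x \<partial>lborel) ^ CARD('n)"
    using gagliardo[of F] assms(1) by (simp add: w_def)
  also have "\<dots> = ennreal (((g * I) powr w) ^ CARD('n))"
    using g2 I0 by (simp add: intF epow_ennreal ennreal_power)
  also have "((g * I) powr w) ^ CARD('n) = (g * I) powr (d / (d - 1))"
    by (simp add: powr_power' w d_def)
  finally have "A \<le> (g * I) powr (d / (d - 1))" by simp
  also have "\<dots> \<le> (g * (sqrt A * G)) powr (d / (d - 1))"
    using I I0 g2 d3 by (intro powr_mono2 mult_left_mono) auto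
  finally have le: "A \<le> (g * (sqrt A * G)) powr (d / (d - 1))" .
  have "A powr (1 / p) \<le> g * G"
  proof (cases "A = 0")
    case True
    then show ?thesis using g2 by (simp add: G_def)
  next
    case False
    then have A: "A > 0" using A0 by simp
    have G0: "G \<ge> 0" by (simp add: G_def)
    have "A powr ((d - 1) / d) \<le> ((g * (sqrt A * G)) powr (d / (d - 1))) powr ((d - 1) / d)"
      using le A0 d3 by (intro powr_mono2) auto
    also have "\<dots> = g * (sqrt A * G)" using d3 A g2 G0 by (simp add: powr_powr)
    finally have "A powr (1 / p) * A powr (1 / 2) \<le> (g * G) * A powr (1 / 2)"
      by (simp add: exps(3)[symmetric] powr_add powr_half_sqrt A0 mult_ac)
    then show ?thesis using A by simp
  qed
  then show ?thesis by (simp add: A_def p_def g_def G_def)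
qed

section \<open>The Sobolev constant\<close>

lemma open_contains_nonempty_cbox:
  fixes \<Omega> :: "'a::euclidean_space set"
  assumes "open \<Omega>" "\<Omega> \<noteq> {}"
  obtains c d where "cbox c d \<subseteq> \<Omega>" "box c d \<noteq> {}"
proof -
  obtain x where "x \<in> \<Omega>" using assms(2) by blast
  then obtain c d where "cbox c d \<subseteq> \<Omega>" "x \<in> box c d"
    by (rule open_contains_cbox[OF assms(1)]) blast
  with that show thesis by blast
qed

lemma measure_lebesgue_on_finite:
  "bounded \<Omega> \<Longrightarrow> open \<Omega> \<Longrightarrow> finite_measure (lebesgue_on \<Omega>)"
  using bounded_set_imp_lmeasurable[of \<Omega>] by (auto intro!: finite_measure_lebesgue_on)

text \<open>The dimension bound is the one under which the critical exponent is finite and exceeds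
  2. p is a parameter tied to \<open>crit_exp\<close>, which keeps later terms short.\<close>

locale critical_domain =
  fixes \<Omega> :: "(real ^ 'n) set" and p :: real
  assumes open_\<Omega>: "open \<Omega>" and bounded_\<Omega>: "bounded \<Omega>" and nonempty_\<Omega>: "\<Omega> \<noteq> {}"
    and d3: "CARD('n) \<ge> 3" and p_def: "p = crit_exp CARD('n)"
begin

lemma p_gt_2: "p > 2"
  using d3 by (simp add: p_def crit_exp_def field_simps)

section \<open>Sobolev's inequality on $H_0^1$\<close>

lemma H01_norm_abs_diff:
  assumes "u \<in> H01 \<Omega>" "v \<in> H01 \<Omega>"
  shows "\<bar>H01_norm \<Omega> u - H01_norm \<Omega> v\<bar> \<le> H01_norm \<Omega> (\<lambda>x. u x - v x)"
  using H01_norm_triangle[OF open_\<Omega> H01_diff[OF open_\<Omega> assms] assms(2)]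
    H01_norm_triangle[OF open_\<Omega> H01_diff[OF open_\<Omega> assms(2,1)] assms(1)]
  by (simp add: H01_norm_minus_commute[OF open_\<Omega> assms(2,1)])

lemma H01_norm_tendsto:
  assumes "\<And>n. u n \<in> H01 \<Omega>" "v \<in> H01 \<Omega>" "(\<lambda>n. H01_norm \<Omega> (\<lambda>x. u n x - v x)) \<longlonglongrightarrow> 0"
  shows "(\<lambda>n. H01_norm \<Omega> (u n)) \<longlonglongrightarrow> H01_norm \<Omega> v"
proof -
  have "(\<lambda>n. H01_norm \<Omega> (u n) - H01_norm \<Omega> v) \<longlonglongrightarrow> 0"
    by (rule Lim_null_comparison[OF _ assms(3)]) (simp add: H01_norm_abs_diff assms)
  then show ?thesis by (simp add: LIM_zero_iff)
qed

lemma
  assumes \<phi>: "\<phi> \<in> test_functions \<Omega>"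
  shows test_powr_integrable: "integrable (lebesgue_on \<Omega>) (\<lambda>x. \<bar>\<phi> x\<bar> powr p)"
    and test_powr_integral: "(LINT x|lebesgue_on \<Omega>. \<bar>\<phi> x\<bar> powr p) = (LINT x|lborel. \<bar>\<phi> x\<bar> powr p)"
proof -
  obtain K where K: "compact K" "K \<subseteq> \<Omega>" "\<And>x. x \<notin> K \<Longrightarrow> \<phi> x = 0"
    using \<phi> by (rule test_functionE) blast
  have off: "\<phi> x = 0" if "x \<notin> \<Omega>" for x using K that by auto
  have c: "continuous_on UNIV (\<lambda>x. \<bar>\<phi> x\<bar> powr p)"
    using p_gt_2 smooth_continuous_on[OF test_function_smooth[OF \<phi>], of UNIV]
    by (intro continuous_on_compose2[OF continuous_on_abs_powr[of p UNIV]]) auto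
  have \<Omega>: "\<Omega> \<in> sets borel" using open_\<Omega> by simp
  have b: "(\<lambda>x. \<bar>\<phi> x\<bar> powr p) \<in> borel_measurable borel" using c by (rule borel_measurable_continuous_onI)
  have "integrable lborel (\<lambda>x. \<bar>\<phi> x\<bar> powr p)"
    by (rule compact_support_integrable[OF c K(1)]) (simp add: K)
  then show "integrable (lebesgue_on \<Omega>) (\<lambda>x. \<bar>\<phi> x\<bar> powr p)"
    by (subst integrable_lebesgue_on_iff_lborel[OF \<Omega> b]) (simp_all add: off)
  show "(LINT x|lebesgue_on \<Omega>. \<bar>\<phi> x\<bar> powr p) = (LINT x|lborel. \<bar>\<phi> x\<bar> powr p)"
    by (rule integral_lebesgue_on_eq_lborel[OF \<Omega> b]) (simp add: off)
qed

lemma test_sobolev: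
  assumes \<phi>: "\<phi> \<in> test_functions \<Omega>"
  shows "(LINT x|lebesgue_on \<Omega>. \<bar>\<phi> x\<bar> powr p) \<le> (gns_const CARD('n) * H01_norm \<Omega> \<phi>) powr p"
proof -
  let ?A = "LINT x|lebesgue_on \<Omega>. \<bar>\<phi> x\<bar> powr p"
  have A: "?A \<ge> 0" by simp
  have "?A = (?A powr (1 / p)) powr p"
    using p_gt_2 by (simp add: powr_powr)
  also have "\<dots> \<le> (gns_const CARD('n) * H01_norm \<Omega> \<phi>) powr p"
    using gagliardo_nirenberg_sobolev[OF d3 \<phi>] p_gt_2
    by (intro powr_mono2) (auto simp: H01_norm_test[OF open_\<Omega> \<phi>] test_powr_integral[OF \<phi>] p_def[symmetric])
  finally show ?thesis .
qed

text \<open>Almost everywhere convergence is added so that Fatou's lemma can carry integral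
  inequalities from test functions to all of \<open>H01\<close>.\<close>

lemma H01_approx_AE:
  assumes u: "u \<in> H01 \<Omega>"
  obtains \<phi> where "\<And>n::nat. \<phi> n \<in> test_functions \<Omega>"
    "(\<lambda>n. H01_norm \<Omega> (\<lambda>x. u x - \<phi> n x)) \<longlonglongrightarrow> 0"
    "(\<lambda>n. H01_norm \<Omega> (\<phi> n)) \<longlonglongrightarrow> H01_norm \<Omega> u"
    "AE x in lebesgue_on \<Omega>. (\<lambda>n. \<phi> n x) \<longlonglongrightarrow> u x"
proof -
  obtain \<psi> where \<psi>: "\<And>n::nat. \<psi> n \<in> test_functions \<Omega>"
    "(\<lambda>n. L2_norm (lebesgue_on \<Omega>) (\<lambda>x. u x - \<psi> n x)) \<longlonglongrightarrow> 0"
    "(\<lambda>n. H01_norm \<Omega> (\<lambda>x. u x - \<psi> n x)) \<longlonglongrightarrow> 0" using H01_approx[OF open_\<Omega> u] by blast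
  note h = H01_test[OF open_\<Omega> \<psi>(1)]
  have "\<exists>r::nat\<Rightarrow>nat. strict_mono r \<and> (AE x in lebesgue_on \<Omega>. (\<lambda>n. \<psi> (r n) x) \<longlonglongrightarrow> u x)"
    by (rule L2_tendsto_AE_subseq[OF H01_L2[OF open_\<Omega> h] H01_L2[OF open_\<Omega> u]])
      (use \<psi>(2) in \<open>simp add: L2_norm_minus_commute[of _ u]\<close>)
  then obtain r :: "nat \<Rightarrow> nat" where r: "strict_mono r" "AE x in lebesgue_on \<Omega>. (\<lambda>n. \<psi> (r n) x) \<longlonglongrightarrow> u x" by blast
  have 3: "(\<lambda>n. H01_norm \<Omega> (\<lambda>x. u x - \<psi> (r n) x)) \<longlonglongrightarrow> 0"
    using LIMSEQ_subseq_LIMSEQ[OF \<psi>(3) r(1)] by (simp add: o_def)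
  moreover have "(\<lambda>n. H01_norm \<Omega> (\<psi> (r n))) \<longlonglongrightarrow> H01_norm \<Omega> u"
    by (rule H01_norm_tendsto[OF h u]) (use 3 in \<open>simp add: H01_norm_minus_commute[OF open_\<Omega> u h]\<close>)
  ultimately show ?thesis using that[of "\<lambda>n. \<psi> (r n)"] \<psi>(1) r(2) by blast
qed

lemma H01_measurable: "u \<in> H01 \<Omega> \<Longrightarrow> u \<in> borel_measurable (lebesgue_on \<Omega>)"
  by (intro L2_measurable H01_L2 open_\<Omega>)

text \<open>Fatou's lemma with convergent bounds B n, the form in which an inequality with the
  \<open>H01\<close> norm on the right passes to the limit.\<close>

lemma AE_Fatou_powr:
  assumes [measurable]: "\<And>n. f n \<in> borel_measurable M" "u \<in> borel_measurable M"
    and int: "\<And>n. integrable M (\<lambda>x. \<bar>f n x\<bar> powr p)"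
    and AE: "AE x in M. (\<lambda>n. f n x) \<longlonglongrightarrow> u x"
    and le: "\<And>n. (LINT x|M. \<bar>f n x\<bar> powr p) \<le> B n" and B: "B \<longlonglongrightarrow> b"
  shows "integrable M (\<lambda>x. \<bar>u x\<bar> powr p)" "(LINT x|M. \<bar>u x\<bar> powr p) \<le> b"
proof -
  have [simp]: "B n \<ge> 0" for n
  proof -
    have "0 \<le> (LINT x|M. \<bar>f n x\<bar> powr p)" by simp
    then show ?thesis using le[of n] by linarith
  qed
  then have b0: "b \<ge> 0" using B by (intro LIMSEQ_le_const) auto
  have "(\<integral>\<^sup>+x. ennreal (\<bar>u x\<bar> powr p) \<partial>M) = (\<integral>\<^sup>+x. liminf (\<lambda>n. ennreal (\<bar>f n x\<bar> powr p)) \<partial>M)"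
    using AE
    by (intro nn_integral_cong_AE, eventually_elim)
      (use p_gt_2 in \<open>auto intro!: lim_imp_Liminf[symmetric] tendsto_ennrealI tendsto_powr' tendsto_rabs\<close>)
  also have "\<dots> \<le> liminf (\<lambda>n. \<integral>\<^sup>+x. ennreal (\<bar>f n x\<bar> powr p) \<partial>M)"
    by (intro nn_integral_liminf) simp
  also have "\<dots> \<le> liminf (\<lambda>n. ennreal (B n))"
    using int le by (intro Liminf_mono always_eventually allI) (auto simp: nn_integral_eq_integral intro!: ennreal_leI)
  also have "\<dots> = ennreal b"
    using B by (intro lim_imp_Liminf tendsto_ennrealI) auto
  finally have *: "(\<integral>\<^sup>+x. ennreal (\<bar>u x\<bar> powr p) \<partial>M) \<le> ennreal b" .
  show i: "integrable M (\<lambda>x. \<bar>u x\<bar> powr p)"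
    using * by (subst integrable_iff_bounded) (auto intro: le_less_trans)
  show "(LINT x|M. \<bar>u x\<bar> powr p) \<le> b"
    using * b0 by (subst (asm) nn_integral_eq_integral[OF i]) auto
qed

text \<open>Density of test functions and Fatou's lemma. Integrability matters in its own right: the
  integral of a function that is not integrable is 0 by convention, and the energy would then lose
  its critical term.\<close>

lemma
  assumes u: "u \<in> H01 \<Omega>"
  shows H01_powr_integrable: "integrable (lebesgue_on \<Omega>) (\<lambda>x. \<bar>u x\<bar> powr p)"
    and H01_sobolev: "(LINT x|lebesgue_on \<Omega>. \<bar>u x\<bar> powr p) \<le> (gns_const CARD('n) * H01_norm \<Omega> u) powr p"
proof -
  obtain \<phi> where \<phi>: "\<And>n::nat. \<phi> n \<in> test_functions \<Omega>"
    "(\<lambda>n. H01_norm \<Omega> (\<phi> n)) \<longlonglongrightarrow> H01_norm \<Omega> u"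
    "AE x in lebesgue_on \<Omega>. (\<lambda>n. \<phi> n x) \<longlonglongrightarrow> u x" using H01_approx_AE[OF u] by blast
  have g0: "gns_const CARD('n) \<ge> 0" using d3 by (simp add: gns_const_def)
  have "(\<lambda>n. (gns_const CARD('n) * H01_norm \<Omega> (\<phi> n)) powr p) \<longlonglongrightarrow> (gns_const CARD('n) * H01_norm \<Omega> u) powr p"
    using \<phi>(2) p_gt_2 g0 by (intro tendsto_powr' tendsto_intros) (auto simp: H01_norm_nonneg[OF open_\<Omega>])
  note F = AE_Fatou_powr[OF _ _ test_powr_integrable[OF \<phi>(1)] \<phi>(3) test_sobolev[OF \<phi>(1)] this]
  show "integrable (lebesgue_on \<Omega>) (\<lambda>x. \<bar>u x\<bar> powr p)"
    "(LINT x|lebesgue_on \<Omega>. \<bar>u x\<bar> powr p) \<le> (gns_const CARD('n) * H01_norm \<Omega> u) powr p"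
    by (intro F H01_measurable u H01_test open_\<Omega> \<phi>(1))+
qed

lemma Lq_norm_powr: "Lq_norm \<Omega> p u powr p = (LINT x|lebesgue_on \<Omega>. \<bar>u x\<bar> powr p)"
  using p_gt_2 by (simp add: Lq_norm_def powr_powr)

lemma energy_eq:
  "energy \<Omega> a b u = a / 2 * (H01_norm \<Omega> u)\<^sup>2 + b / 4 * (H01_norm \<Omega> u) ^ 4
     - 1 / p * (LINT x|lebesgue_on \<Omega>. \<bar>u x\<bar> powr p)"
  by (simp add: energy_def Lq_norm_powr p_def[symmetric])

lemma powr_integral_eq_0_iff:
  assumes u: "u \<in> H01 \<Omega>"
  shows "(LINT x|lebesgue_on \<Omega>. \<bar>u x\<bar> powr p) = 0 \<longleftrightarrow> ae_eq \<Omega> u (\<lambda>_. 0)"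
  using integral_nonneg_eq_0_iff_AE[OF H01_powr_integrable[OF u]] by (simp add: ae_eq_def)

lemma H01_norm_eq_0_imp: "u \<in> H01 \<Omega> \<Longrightarrow> H01_norm \<Omega> u = 0 \<Longrightarrow> ae_eq \<Omega> u (\<lambda>_. 0)"
proof -
  assume u: "u \<in> H01 \<Omega>" and "H01_norm \<Omega> u = 0"
  then have "(LINT x|lebesgue_on \<Omega>. \<bar>u x\<bar> powr p) \<le> 0" using H01_sobolev[OF u] by simp
  moreover have "(LINT x|lebesgue_on \<Omega>. \<bar>u x\<bar> powr p) \<ge> 0" by simp
  ultimately show "ae_eq \<Omega> u (\<lambda>_. 0)" using powr_integral_eq_0_iff[OF u] by linarith
qed

lemma powr_integral_pos:
  assumes u: "u \<in> H01 \<Omega>" and "\<not> ae_eq \<Omega> u (\<lambda>_. 0)"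
  shows "(LINT x|lebesgue_on \<Omega>. \<bar>u x\<bar> powr p) > 0"
proof -
  have "(LINT x|lebesgue_on \<Omega>. \<bar>u x\<bar> powr p) \<ge> 0" by simp
  with powr_integral_eq_0_iff[OF u] assms(2) show ?thesis by linarith
qed

text \<open>Guarantees that the infimum defining \<open>sobolev_const\<close> is taken over a
  nonempty set, where it is meaningful.\<close>

lemma exists_nonzero_test_function: "\<exists>\<phi>\<in>test_functions \<Omega>. \<not> ae_eq \<Omega> \<phi> (\<lambda>_. 0)"
proof -
  obtain c d where cd: "cbox c d \<subseteq> \<Omega>" "box c d \<noteq> {}"
    using open_contains_nonempty_cbox[OF open_\<Omega> nonempty_\<Omega>] .
  have b: "bump 1 c d \<in> test_functions \<Omega>"
    by (intro test_function_bump[OF box_subset_cbox cd(1)]) simp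
  have "\<not> ae_eq \<Omega> (bump 1 c d) (\<lambda>_. 0)"
  proof
    assume "ae_eq \<Omega> (bump 1 c d) (\<lambda>_. 0)"
    then have "AE x in lebesgue. x \<in> \<Omega> \<longrightarrow> bump 1 c d x = 0"
      using open_\<Omega> unfolding ae_eq_def by (subst (asm) AE_restrict_space_iff) auto
    then have "AE x in lebesgue. x \<notin> box c d"
    proof eventually_elim
      case (elim x)
      then show ?case using bump_pos_iff[of 1 c d x] cd(1) box_subset_cbox[of c d] by auto
    qed
    then have "box c d \<in> null_sets lebesgue" by (simp add: AE_iff_null_sets)
    then have "negligible (box c d)" by (simp add: negligible_iff_null_sets)
    then show False using open_not_negligible[of "box c d"] cd(2) by auto
  qed
  with b show ?thesis by blast
qed

text \<open>The Gagliardo-Nirenberg-Sobolev inequality bounds every quotient from below by 1/g^2,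
  with g = \<open>gns_const\<close>.\<close>

lemma sobolev_const_pos: "sobolev_const \<Omega> > 0"
proof -
  let ?Q = "{(H01_norm \<Omega> u)\<^sup>2 / (Lq_norm \<Omega> (crit_exp CARD('n)) u)\<^sup>2 | u. u \<in> H01 \<Omega> \<and> \<not> ae_eq \<Omega> u (\<lambda>_. 0)}"
  let ?g = "gns_const CARD('n)"
  have g0: "?g > 0" using d3 by (simp add: gns_const_def)
  have "1 / ?g\<^sup>2 \<le> Inf ?Q"
  proof (rule cInf_greatest)
    show "?Q \<noteq> {}" using exists_nonzero_test_function H01_test[OF open_\<Omega>] by fastforce
    fix y assume "y \<in> ?Q"
    then obtain u where u: "u \<in> H01 \<Omega>" "\<not> ae_eq \<Omega> u (\<lambda>_. 0)"
      and y: "y = (H01_norm \<Omega> u)\<^sup>2 / (Lq_norm \<Omega> p u)\<^sup>2" by (auto simp: p_def)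
    let ?A = "LINT x|lebesgue_on \<Omega>. \<bar>u x\<bar> powr p"
    have A: "?A > 0" using powr_integral_pos[OF u] .
    then have L: "Lq_norm \<Omega> p u > 0" by (simp add: Lq_norm_def)
    have "Lq_norm \<Omega> p u \<le> ((?g * H01_norm \<Omega> u) powr p) powr (1 / p)"
      unfolding Lq_norm_def using H01_sobolev[OF u(1)] A p_gt_2 by (intro powr_mono2) auto
    also have "\<dots> = ?g * H01_norm \<Omega> u"
      using p_gt_2 g0 by (simp add: powr_powr H01_norm_nonneg[OF open_\<Omega>])
    finally have "(Lq_norm \<Omega> p u)\<^sup>2 \<le> (?g * H01_norm \<Omega> u)\<^sup>2" using L by (intro power_mono) auto
    then show "1 / ?g\<^sup>2 \<le> y" using L g0 by (simp add: y field_simps power_mult_distrib)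
  qed
  then have "1 / ?g\<^sup>2 \<le> sobolev_const \<Omega>" by (simp add: sobolev_const_def)
  moreover have "1 / ?g\<^sup>2 > 0" using g0 by simp
  ultimately show ?thesis by linarith
qed

text \<open>The factor on the right is the sharp constant K in terms of which all three thresholds
  are expressed; the exponent -p/2 comes from raising the quadratic quotient to the power
  p/2.\<close>

lemma sobolev_inequality:
  assumes u: "u \<in> H01 \<Omega>"
  shows "(LINT x|lebesgue_on \<Omega>. \<bar>u x\<bar> powr p) \<le> sobolev_const \<Omega> powr (- p / 2) * H01_norm \<Omega> u powr p"
proof (cases "ae_eq \<Omega> u (\<lambda>_. 0)")
  case True
  then have "(LINT x|lebesgue_on \<Omega>. \<bar>u x\<bar> powr p) = 0" using powr_integral_eq_0_iff[OF u] by simp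
  then show ?thesis by simp
next
  case False
  let ?A = "LINT x|lebesgue_on \<Omega>. \<bar>u x\<bar> powr p"
  have A: "?A > 0" using powr_integral_pos[OF u False] .
  have "sobolev_const \<Omega> \<le> (H01_norm \<Omega> u)\<^sup>2 / (Lq_norm \<Omega> p u)\<^sup>2"
    unfolding sobolev_const_def p_def[symmetric] using u False
    by (intro cInf_lower bdd_belowI[of _ 0]) auto
  also have "(Lq_norm \<Omega> p u)\<^sup>2 = ?A powr (2 / p)"
    using A by (simp add: Lq_norm_def powr_power')
  finally have "sobolev_const \<Omega> * ?A powr (2 / p) \<le> (H01_norm \<Omega> u)\<^sup>2" using A by (simp add: field_simps)
  then have "(sobolev_const \<Omega> * ?A powr (2 / p)) powr (p / 2) \<le> ((H01_norm \<Omega> u)\<^sup>2) powr (p / 2)"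
    using sobolev_const_pos p_gt_2 by (intro powr_mono2) auto
  also have "((H01_norm \<Omega> u)\<^sup>2) powr (p / 2) = H01_norm \<Omega> u powr p"
    using powr_powr[of "H01_norm \<Omega> u" 2 "p / 2"] H01_norm_nonneg[OF open_\<Omega>, of u]
    by (cases "H01_norm \<Omega> u = 0") (auto simp: powr_numeral)
  also have "(sobolev_const \<Omega> * ?A powr (2 / p)) powr (p / 2) = sobolev_const \<Omega> powr (p / 2) * ?A"
    using sobolev_const_pos A p_gt_2 by (simp add: powr_mult powr_powr)
  finally show ?thesis using sobolev_const_pos by (simp add: powr_minus field_simps)
qed

text \<open>On a set of finite measure the L2 norm is controlled by the critical integral: with l
  the Sobolev bound of the Lp norm, squares of values up to l are at most l^2, and those of larger
  values at most l^(2-p) |u|^p.\<close>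

lemma poincare: "\<exists>C\<ge>0. \<forall>u\<in>H01 \<Omega>. L2_norm (lebesgue_on \<Omega>) u \<le> C * H01_norm \<Omega> u"
proof -
  let ?M = "lebesgue_on \<Omega>" and ?g = "gns_const CARD('n)"
  interpret finite_measure ?M using bounded_\<Omega> open_\<Omega> by (rule measure_lebesgue_on_finite)
  define m where "m = measure ?M (space ?M)"
  have m: "m \<ge> 0" by (simp add: m_def)
  have g0: "?g > 0" using d3 by (simp add: gns_const_def)
  have "L2_norm ?M u \<le> (sqrt (m + 1) * ?g) * H01_norm \<Omega> u" if u: "u \<in> H01 \<Omega>" for u
  proof (cases "H01_norm \<Omega> u = 0")
    case True
    then have "AE x in ?M. u x = 0" using H01_norm_eq_0_imp[OF u] by (simp add: ae_eq_def)
    then show ?thesis using L2_norm_eq_0_iff[OF H01_L2[OF open_\<Omega> u]] True by simp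
  next
    case False
    \<comment> \<open>At this scale both terms of the pointwise bound integrate to at most a
      multiple of l^2, which makes the estimate homogeneous in u.\<close>
    define l where "l = ?g * H01_norm \<Omega> u"
    have l: "l > 0" using False g0 H01_norm_nonneg[OF open_\<Omega>, of u] by (simp add: l_def)
    have le: "t\<^sup>2 \<le> l\<^sup>2 + l powr (2 - p) * \<bar>t\<bar> powr p" for t
    proof (cases "\<bar>t\<bar> \<le> l")
      case True
      then have "t\<^sup>2 \<le> l\<^sup>2" using l by (simp add: abs_le_square_iff[symmetric])
      then show ?thesis by (simp add: add_increasing2)
    next
      case False
      then have t: "\<bar>t\<bar> > 0" using l by linarith
      have "t\<^sup>2 = \<bar>t\<bar> powr (2 - p) * \<bar>t\<bar> powr p"
        using t powr_add[of "\<bar>t\<bar>" "2 - p" p] by (simp add: powr_numeral)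
      also have "\<dots> \<le> l powr (2 - p) * \<bar>t\<bar> powr p"
        using False l p_gt_2 by (intro mult_right_mono powr_mono2') auto
      finally show ?thesis by (simp add: add_increasing)
    qed
    have "(L2_norm ?M u)\<^sup>2 = (LINT x|?M. (u x)\<^sup>2)" by (simp add: L2_norm_power2)
    also have "\<dots> \<le> (LINT x|?M. l\<^sup>2 + l powr (2 - p) * \<bar>u x\<bar> powr p)"
      using L2_integrable[OF H01_L2[OF open_\<Omega> u]] H01_powr_integrable[OF u]
      by (intro integral_mono le) auto
    also have "\<dots> = m * l\<^sup>2 + l powr (2 - p) * (LINT x|?M. \<bar>u x\<bar> powr p)"
      using H01_powr_integrable[OF u] by (simp add: m_def)
    also have "\<dots> \<le> m * l\<^sup>2 + l powr (2 - p) * l powr p"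
      using H01_sobolev[OF u] by (intro add_left_mono mult_left_mono) (auto simp: l_def)
    also have "\<dots> = (sqrt (m + 1) * l)\<^sup>2"
    proof -
      have "l powr (2 - p) * l powr p = l\<^sup>2"
        using l powr_add[of l "2 - p" p] by (simp add: powr_numeral)
      then show ?thesis using m by (simp add: power_mult_distrib algebra_simps)
    qed
    finally have "L2_norm ?M u \<le> sqrt (m + 1) * l" by (rule power2_le_imp_le) (use l m in simp)
    then show ?thesis by (simp add: l_def mult.assoc)
  qed
  moreover have "sqrt (m + 1) * ?g \<ge> 0" using m g0 by simp
  ultimately show ?thesis by blast
qed

text \<open>The infimum runs over \<open>H01\<close>, but the rescaling argument needs compact
  support. If all test functions obeyed the bound with k, Fatou's lemma would extend a bound with
  some k' < K to \<open>H01\<close> and force \<open>sobolev_const\<close> above itself.\<close>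

lemma near_optimal_test_function:
  assumes "k < sobolev_const \<Omega> powr (- p / 2)"
  obtains \<phi> where "\<phi> \<in> test_functions \<Omega>" "H01_norm \<Omega> \<phi> > 0"
    "(LINT x|lebesgue_on \<Omega>. \<bar>\<phi> x\<bar> powr p) > k * H01_norm \<Omega> \<phi> powr p"
proof (rule ccontr)
  note T = that
  assume nt: "\<not> thesis"
  have no: "(LINT x|lebesgue_on \<Omega>. \<bar>\<phi> x\<bar> powr p) \<le> k * H01_norm \<Omega> \<phi> powr p"
    if "\<phi> \<in> test_functions \<Omega>" "H01_norm \<Omega> \<phi> > 0" for \<phi> using T[OF that] nt by (meson linorder_not_le)
  \<comment> \<open>k may be negative or zero; k' is positive, as the powers below require, and
    still smaller than the sharp constant.\<close>
  define k' where "k' = max k (sobolev_const \<Omega> powr (- p / 2) / 2)"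
  have k': "0 < k'" "k' < sobolev_const \<Omega> powr (- p / 2)" "k \<le> k'"
    using assms sobolev_const_pos by (auto simp: k'_def less_max_iff_disj)
  have no': "(LINT x|lebesgue_on \<Omega>. \<bar>\<phi> x\<bar> powr p) \<le> k' * H01_norm \<Omega> \<phi> powr p"
    if \<phi>: "\<phi> \<in> test_functions \<Omega>" for \<phi>
  proof (cases "H01_norm \<Omega> \<phi> > 0")
    case True
    have "k * H01_norm \<Omega> \<phi> powr p \<le> k' * H01_norm \<Omega> \<phi> powr p"
      using k'(3) by (intro mult_right_mono) auto
    then show ?thesis using no[OF \<phi> True] by linarith
  next
    case False
    then have "H01_norm \<Omega> \<phi> = 0" using H01_norm_nonneg[OF open_\<Omega>, of \<phi>] by linarith
    then show ?thesis using test_sobolev[OF \<phi>] by simp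
  qed
  have no'': "(LINT x|lebesgue_on \<Omega>. \<bar>u x\<bar> powr p) \<le> k' * H01_norm \<Omega> u powr p"
    if u: "u \<in> H01 \<Omega>" for u
  proof -
    obtain \<phi> where \<phi>: "\<And>n::nat. \<phi> n \<in> test_functions \<Omega>"
      "(\<lambda>n. H01_norm \<Omega> (\<phi> n)) \<longlonglongrightarrow> H01_norm \<Omega> u"
      "AE x in lebesgue_on \<Omega>. (\<lambda>n. \<phi> n x) \<longlonglongrightarrow> u x" using H01_approx_AE[OF u] by blast
    have "(\<lambda>n. k' * H01_norm \<Omega> (\<phi> n) powr p) \<longlonglongrightarrow> k' * H01_norm \<Omega> u powr p"
      using p_gt_2
      by (intro tendsto_mult[OF tendsto_const] tendsto_powr'[OF \<phi>(2) tendsto_const])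
        (auto simp: H01_norm_nonneg[OF open_\<Omega>])
    from AE_Fatou_powr(2)[OF _ _ test_powr_integrable[OF \<phi>(1)] \<phi>(3) no'[OF \<phi>(1)] this]
    show ?thesis using \<phi>(1) u by (auto intro: H01_measurable H01_test open_\<Omega>)
  qed
  let ?Q = "{(H01_norm \<Omega> u)\<^sup>2 / (Lq_norm \<Omega> (crit_exp CARD('n)) u)\<^sup>2 | u. u \<in> H01 \<Omega> \<and> \<not> ae_eq \<Omega> u (\<lambda>_. 0)}"
  have "k' powr (- 2 / p) \<le> Inf ?Q"
  proof (rule cInf_greatest)
    show "?Q \<noteq> {}" using exists_nonzero_test_function H01_test[OF open_\<Omega>] by fastforce
    fix y assume "y \<in> ?Q"
    then obtain u where u: "u \<in> H01 \<Omega>" "\<not> ae_eq \<Omega> u (\<lambda>_. 0)"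
      and y: "y = (H01_norm \<Omega> u)\<^sup>2 / (Lq_norm \<Omega> p u)\<^sup>2" by (auto simp: p_def)
    let ?A = "LINT x|lebesgue_on \<Omega>. \<bar>u x\<bar> powr p"
    have A: "?A > 0" using powr_integral_pos[OF u] .
    have H: "H01_norm \<Omega> u > 0"
      using no''[OF u(1)] A H01_norm_nonneg[OF open_\<Omega>, of u] by (cases "H01_norm \<Omega> u = 0") auto
    have "(Lq_norm \<Omega> p u)\<^sup>2 = ?A powr (2 / p)"
      using A by (simp add: Lq_norm_def powr_power')
    also have "\<dots> \<le> (k' * H01_norm \<Omega> u powr p) powr (2 / p)"
      using no''[OF u(1)] A p_gt_2 by (intro powr_mono2) auto
    also have "\<dots> = k' powr (2 / p) * (H01_norm \<Omega> u)\<^sup>2"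
      using k' H p_gt_2 by (simp add: powr_mult powr_powr powr_numeral)
    finally have "(Lq_norm \<Omega> p u)\<^sup>2 \<le> k' powr (2 / p) * (H01_norm \<Omega> u)\<^sup>2" .
    moreover have "(Lq_norm \<Omega> p u)\<^sup>2 > 0" using A by (simp add: Lq_norm_def)
    ultimately show "k' powr (- 2 / p) \<le> y"
      using k' by (simp add: y powr_minus field_simps)
  qed
  then have "k' powr (- 2 / p) \<le> sobolev_const \<Omega>" by (simp add: sobolev_const_def)
  then have "sobolev_const \<Omega> powr (- p / 2) \<le> (k' powr (- 2 / p)) powr (- p / 2)"
    using k' p_gt_2 by (intro powr_mono2') auto
  also have "\<dots> = k'" using k' p_gt_2 by (simp add: powr_powr)
  finally show False using k' by simp
qed

end

section \<open>Cube averages\<close>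

lemma nn_integral_lborel_shift:
  fixes f :: "'a::euclidean_space \<Rightarrow> ennreal"
  assumes [measurable]: "f \<in> borel_measurable borel"
  shows "(\<integral>\<^sup>+x. f (x + c) \<partial>lborel) = (\<integral>\<^sup>+x. f x \<partial>lborel)"
proof -
  have "(\<integral>\<^sup>+x. f x \<partial>lborel) = (\<integral>\<^sup>+x. f x \<partial>distr lborel borel (\<lambda>x. c + x))"
    by (simp add: lborel_distr_plus)
  then show ?thesis by (simp add: nn_integral_distr add.commute)
qed

text \<open>The fundamental theorem of calculus and Cauchy-Schwarz on the unit interval.\<close>

lemma power2_diff_le_integral_derivative:
  fixes h :: "real \<Rightarrow> real"
  assumes der: "\<And>s. (h has_real_derivative h' s) (at s)" and cont: "continuous_on UNIV h'"
  shows "ennreal ((h 1 - h 0)\<^sup>2) \<le> (\<integral>\<^sup>+s. ennreal ((h' s)\<^sup>2) * indicator {0..1} s \<partial>lborel)"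
proof -
  have [measurable]: "h' \<in> borel_measurable borel" using cont by (rule borel_measurable_continuous_onI)
  let ?f = "\<lambda>s. h' s * indicator {0..1::real} s"
  have "integrable lborel (\<lambda>s. indicator {0..1::real} s *\<^sub>R (h' s)\<^sup>2)"
    using cont by (intro borel_integrable_compact continuous_intros) (auto intro: continuous_on_subset)
  moreover have eq: "(?f s)\<^sup>2 = indicator {0..1::real} s *\<^sub>R (h' s)\<^sup>2" for s by (simp add: indicator_def)
  ultimately have L2f: "L2 lborel ?f" by (simp add: L2_def)
  have sq1: "(indicator {0..1::real} s :: real)\<^sup>2 = indicator {0..1} s" for s :: real by (simp add: indicator_def)
  have L2i: "L2 lborel (\<lambda>s. indicator {0..1::real} s :: real)" by (simp add: L2_def sq1)
  have L2ni: "L2_norm lborel (\<lambda>s. indicator {0..1::real} s :: real) = 1" by (simp add: L2_norm_def sq1)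
  have "(LINT s|lborel. ?f s \<bullet> indicator {0..1} s) = (LINT s|lborel. h' s * indicator {0..1} s)"
    by (intro Bochner_Integration.integral_cong) (simp_all add: indicator_def)
  also have "\<dots> = h 1 - h 0"
    using cont der by (intro integral_FTC_Icc_real) (auto simp: continuous_on_eq_continuous_at)
  finally have "\<bar>h 1 - h 0\<bar> \<le> L2_norm lborel ?f"
    using L2_Cauchy_Schwarz[OF L2f L2i] by (simp add: L2ni)
  then have "(h 1 - h 0)\<^sup>2 \<le> (L2_norm lborel ?f)\<^sup>2"
    by (simp add: abs_le_square_iff[symmetric])
  then have "ennreal ((h 1 - h 0)\<^sup>2) \<le> ennreal ((L2_norm lborel ?f)\<^sup>2)" by (rule ennreal_leI)
  also have "\<dots> = (\<integral>\<^sup>+s. ennreal ((norm (?f s))\<^sup>2) \<partial>lborel)" by (rule L2_nn_integral[OF L2f, symmetric])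
  also have "\<dots> = (\<integral>\<^sup>+s. ennreal ((h' s)\<^sup>2) * indicator {0..1} s \<partial>lborel)"
    by (intro nn_integral_cong) (simp add: indicator_def)
  finally show ?thesis .
qed

text \<open>The squared difference is bounded by an integral along the segment from x to x + z.
  Integrating in x first, translation invariance removes the shift s z.\<close>

lemma translation_estimate:
  fixes \<phi> :: "real ^ 'n \<Rightarrow> real"
  assumes \<phi>: "\<phi> \<in> test_functions \<Omega>"
  shows "(\<integral>\<^sup>+x. ennreal ((\<phi> (x + z) - \<phi> x)\<^sup>2) \<partial>lborel)
    \<le> ennreal ((norm z)\<^sup>2 * (L2_norm lborel (gradient \<phi>))\<^sup>2)"
proof -
  note s = test_function_smooth[OF \<phi>]
  note [measurable] = test_function_borel[OF \<phi>] gradient_borel[OF \<phi>]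
  have L2g: "L2 lborel (gradient \<phi>)"
    using gradient_L2(1)[OF open_UNIV test_function_mono[OF subset_UNIV \<phi>]] .
  have pt: "ennreal ((\<phi> (x + z) - \<phi> x)\<^sup>2)
    \<le> (\<integral>\<^sup>+s. ennreal ((gradient \<phi> (x + s *\<^sub>R z) \<bullet> z)\<^sup>2) * indicator {0..1::real} s \<partial>lborel)" for x
  proof -
    have "((\<lambda>s. \<phi> (x + s *\<^sub>R z)) has_real_derivative (gradient \<phi> (x + s *\<^sub>R z) \<bullet> z)) (at s)" for s
    proof -
      have "((\<lambda>s. x + s *\<^sub>R z) has_derivative (\<lambda>r. r *\<^sub>R z)) (at s)"
        by (auto intro!: derivative_eq_intros)
      from has_derivative_compose[OF this has_derivative_gradient[OF smooth_differentiable[OF s]]]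
      show ?thesis by (simp add: has_field_derivative_def mult_commute_abs)
    qed
    moreover have "continuous_on UNIV (\<lambda>s. gradient \<phi> (x + s *\<^sub>R z) \<bullet> z)"
      by (intro continuous_intros continuous_on_compose2[OF smooth_continuous_on_gradient[OF s, of UNIV]]) auto
    ultimately show ?thesis
      using power2_diff_le_integral_derivative[of "\<lambda>s. \<phi> (x + s *\<^sub>R z)"] by simp
  qed
  have "(\<integral>\<^sup>+x. ennreal ((\<phi> (x + z) - \<phi> x)\<^sup>2) \<partial>lborel)
      \<le> (\<integral>\<^sup>+x. \<integral>\<^sup>+s. ennreal ((gradient \<phi> (x + s *\<^sub>R z) \<bullet> z)\<^sup>2) * indicator {0..1::real} s \<partial>lborel \<partial>lborel)"
    by (intro nn_integral_mono pt)
  also have "\<dots> = (\<integral>\<^sup>+s. \<integral>\<^sup>+x. ennreal ((gradient \<phi> (x + s *\<^sub>R z) \<bullet> z)\<^sup>2) * indicator {0..1::real} s \<partial>lborel \<partial>lborel)"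
    by (rule lborel_pair.Fubini'[symmetric]) measurable
  also have "\<dots> = (\<integral>\<^sup>+s. (\<integral>\<^sup>+x. ennreal ((gradient \<phi> x \<bullet> z)\<^sup>2) \<partial>lborel) * indicator {0..1::real} s \<partial>lborel)"
    by (intro nn_integral_cong) (simp add: nn_integral_multc nn_integral_lborel_shift[of "\<lambda>x. ennreal ((gradient \<phi> x \<bullet> z)\<^sup>2)"])
  also have "\<dots> = (\<integral>\<^sup>+x. ennreal ((gradient \<phi> x \<bullet> z)\<^sup>2) \<partial>lborel)"
    by (simp add: nn_integral_cmult_indicator)
  also have "\<dots> \<le> (\<integral>\<^sup>+x. ennreal ((norm z)\<^sup>2) * ennreal ((norm (gradient \<phi> x))\<^sup>2) \<partial>lborel)"
  proof (intro nn_integral_mono)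
    fix x
    have "(gradient \<phi> x \<bullet> z)\<^sup>2 \<le> (norm (gradient \<phi> x) * norm z)\<^sup>2"
      using Cauchy_Schwarz_ineq2[of "gradient \<phi> x" z] by (simp add: abs_le_square_iff[symmetric])
    then show "ennreal ((gradient \<phi> x \<bullet> z)\<^sup>2) \<le> ennreal ((norm z)\<^sup>2) * ennreal ((norm (gradient \<phi> x))\<^sup>2)"
      by (simp add: power_mult_distrib mult.commute flip: ennreal_mult)
  qed
  also have "\<dots> = ennreal ((norm z)\<^sup>2 * (L2_norm lborel (gradient \<phi>))\<^sup>2)"
    by (simp add: nn_integral_cmult L2_nn_integral[OF L2g] ennreal_mult)
  finally show ?thesis .
qed

text \<open>The half-open cubes of the grid of side h, as equivalence classes of points with equal
  floors. Comparing the floors as reals gives Borel measurability in both variables.\<close>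

definition same_cube :: "real \<Rightarrow> real ^ 'n \<Rightarrow> real ^ 'n \<Rightarrow> bool" where
  "same_cube h x y \<longleftrightarrow> (\<forall>i\<in>UNIV. real_of_int \<lfloor>x $ i / h\<rfloor> = real_of_int \<lfloor>y $ i / h\<rfloor>)"

definition cube :: "real \<Rightarrow> real ^ 'n \<Rightarrow> (real ^ 'n) set" where
  "cube h x = {y. same_cube h x y}"

lemma measurable_same_cube [measurable]:
  "Measurable.pred (borel \<Otimes>\<^sub>M borel) (\<lambda>p. same_cube h (fst p) (snd p))"
proof -
  note [measurable] = borel_measurable_nth borel_measurable_real_floor
  show ?thesis unfolding same_cube_def by measurable
qed

lemma cube_sets [measurable]: "cube h x \<in> sets borel"
proof -
  note [measurable] = borel_measurable_nth borel_measurable_real_floor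
  show ?thesis unfolding cube_def same_cube_def by measurable
qed

lemma cube_eq: "same_cube h x y \<Longrightarrow> cube h x = cube h y"
  by (auto simp: cube_def same_cube_def)

lemma cube_dist:
  assumes "h > 0" "same_cube h x y"
  shows "\<bar>y $ i - x $ i\<bar> \<le> h"
proof -
  have "\<lfloor>x $ i / h\<rfloor> = \<lfloor>y $ i / h\<rfloor>" using assms(2) by (auto simp: same_cube_def)
  then have "\<bar>y $ i / h - x $ i / h\<bar> \<le> 1" by linarith
  then have "\<bar>(y $ i - x $ i) / h\<bar> \<le> 1" by (simp add: diff_divide_distrib)
  then show ?thesis using assms(1) by (simp add: abs_divide)
qed

lemma emeasure_box_side:
  fixes l :: "real ^ 'n"
  assumes "h > 0"
  shows "emeasure lborel (box l (l + vec h)) = ennreal (h ^ CARD('n))"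
    and "emeasure lborel (cbox l (l + vec h)) = ennreal (h ^ CARD('n))"
proof -
  have b: "(vec h :: real ^ 'n) \<bullet> b = h" if "b \<in> Basis" for b
    using that by (auto simp: Basis_vec_def inner_axis)
  then have le: "l \<bullet> b \<le> (l + vec h) \<bullet> b" if "b \<in> Basis" for b
    using that assms by (simp add: inner_add_left)
  have "(\<Prod>b\<in>Basis. (l + vec h - l) \<bullet> b) = (\<Prod>b\<in>(Basis :: (real ^ 'n) set). h)"
    by (intro prod.cong) (simp_all add: b)
  then have "(\<Prod>b\<in>Basis. (l + vec h - l) \<bullet> b) = h ^ CARD('n)" by simp
  then show "emeasure lborel (box l (l + vec h)) = ennreal (h ^ CARD('n))"
    "emeasure lborel (cbox l (l + vec h)) = ennreal (h ^ CARD('n))"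
    using le by (simp_all only: emeasure_lborel_box emeasure_lborel_cbox)
qed

text \<open>The half-open cube lies between the open and the closed box with the same corners, which
  have equal measure.\<close>

lemma emeasure_cube:
  fixes x :: "real ^ 'n"
  assumes h: "h > 0"
  shows "emeasure lborel (cube h x) = ennreal (h ^ CARD('n))"
proof -
  define l :: "real ^ 'n" where "l = (\<chi> i. h * real_of_int \<lfloor>x $ i / h\<rfloor>)"
  have cube: "y \<in> cube h x \<longleftrightarrow> (\<forall>i. l $ i \<le> y $ i \<and> y $ i < l $ i + h)" for y
  proof -
    have "real_of_int \<lfloor>x $ i / h\<rfloor> = real_of_int \<lfloor>y $ i / h\<rfloor> \<longleftrightarrow> l $ i \<le> y $ i \<and> y $ i < l $ i + h" for i
    proof -
      have "real_of_int \<lfloor>x $ i / h\<rfloor> = real_of_int \<lfloor>y $ i / h\<rfloor>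
        \<longleftrightarrow> real_of_int \<lfloor>x $ i / h\<rfloor> \<le> y $ i / h \<and> y $ i / h < real_of_int \<lfloor>x $ i / h\<rfloor> + 1"
        unfolding of_int_eq_iff eq_commute[of "\<lfloor>x $ i / h\<rfloor>"] by (rule floor_eq_iff)
      also have "\<dots> \<longleftrightarrow> l $ i \<le> y $ i \<and> y $ i < l $ i + h"
        using h by (simp add: l_def field_simps)
      finally show ?thesis .
    qed
    then show ?thesis by (simp add: cube_def same_cube_def)
  qed
  have 1: "box l (l + vec h) \<subseteq> cube h x"
    by (auto simp: cube mem_box_cart less_imp_le)
  have 2: "cube h x \<subseteq> cbox l (l + vec h)"
    by (auto simp: cube mem_box_cart less_imp_le)
  show ?thesis
    using emeasure_mono[OF 1, of lborel] emeasure_mono[OF 2, of lborel] emeasure_box_side[OF h, of l]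
    by (intro antisym) auto
qed

definition cube_mean :: "real \<Rightarrow> (real ^ 'n \<Rightarrow> real) \<Rightarrow> real ^ 'n \<Rightarrow> real" where
  "cube_mean h f x = (LINT y|lborel. indicator (cube h x) y * f y) / h ^ CARD('n)"

lemma cube_mean_measurable:
  fixes f :: "real ^ 'n \<Rightarrow> real"
  assumes [measurable]: "f \<in> borel_measurable borel"
  shows "cube_mean h f \<in> borel_measurable borel"
proof -
  have eq: "(\<lambda>x. LINT y|lborel. indicator (cube h x) y * f y)
      = (\<lambda>x. LINT y|lborel. (if same_cube h x y then f y else 0))"
    by (intro ext Bochner_Integration.integral_cong) (auto simp: cube_def indicator_def)
  have "(\<lambda>p. if same_cube h (fst p) (snd p) then f (snd p) else 0) \<in> borel_measurable (borel \<Otimes>\<^sub>M borel)"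
    by measurable
  also have "borel_measurable (borel \<Otimes>\<^sub>M borel) = borel_measurable (borel \<Otimes>\<^sub>M (lborel :: (real ^ 'n) measure))"
    by (intro measurable_cong_sets sets_pair_measure_cong) auto
  finally have "(\<lambda>(x, y). if same_cube h x y then f y else 0) \<in> borel_measurable (borel \<Otimes>\<^sub>M lborel)"
    by (simp add: case_prod_beta')
  then have "(\<lambda>x. LINT y|lborel. (if same_cube h x y then f y else 0)) \<in> borel_measurable borel"
    by (rule lborel.borel_measurable_lebesgue_integral)
  then have "(\<lambda>x. LINT y|lborel. indicator (cube h x) y * f y) \<in> borel_measurable borel"
    by (simp only: eq)
  then show ?thesis unfolding cube_mean_def[abs_def] by (rule borel_measurable_divide) simp
qed

text \<open>Two points of one cube differ by a vector in the box Z of side 2h, so the squared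
  deviation from the mean is at most 1/h^d times an integral over Z of squared differences under
  translation. The factor 2^d is the ratio of the volumes, and (d h)^2 bounds |z|^2 on Z.\<close>

lemma cube_mean_estimate:
  fixes \<phi> :: "real ^ 'n \<Rightarrow> real"
  assumes \<phi>: "\<phi> \<in> test_functions \<Omega>" and h: "h > 0"
  shows "(\<integral>\<^sup>+x. ennreal ((\<phi> x - cube_mean h \<phi> x)\<^sup>2) \<partial>lborel)
    \<le> ennreal (2 ^ CARD('n) * (real CARD('n) * h)\<^sup>2 * (L2_norm lborel (gradient \<phi>))\<^sup>2)"
proof -
  note s = test_function_smooth[OF \<phi>]
  note [measurable] = test_function_borel[OF \<phi>] gradient_borel[OF \<phi>]
  define m where "m = h ^ CARD('n)"
  define G where "G = L2_norm lborel (gradient \<phi>)"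
  have m: "m > 0" using h by (simp add: m_def)
  obtain B where B: "\<And>x. norm (\<phi> x) \<le> B" "B \<ge> 0"
  proof -
    obtain K where K: "compact K" "\<And>x. x \<notin> K \<Longrightarrow> \<phi> x = 0"
      using \<phi> by (rule test_functionE) blast
    show ?thesis
      by (rule compact_support_bounded[OF smooth_continuous_on[OF s] K]) (use that in auto)
  qed
  define Z where "Z = cbox (- vec h) (- vec h + vec (2 * h) :: real ^ 'n)"
  have Zm [measurable]: "Z \<in> sets borel" by (simp add: Z_def)
  have Z: "z \<in> Z \<longleftrightarrow> (\<forall>i. \<bar>z $ i\<bar> \<le> h)" for z by (auto simp: Z_def mem_box_cart abs_le_iff minus_le_iff)
  have pt: "ennreal ((\<phi> x - cube_mean h \<phi> x)\<^sup>2)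
      \<le> ennreal (1 / m) * (\<integral>\<^sup>+z. ennreal ((\<phi> (x + z) - \<phi> x)\<^sup>2) * indicator Z z \<partial>lborel)" for x
  proof -
    let ?i = "\<lambda>y. indicator (cube h x) y :: real"
    let ?f = "\<lambda>y. ?i y * (\<phi> y - \<phi> x)"
    have mcube: "measure lborel (cube h x) = m" "emeasure lborel (cube h x) < \<infinity>"
      using emeasure_cube[OF h, of x] m by (simp_all add: m_def measure_def)
    have inti: "integrable lborel ?i" using mcube(2) by (intro integrable_real_indicator) auto
    have sqi: "(?i y)\<^sup>2 = ?i y" for y by (simp add: indicator_def)
    have L2i: "L2 lborel ?i" using inti by (simp add: L2_def sqi)
    have L2ni: "L2_norm lborel ?i = sqrt m" by (simp add: L2_norm_def sqi mcube)
    have bd: "\<bar>\<phi> y - \<phi> x\<bar> \<le> 2 * B" for y using B(1)[of y] B(1)[of x] by simp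
    have L2f: "L2 lborel ?f"
    proof -
      have "integrable lborel (\<lambda>y. (norm (?f y))\<^sup>2)"
      proof (rule Bochner_Integration.integrable_bound[OF integrable_mult_left[OF inti, of "(2 * B)\<^sup>2"]])
        have "(\<phi> y - \<phi> x)\<^sup>2 \<le> (2 * B)\<^sup>2" for y
          using power_mono[OF bd[of y], of 2] by simp
        then show "AE y in lborel. norm ((norm (?f y))\<^sup>2) \<le> norm (?i y * (2 * B)\<^sup>2)"
          by (intro AE_I2) (simp add: power_mult_distrib sqi mult_left_mono)
      qed measurable
      then show ?thesis by (simp add: L2_def)
    qed
    have inti\<phi>: "integrable lborel (\<lambda>y. ?i y * \<phi> y)"
      using B by (intro Bochner_Integration.integrable_bound[OF integrable_mult_left[OF inti, of B]])
        (auto intro!: AE_I2 mult_left_mono simp: abs_mult)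
    have "(LINT y|lborel. ?f y) = (LINT y|lborel. ?i y * \<phi> y) - \<phi> x * m"
      using inti inti\<phi> by (simp add: right_diff_distrib mcube)
    then have "cube_mean h \<phi> x - \<phi> x = (LINT y|lborel. ?f y) / m"
      using m by (simp add: cube_mean_def m_def[symmetric] diff_divide_distrib)
    moreover have "\<bar>LINT y|lborel. ?f y\<bar> \<le> L2_norm lborel ?f * sqrt m"
    proof -
      have "(LINT y|lborel. ?f y \<bullet> ?i y) = (LINT y|lborel. ?f y)"
        by (intro Bochner_Integration.integral_cong) (simp_all add: indicator_def)
      then show ?thesis using L2_Cauchy_Schwarz[OF L2f L2i] by (simp add: L2ni)
    qed
    then have "(LINT y|lborel. ?f y)\<^sup>2 \<le> (L2_norm lborel ?f * sqrt m)\<^sup>2"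
      using m by (simp add: abs_le_square_iff[symmetric])
    then have "(LINT y|lborel. ?f y)\<^sup>2 / m\<^sup>2 \<le> (L2_norm lborel ?f)\<^sup>2 * m / m\<^sup>2"
      using m by (intro divide_right_mono) (simp_all add: power_mult_distrib)
    then have "((LINT y|lborel. ?f y) / m)\<^sup>2 \<le> 1 / m * (L2_norm lborel ?f)\<^sup>2"
      using m by (simp add: power_divide power2_eq_square[of m])
    ultimately have "(\<phi> x - cube_mean h \<phi> x)\<^sup>2 \<le> 1 / m * (L2_norm lborel ?f)\<^sup>2"
      by (simp add: power2_commute[of "\<phi> x" "cube_mean h \<phi> x"])
    then have "ennreal ((\<phi> x - cube_mean h \<phi> x)\<^sup>2) \<le> ennreal (1 / m * (L2_norm lborel ?f)\<^sup>2)"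
      by (rule ennreal_leI)
    also have "\<dots> = ennreal (1 / m) * (\<integral>\<^sup>+y. ennreal ((norm (?f y))\<^sup>2) \<partial>lborel)"
      using m by (subst ennreal_mult) (simp_all add: L2_nn_integral[OF L2f, symmetric])
    also have "(\<integral>\<^sup>+y. ennreal ((norm (?f y))\<^sup>2) \<partial>lborel)
        \<le> (\<integral>\<^sup>+y. ennreal ((\<phi> y - \<phi> x)\<^sup>2) * indicator Z (y - x) \<partial>lborel)"
      using cube_dist[OF h] by (intro nn_integral_mono) (auto simp: indicator_def cube_def Z)
    also have "\<dots> = (\<integral>\<^sup>+z. ennreal ((\<phi> (z + x) - \<phi> x)\<^sup>2) * indicator Z (z + x - x) \<partial>lborel)"
      by (rule nn_integral_lborel_shift[symmetric]) measurable
    finally show ?thesis by (simp add: add.commute mult_left_mono)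
  qed
  have "(\<integral>\<^sup>+x. ennreal ((\<phi> x - cube_mean h \<phi> x)\<^sup>2) \<partial>lborel)
      \<le> (\<integral>\<^sup>+x. ennreal (1 / m) * (\<integral>\<^sup>+z. ennreal ((\<phi> (x + z) - \<phi> x)\<^sup>2) * indicator Z z \<partial>lborel) \<partial>lborel)"
    by (intro nn_integral_mono pt)
  also have "\<dots> = ennreal (1 / m) * (\<integral>\<^sup>+x. \<integral>\<^sup>+z. ennreal ((\<phi> (x + z) - \<phi> x)\<^sup>2) * indicator Z z \<partial>lborel \<partial>lborel)"
    by (intro nn_integral_cmult) measurable
  also have "(\<integral>\<^sup>+x. \<integral>\<^sup>+z. ennreal ((\<phi> (x + z) - \<phi> x)\<^sup>2) * indicator Z z \<partial>lborel \<partial>lborel)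
      = (\<integral>\<^sup>+z. \<integral>\<^sup>+x. ennreal ((\<phi> (x + z) - \<phi> x)\<^sup>2) * indicator Z z \<partial>lborel \<partial>lborel)"
    by (rule lborel_pair.Fubini'[symmetric]) measurable
  also have "\<dots> \<le> (\<integral>\<^sup>+z. ennreal ((real CARD('n) * h)\<^sup>2 * G\<^sup>2) * indicator Z z \<partial>lborel)"
  proof (intro nn_integral_mono)
    fix z :: "real ^ 'n"
    have "(\<integral>\<^sup>+x. ennreal ((\<phi> (x + z) - \<phi> x)\<^sup>2) \<partial>lborel) \<le> ennreal ((real CARD('n) * h)\<^sup>2 * G\<^sup>2)"
      if "z \<in> Z"
    proof -
      have "norm z \<le> (\<Sum>i\<in>UNIV. \<bar>z $ i\<bar>)" by (rule norm_le_l1_cart)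
      also have "\<dots> \<le> (\<Sum>i\<in>(UNIV :: 'n set). h)" using that by (intro sum_mono) (auto simp: Z)
      finally have "(norm z)\<^sup>2 \<le> (real CARD('n) * h)\<^sup>2" by (intro power_mono) auto
      then have "(norm z)\<^sup>2 * G\<^sup>2 \<le> (real CARD('n) * h)\<^sup>2 * G\<^sup>2" by (rule mult_right_mono) simp
      then show ?thesis
        using translation_estimate[OF \<phi>, of z] unfolding G_def[symmetric]
        by (meson ennreal_leI order_trans)
    qed
    then show "(\<integral>\<^sup>+x. ennreal ((\<phi> (x + z) - \<phi> x)\<^sup>2) * indicator Z z \<partial>lborel)
        \<le> ennreal ((real CARD('n) * h)\<^sup>2 * G\<^sup>2) * indicator Z z"
      by (auto simp: indicator_def)
  qed
  also have "\<dots> = ennreal ((real CARD('n) * h)\<^sup>2 * G\<^sup>2) * ennreal ((2 * h) ^ CARD('n))"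
  proof -
    have "emeasure lborel Z = ennreal ((2 * h) ^ CARD('n))"
      unfolding Z_def using h by (intro emeasure_box_side) simp
    then show ?thesis by (subst nn_integral_cmult_indicator) simp_all
  qed
  finally have "(\<integral>\<^sup>+x. ennreal ((\<phi> x - cube_mean h \<phi> x)\<^sup>2) \<partial>lborel)
    \<le> ennreal (1 / m) * (ennreal ((real CARD('n) * h)\<^sup>2 * G\<^sup>2) * ennreal ((2 * h) ^ CARD('n)))"
    by (simp add: mult_left_mono)
  also have "\<dots> = ennreal (1 / m * ((real CARD('n) * h)\<^sup>2 * G\<^sup>2 * (2 * h) ^ CARD('n)))"
    using m h by (simp flip: ennreal_mult)
  also have "1 / m * ((real CARD('n) * h)\<^sup>2 * G\<^sup>2 * (2 * h) ^ CARD('n))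
      = 2 ^ CARD('n) * (real CARD('n) * h)\<^sup>2 * G\<^sup>2"
    using h by (simp add: m_def power_mult_distrib)
  finally show ?thesis by (simp add: G_def)
qed

section \<open>The Rellich theorem\<close>

lemma bounded_sequences_diagonal_convergent:
  fixes a :: "nat \<Rightarrow> nat \<Rightarrow> real"
  assumes "\<And>i. \<exists>B. \<forall>n. \<bar>a n i\<bar> \<le> B"
  shows "\<exists>r::nat\<Rightarrow>nat. strict_mono r \<and> (\<forall>i. convergent (\<lambda>n. a (r n) i))"
proof -
  let ?P = "\<lambda>i s. convergent (\<lambda>k. a (s k) i)"
  interpret nat: subseqs ?P
  proof
    fix i :: nat and s :: "nat \<Rightarrow> nat" assume "strict_mono s"
    obtain B where B: "\<And>n. \<bar>a n i\<bar> \<le> B" using assms by blast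
    have "bounded (range (\<lambda>k. a (s k) i))" using B by (intro boundedI[of _ B]) auto
    then obtain l r' where "strict_mono r'" "((\<lambda>k. a (s k) i) \<circ> r') \<longlonglongrightarrow> l"
      using bounded_imp_convergent_subsequence by blast
    then show "\<exists>r'. strict_mono r' \<and> ?P i (s \<circ> r')"
      by (auto simp: o_def convergent_def)
  qed
  have "?P i nat.diagseq" for i
  proof -
    \<comment> \<open>The diagonal sequence is controlled by the choice made for index i only from
      position Suc i on, and convergence ignores the initial segment.\<close>
    have "?P i (nat.diagseq \<circ> ((+) (Suc i)))"
    proof (rule nat.diagseq_holds)
      fix r s :: "nat \<Rightarrow> nat" and n assume "strict_mono r" "?P n s"
      then show "?P n (s \<circ> r)"
        using convergent_subseq_convergent[of "\<lambda>k. a (s k) n" r] by (simp add: o_def)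
    qed
    then have "convergent (\<lambda>k. a (nat.diagseq (k + Suc i)) i)" by (simp add: o_def add.commute)
    then show ?thesis using convergent_ignore_initial_segment[of "\<lambda>k. a (nat.diagseq k) i" "Suc i"] by simp
  qed
  then show ?thesis using nat.subseq_diagseq by blast
qed

lemma nn_integral_lebesgue_on_le_lborel:
  assumes "\<Omega> \<in> sets borel" and [measurable]: "f \<in> borel_measurable borel"
  shows "(\<integral>\<^sup>+x. f x \<partial>lebesgue_on \<Omega>) \<le> (\<integral>\<^sup>+x. f x \<partial>lborel)"
proof -
  have "(\<integral>\<^sup>+x. f x \<partial>lebesgue_on \<Omega>) = (\<integral>\<^sup>+x. f x * indicator \<Omega> x \<partial>lebesgue)"
    using assms by (subst nn_integral_restrict_space) auto
  also have "\<dots> \<le> (\<integral>\<^sup>+x. f x \<partial>lebesgue)" by (intro nn_integral_mono) (simp add: indicator_def)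
  also have "\<dots> = (\<integral>\<^sup>+x. f x \<partial>lborel)" by (rule nn_integral_completion)
  finally show ?thesis .
qed

context critical_domain
begin

abbreviation (input) "M \<equiv> lebesgue_on \<Omega>"

lemma finite_measure_M: "finite_measure M"
  using bounded_\<Omega> open_\<Omega> by (rule measure_lebesgue_on_finite)

lemma L2_bounded:
  fixes f :: "real ^ 'n \<Rightarrow> real"
  assumes [measurable]: "f \<in> borel_measurable M" and "\<And>x. \<bar>f x\<bar> \<le> B"
  shows "L2 M f"
proof -
  interpret finite_measure M by (rule finite_measure_M)
  have "integrable M (\<lambda>x. (norm (f x))\<^sup>2)"
    by (rule integrable_const_bound[of _ "B\<^sup>2"]) (use assms(2) power_mono[OF assms(2), of _ 2] in auto)
  then show ?thesis by (simp add: L2_def)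
qed

text \<open>For test functions these are the cube averages up to the volume of the cube, in the form
  of bounded linear functionals; they link weak convergence to \<open>cube_mean\<close>.\<close>

definition cube_integral :: "real \<Rightarrow> real ^ 'n \<Rightarrow> (real ^ 'n \<Rightarrow> real) \<Rightarrow> real" where
  "cube_integral h c u = (LINT x|M. indicator (cube h c) x * u x)"

lemma L2_indicator_cube: "L2 M (\<lambda>x. indicator (cube h c) x :: real)"
  by (intro L2_bounded[of _ 1] borel_imp_lebesgue_on) (auto simp: indicator_def cube_sets)

lemma cube_integral_bound:
  obtains C where "C \<ge> 0" "\<And>h c (u :: real ^ 'n \<Rightarrow> real). L2 M u \<Longrightarrow> \<bar>cube_integral h c u\<bar> \<le> C * L2_norm M u"
proof
  interpret finite_measure M by (rule finite_measure_M)
  let ?C = "L2_norm M (\<lambda>_. 1 :: real)"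
  show "?C \<ge> 0" by simp
  fix h c and u :: "real ^ 'n \<Rightarrow> real" assume u: "L2 M u"
  have "L2_norm M (\<lambda>x. indicator (cube h c) x :: real) \<le> ?C"
    unfolding L2_norm_def
    by (intro real_sqrt_le_mono integral_mono L2_integrable[OF L2_indicator_cube]) (auto simp: indicator_def)
  then have "L2_norm M (\<lambda>x. indicator (cube h c) x :: real) * L2_norm M u \<le> ?C * L2_norm M u"
    by (rule mult_right_mono) simp
  then show "\<bar>cube_integral h c u\<bar> \<le> ?C * L2_norm M u"
    using L2_Cauchy_Schwarz[OF L2_indicator_cube u, of h c] by (simp add: cube_integral_def)
qed

lemma cube_integral_integrable:
  fixes u :: "real ^ 'n \<Rightarrow> real"
  shows "L2 M u \<Longrightarrow> integrable M (\<lambda>x. indicator (cube h c) x * u x)"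
  using L2_inner_integrable[OF L2_indicator_cube] by simp

lemma cube_integral_add:
  "L2 M u \<Longrightarrow> L2 M v \<Longrightarrow> cube_integral h c (\<lambda>x. u x + v x) = cube_integral h c u + cube_integral h c v"
  by (simp add: cube_integral_def distrib_left cube_integral_integrable)

lemma cube_integral_diff:
  "L2 M u \<Longrightarrow> L2 M v \<Longrightarrow> cube_integral h c (\<lambda>x. u x - v x) = cube_integral h c u - cube_integral h c v"
  by (simp add: cube_integral_def right_diff_distrib cube_integral_integrable)

lemma cube_integral_cmult: "cube_integral h c (\<lambda>x. k * u x) = k * cube_integral h c u"
  by (simp add: cube_integral_def mult.left_commute)

lemma cube_integral_dual: "cube_integral h c \<in> H01_dual \<Omega>"
proof -
  obtain C where C: "C \<ge> 0" "\<And>h c (u :: real ^ 'n \<Rightarrow> real). L2 M u \<Longrightarrow> \<bar>cube_integral h c u\<bar> \<le> C * L2_norm M u"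
    using cube_integral_bound by blast
  obtain D where D: "D \<ge> 0" "\<And>u. u \<in> H01 \<Omega> \<Longrightarrow> L2_norm M u \<le> D * H01_norm \<Omega> u"
    using poincare by blast
  have "\<bar>cube_integral h c u\<bar> \<le> (C * D) * H01_norm \<Omega> u" if u: "u \<in> H01 \<Omega>" for u
    using C(2)[OF H01_L2[OF open_\<Omega> u], of h c] mult_left_mono[OF D(2)[OF u] C(1)] by (simp add: mult.assoc)
  then show ?thesis unfolding H01_dual_def
    by (auto simp: cube_integral_add cube_integral_cmult H01_L2[OF open_\<Omega>])
qed

lemma cube_mean_test:
  assumes \<phi>: "\<phi> \<in> test_functions \<Omega>"
  shows "cube_mean h \<phi> x = cube_integral h x \<phi> / h ^ CARD('n)"
proof -
  obtain K where K: "K \<subseteq> \<Omega>" "\<And>x. x \<notin> K \<Longrightarrow> \<phi> x = 0"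
    using \<phi> by (rule test_functionE) blast
  note [measurable] = test_function_borel[OF \<phi>] cube_sets
  have "cube_integral h x \<phi> = (LINT y|lborel. indicator (cube h x) y * \<phi> y)"
    unfolding cube_integral_def using open_\<Omega> K by (intro integral_lebesgue_on_eq_lborel) auto
  then show ?thesis by (simp add: cube_mean_def)
qed

text \<open>Each function is split into its cube average and the remainder. The remainder has L2
  norm at most q h uniformly in n; for fixed h the averages are uniformly bounded and tend to 0
  pointwise, hence in L2 on the bounded domain. Only dyadic sides are tested, so that countably many
  cubes are involved.\<close>

lemma test_functions_cube_integrals_imp_L2_tendsto_0:
  assumes \<phi>: "\<And>n. \<phi> n \<in> test_functions \<Omega>" and K: "\<And>n. H01_norm \<Omega> (\<phi> n) \<le> K"
    and c: "\<And>j c. (\<lambda>n. cube_integral ((1/2) ^ j) c (\<phi> n)) \<longlonglongrightarrow> 0"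
  shows "(\<lambda>n. L2_norm M (\<phi> n)) \<longlonglongrightarrow> 0"
proof (rule LIMSEQ_I)
  fix e :: real assume e: "e > 0"
  interpret finite_measure M by (rule finite_measure_M)
  obtain C where C: "C \<ge> 0" "\<And>h c (u :: real ^ 'n \<Rightarrow> real). L2 M u \<Longrightarrow> \<bar>cube_integral h c u\<bar> \<le> C * L2_norm M u"
    using cube_integral_bound by blast
  obtain D where D: "D \<ge> 0" "\<And>u. u \<in> H01 \<Omega> \<Longrightarrow> L2_norm M u \<le> D * H01_norm \<Omega> u"
    using poincare by blast
  have K0: "K \<ge> 0" using K[of 0] H01_norm_nonneg[OF open_\<Omega>, of "\<phi> 0"] by linarith
  \<comment> \<open>The square root of the constant in the cube estimate, with K in place of the
    gradient norm and the side h split off.\<close>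
  define q where "q = sqrt (2 ^ CARD('n)) * real CARD('n) * K"
  have q0: "q \<ge> 0" using K0 by (simp add: q_def)
  have "(\<lambda>j. q * (1/2) ^ j) \<longlonglongrightarrow> q * 0"
    by (intro tendsto_mult tendsto_const LIMSEQ_realpow_zero) auto
  then have "\<forall>\<^sub>F j in sequentially. q * (1/2) ^ j < e / 2"
    using e by (intro order_tendstoD(2)[of _ "q * 0"]) auto
  then obtain j where j: "q * (1/2) ^ j < e / 2" by (auto simp: eventually_sequentially)
  define h :: real where "h = (1/2) ^ j"
  have h: "h > 0" by (simp add: h_def)
  note [measurable] = test_function_borel[OF \<phi>] cube_mean_measurable[OF test_function_borel[OF \<phi>]]
  have mm: "cube_mean h (\<phi> n) \<in> borel_measurable M" for n
    by (intro borel_imp_lebesgue_on) measurable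
  have bd: "\<bar>cube_mean h (\<phi> n) x\<bar> \<le> C * (D * K) / h ^ CARD('n)" for n x
  proof -
    have "\<bar>cube_integral h x (\<phi> n)\<bar> \<le> C * L2_norm M (\<phi> n)"
      by (intro C test_function_L2 open_\<Omega> \<phi>)
    also have "\<dots> \<le> C * (D * H01_norm \<Omega> (\<phi> n))"
      by (intro mult_left_mono C D H01_test open_\<Omega> \<phi>)
    also have "\<dots> \<le> C * (D * K)" by (intro mult_left_mono C D K)
    finally show ?thesis using h by (simp add: cube_mean_test[OF \<phi>] abs_divide divide_right_mono)
  qed
  have L2m: "L2 M (cube_mean h (\<phi> n))" for n using mm bd by (rule L2_bounded)
  have L2p: "L2 M (\<phi> n)" for n by (intro test_function_L2 open_\<Omega> \<phi>)
  have mean0: "(\<lambda>n. L2_norm M (cube_mean h (\<phi> n))) \<longlonglongrightarrow> 0"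
  proof -
    have "(\<lambda>n. LINT x|M. (norm (cube_mean h (\<phi> n) x))\<^sup>2) \<longlonglongrightarrow> (LINT x|M. 0)"
    proof (rule integral_dominated_convergence)
      show "integrable M (\<lambda>_. (C * (D * K) / h ^ CARD('n))\<^sup>2)" by simp
      show "AE x in M. (\<lambda>n. (norm (cube_mean h (\<phi> n) x))\<^sup>2) \<longlonglongrightarrow> 0"
      proof (rule AE_I2)
        fix x
        have "(\<lambda>n. (norm (cube_integral h x (\<phi> n) / h ^ CARD('n)))\<^sup>2) \<longlonglongrightarrow> (norm (0 / h ^ CARD('n)))\<^sup>2"
          using h c[of j x] by (intro tendsto_intros) (auto simp: h_def)
        then show "(\<lambda>n. (norm (cube_mean h (\<phi> n) x))\<^sup>2) \<longlonglongrightarrow> 0" by (simp add: cube_mean_test[OF \<phi>])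
      qed
      show "AE x in M. norm ((norm (cube_mean h (\<phi> n) x))\<^sup>2) \<le> (C * (D * K) / h ^ CARD('n))\<^sup>2" for n
        using power_mono[OF bd, of _ _ 2] by (intro AE_I2) simp
    qed (use mm in auto)
    then have "(\<lambda>n. sqrt (LINT x|M. (norm (cube_mean h (\<phi> n) x))\<^sup>2)) \<longlonglongrightarrow> sqrt 0"
      by (intro tendsto_real_sqrt) simp
    then show ?thesis by (simp add: L2_norm_def)
  qed
  have diff: "L2_norm M (\<lambda>x. \<phi> n x - cube_mean h (\<phi> n) x) \<le> q * h" for n
  proof -
    let ?G = "H01_norm \<Omega> (\<phi> n)"
    have "ennreal ((L2_norm M (\<lambda>x. \<phi> n x - cube_mean h (\<phi> n) x))\<^sup>2)
        = (\<integral>\<^sup>+x. ennreal ((norm (\<phi> n x - cube_mean h (\<phi> n) x))\<^sup>2) \<partial>M)"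
      by (rule L2_nn_integral[OF L2_diff[OF L2p L2m], symmetric])
    also have "\<dots> \<le> (\<integral>\<^sup>+x. ennreal ((norm (\<phi> n x - cube_mean h (\<phi> n) x))\<^sup>2) \<partial>lborel)"
      using open_\<Omega> by (intro nn_integral_lebesgue_on_le_lborel) auto
    also have "\<dots> \<le> ennreal (2 ^ CARD('n) * (real CARD('n) * h)\<^sup>2 * ?G\<^sup>2)"
      using cube_mean_estimate[OF \<phi>[of n] h] by (simp add: H01_norm_test[OF open_\<Omega> \<phi>])
    also have "\<dots> \<le> ennreal ((q * h)\<^sup>2)"
    proof (rule ennreal_leI)
      have "?G\<^sup>2 \<le> K\<^sup>2" using K H01_norm_nonneg[OF open_\<Omega>] by (intro power_mono)
      then have "2 ^ CARD('n) * (real CARD('n) * h)\<^sup>2 * ?G\<^sup>2 \<le> 2 ^ CARD('n) * (real CARD('n) * h)\<^sup>2 * K\<^sup>2"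
        by (intro mult_left_mono) auto
      also have "\<dots> = (q * h)\<^sup>2" by (simp add: q_def power_mult_distrib)
      finally show "2 ^ CARD('n) * (real CARD('n) * h)\<^sup>2 * ?G\<^sup>2 \<le> (q * h)\<^sup>2" .
    qed
    finally have "(L2_norm M (\<lambda>x. \<phi> n x - cube_mean h (\<phi> n) x))\<^sup>2 \<le> (q * h)\<^sup>2" by simp
    then show ?thesis by (rule power2_le_imp_le) (use q0 h in simp)
  qed
  have "\<forall>\<^sub>F n in sequentially. L2_norm M (cube_mean h (\<phi> n)) < e / 2"
    using mean0 e by (intro order_tendstoD(2)[of _ 0]) auto
  then obtain N where N: "\<And>n. n \<ge> N \<Longrightarrow> L2_norm M (cube_mean h (\<phi> n)) < e / 2"
    by (auto simp: eventually_sequentially)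
  have "norm (L2_norm M (\<phi> n) - 0) < e" if "n \<ge> N" for n
    using L2_norm_triangle[OF L2_diff[OF L2p[of n] L2m[of n]] L2m[of n]] diff[of n] N[OF that] j
    by (simp add: h_def)
  then show "\<exists>no. \<forall>n\<ge>no. norm (L2_norm M (\<phi> n) - 0) < e" by blast
qed

text \<open>Replacing w n by a test function at distance below 1/(n+1) changes cube integrals and L2
  norms by null sequences and the norm bound by at most 1.\<close>

lemma cube_integrals_imp_L2_tendsto_0:
  assumes w: "\<And>n. w n \<in> H01 \<Omega>" and K: "\<And>n. H01_norm \<Omega> (w n) \<le> K"
    and c: "\<And>j c. (\<lambda>n. cube_integral ((1/2) ^ j) c (w n)) \<longlonglongrightarrow> 0"
  shows "(\<lambda>n. L2_norm M (w n)) \<longlonglongrightarrow> 0"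
proof -
  let ?e = "\<lambda>n. inverse (real (Suc n))"
  have "\<exists>\<phi>. \<phi> \<in> test_functions \<Omega> \<and> L2_norm M (\<lambda>x. w n x - \<phi> x) < ?e n \<and> H01_norm \<Omega> (\<lambda>x. w n x - \<phi> x) < ?e n" for n
  proof -
    have "?e n > 0" by simp
    then show ?thesis by (rule H01_approx_within[OF open_\<Omega> w[of n]]) blast
  qed
  from choice[OF allI[OF this]] obtain \<phi> where "\<forall>n. \<phi> n \<in> test_functions \<Omega>
    \<and> L2_norm M (\<lambda>x. w n x - \<phi> n x) < ?e n \<and> H01_norm \<Omega> (\<lambda>x. w n x - \<phi> n x) < ?e n" ..
  then have \<phi>: "\<And>n. \<phi> n \<in> test_functions \<Omega>" "\<And>n. L2_norm M (\<lambda>x. w n x - \<phi> n x) < ?e n"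
    "\<And>n. H01_norm \<Omega> (\<lambda>x. w n x - \<phi> n x) < ?e n" by auto
  obtain C where C: "C \<ge> 0" "\<And>h c (u :: real ^ 'n \<Rightarrow> real). L2 M u \<Longrightarrow> \<bar>cube_integral h c u\<bar> \<le> C * L2_norm M u"
    using cube_integral_bound by blast
  note L = H01_L2[OF open_\<Omega> w] test_function_L2(2)[OF open_\<Omega> \<phi>(1)]
  have d0: "(\<lambda>n. L2_norm M (\<lambda>x. w n x - \<phi> n x)) \<longlonglongrightarrow> 0"
    by (rule Lim_null_comparison[OF _ LIMSEQ_inverse_real_of_nat])
      (use \<phi>(2)[THEN less_imp_le] in \<open>simp\<close>)
  have "(\<lambda>n. L2_norm M (\<phi> n)) \<longlonglongrightarrow> 0"
  proof (rule test_functions_cube_integrals_imp_L2_tendsto_0[OF \<phi>(1)])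
    fix n
    have "?e n \<le> 1" by (simp add: inverse_eq_divide)
    then show "H01_norm \<Omega> (\<phi> n) \<le> K + 1"
      using H01_norm_abs_diff[OF w H01_test[OF open_\<Omega> \<phi>(1)], of n n] \<phi>(3)[of n] K[of n] by linarith
  next
    fix j c
    have "(\<lambda>n. cube_integral ((1/2) ^ j) c (\<lambda>x. w n x - \<phi> n x)) \<longlonglongrightarrow> 0"
      by (rule Lim_null_comparison[OF _ tendsto_mult_right_zero[OF d0, of C]])
        (simp add: C(2)[OF L2_diff[OF L]])
    from tendsto_diff[OF assms(3)[of j c] this]
    show "(\<lambda>n. cube_integral ((1/2) ^ j) c (\<phi> n)) \<longlonglongrightarrow> 0"
      by (simp add: cube_integral_diff[OF L])
  qed
  from tendsto_add_zero[OF d0 this]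
  show ?thesis
  proof (rule Lim_null_comparison[rotated])
    have "L2_norm M (w n) \<le> L2_norm M (\<lambda>x. w n x - \<phi> n x) + L2_norm M (\<phi> n)" for n
      using L2_norm_triangle[OF L2_diff[OF L(1)[of n] L(2)[of n]] L(2)[of n]] by simp
    then show "\<forall>\<^sub>F n in sequentially. norm (L2_norm M (w n)) \<le> L2_norm M (\<lambda>x. w n x - \<phi> n x) + L2_norm M (\<phi> n)"
      by simp
  qed
qed

text \<open>Cube integrals belong to the dual, so weak convergence makes those of u n - v vanish. In
  the application the bound K comes from coercivity of the energy.\<close>

lemma weakly_converges_imp_L2:
  assumes "weakly_converges \<Omega> u v" and K: "\<And>n. H01_norm \<Omega> (u n) \<le> K"
  shows "(\<lambda>n. L2_norm M (\<lambda>x. u n x - v x)) \<longlonglongrightarrow> 0"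
proof (rule cube_integrals_imp_L2_tendsto_0)
  have u: "\<And>n. u n \<in> H01 \<Omega>" and v: "v \<in> H01 \<Omega>" using assms(1) by (auto simp: weakly_converges_def)
  then show "(\<lambda>x. u n x - v x) \<in> H01 \<Omega>" for n by (intro H01_diff open_\<Omega>)
  show "H01_norm \<Omega> (\<lambda>x. u n x - v x) \<le> K + H01_norm \<Omega> v" for n
    using H01_norm_triangle_diff[OF open_\<Omega> u v] K[of n] by (meson add_right_mono order_trans)
  fix j c
  have "(\<lambda>n. cube_integral ((1/2) ^ j) c (u n)) \<longlonglongrightarrow> cube_integral ((1/2) ^ j) c v"
    using assms(1) cube_integral_dual by (simp add: weakly_converges_def)
  then show "(\<lambda>n. cube_integral ((1/2) ^ j) c (\<lambda>x. u n x - v x)) \<longlonglongrightarrow> 0"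
    using u v by (simp add: cube_integral_diff H01_L2[OF open_\<Omega>] LIM_zero)
qed

text \<open>A diagonal subsequence makes the integrals over all dyadic grid cubes converge. If it
  were not Cauchy in L2, two index sequences would stay e apart although all cube integrals of the
  differences tend to 0.\<close>

theorem rellich:
  assumes u: "\<And>n. u n \<in> H01 \<Omega>" and K: "\<And>n. H01_norm \<Omega> (u n) \<le> K"
  obtains r v where "strict_mono (r :: nat \<Rightarrow> nat)" "L2 M v"
    "(\<lambda>n. L2_norm M (\<lambda>x. u (r n) x - v x)) \<longlonglongrightarrow> 0"
proof -
  obtain C where C: "C \<ge> 0" "\<And>h c (u :: real ^ 'n \<Rightarrow> real). L2 M u \<Longrightarrow> \<bar>cube_integral h c u\<bar> \<le> C * L2_norm M u"
    using cube_integral_bound by blast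
  obtain D where D: "D \<ge> 0" "\<And>u. u \<in> H01 \<Omega> \<Longrightarrow> L2_norm M u \<le> D * H01_norm \<Omega> u"
    using poincare by blast
  \<comment> \<open>Cubes of side (1/2)^j are indexed by the integer vector k of their corner, and
    the pairs (j, k) are enumerated by \<open>from_nat\<close>.\<close>
  define rep where "rep h k = (\<chi> i. h * real_of_int (k $ i))" for h and k :: "int ^ 'n"
  define a where "a n i = (let (j, k) = from_nat i :: nat \<times> (int ^ 'n)
      in cube_integral ((1/2) ^ j) (rep ((1/2) ^ j) k) (u n))" for n i
  have "\<exists>r::nat\<Rightarrow>nat. strict_mono r \<and> (\<forall>i. convergent (\<lambda>n. a (r n) i))"
  proof (rule bounded_sequences_diagonal_convergent)
    fix i
    have "\<bar>a n i\<bar> \<le> C * (D * K)" for n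
    proof -
      have "\<bar>a n i\<bar> \<le> C * L2_norm M (u n)"
        using C(2)[OF H01_L2[OF open_\<Omega> u]] by (simp add: a_def split: prod.split)
      also have "\<dots> \<le> C * (D * H01_norm \<Omega> (u n))" by (intro mult_left_mono C D u)
      also have "\<dots> \<le> C * (D * K)" by (intro mult_left_mono C D K)
      finally show ?thesis .
    qed
    then show "\<exists>B. \<forall>n. \<bar>a n i\<bar> \<le> B" by blast
  qed
  then obtain r :: "nat \<Rightarrow> nat" where r: "strict_mono r" "\<And>i. convergent (\<lambda>n. a (r n) i)" by blast
  have conv: "convergent (\<lambda>n. cube_integral ((1/2) ^ j) c (u (r n)))" for j c
  proof -
    \<comment> \<open>Every point c lies in the cube of its own floor vector, so the enumerated
      functionals cover the cubes around all points.\<close>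
    define k :: "int ^ 'n" where "k = (\<chi> i. \<lfloor>c $ i / (1/2) ^ j\<rfloor>)"
    have "same_cube ((1/2) ^ j) c (rep ((1/2) ^ j) k)"
      by (simp add: same_cube_def rep_def k_def)
    then have "cube ((1/2) ^ j) c = cube ((1/2) ^ j) (rep ((1/2) ^ j) k)" by (rule cube_eq)
    then show ?thesis using r(2)[of "to_nat (j, k)"] by (simp add: a_def cube_integral_def)
  qed
  have Cauchy: "\<exists>N. \<forall>m\<ge>N. \<forall>n\<ge>N. L2_norm M (\<lambda>x. u (r m) x - u (r n) x) < e" if e: "e > 0" for e
  proof (rule ccontr)
    assume "\<not> ?thesis"
    then have "\<forall>N. \<exists>m n. m \<ge> N \<and> n \<ge> N \<and> L2_norm M (\<lambda>x. u (r m) x - u (r n) x) \<ge> e"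
      by (meson linorder_not_less)
    then obtain m n where mn: "\<And>N. m N \<ge> N" "\<And>N. n N \<ge> N"
      "\<And>N. L2_norm M (\<lambda>x. u (r (m N)) x - u (r (n N)) x) \<ge> e" by metis
    have fm: "filterlim m at_top sequentially" and fn: "filterlim n at_top sequentially"
      using mn(1,2) by (auto intro: filterlim_at_top_mono[OF filterlim_ident])
    have "(\<lambda>N. L2_norm M (\<lambda>x. u (r (m N)) x - u (r (n N)) x)) \<longlonglongrightarrow> 0"
    proof (rule cube_integrals_imp_L2_tendsto_0)
      show "(\<lambda>x. u (r (m N)) x - u (r (n N)) x) \<in> H01 \<Omega>" for N by (intro H01_diff open_\<Omega> u)
      show "H01_norm \<Omega> (\<lambda>x. u (r (m N)) x - u (r (n N)) x) \<le> K + K" for N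
        using H01_norm_triangle_diff[OF open_\<Omega> u u, of "r (m N)" "r (n N)"] K[of "r (m N)"] K[of "r (n N)"] by linarith
      fix j c
      obtain l where l: "(\<lambda>n. cube_integral ((1/2) ^ j) c (u (r n))) \<longlonglongrightarrow> l"
        using conv convergent_def by blast
      from tendsto_diff[OF filterlim_compose[OF l fm] filterlim_compose[OF l fn]]
      show "(\<lambda>N. cube_integral ((1/2) ^ j) c (\<lambda>x. u (r (m N)) x - u (r (n N)) x)) \<longlonglongrightarrow> 0"
        by (simp add: cube_integral_diff H01_L2[OF open_\<Omega> u])
    qed
    then have "e \<le> 0" by (rule LIMSEQ_le_const) (use mn(3) in auto)
    with e show False by simp
  qed
  obtain v where "L2 M v" "(\<lambda>n. L2_norm M (\<lambda>x. u (r n) x - v x)) \<longlonglongrightarrow> 0"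
    by (rule L2_complete[of M "\<lambda>n. u (r n)", OF H01_L2[OF open_\<Omega> u] Cauchy])
  with r(1) that show thesis by blast
qed

end

section \<open>The Brezis--Lieb lemma\<close>

text \<open>Dominated convergence is applied to the positive part of $|h_n|-\varepsilon k_n$.\<close>

lemma vanishing_integral:
  fixes h k :: "nat \<Rightarrow> 'a \<Rightarrow> real"
  assumes [measurable]: "\<And>n. h n \<in> borel_measurable M"
    and k: "\<And>n. integrable M (k n)" "\<And>n x. k n x \<ge> 0" "\<And>n. integral\<^sup>L M (k n) \<le> B"
    and AE: "AE x in M. (\<lambda>n. h n x) \<longlonglongrightarrow> 0"
    and dom: "\<And>\<epsilon>. \<epsilon> > 0 \<Longrightarrow> \<exists>w. integrable M w \<and> (\<forall>n x. \<bar>h n x\<bar> \<le> \<epsilon> * k n x + w x)"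
  shows "\<And>n. integrable M (h n)" "(\<lambda>n. LINT x|M. \<bar>h n x\<bar>) \<longlonglongrightarrow> 0"
proof -
  note [measurable] = borel_measurable_integrable[OF k(1)]
  show int: "integrable M (h n)" for n
  proof -
    obtain w where w: "integrable M w" "\<And>n x. \<bar>h n x\<bar> \<le> 1 * k n x + w x" using dom[OF zero_less_one] by blast
    have "norm (h n x) \<le> norm (k n x + w x)" for x using w(2)[of n x] by simp
    then show ?thesis
      by (intro Bochner_Integration.integrable_bound[OF Bochner_Integration.integrable_add[OF k(1) w(1)]] AE_I2)
        measurable
  qed
  show "(\<lambda>n. LINT x|M. \<bar>h n x\<bar>) \<longlonglongrightarrow> 0"
  proof (rule LIMSEQ_I)
    fix e :: real assume e: "e > 0"
    have "integral\<^sup>L M (k 0) \<ge> 0" by (intro integral_nonneg_AE AE_I2 k(2))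
    then have B: "B \<ge> 0" using k(3)[of 0] by linarith
    define \<epsilon> where "\<epsilon> = e / (2 * (B + 1))"
    have \<epsilon>: "\<epsilon> > 0" using e B by (simp add: \<epsilon>_def)
    have \<epsilon>B: "\<epsilon> * B < e / 2" using e B by (simp add: \<epsilon>_def field_simps)
    obtain w where w: "integrable M w" "\<And>n x. \<bar>h n x\<bar> \<le> \<epsilon> * k n x + w x" using dom[OF \<epsilon>] by blast
    define v where "v n x = max 0 (\<bar>h n x\<bar> - \<epsilon> * k n x)" for n x
    have [measurable]: "v n \<in> borel_measurable M" for n unfolding v_def[abs_def] by measurable
    have vw: "\<bar>v n x\<bar> \<le> \<bar>w x\<bar>" for n x using w(2)[of n x] by (auto simp: v_def)
    have vh: "\<bar>v n x\<bar> \<le> \<bar>h n x\<bar>" for n x using mult_nonneg_nonneg[OF less_imp_le[OF \<epsilon>] k(2)[of n x]] by (auto simp: v_def)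
    have intv: "integrable M (v n)" for n
      by (rule Bochner_Integration.integrable_bound[OF w(1)]) (auto simp: vw)
    have "(\<lambda>n. integral\<^sup>L M (v n)) \<longlonglongrightarrow> (LINT x|M. 0)"
    proof (rule integral_dominated_convergence[of _ _ _ "\<lambda>x. \<bar>w x\<bar>"])
      show "AE x in M. (\<lambda>n. v n x) \<longlonglongrightarrow> 0"
        using AE
      proof eventually_elim
        case (elim x)
        show ?case by (rule Lim_null_comparison[OF _ tendsto_rabs_zero[OF elim]]) (simp add: vh)
      qed
    qed (use w(1) vw in auto)
    then have "\<forall>\<^sub>F n in sequentially. integral\<^sup>L M (v n) < e / 2"
      using e by (intro order_tendstoD(2)[of _ 0]) auto
    then obtain N where N: "\<And>n. n \<ge> N \<Longrightarrow> integral\<^sup>L M (v n) < e / 2" by (auto simp: eventually_sequentially)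
    have "norm ((LINT x|M. \<bar>h n x\<bar>) - 0) < e" if "n \<ge> N" for n
    proof -
      have "(LINT x|M. \<bar>h n x\<bar>) \<le> (LINT x|M. \<epsilon> * k n x + v n x)"
        using int k(1) intv by (intro integral_mono) (auto simp: v_def)
      also have "\<dots> = \<epsilon> * integral\<^sup>L M (k n) + integral\<^sup>L M (v n)" using k(1) intv by simp
      also have "\<dots> \<le> \<epsilon> * B + integral\<^sup>L M (v n)" using \<epsilon> k(3)[of n] by simp
      also have "\<dots> < e" using N[OF that] \<epsilon>B by linarith
      finally show ?thesis by simp
    qed
    then show "\<exists>no. \<forall>n\<ge>no. norm ((LINT x|M. \<bar>h n x\<bar>) - 0) < e" by blast
  qed
qed

text \<open>Convexity of t^p with weights 1 - l and l, applied to |x|/(1-l) and |y|/l. Small l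
  brings the first coefficient close to 1 at the expense of the second.\<close>

lemma abs_add_powr_le:
  fixes x y :: real
  assumes p: "p \<ge> 1" and l: "0 < l" "l < 1"
  shows "\<bar>x + y\<bar> powr p \<le> (1 - l) powr (1 - p) * \<bar>x\<bar> powr p + l powr (1 - p) * \<bar>y\<bar> powr p"
proof -
  have ge1: "1 \<le> t powr (1 - p)" if "0 < t" "t < 1" for t
    using powr_mono2'[of "1 - p" t 1] that p by simp
  have "\<bar>x + y\<bar> powr p \<le> (\<bar>x\<bar> + \<bar>y\<bar>) powr p" using p by (intro powr_mono2) auto
  also have "\<dots> \<le> (1 - l) powr (1 - p) * \<bar>x\<bar> powr p + l powr (1 - p) * \<bar>y\<bar> powr p"
  proof (cases "x = 0 \<or> y = 0")
    case True
    then show ?thesis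
      using ge1[of l] ge1[of "1 - l"] l mult_right_mono[of 1 "l powr (1 - p)" "\<bar>y\<bar> powr p"]
        mult_right_mono[of 1 "(1 - l) powr (1 - p)" "\<bar>x\<bar> powr p"] p by auto
  next
    case False
    let ?a = "\<bar>x\<bar> / (1 - l)" and ?b = "\<bar>y\<bar> / l"
    have "((1 - l) *\<^sub>R ?a + l *\<^sub>R ?b) powr p \<le> (1 - l) * ?a powr p + l * ?b powr p"
      using False l by (intro convex_onD[OF powr_convex[OF p]]) auto
    moreover have "(1 - l) *\<^sub>R ?a + l *\<^sub>R ?b = \<bar>x\<bar> + \<bar>y\<bar>" using l by simp
    moreover have "(1 - l) * ?a powr p = (1 - l) powr (1 - p) * \<bar>x\<bar> powr p"
      using l by (simp add: powr_divide powr_diff)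
    moreover have "l * ?b powr p = l powr (1 - p) * \<bar>y\<bar> powr p"
      using l by (simp add: powr_divide powr_diff)
    ultimately show ?thesis by simp
  qed
  finally show ?thesis .
qed

text \<open>Choosing l with (1-l)^(1-p) < 1 + \<delta> gives the upper estimate; applying the same
  bound to x + y and -y gives the lower one.\<close>

lemma abs_add_powr_diff_le:
  fixes p :: real
  assumes p: "p \<ge> 1" and e: "\<epsilon> > 0"
  obtains C where "\<And>x y::real. \<bar>\<bar>x + y\<bar> powr p - \<bar>x\<bar> powr p\<bar> \<le> \<epsilon> * \<bar>x\<bar> powr p + C * \<bar>y\<bar> powr p"
proof -
  \<comment> \<open>The reverse estimate produces the factor \<delta> (1 + \<delta>), which this
    choice keeps at most \<epsilon>.\<close>
  define \<delta> where "\<delta> = min 1 (\<epsilon> / 2)"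
  have \<delta>: "0 < \<delta>" "\<delta> \<le> 1" "\<delta> \<le> \<epsilon> / 2" using e by (auto simp: \<delta>_def)
  have "((\<lambda>l. (1 - l) powr (1 - p)) \<longlongrightarrow> (1 - 0) powr (1 - p)) (at_right 0)"
    by (intro tendsto_intros) auto
  then have "\<forall>\<^sub>F l in at_right 0. (1 - l) powr (1 - p) < 1 + \<delta>"
    using \<delta> by (intro order_tendstoD(2)[of _ 1]) auto
  moreover have "\<forall>\<^sub>F l in at_right (0::real). 0 < l \<and> l < 1"
    by (auto simp: eventually_at_right_field intro!: exI[of _ 1])
  ultimately have "\<forall>\<^sub>F l in at_right 0. (1 - l) powr (1 - p) < 1 + \<delta> \<and> 0 < l \<and> l < 1"
    by eventually_elim simp
  then obtain l :: real where l: "(1 - l) powr (1 - p) < 1 + \<delta>" "0 < l" "l < 1"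
    using eventually_happens'[OF trivial_limit_at_right_real] by blast
  define D where "D = l powr (1 - p)"
  have D: "D \<ge> 0" by (simp add: D_def)
  have up: "\<bar>x + y\<bar> powr p \<le> (1 + \<delta>) * \<bar>x\<bar> powr p + D * \<bar>y\<bar> powr p" for x y :: real
  proof -
    have "(1 - l) powr (1 - p) * \<bar>x\<bar> powr p \<le> (1 + \<delta>) * \<bar>x\<bar> powr p"
      using l by (intro mult_right_mono) auto
    then show ?thesis using abs_add_powr_le[OF p l(2,3), of x y] by (simp add: D_def)
  qed
  have "\<bar>\<bar>x + y\<bar> powr p - \<bar>x\<bar> powr p\<bar> \<le> \<epsilon> * \<bar>x\<bar> powr p + 2 * D * \<bar>y\<bar> powr p" for x y :: real
  proof -
    let ?X = "\<bar>x\<bar> powr p" and ?Y = "\<bar>y\<bar> powr p" and ?Z = "\<bar>x + y\<bar> powr p"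
    have 1: "?Z \<le> (1 + \<delta>) * ?X + D * ?Y" by (rule up)
    have 2: "?X \<le> (1 + \<delta>) * ?Z + D * ?Y" using up[of "x + y" "- y"] by simp
    have 3: "\<delta> * ?Z \<le> \<delta> * ((1 + \<delta>) * ?X + D * ?Y)" using 1 \<delta> by (intro mult_left_mono) auto
    have 4: "\<delta> * ((1 + \<delta>) * ?X) \<le> \<epsilon> * ?X"
    proof -
      have "\<delta> * (1 + \<delta>) \<le> (\<epsilon> / 2) * 2" using \<delta> by (intro mult_mono) auto
      then have "\<delta> * (1 + \<delta>) * ?X \<le> \<epsilon> * ?X" by (intro mult_right_mono) auto
      then show ?thesis by (simp add: mult.assoc)
    qed
    have 5: "\<delta> * (D * ?Y) \<le> D * ?Y" using \<delta> D by (intro mult_left_le_one_le) auto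
    have 6: "D * ?Y \<ge> 0" using D by simp
    have 7: "\<delta> * ?X \<le> \<epsilon> * ?X" using \<delta> e by (intro mult_right_mono) auto
    show ?thesis using 1 2 3 4 5 6 7 by (simp add: abs_le_iff algebra_simps)
  qed
  then show thesis by (rule that)
qed

theorem brezis_lieb:
  fixes f :: "nat \<Rightarrow> 'a \<Rightarrow> real"
  assumes p: "p > 1"
    and [measurable]: "\<And>n. f n \<in> borel_measurable M" "g \<in> borel_measurable M"
    and int: "\<And>n. integrable M (\<lambda>x. \<bar>f n x - g x\<bar> powr p)" "integrable M (\<lambda>x. \<bar>g x\<bar> powr p)"
      "\<And>n. integrable M (\<lambda>x. \<bar>f n x\<bar> powr p)"
    and B: "\<And>n. (LINT x|M. \<bar>f n x - g x\<bar> powr p) \<le> B"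
    and AE: "AE x in M. (\<lambda>n. f n x) \<longlonglongrightarrow> g x"
  shows "(\<lambda>n. (LINT x|M. \<bar>f n x\<bar> powr p) - (LINT x|M. \<bar>f n x - g x\<bar> powr p)) \<longlonglongrightarrow> (LINT x|M. \<bar>g x\<bar> powr p)"
proof -
  define h where "h n x = \<bar>f n x\<bar> powr p - \<bar>f n x - g x\<bar> powr p - \<bar>g x\<bar> powr p" for n x
  have [measurable]: "h n \<in> borel_measurable M" for n unfolding h_def[abs_def] by measurable
  have "(\<lambda>n. LINT x|M. \<bar>h n x\<bar>) \<longlonglongrightarrow> 0"
  proof (rule vanishing_integral(2)[OF _ int(1) _ B])
    show "AE x in M. (\<lambda>n. h n x) \<longlonglongrightarrow> 0"
      using AE
    proof eventually_elim
      case (elim x)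
      have "(\<lambda>n. \<bar>f n x\<bar> powr p - \<bar>f n x - g x\<bar> powr p - \<bar>g x\<bar> powr p)
          \<longlonglongrightarrow> \<bar>g x\<bar> powr p - \<bar>g x - g x\<bar> powr p - \<bar>g x\<bar> powr p"
        using p by (intro tendsto_diff tendsto_const tendsto_powr' tendsto_rabs elim) auto
      then show ?case by (simp add: h_def)
    qed
    fix \<epsilon> :: real assume "\<epsilon> > 0"
    then obtain C where C: "\<And>x y::real. \<bar>\<bar>x + y\<bar> powr p - \<bar>x\<bar> powr p\<bar> \<le> \<epsilon> * \<bar>x\<bar> powr p + C * \<bar>y\<bar> powr p"
      using abs_add_powr_diff_le[of p \<epsilon>] p by (metis less_imp_le)
    have "\<bar>h n x\<bar> \<le> \<epsilon> * \<bar>f n x - g x\<bar> powr p + (C + 1) * \<bar>g x\<bar> powr p" for n x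
    proof -
      have "\<bar>\<bar>f n x\<bar> powr p - \<bar>f n x - g x\<bar> powr p\<bar> \<le> \<epsilon> * \<bar>f n x - g x\<bar> powr p + C * \<bar>g x\<bar> powr p"
        using C[of "f n x - g x" "g x"] by simp
      moreover have "0 \<le> \<bar>g x\<bar> powr p" by simp
      ultimately show ?thesis unfolding h_def distrib_right by linarith
    qed
    then show "\<exists>w. integrable M w \<and> (\<forall>n x. \<bar>h n x\<bar> \<le> \<epsilon> * \<bar>f n x - g x\<bar> powr p + w x)"
      using int(2) by (intro exI[of _ "\<lambda>x. (C + 1) * \<bar>g x\<bar> powr p"]) auto
  qed auto
  then have "(\<lambda>n. integral\<^sup>L M (h n)) \<longlonglongrightarrow> 0"
    by (rule Lim_null_comparison[rotated]) (simp add: integral_abs_bound)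
  then have "(\<lambda>n. integral\<^sup>L M (h n) + (LINT x|M. \<bar>g x\<bar> powr p)) \<longlonglongrightarrow> 0 + (LINT x|M. \<bar>g x\<bar> powr p)"
    by (intro tendsto_intros)
  then show ?thesis using int by (simp add: h_def[abs_def])
qed

text \<open>Splitting at |t| = \<epsilon> |s| gives this form of Young's inequality
  directly.\<close>

lemma abs_mult_powr_le:
  fixes s t :: real
  assumes p: "p > 1" and e: "\<epsilon> > 0"
  shows "\<bar>s\<bar> powr (p - 1) * \<bar>t\<bar> \<le> \<epsilon> * \<bar>s\<bar> powr p + \<epsilon> powr (1 - p) * \<bar>t\<bar> powr p"
proof (cases "\<bar>t\<bar> \<le> \<epsilon> * \<bar>s\<bar>")
  case True
  have "\<bar>s\<bar> powr (p - 1) * \<bar>t\<bar> \<le> \<bar>s\<bar> powr (p - 1) * (\<epsilon> * \<bar>s\<bar>)" using True by (intro mult_left_mono) auto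
  also have "\<dots> = \<epsilon> * \<bar>s\<bar> powr p" by (cases "s = 0") (auto simp: powr_diff)
  finally show ?thesis by (simp add: add_increasing2)
next
  case False
  moreover have "0 \<le> \<epsilon> * \<bar>s\<bar>" using e by simp
  ultimately have t: "\<bar>t\<bar> > 0" by linarith
  have "\<bar>s\<bar> powr (p - 1) \<le> (\<bar>t\<bar> / \<epsilon>) powr (p - 1)"
    using False e p by (intro powr_mono2) (auto simp: field_simps)
  also have "\<dots> = \<epsilon> powr (1 - p) * \<bar>t\<bar> powr (p - 1)"
    using powr_minus_divide[of \<epsilon> "p - 1"] e by (simp add: powr_divide)
  finally have "\<bar>s\<bar> powr (p - 1) * \<bar>t\<bar> \<le> \<epsilon> powr (1 - p) * \<bar>t\<bar> powr (p - 1) * \<bar>t\<bar>"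
    by (rule mult_right_mono) simp
  also have "\<dots> = \<epsilon> powr (1 - p) * \<bar>t\<bar> powr p" using t by (simp add: powr_diff)
  finally show ?thesis using e by (simp add: add_increasing)
qed

lemma abs_sgn_powr_le: "\<bar>sgn_powr q t\<bar> \<le> \<bar>t\<bar> powr q"
  by (simp add: sgn_powr_def abs_mult abs_sgn_eq)

lemma sgn_powr_mult_self: "sgn_powr (p - 1) t * t = \<bar>t\<bar> powr p"
  by (cases t "0::real" rule: linorder_cases) (auto simp: sgn_powr_def powr_diff)

lemma sgn_powr_mult_integrable:
  fixes f g :: "'a \<Rightarrow> real"
  assumes p: "p > 1" and [measurable]: "f \<in> borel_measurable M" "g \<in> borel_measurable M"
    and int: "integrable M (\<lambda>x. \<bar>f x\<bar> powr p)" "integrable M (\<lambda>x. \<bar>g x\<bar> powr p)"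
  shows "integrable M (\<lambda>x. sgn_powr (p - 1) (f x) * g x)"
proof (rule Bochner_Integration.integrable_bound[OF Bochner_Integration.integrable_add[OF int]])
  have "\<bar>sgn_powr (p - 1) (f x) * g x\<bar> \<le> \<bar>f x\<bar> powr p + \<bar>g x\<bar> powr p" for x
    using abs_mult_powr_le[OF p, of 1 "f x" "g x"] mult_right_mono[OF abs_sgn_powr_le[of "p - 1" "f x"], of "\<bar>g x\<bar>"]
    by (simp add: abs_mult)
  then show "AE x in M. norm (sgn_powr (p - 1) (f x) * g x) \<le> norm (\<bar>f x\<bar> powr p + \<bar>g x\<bar> powr p)" by simp
qed measurable

text \<open>The nonlinearity along the sequence, paired with the limit, behaves as under strong
  convergence: the error is at most \<epsilon> |f n|^p plus a multiple of |g|^p. This evaluates the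
  cross term in the derivative along a Palais-Smale sequence.\<close>

theorem sgn_powr_pairing_tendsto:
  fixes f :: "nat \<Rightarrow> 'a \<Rightarrow> real"
  assumes p: "p > 2"
    and [measurable]: "\<And>n. f n \<in> borel_measurable M" "g \<in> borel_measurable M"
    and int: "\<And>n. integrable M (\<lambda>x. \<bar>f n x\<bar> powr p)" "integrable M (\<lambda>x. \<bar>g x\<bar> powr p)"
    and B: "\<And>n. (LINT x|M. \<bar>f n x\<bar> powr p) \<le> B"
    and AE: "AE x in M. (\<lambda>n. f n x) \<longlonglongrightarrow> g x"
  shows "(\<lambda>n. LINT x|M. sgn_powr (p - 1) (f n x) * g x) \<longlonglongrightarrow> (LINT x|M. \<bar>g x\<bar> powr p)"
proof -
  have p1: "p > 1" using p by simp
  define h where "h n x = sgn_powr (p - 1) (f n x) * g x - \<bar>g x\<bar> powr p" for n x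
  have [measurable]: "h n \<in> borel_measurable M" for n unfolding h_def[abs_def] by measurable
  have "(\<lambda>n. LINT x|M. \<bar>h n x\<bar>) \<longlonglongrightarrow> 0"
  proof (rule vanishing_integral(2)[OF _ int(1) _ B])
    show "AE x in M. (\<lambda>n. h n x) \<longlonglongrightarrow> 0"
      using AE
    proof eventually_elim
      case (elim x)
      have "isCont (sgn_powr (p - 1)) (g x)"
        using DERIV_isCont[OF has_real_derivative_sgn_powr] p by simp
      then have "(\<lambda>n. sgn_powr (p - 1) (f n x) * g x - \<bar>g x\<bar> powr p)
          \<longlonglongrightarrow> sgn_powr (p - 1) (g x) * g x - \<bar>g x\<bar> powr p"
        by (intro tendsto_diff tendsto_mult tendsto_const isCont_tendsto_compose[OF _ elim])
      then show ?case by (simp add: h_def sgn_powr_mult_self)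
    qed
    fix \<epsilon> :: real assume \<epsilon>: "\<epsilon> > 0"
    have "\<bar>h n x\<bar> \<le> \<epsilon> * \<bar>f n x\<bar> powr p + (\<epsilon> powr (1 - p) + 1) * \<bar>g x\<bar> powr p" for n x
    proof -
      have "\<bar>sgn_powr (p - 1) (f n x) * g x\<bar> \<le> \<bar>f n x\<bar> powr (p - 1) * \<bar>g x\<bar>"
        unfolding abs_mult by (intro mult_right_mono abs_sgn_powr_le) simp
      moreover have "0 \<le> \<bar>g x\<bar> powr p" by simp
      ultimately show ?thesis
        using abs_mult_powr_le[OF p1 \<epsilon>, of "f n x" "g x"] unfolding h_def distrib_right by linarith
    qed
    then show "\<exists>w. integrable M w \<and> (\<forall>n x. \<bar>h n x\<bar> \<le> \<epsilon> * \<bar>f n x\<bar> powr p + w x)"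
      using int(2) by (intro exI[of _ "\<lambda>x. (\<epsilon> powr (1 - p) + 1) * \<bar>g x\<bar> powr p"]) auto
  qed auto
  then have "(\<lambda>n. integral\<^sup>L M (h n)) \<longlonglongrightarrow> 0"
    by (rule Lim_null_comparison[rotated]) (simp add: integral_abs_bound)
  then have "(\<lambda>n. integral\<^sup>L M (h n) + (LINT x|M. \<bar>g x\<bar> powr p)) \<longlonglongrightarrow> 0 + (LINT x|M. \<bar>g x\<bar> powr p)"
    by (intro tendsto_intros)
  then show ?thesis
    using int sgn_powr_mult_integrable[OF p1 _ _ int(1) int(2)] by (simp add: h_def[abs_def])
qed

section \<open>The thresholds\<close>

text \<open>\<open>young_threshold d \<kappa>\<close> is the value of $\alpha^{(d-4)/2}\beta$ above which
  $\alpha+\beta\sigma\ge\kappa\sigma^{2/(d-2)}$ for all $\sigma\ge0$. As in the definitions of the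
  constants, \<open>d = 4\<close> is separate because \<open>0 powr 0 = 0\<close>.\<close>

definition young_threshold :: "nat \<Rightarrow> real \<Rightarrow> real" where
  "young_threshold d \<kappa> = (if d = 4 then \<kappa>
    else 2 * (real d - 4) powr ((real d - 4) / 2) / (real d - 2) powr ((real d - 2) / 2)
      * \<kappa> powr ((real d - 2) / 2))"

text \<open>Weighted arithmetic-geometric mean inequality with weights \<tau> = (d-4)/(d-2) and
  \<theta> = 2/(d-2), applied to \<alpha>/\<tau> and \<beta> s/\<theta>. For given \<alpha> and
  \<beta> it yields the best constant m, attained at \<sigma>, so that a comparison of thresholds
  becomes the comparison of \<kappa> with m.\<close>

lemma young_optimal_constant:
  fixes d :: nat and \<alpha> \<beta> :: real
  assumes d: "d > 4" and \<alpha>: "\<alpha> > 0" and \<beta>: "\<beta> > 0"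
  obtains m \<sigma> where "m > 0" "\<sigma> > 0"
    "\<And>s. s \<ge> 0 \<Longrightarrow> m * s powr (2 / (real d - 2)) \<le> \<alpha> + \<beta> * s"
    "\<alpha> + \<beta> * \<sigma> = m * \<sigma> powr (2 / (real d - 2))"
    "\<alpha> powr ((real d - 4) / 2) * \<beta> = young_threshold d m"
proof -
  define \<theta> where "\<theta> = 2 / (real d - 2)"
  define \<tau> where "\<tau> = (real d - 4) / (real d - 2)"
  have "\<tau> + \<theta> = (real d - 2) / (real d - 2)"
    unfolding \<theta>_def \<tau>_def add_divide_distrib[symmetric] by simp
  then have t: "\<theta> > 0" "\<tau> > 0" "\<tau> + \<theta> = 1" using d by (auto simp: \<theta>_def \<tau>_def)
  define m where "m = (\<alpha> / \<tau>) powr \<tau> * (\<beta> / \<theta>) powr \<theta>"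
  \<comment> \<open>Equality holds where the two terms agree, that is where \<beta>
    \<sigma>/\<theta> = \<alpha>/\<tau>.\<close>
  define \<sigma> where "\<sigma> = (\<alpha> / \<tau>) / (\<beta> / \<theta>)"
  have m: "m > 0" using t \<alpha> \<beta> by (simp add: m_def)
  have s: "\<sigma> > 0" using t \<alpha> \<beta> by (simp add: \<sigma>_def)
  have le: "m * s powr \<theta> \<le> \<alpha> + \<beta> * s" if "s \<ge> 0" for s
  proof (cases "s = 0")
    case True
    then show ?thesis using \<alpha> by simp
  next
    case False
    with that have "s > 0" by simp
    then have "(\<alpha> / \<tau>) powr \<tau> * (\<beta> * s / \<theta>) powr \<theta> \<le> \<tau> * (\<alpha> / \<tau>) + \<theta> * (\<beta> * s / \<theta>)"
      using t \<alpha> \<beta> by (intro Youngs_inequality_0) auto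
    moreover have "(\<beta> * s / \<theta>) powr \<theta> = (\<beta> / \<theta>) powr \<theta> * s powr \<theta>"
      using \<open>s > 0\<close> t \<beta> powr_mult[of "\<beta> / \<theta>" s \<theta>] by simp
    ultimately show ?thesis using t by (simp add: m_def mult.assoc)
  qed
  have eq: "\<alpha> + \<beta> * \<sigma> = m * \<sigma> powr \<theta>"
  proof -
    have b0: "\<beta> / \<theta> > 0" and a0: "\<alpha> / \<tau> > 0" using t \<alpha> \<beta> by auto
    have "m * \<sigma> powr \<theta> = (\<alpha> / \<tau>) powr \<tau> * (\<alpha> / \<tau>) powr \<theta>"
      using a0 b0 unfolding m_def \<sigma>_def by (subst powr_divide) auto
    also have "\<dots> = \<alpha> / \<tau>" using a0 t powr_add[of "\<alpha> / \<tau>" \<tau> \<theta>] \<alpha> by simp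
    finally have 1: "m * \<sigma> powr \<theta> = \<alpha> / \<tau>" .
    have "\<beta> * \<sigma> = \<theta> * (\<alpha> / \<tau>)" using \<beta> t by (simp add: \<sigma>_def)
    then have "\<alpha> + \<beta> * \<sigma> = (\<tau> + \<theta>) * (\<alpha> / \<tau>)" unfolding distrib_right using t by simp
    with 1 t show ?thesis by simp
  qed
  have thr: "\<alpha> powr ((real d - 4) / 2) * \<beta> = young_threshold d m"
  proof -
    \<comment> \<open>Here k = j + 1, \<tau> k = j and \<theta> k = 1, so raising m to the power k
      leaves \<alpha>^j \<beta> up to a constant.\<close>
    define k where "k = (real d - 2) / 2"
    define j where "j = (real d - 4) / 2"
    have kj: "k = j + 1" "k > 0" "j > 0" using d by (auto simp: k_def j_def field_simps)
    have two: "real d - 4 = 2 * j" "real d - 2 = 2 * k" by (simp_all add: j_def k_def)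
    have \<tau>: "\<tau> = j / k" and \<theta>: "\<theta> = 1 / k" unfolding \<tau>_def \<theta>_def two by simp_all
    have tk: "\<tau> * k = j" "\<theta> * k = 1" using kj by (auto simp: \<tau> \<theta>)
    have "m powr k = ((\<alpha> / \<tau>) powr \<tau>) powr k * ((\<beta> / \<theta>) powr \<theta>) powr k"
      unfolding m_def by (rule powr_mult)
    also have "\<dots> = (\<alpha> / \<tau>) powr j * (\<beta> / \<theta>)"
      using \<beta> t by (simp add: powr_powr tk)
    also have "\<dots> = \<alpha> powr j * \<beta> * (k powr j * k / j powr j)"
      using \<alpha> kj(2,3) by (simp add: \<tau> \<theta> powr_mult powr_divide)
    also have "k powr j * k = k powr k" using kj(2) by (simp add: kj(1) powr_add)
    finally have mk: "m powr k = \<alpha> powr j * \<beta> * (k powr k / j powr j)" .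
    have "young_threshold d m = 2 * (2 * j) powr j / (2 * k) powr k * m powr k"
      using d unfolding young_threshold_def two by simp
    also have "(2 * j) powr j = 2 powr j * j powr j" using kj by (simp add: powr_mult)
    also have "(2 * k) powr k = 2 * 2 powr j * k powr k"
    proof -
      have "2 powr k = (2 :: real) * 2 powr j" by (simp add: kj(1) powr_add)
      then show ?thesis using powr_mult[of 2 k k] by simp
    qed
    finally have "young_threshold d m = (j powr j / k powr k) * m powr k" by simp
    also have "\<dots> = \<alpha> powr j * \<beta>" using kj(2,3) by (simp add: mk)
    finally show ?thesis by (simp add: j_def)
  qed
  show thesis by (rule that[OF m s _ _ thr]) (use le eq in \<open>auto simp: \<theta>_def\<close>)
qed

lemma young_threshold_le_iff:
  assumes "d \<ge> 4" "x > 0" "y > 0"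
  shows "young_threshold d x \<le> young_threshold d y \<longleftrightarrow> x \<le> y"
proof (cases "d = 4")
  case False
  then have d: "real d > 4" using assms(1) by simp
  define c where "c = 2 * (real d - 4) powr ((real d - 4) / 2) / (real d - 2) powr ((real d - 2) / 2)"
  define k where "k = (real d - 2) / 2"
  have c: "c > 0" and k: "k > 0" using d by (auto simp: c_def k_def)
  have "young_threshold d z = c * z powr k" for z using False by (simp add: young_threshold_def c_def k_def)
  moreover have "x powr k \<le> y powr k \<longleftrightarrow> x \<le> y"
    using powr_mono2[of k x y] powr_less_mono2[of k y x] k assms by (auto simp: not_le[symmetric])
  ultimately show ?thesis using c by simp
qed (simp add: young_threshold_def)

text \<open>For d > 4 the cases are \<kappa> <= m, \<kappa> < m and m < \<kappa> for the optimal m,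
  as the threshold is strictly increasing in \<kappa>. For d = 4 both sides are linear in s and the
  sign of \<beta> - \<kappa> decides.\<close>

lemma
  fixes d :: nat and \<alpha> \<beta> \<kappa> :: real
  assumes d: "d \<ge> 4" and \<alpha>: "\<alpha> > 0" and \<beta>: "\<beta> > 0" and \<kappa>: "\<kappa> > 0"
  shows young_ge: "young_threshold d \<kappa> \<le> \<alpha> powr ((real d - 4) / 2) * \<beta> \<Longrightarrow> s \<ge> 0
      \<Longrightarrow> \<kappa> * s powr (2 / (real d - 2)) \<le> \<alpha> + \<beta> * s"
    and young_gt: "young_threshold d \<kappa> < \<alpha> powr ((real d - 4) / 2) * \<beta>
      \<Longrightarrow> \<exists>\<epsilon>>0. \<forall>s\<ge>0. \<kappa> * s powr (2 / (real d - 2)) + \<epsilon> \<le> \<alpha> + \<beta> * s"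
    and young_lt: "\<alpha> powr ((real d - 4) / 2) * \<beta> < young_threshold d \<kappa>
      \<Longrightarrow> \<exists>s>0. \<alpha> + \<beta> * s < \<kappa> * s powr (2 / (real d - 2))"
proof -
  have "(young_threshold d \<kappa> \<le> \<alpha> powr ((real d - 4) / 2) * \<beta>
      \<longrightarrow> (\<forall>s\<ge>0. \<kappa> * s powr (2 / (real d - 2)) \<le> \<alpha> + \<beta> * s))
    \<and> (young_threshold d \<kappa> < \<alpha> powr ((real d - 4) / 2) * \<beta>
      \<longrightarrow> (\<exists>\<epsilon>>0. \<forall>s\<ge>0. \<kappa> * s powr (2 / (real d - 2)) + \<epsilon> \<le> \<alpha> + \<beta> * s))
    \<and> (\<alpha> powr ((real d - 4) / 2) * \<beta> < young_threshold d \<kappa>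
      \<longrightarrow> (\<exists>s>0. \<alpha> + \<beta> * s < \<kappa> * s powr (2 / (real d - 2))))"
  proof (cases "d = 4")
    case True
    have "\<kappa> * s powr 1 + \<alpha> \<le> \<alpha> + \<beta> * s" if "\<kappa> \<le> \<beta>" "s \<ge> 0" for s
      using mult_right_mono[OF that] that by simp
    moreover have "\<exists>s>0. \<alpha> + \<beta> * s < \<kappa> * s powr 1" if "\<beta> < \<kappa>"
    proof -
      \<comment> \<open>Twice the point where the two lines cross.\<close>
      define s where "s = 2 * \<alpha> / (\<kappa> - \<beta>)"
      have s: "s > 0" using \<alpha> that by (simp add: s_def)
      have "(\<kappa> - \<beta>) * s = 2 * \<alpha>" using that by (simp add: s_def)
      then have "\<alpha> + \<beta> * s < \<kappa> * s" using \<alpha> by (simp add: left_diff_distrib)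
      with s show ?thesis by auto
    qed
    ultimately show ?thesis using True \<alpha> by (force simp: young_threshold_def)
  next
    case False
    with d have d: "d > 4" by simp
    obtain m \<sigma> where m: "m > 0" "\<sigma> > 0"
      "\<And>s. s \<ge> 0 \<Longrightarrow> m * s powr (2 / (real d - 2)) \<le> \<alpha> + \<beta> * s"
      "\<alpha> + \<beta> * \<sigma> = m * \<sigma> powr (2 / (real d - 2))"
      "\<alpha> powr ((real d - 4) / 2) * \<beta> = young_threshold d m"
      by (rule young_optimal_constant[OF d \<alpha> \<beta>]) blast
    have le: "young_threshold d x \<le> young_threshold d y \<longleftrightarrow> x \<le> y" if "x > 0" "y > 0" for x y
      using young_threshold_le_iff[of d x y] d that by simp
    have 1: "\<kappa> * s powr (2 / (real d - 2)) \<le> \<alpha> + \<beta> * s" if "\<kappa> \<le> m" "s \<ge> 0" for s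
      using mult_right_mono[OF that(1), of "s powr (2 / (real d - 2))"] m(3)[OF that(2)] by simp
    have 2: "\<exists>\<epsilon>>0. \<forall>s\<ge>0. \<kappa> * s powr (2 / (real d - 2)) + \<epsilon> \<le> \<alpha> + \<beta> * s" if "\<kappa> < m"
    proof (intro exI conjI allI impI)
      \<comment> \<open>Scaling the optimal inequality by \<kappa>/m < 1 leaves the fraction 1 -
        \<kappa>/m of the right-hand side to spare, of which the summand \<alpha> gives a gap
        uniform in s.\<close>
      show "(1 - \<kappa> / m) * \<alpha> > 0" using that m \<alpha> \<kappa> by simp
      fix s :: real assume s: "s \<ge> 0"
      have "\<kappa> / m * (m * s powr (2 / (real d - 2))) \<le> \<kappa> / m * (\<alpha> + \<beta> * s)"
        using m(3)[OF s] m(1) \<kappa> by (intro mult_left_mono) auto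
      then have "\<kappa> * s powr (2 / (real d - 2)) \<le> \<kappa> / m * (\<alpha> + \<beta> * s)" using m(1) by simp
      moreover have "(1 - \<kappa> / m) * (\<beta> * s) \<ge> 0" using that m s \<beta> \<kappa> by (intro mult_nonneg_nonneg) auto
      ultimately show "\<kappa> * s powr (2 / (real d - 2)) + (1 - \<kappa> / m) * \<alpha> \<le> \<alpha> + \<beta> * s"
        by (simp add: algebra_simps)
    qed
    have 3: "\<exists>s>0. \<alpha> + \<beta> * s < \<kappa> * s powr (2 / (real d - 2))" if "m < \<kappa>"
      using m(2,4) mult_strict_right_mono[OF that, of "\<sigma> powr (2 / (real d - 2))"] by auto
    show ?thesis unfolding m(5)
      using 1 2 3 le[OF \<kappa> m(1)] le[OF m(1) \<kappa>] by (meson linorder_not_le)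
  qed
  then show "young_threshold d \<kappa> \<le> \<alpha> powr ((real d - 4) / 2) * \<beta> \<Longrightarrow> s \<ge> 0
      \<Longrightarrow> \<kappa> * s powr (2 / (real d - 2)) \<le> \<alpha> + \<beta> * s"
    and "young_threshold d \<kappa> < \<alpha> powr ((real d - 4) / 2) * \<beta>
      \<Longrightarrow> \<exists>\<epsilon>>0. \<forall>s\<ge>0. \<kappa> * s powr (2 / (real d - 2)) + \<epsilon> \<le> \<alpha> + \<beta> * s"
    and "\<alpha> powr ((real d - 4) / 2) * \<beta> < young_threshold d \<kappa>
      \<Longrightarrow> \<exists>s>0. \<alpha> + \<beta> * s < \<kappa> * s powr (2 / (real d - 2))" by blast+
qed

text \<open>K is the sharp Sobolev constant in power form, and K^((d-2)/2) = S^(-d/2). Moreover p -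
  1 = (d+2)/(d-2) and 2/p = (d-2)/d; the factor 2 for \<open>L_const\<close> reflects that the
  energy enters with b/2.\<close>

lemma
  fixes S :: real
  assumes d: "d \<ge> 4" and S: "S > 0"
  defines "K \<equiv> S powr (- crit_exp d / 2)"
  shows PS_const_eq: "PS_const d S = young_threshold d K"
    and C_const_eq: "C_const d S = young_threshold d ((crit_exp d - 1) * K)"
    and L_const_eq: "L_const d S = 2 * young_threshold d (2 / crit_exp d * K)"
proof -
  have "PS_const d S = young_threshold d K \<and> C_const d S = young_threshold d ((crit_exp d - 1) * K)
    \<and> L_const d S = 2 * young_threshold d (2 / crit_exp d * K)"
  proof (cases "d = 4")
    case True
    have "K = 1 / S\<^sup>2" using S powr_realpow[OF S, of 2] True
      by (simp add: K_def crit_exp_def powr_minus_divide)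
    then show ?thesis using True
      by (simp add: PS_const_def C_const_def L_const_def young_threshold_def crit_exp_def)
  next
    case False
    define D where "D = real d"
    have D: "D > 4" using False d by (simp add: D_def)
    define k where "k = (D - 2) / 2"
    have p: "crit_exp d = 2 * D / (D - 2)" by (simp add: crit_exp_def D_def)
    have Kk: "K powr k = 1 / S powr (D / 2)"
    proof -
      define e where "e = D - 2"
      have "e \<noteq> 0" using D by (simp add: e_def)
      then have "- crit_exp d / 2 * k = - (D / 2)" unfolding p k_def e_def[symmetric] by simp
      moreover have "K powr k = S powr (- crit_exp d / 2 * k)" by (simp only: K_def powr_powr)
      ultimately show ?thesis by (simp only: powr_minus_divide)
    qed
    have K0: "K \<ge> 0" by (simp add: K_def)
    have p1: "crit_exp d - 1 = (D + 2) / (D - 2)" "2 / crit_exp d = (D - 2) / D"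
      using D by (auto simp: p field_simps)
    have sq: "(D - 2) powr k * (D - 2) powr k = (D - 2) powr (D - 2)"
      by (simp add: k_def flip: powr_add)
    have T: "young_threshold d x = 2 * (D - 4) powr ((D - 4) / 2) / (D - 2) powr k * x powr k" for x
      using False by (simp add: young_threshold_def D_def k_def)
    have PS: "PS_const d S = 2 * (D - 4) powr ((D - 4) / 2) / ((D - 2) powr k * S powr (D / 2))"
      using False by (simp add: PS_const_def D_def k_def)
    have C: "C_const d S = 2 * (D - 4) powr ((D - 4) / 2) * (D + 2) powr k / ((D - 2) powr (D - 2) * S powr (D / 2))"
      using False by (simp add: C_const_def D_def k_def)
    have L: "L_const d S = 4 * (D - 4) powr ((D - 4) / 2) / (D powr k * S powr (D / 2))"
      using False by (simp add: L_const_def D_def k_def)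
    have 1: "((D + 2) / (D - 2) * K) powr k = (D + 2) powr k / (D - 2) powr k * K powr k"
      using D K0 by (subst powr_mult) (auto simp: powr_divide)
    have 2: "((D - 2) / D * K) powr k = (D - 2) powr k / D powr k * K powr k"
      using D K0 by (subst powr_mult) (auto simp: powr_divide)
    have pos: "(D - 2) powr k > 0" "D powr k > 0" using D by auto
    show ?thesis
      unfolding T PS C L p1 1 2 Kk sq[symmetric] using pos by simp
  qed
  then show "PS_const d S = young_threshold d K" "C_const d S = young_threshold d ((crit_exp d - 1) * K)"
    "L_const d S = 2 * young_threshold d (2 / crit_exp d * K)" by auto
qed

section \<open>Convexity\<close>

text \<open>Dominated convergence for difference quotients, which the mean value theorem bounds by G
  within distance 1 of t0.\<close>

lemma DERIV_integral_dominated: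
  fixes F F' :: "real \<Rightarrow> 'a \<Rightarrow> real"
  assumes int: "\<And>t. integrable M (F t)" and [measurable]: "F' t0 \<in> borel_measurable M"
    and der: "\<And>t x. ((\<lambda>t. F t x) has_real_derivative F' t x) (at t)"
    and G: "integrable M G" "\<And>t x. \<bar>t - t0\<bar> \<le> 1 \<Longrightarrow> \<bar>F' t x\<bar> \<le> G x"
  shows "((\<lambda>t. integral\<^sup>L M (F t)) has_real_derivative integral\<^sup>L M (F' t0)) (at t0)"
  unfolding DERIV_def tendsto_at_iff_sequentially
proof (intro allI impI)
  fix X :: "nat \<Rightarrow> real" assume X: "\<forall>i. X i \<in> UNIV - {0}" "X \<longlonglongrightarrow> 0"
  then have nz: "X i \<noteq> 0" for i by simp
  note [measurable] = borel_measurable_integrable[OF int]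
  have "\<forall>\<^sub>F i in sequentially. \<bar>X i\<bar> < 1"
    using order_tendstoD(2)[OF tendsto_rabs_zero[OF X(2)], of 1] by simp
  then obtain N where N: "\<And>i. i \<ge> N \<Longrightarrow> \<bar>X i\<bar> < 1" by (auto simp: eventually_sequentially)
  \<comment> \<open>Dropping N terms leaves only increments of size at most 1, where G
    dominates.\<close>
  define Y where "Y i = X (i + N)" for i
  have Y: "Y i \<noteq> 0" "\<bar>Y i\<bar> \<le> 1" for i using nz N[of "i + N"] by (auto simp: Y_def)
  have Y0: "Y \<longlonglongrightarrow> 0" unfolding Y_def using X(2) by (rule LIMSEQ_ignore_initial_segment)
  have "(\<lambda>i. LINT x|M. (F (t0 + Y i) x - F t0 x) / Y i) \<longlonglongrightarrow> integral\<^sup>L M (F' t0)"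
  proof (rule integral_dominated_convergence[OF _ _ G(1)])
    show "AE x in M. (\<lambda>i. (F (t0 + Y i) x - F t0 x) / Y i) \<longlonglongrightarrow> F' t0 x"
    proof (rule AE_I2)
      fix x
      have "((\<lambda>h. (F (t0 + h) x - F t0 x) / h) \<longlongrightarrow> F' t0 x) (at 0)" using der by (simp add: DERIV_def)
      moreover have "filterlim Y (at 0) sequentially" using Y0 Y(1) by (simp add: filterlim_at)
      ultimately show "(\<lambda>i. (F (t0 + Y i) x - F t0 x) / Y i) \<longlonglongrightarrow> F' t0 x"
        by (rule filterlim_compose)
    qed
    show "AE x in M. norm ((F (t0 + Y i) x - F t0 x) / Y i) \<le> G x" for i
    proof (rule AE_I2)
      fix x
      have "norm (F (t0 + Y i) x - F t0 x) \<le> G x * norm (t0 + Y i - t0)"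
      proof (rule field_differentiable_bound[of "cball t0 1" _ "\<lambda>t. F' t x"])
        show "norm (F' t x) \<le> G x" if "t \<in> cball t0 1" for t
          using G(2)[of t x] that by (simp add: dist_real_def abs_minus_commute)
      qed (use Y(2)[of i] der in \<open>auto simp: dist_real_def intro: has_field_derivative_at_within\<close>)
      then show "norm ((F (t0 + Y i) x - F t0 x) / Y i) \<le> G x"
        using Y(1)[of i] by (simp add: divide_le_eq)
    qed
  qed measurable
  then have "(\<lambda>i. (integral\<^sup>L M (F (t0 + Y i)) - integral\<^sup>L M (F t0)) / Y i) \<longlonglongrightarrow> integral\<^sup>L M (F' t0)"
    using int by simp
  then have "(\<lambda>i. ((\<lambda>h. (integral\<^sup>L M (F (t0 + h)) - integral\<^sup>L M (F t0)) / h) \<circ> X) (i + N)) \<longlonglongrightarrow> integral\<^sup>L M (F' t0)"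
    by (simp add: Y_def)
  then show "((\<lambda>h. (integral\<^sup>L M (F (t0 + h)) - integral\<^sup>L M (F t0)) / h) \<circ> X) \<longlonglongrightarrow> integral\<^sup>L M (F' t0)"
    by (rule LIMSEQ_offset)
qed

lemma integrable_abs_add_powr:
  fixes f g :: "'a \<Rightarrow> real"
  assumes p: "p \<ge> 1" and [measurable]: "f \<in> borel_measurable M" "g \<in> borel_measurable M"
    and int: "integrable M (\<lambda>x. \<bar>f x\<bar> powr p)" "integrable M (\<lambda>x. \<bar>g x\<bar> powr p)"
  shows "integrable M (\<lambda>x. \<bar>f x + g x\<bar> powr p)"
proof (rule Bochner_Integration.integrable_bound)
  let ?c = "(1 / 2) powr (1 - p)"
  show "integrable M (\<lambda>x. ?c * \<bar>f x\<bar> powr p + ?c * \<bar>g x\<bar> powr p)" using int by simp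
  show "AE x in M. norm (\<bar>f x + g x\<bar> powr p) \<le> norm (?c * \<bar>f x\<bar> powr p + ?c * \<bar>g x\<bar> powr p)"
    using abs_add_powr_le[OF p, of "1 / 2"] by (intro AE_I2) (simp add: add_nonneg_nonneg)
qed measurable

lemma integrable_abs_cmult_powr:
  fixes f :: "'a \<Rightarrow> real"
  shows "integrable M (\<lambda>x. \<bar>f x\<bar> powr p) \<Longrightarrow> integrable M (\<lambda>x. \<bar>c * f x\<bar> powr p)"
  by (simp add: abs_mult powr_mult)

lemma powr_mult_power2_le:
  assumes "p \<ge> 2"
  shows "\<bar>s\<bar> powr (p - 2) * t\<^sup>2 \<le> \<bar>s\<bar> powr p + \<bar>t::real\<bar> powr p"
proof (cases "s = 0 \<or> t = 0")
  case False
  have p: "\<bar>r\<bar> powr (p - 2) * r\<^sup>2 = \<bar>r\<bar> powr p" if "r \<noteq> 0" for r :: real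
    using that powr_add[of "\<bar>r\<bar>" "p - 2" 2] by (simp add: powr_numeral)
  show ?thesis
  proof (cases "\<bar>t\<bar> \<le> \<bar>s\<bar>")
    case True
    then have "\<bar>s\<bar> powr (p - 2) * t\<^sup>2 \<le> \<bar>s\<bar> powr (p - 2) * s\<^sup>2"
      by (intro mult_left_mono) (auto simp: abs_le_square_iff)
    then show ?thesis using p[of s] False by (simp add: add_increasing2)
  next
    case 2: False
    then have "\<bar>s\<bar> powr (p - 2) * t\<^sup>2 \<le> \<bar>t\<bar> powr (p - 2) * t\<^sup>2"
      using assms by (intro mult_right_mono powr_mono2) auto
    then show ?thesis using p[of t] False by (simp add: add_increasing)
  qed
qed auto

text \<open>Hoelder's inequality with exponents p/(p-2) and p/2, obtained from Young's inequality
  for the powers |f|^p and |g|^p normalised by A and B.\<close>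

lemma Holder_power2:
  fixes f g :: "'a \<Rightarrow> real"
  assumes p: "p > 2" and [measurable]: "f \<in> borel_measurable M" "g \<in> borel_measurable M"
    and int: "integrable M (\<lambda>x. \<bar>f x\<bar> powr p)" "integrable M (\<lambda>x. \<bar>g x\<bar> powr p)"
  defines "A \<equiv> LINT x|M. \<bar>f x\<bar> powr p" and "B \<equiv> LINT x|M. \<bar>g x\<bar> powr p"
  shows "integrable M (\<lambda>x. \<bar>f x\<bar> powr (p - 2) * (g x)\<^sup>2)"
    and "(LINT x|M. \<bar>f x\<bar> powr (p - 2) * (g x)\<^sup>2) \<le> A powr ((p - 2) / p) * B powr (2 / p)"
proof -
  show i: "integrable M (\<lambda>x. \<bar>f x\<bar> powr (p - 2) * (g x)\<^sup>2)"
    by (rule Bochner_Integration.integrable_bound[OF Bochner_Integration.integrable_add[OF int]])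
      (use powr_mult_power2_le[of p] p in auto)
  have AB: "A \<ge> 0" "B \<ge> 0" by (auto simp: A_def B_def)
  show "(LINT x|M. \<bar>f x\<bar> powr (p - 2) * (g x)\<^sup>2) \<le> A powr ((p - 2) / p) * B powr (2 / p)"
  proof (cases "A = 0 \<or> B = 0")
    case True
    then have "AE x in M. \<bar>f x\<bar> powr (p - 2) * (g x)\<^sup>2 = 0"
    proof
      assume "A = 0"
      then have "AE x in M. \<bar>f x\<bar> powr p = 0"
        using integral_nonneg_eq_0_iff_AE[OF int(1)] by (simp add: A_def)
      then show ?thesis by eventually_elim simp
    next
      assume "B = 0"
      then have "AE x in M. \<bar>g x\<bar> powr p = 0"
        using integral_nonneg_eq_0_iff_AE[OF int(2)] by (simp add: B_def)
      then show ?thesis by eventually_elim simp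
    qed
    then have "(LINT x|M. \<bar>f x\<bar> powr (p - 2) * (g x)\<^sup>2) = (LINT x|M. 0)"
      by (intro integral_cong_AE) auto
    then show ?thesis by simp
  next
    case False
    with AB have A: "A > 0" and B: "B > 0" by auto
    define \<alpha> where "\<alpha> = (p - 2) / p"
    define \<beta> where "\<beta> = 2 / p"
    have ab: "\<alpha> \<ge> 0" "\<beta> \<ge> 0" "\<alpha> + \<beta> = 1" using p by (auto simp: \<alpha>_def \<beta>_def field_simps)
    have abp: "p * \<alpha> = p - 2" "p * \<beta> = 2" using p by (auto simp: \<alpha>_def \<beta>_def)
    define c where "c = A powr \<alpha> * B powr \<beta>"
    have c: "c > 0" using A B by (simp add: c_def)
    have pt: "\<bar>s\<bar> powr (p - 2) * t\<^sup>2 \<le> c * (\<alpha> * (\<bar>s\<bar> powr p / A) + \<beta> * (\<bar>t\<bar> powr p / B))" for s t :: real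
    proof (cases "s = 0 \<or> t = 0")
      case True
      then have "\<bar>s\<bar> powr (p - 2) * t\<^sup>2 = 0" by auto
      also have "0 \<le> c * (\<alpha> * (\<bar>s\<bar> powr p / A) + \<beta> * (\<bar>t\<bar> powr p / B))"
        using ab A B c by (intro mult_nonneg_nonneg add_nonneg_nonneg) auto
      finally show ?thesis .
    next
      case False
      have "(\<bar>s\<bar> powr p / A) powr \<alpha> * (\<bar>t\<bar> powr p / B) powr \<beta>
          \<le> \<alpha> * (\<bar>s\<bar> powr p / A) + \<beta> * (\<bar>t\<bar> powr p / B)"
        using False ab A B by (intro Youngs_inequality_0) auto
      moreover have "(\<bar>s\<bar> powr p / A) powr \<alpha> = \<bar>s\<bar> powr (p - 2) / A powr \<alpha>"
        using A by (simp add: powr_divide powr_powr abp)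
      moreover have "(\<bar>t\<bar> powr p / B) powr \<beta> = t\<^sup>2 / B powr \<beta>"
        using B False by (simp add: powr_divide powr_powr abp powr_numeral)
      ultimately have "\<bar>s\<bar> powr (p - 2) * t\<^sup>2 / c \<le> \<alpha> * (\<bar>s\<bar> powr p / A) + \<beta> * (\<bar>t\<bar> powr p / B)"
        by (simp add: c_def)
      then show ?thesis using c by (simp add: divide_le_eq mult.commute)
    qed
    have "(LINT x|M. \<bar>f x\<bar> powr (p - 2) * (g x)\<^sup>2)
        \<le> (LINT x|M. c * (\<alpha> * (\<bar>f x\<bar> powr p / A) + \<beta> * (\<bar>g x\<bar> powr p / B)))"
      using int by (intro integral_mono i pt) auto
    also have "\<dots> = c * (\<alpha> * (A / A) + \<beta> * (B / B))"
      using int by (simp add: A_def B_def)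
    also have "\<dots> = c" using A B ab by simp
    finally show ?thesis by (simp add: c_def \<alpha>_def \<beta>_def)
  qed
qed

context critical_domain
begin

definition \<Phi> :: "(real ^ 'n \<Rightarrow> real) \<Rightarrow> real" where
  "\<Phi> u = (LINT x|M. \<bar>u x\<bar> powr p)"

text \<open>Since p > 2, |t|^p has two continuous derivatives, and differentiation under the
  integral applies twice.\<close>

lemma \<Phi>_derivatives:
  assumes u: "u \<in> H01 \<Omega>" and w: "w \<in> H01 \<Omega>"
  shows "((\<lambda>t. \<Phi> (\<lambda>x. u x + t * w x)) has_real_derivative
      p * (LINT x|M. sgn_powr (p - 1) (u x + t * w x) * w x)) (at t)"
    and "((\<lambda>t. LINT x|M. sgn_powr (p - 1) (u x + t * w x) * w x) has_real_derivative
      (p - 1) * (LINT x|M. \<bar>u x + t * w x\<bar> powr (p - 2) * (w x)\<^sup>2)) (at t)"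
proof -
  note p = p_gt_2
  note [measurable] = H01_measurable[OF u] H01_measurable[OF w]
  have v: "(\<lambda>x. u x + s * w x) \<in> H01 \<Omega>" for s by (intro H01_add H01_cmult open_\<Omega> u w)
  note iu = H01_powr_integrable[OF u] and iw = H01_powr_integrable[OF w] and iv = H01_powr_integrable[OF v]
  \<comment> \<open>For |s - t| <= 1 one has |s| <= c, so m dominates |u + s w| uniformly and has an
    integrable p-th power.\<close>
  define c where "c = \<bar>t\<bar> + 1"
  define m where "m x = \<bar>u x\<bar> + c * \<bar>w x\<bar>" for x
  have [measurable]: "m \<in> borel_measurable M" unfolding m_def[abs_def] by measurable
  have m0: "\<bar>m x\<bar> = m x" for x by (simp add: m_def c_def)
  have im: "integrable M (\<lambda>x. \<bar>m x\<bar> powr p)"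
    unfolding m_def using p iu iw integrable_abs_cmult_powr[of M "\<lambda>x. \<bar>w x\<bar>" p c]
    by (intro integrable_abs_add_powr) auto
  have le: "\<bar>u x + s * w x\<bar> \<le> \<bar>m x\<bar>" if "\<bar>s - t\<bar> \<le> 1" for s x
  proof -
    have "\<bar>s\<bar> \<le> c" using that by (simp add: c_def)
    then have "\<bar>s * w x\<bar> \<le> c * \<bar>w x\<bar>" unfolding abs_mult by (rule mult_right_mono) simp
    then show ?thesis unfolding m0 by (simp add: m_def)
  qed
  have aff: "((\<lambda>s. u x + s * w x) has_real_derivative w x) (at s)" for s x
    by (auto intro!: derivative_eq_intros)
  have "((\<lambda>s. LINT x|M. \<bar>u x + s * w x\<bar> powr p) has_real_derivative
      (LINT x|M. p * (sgn_powr (p - 1) (u x + t * w x) * w x))) (at t)"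
  proof (rule DERIV_integral_dominated[OF iv])
    show "((\<lambda>s. \<bar>u x + s * w x\<bar> powr p) has_real_derivative p * (sgn_powr (p - 1) (u x + s * w x) * w x)) (at s)" for s x
      using DERIV_chain2[OF has_real_derivative_abs_powr aff] p by (simp add: mult.assoc)
    show "integrable M (\<lambda>x. p * (\<bar>m x\<bar> powr p + \<bar>w x\<bar> powr p))" using im iw by simp
    fix s x assume s: "\<bar>s - t\<bar> \<le> 1"
    have "\<bar>sgn_powr (p - 1) (u x + s * w x) * w x\<bar> \<le> \<bar>m x\<bar> powr (p - 1) * \<bar>w x\<bar>"
      unfolding abs_mult using p
      by (intro mult_right_mono order_trans[OF abs_sgn_powr_le] powr_mono2 le s) auto
    also have "\<dots> \<le> \<bar>m x\<bar> powr p + \<bar>w x\<bar> powr p" using abs_mult_powr_le[of p 1 "m x" "w x"] p by simp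
    finally show "\<bar>p * (sgn_powr (p - 1) (u x + s * w x) * w x)\<bar> \<le> p * (\<bar>m x\<bar> powr p + \<bar>w x\<bar> powr p)"
      using p by (simp add: abs_mult)
  qed measurable
  then show "((\<lambda>t. \<Phi> (\<lambda>x. u x + t * w x)) has_real_derivative
      p * (LINT x|M. sgn_powr (p - 1) (u x + t * w x) * w x)) (at t)"
    by (simp add: \<Phi>_def)
  have "((\<lambda>s. LINT x|M. sgn_powr (p - 1) (u x + s * w x) * w x) has_real_derivative
      (LINT x|M. (p - 1) * (\<bar>u x + t * w x\<bar> powr (p - 2) * (w x)\<^sup>2))) (at t)"
  proof (rule DERIV_integral_dominated)
    show "integrable M (\<lambda>x. sgn_powr (p - 1) (u x + s * w x) * w x)" for s
      using p iv iw by (intro sgn_powr_mult_integrable) auto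
    show "((\<lambda>s. sgn_powr (p - 1) (u x + s * w x) * w x) has_real_derivative
        (p - 1) * (\<bar>u x + s * w x\<bar> powr (p - 2) * (w x)\<^sup>2)) (at s)" for s x
      using DERIV_cmult_right[OF DERIV_chain2[OF has_real_derivative_sgn_powr[of "p - 1"] aff[of x s]], of "w x"] p
      by (simp add: mult.assoc power2_eq_square)
    show "integrable M (\<lambda>x. (p - 1) * (\<bar>m x\<bar> powr p + \<bar>w x\<bar> powr p))" using im iw by simp
    fix s x assume s: "\<bar>s - t\<bar> \<le> 1"
    have "\<bar>u x + s * w x\<bar> powr (p - 2) * (w x)\<^sup>2 \<le> \<bar>m x\<bar> powr (p - 2) * (w x)\<^sup>2"
      using p by (intro mult_right_mono powr_mono2 le s) auto
    also have "\<dots> \<le> \<bar>m x\<bar> powr p + \<bar>w x\<bar> powr p" using powr_mult_power2_le[of p "m x" "w x"] p by simp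
    finally show "\<bar>(p - 1) * (\<bar>u x + s * w x\<bar> powr (p - 2) * (w x)\<^sup>2)\<bar> \<le> (p - 1) * (\<bar>m x\<bar> powr p + \<bar>w x\<bar> powr p)"
      using p by (simp add: abs_mult)
  qed measurable
  then show "((\<lambda>t. LINT x|M. sgn_powr (p - 1) (u x + t * w x) * w x) has_real_derivative
      (p - 1) * (LINT x|M. \<bar>u x + t * w x\<bar> powr (p - 2) * (w x)\<^sup>2)) (at t)" by simp
qed

abbreviation (input) "K \<equiv> sobolev_const \<Omega> powr (- p / 2)"

text \<open>Hoelder's inequality, then the sharp Sobolev inequality for u and for w; the exponents
  (p-2)/p and 2/p of K add up to 1.\<close>

lemma second_variation_bound:
  assumes u: "u \<in> H01 \<Omega>" and w: "w \<in> H01 \<Omega>"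
  shows "(LINT x|M. \<bar>u x\<bar> powr (p - 2) * (w x)\<^sup>2) \<le> K * H01_norm \<Omega> u powr (p - 2) * (H01_norm \<Omega> w)\<^sup>2"
proof -
  note p = p_gt_2
  let ?s = "H01_norm \<Omega> u" and ?r = "H01_norm \<Omega> w"
  have sr: "?s \<ge> 0" "?r \<ge> 0" by (auto simp: H01_norm_nonneg[OF open_\<Omega>])
  have "(LINT x|M. \<bar>u x\<bar> powr (p - 2) * (w x)\<^sup>2)
      \<le> (LINT x|M. \<bar>u x\<bar> powr p) powr ((p - 2) / p) * (LINT x|M. \<bar>w x\<bar> powr p) powr (2 / p)"
    by (intro Holder_power2 p H01_measurable H01_powr_integrable u w)
  also have "\<dots> \<le> (K * ?s powr p) powr ((p - 2) / p) * (K * ?r powr p) powr (2 / p)"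
    using p by (intro mult_mono powr_mono2 sobolev_inequality u w) auto
  also have "\<dots> = (K powr ((p - 2) / p) * ?s powr (p - 2)) * (K powr (2 / p) * ?r\<^sup>2)"
    using p sr by (subst (1 2) powr_mult) (auto simp: powr_powr powr_numeral)
  also have "\<dots> = K powr ((p - 2) / p + 2 / p) * ?s powr (p - 2) * ?r\<^sup>2"
    by (simp only: powr_add mult_ac)
  also have "(p - 2) / p + 2 / p = 1" using p by (simp flip: add_divide_distrib)
  finally show ?thesis by simp
qed

text \<open>As p - 2 = 4/(d-2), the power of the norm becomes the power 2/(d-2) of its square, the
  variable s of the scalar inequality.\<close>

lemma norm_powr_eq:
  "H01_norm \<Omega> u powr (p - 2) = ((H01_norm \<Omega> u)\<^sup>2) powr (2 / (real CARD('n) - 2))"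
proof -
  have "p - 2 = 2 * (2 / (real CARD('n) - 2))" using d3 by (simp add: p_def crit_exp_def field_simps)
  moreover have "(H01_norm \<Omega> u)\<^sup>2 = H01_norm \<Omega> u powr 2"
    by (simp add: powr_numeral H01_norm_nonneg[OF open_\<Omega>])
  ultimately show ?thesis by (simp only: powr_powr)
qed

text \<open>Subtracting (\<epsilon>/2) r s^2 from the energy on the segment leaves a function with
  nonnegative second derivative. \<epsilon> = 0 gives convexity; \<epsilon> > 0 gives strict
  convexity with an explicit gap.\<close>

theorem uniform_convexity_along_segments:
  assumes \<epsilon>: "\<epsilon> \<ge> 0"
    and ab: "b > 0" "\<And>s. s \<ge> 0 \<Longrightarrow> (p - 1) * K * s powr (2 / (real CARD('n) - 2)) + \<epsilon> \<le> a + b * s"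
    and u: "u \<in> H01 \<Omega>" and v: "v \<in> H01 \<Omega>" and t: "0 \<le> t" "t \<le> 1"
  shows "energy \<Omega> a b (\<lambda>x. (1 - t) * u x + t * v x)
    \<le> (1 - t) * energy \<Omega> a b u + t * energy \<Omega> a b v - \<epsilon> / 2 * (H01_norm \<Omega> (\<lambda>x. v x - u x))\<^sup>2 * (t * (1 - t))"
proof -
  note p = p_gt_2
  define w where "w x = v x - u x" for x
  have w: "w \<in> H01 \<Omega>" unfolding w_def[abs_def] by (intro H01_diff open_\<Omega> u v)
  have z: "(\<lambda>x. u x + s * w x) \<in> H01 \<Omega>" for s by (intro H01_add H01_cmult open_\<Omega> u w)
  define r where "r = (H01_norm \<Omega> w)\<^sup>2"
  define q where "q s = (H01_norm \<Omega> u)\<^sup>2 + 2 * s * ip \<Omega> u w + s\<^sup>2 * r" for s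
  define q' where "q' s = 2 * ip \<Omega> u w + 2 * s * r" for s
  have q: "(H01_norm \<Omega> (\<lambda>x. u x + s * w x))\<^sup>2 = q s" for s
    using H01_norm_power2_add[OF open_\<Omega> u H01_cmult[OF open_\<Omega> w]] w u
    by (simp add: q_def r_def ip_cmult_right[OF open_\<Omega>] H01_norm_cmult[OF open_\<Omega>] power_mult_distrib)
  have q4: "(H01_norm \<Omega> (\<lambda>x. u x + s * w x)) ^ 4 = (q s)\<^sup>2" for s
    unfolding q[symmetric] by (simp flip: power_mult)
  define N where "N s = (LINT x|M. sgn_powr (p - 1) (u x + s * w x) * w x)" for s
  define N' where "N' s = (p - 1) * (LINT x|M. \<bar>u x + s * w x\<bar> powr (p - 2) * (w x)\<^sup>2)" for s
  define e where "e s = energy \<Omega> a b (\<lambda>x. u x + s * w x) - \<epsilon> / 2 * r * s\<^sup>2" for s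
  have e: "e s = a / 2 * q s + b / 4 * (q s)\<^sup>2 - 1 / p * \<Phi> (\<lambda>x. u x + s * w x) - \<epsilon> / 2 * r * s\<^sup>2" for s
    by (simp add: e_def energy_eq q q4 \<Phi>_def)
  have dq: "(q has_real_derivative q' s) (at s)" for s
    unfolding q_def q'_def by (auto intro!: derivative_eq_intros)
  have dq': "(q' has_real_derivative 2 * r) (at s)" for s
    unfolding q'_def by (auto intro!: derivative_eq_intros)
  have dN: "(N has_real_derivative N' s) (at s)" for s
    unfolding N_def[abs_def] N'_def by (rule \<Phi>_derivatives(2)[OF u w])
  have d\<Phi>: "((\<lambda>s. \<Phi> (\<lambda>x. u x + s * w x)) has_real_derivative p * N s) (at s)" for s
    unfolding N_def by (rule \<Phi>_derivatives(1)[OF u w])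
  define e' where "e' s = a / 2 * q' s + b / 2 * (q s * q' s) - N s - \<epsilon> * r * s" for s
  define e'' where "e'' s = a * r + b / 2 * (q' s * q' s + 2 * r * q s) - N' s - \<epsilon> * r" for s
  have de: "(e has_real_derivative e' s) (at s)" for s
    unfolding e[abs_def] e'_def using p
    by (auto intro!: derivative_eq_intros dq d\<Phi> simp: field_simps)
  have de': "(e' has_real_derivative e'' s) (at s)" for s
    unfolding e'_def[abs_def] e''_def
    by (auto intro!: derivative_eq_intros dq dq' dN simp: field_simps)
  have e''0: "e'' s \<ge> 0" for s
  proof -
    have q0: "q s \<ge> 0" unfolding q[symmetric] by simp
    have r0: "r \<ge> 0" by (simp add: r_def)
    have "N' s \<le> (p - 1) * (K * H01_norm \<Omega> (\<lambda>x. u x + s * w x) powr (p - 2) * r)"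
      unfolding N'_def r_def using p by (intro mult_left_mono second_variation_bound z w) auto
    also have "\<dots> = ((p - 1) * K * q s powr (2 / (real CARD('n) - 2))) * r"
      by (simp only: norm_powr_eq q mult_ac)
    also have "\<dots> \<le> (a + b * q s - \<epsilon>) * r"
      using ab(2)[OF q0] r0 by (intro mult_right_mono) auto
    finally have "N' s \<le> a * r + b * (r * q s) - \<epsilon> * r" by (simp add: algebra_simps)
    \<comment> \<open>The quartic term also contributes the square of the first derivative of q,
      which has a favourable sign and is dropped.\<close>
    moreover have "b / 2 * (q' s * q' s) \<ge> 0" using ab(1) by simp
    ultimately show ?thesis by (simp add: e''_def algebra_simps)
  qed
  have "convex_on UNIV e"
    using de de' e''0 by (intro f''_ge0_imp_convex[of UNIV e e' e'']) auto
  then have "e ((1 - t) *\<^sub>R 0 + t *\<^sub>R 1) \<le> (1 - t) * e 0 + t * e 1"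
    using t by (intro convex_onD) auto
  moreover have "(\<lambda>x. u x + t * w x) = (\<lambda>x. (1 - t) * u x + t * v x)"
    by (simp add: w_def algebra_simps)
  moreover have "(\<lambda>x. u x + 1 * w x) = v" by (simp add: w_def)
  ultimately show ?thesis
    by (simp add: e_def r_def w_def[symmetric] power2_eq_square algebra_simps diff_divide_distrib)
qed

theorem energy_convex:
  assumes d: "CARD('n) \<ge> 4" and ab: "a > 0" "b > 0"
    and C: "C_const CARD('n) (sobolev_const \<Omega>) \<le> a powr ((real CARD('n) - 4) / 2) * b"
  shows "convex_functional \<Omega> (energy \<Omega> a b)"
  unfolding convex_functional_def
proof (intro ballI allI impI)
  fix u v t assume uv: "u \<in> H01 \<Omega>" "v \<in> H01 \<Omega>" and t: "0 \<le> t \<and> t \<le> (1::real)"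
  have "(p - 1) * K > 0" using p_gt_2 sobolev_const_pos by simp
  then have "(p - 1) * K * s powr (2 / (real CARD('n) - 2)) + 0 \<le> a + b * s" if "s \<ge> 0" for s
    using young_ge[OF d ab, of "(p - 1) * K" s] C that
    by (simp add: C_const_eq[OF d sobolev_const_pos] p_def[symmetric])
  from uniform_convexity_along_segments[OF order_refl ab(2) this uv] t
  show "energy \<Omega> a b (\<lambda>x. (1 - t) * u x + t * v x) \<le> (1 - t) * energy \<Omega> a b u + t * energy \<Omega> a b v"
    by simp
qed

theorem energy_strictly_convex:
  assumes d: "CARD('n) \<ge> 4" and ab: "a > 0" "b > 0"
    and C: "C_const CARD('n) (sobolev_const \<Omega>) < a powr ((real CARD('n) - 4) / 2) * b"
  shows "strictly_convex_functional \<Omega> (energy \<Omega> a b)"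
  unfolding strictly_convex_functional_def
proof (intro ballI allI impI)
  fix u v t assume uv: "u \<in> H01 \<Omega>" "v \<in> H01 \<Omega>" and t: "\<not> ae_eq \<Omega> u v \<and> 0 < t \<and> t < (1::real)"
  have K0: "(p - 1) * K > 0" using p_gt_2 sobolev_const_pos by simp
  have "\<exists>\<epsilon>>0. \<forall>s\<ge>0. (p - 1) * K * s powr (2 / (real CARD('n) - 2)) + \<epsilon> \<le> a + b * s"
    using C by (intro young_gt[OF d ab K0]) (simp add: C_const_eq[OF d sobolev_const_pos] p_def[symmetric])
  then obtain \<epsilon> where \<epsilon>: "\<epsilon> > 0"
    "\<And>s. s \<ge> 0 \<Longrightarrow> (p - 1) * K * s powr (2 / (real CARD('n) - 2)) + \<epsilon> \<le> a + b * s" by blast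
  have w: "(\<lambda>x. v x - u x) \<in> H01 \<Omega>" using uv by (intro H01_diff open_\<Omega>)
  \<comment> \<open>A vanishing norm would make u and v equal almost everywhere by Sobolev's
    inequality.\<close>
  have "H01_norm \<Omega> (\<lambda>x. v x - u x) \<noteq> 0"
  proof
    assume "H01_norm \<Omega> (\<lambda>x. v x - u x) = 0"
    then have "ae_eq \<Omega> (\<lambda>x. v x - u x) (\<lambda>_. 0)" using H01_norm_eq_0_imp[OF w] by simp
    then have "AE x in M. u x = v x" unfolding ae_eq_def by eventually_elim simp
    with t show False by (simp add: ae_eq_def)
  qed
  then have "\<epsilon> / 2 * (H01_norm \<Omega> (\<lambda>x. v x - u x))\<^sup>2 * (t * (1 - t)) > 0"
    using \<epsilon>(1) t by simp
  with uniform_convexity_along_segments[OF less_imp_le[OF \<epsilon>(1)] ab(2) \<epsilon>(2) uv, of t] t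
  show "energy \<Omega> a b (\<lambda>x. (1 - t) * u x + t * v x) < (1 - t) * energy \<Omega> a b u + t * energy \<Omega> a b v"
    by linarith
qed

end

section \<open>Weak lower semicontinuity\<close>

lemma lborel_integral_affine:
  fixes f :: "'a::euclidean_space \<Rightarrow> real"
  assumes [measurable]: "f \<in> borel_measurable borel" and l: "l > 0"
  shows "l ^ DIM('a) * (LINT x|lborel. f (l *\<^sub>R x + v)) = integral\<^sup>L lborel f"
proof -
  have "integral\<^sup>L lborel f = integral\<^sup>L (density (distr lborel borel (\<lambda>x. v + l *\<^sub>R x)) (\<lambda>_. \<bar>l\<bar> ^ DIM('a))) f"
    using lborel_affine[of l v] l by simp
  also have "\<dots> = (LINT x|distr lborel borel (\<lambda>x. v + l *\<^sub>R x). \<bar>l\<bar> ^ DIM('a) * f x)"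
    by (subst integral_real_density) auto
  also have "\<dots> = (LINT x|lborel. \<bar>l\<bar> ^ DIM('a) * f (v + l *\<^sub>R x))"
    by (rule integral_distr) auto
  finally show ?thesis using l by (simp add: add.commute)
qed

text \<open>For d > 4 the exponent 2/(d-2) is below 1, so the linear term wins for large s whatever
  the size of \<kappa>; for d = 4 the exponent is 1 and the coefficients must be ordered.\<close>

lemma power_eventually_dominated:
  fixes \<kappa> \<beta> :: real
  assumes d: "d \<ge> 4" and \<beta>: "\<beta> > 0" and 4: "d = 4 \<longrightarrow> \<kappa> \<le> \<beta>"
  obtains R where "R \<ge> 0" "\<And>s. s \<ge> R \<Longrightarrow> \<kappa> * s powr (2 / (real d - 2)) \<le> \<beta> * s"
proof (cases "d = 4")
  case True
  show thesis
  proof (rule that[of 0])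
    fix s :: real assume "s \<ge> 0"
    then show "\<kappa> * s powr (2 / (real d - 2)) \<le> \<beta> * s" using True 4 by (simp add: mult_right_mono)
  qed simp
next
  case False
  define \<theta> where "\<theta> = 2 / (real d - 2)"
  have \<theta>: "\<theta> < 1" using d False by (simp add: \<theta>_def)
  define k where "k = max \<kappa> 0"
  define R where "R = max 1 ((k / \<beta>) powr (1 / (1 - \<theta>)))"
  show thesis
  proof (rule that[of R])
    fix s assume s: "s \<ge> R"
    then have s1: "s > 0" by (simp add: R_def)
    have "k / \<beta> = ((k / \<beta>) powr (1 / (1 - \<theta>))) powr (1 - \<theta>)"
      using \<theta> \<beta> by (simp add: powr_powr k_def)
    also have "\<dots> \<le> s powr (1 - \<theta>)" using s \<theta> by (intro powr_mono2) (auto simp: R_def)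
    finally have "k \<le> \<beta> * s powr (1 - \<theta>)" using \<beta> by (simp add: field_simps)
    then have "k * s powr \<theta> \<le> \<beta> * s powr (1 - \<theta>) * s powr \<theta>" by (rule mult_right_mono) simp
    also have "\<dots> = \<beta> * s" using s1 powr_add[of s "1 - \<theta>" \<theta>] by simp
    finally have "k * s powr \<theta> \<le> \<beta> * s" .
    moreover have "\<kappa> * s powr \<theta> \<le> k * s powr \<theta>" by (intro mult_right_mono) (auto simp: k_def)
    ultimately show "\<kappa> * s powr (2 / (real d - 2)) \<le> \<beta> * s" by (simp add: \<theta>_def)
  qed (simp add: R_def)
qed

context critical_domain
begin

lemma ip_dual: "u \<in> H01 \<Omega> \<Longrightarrow> (\<lambda>v. ip \<Omega> v u) \<in> H01_dual \<Omega>"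
  unfolding H01_dual_def
  by (auto simp: ip_add_left[OF open_\<Omega>] ip_cmult_left[OF open_\<Omega>] intro!: exI[of _ "H01_norm \<Omega> u"])
    (metis ip_Cauchy_Schwarz[OF open_\<Omega>] mult.commute)

lemma norm_p_split: "H01_norm \<Omega> u powr p = (H01_norm \<Omega> u)\<^sup>2 * ((H01_norm \<Omega> u)\<^sup>2) powr (2 / (real CARD('n) - 2))"
  using powr_add[of "H01_norm \<Omega> u" 2 "p - 2"]
  by (simp add: norm_powr_eq powr_numeral H01_norm_nonneg[OF open_\<Omega>])

text \<open>Factoring \<sigma>/2 out of the energy, with \<sigma> the squared norm, turns b/4 into
  b/2 and K/p into 2K/p: the parameters that define the threshold for lower semicontinuity.\<close>

lemma energy_lower_bound:
  assumes u: "u \<in> H01 \<Omega>"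
  shows "(H01_norm \<Omega> u)\<^sup>2 / 2 * (a + b / 2 * (H01_norm \<Omega> u)\<^sup>2
      - 2 / p * K * ((H01_norm \<Omega> u)\<^sup>2) powr (2 / (real CARD('n) - 2))) \<le> energy \<Omega> a b u"
proof -
  let ?s = "(H01_norm \<Omega> u)\<^sup>2"
  have "1 / p * \<Phi> u \<le> 1 / p * (K * (?s * ?s powr (2 / (real CARD('n) - 2))))"
    using sobolev_inequality[OF u] p_gt_2 unfolding norm_p_split \<Phi>_def by (intro mult_left_mono) auto
  moreover have "(H01_norm \<Omega> u) ^ 4 = ?s\<^sup>2" by (simp flip: power_mult)
  ultimately show ?thesis
    by (simp add: energy_eq \<Phi>_def[symmetric] power2_eq_square[of ?s] algebra_simps)
qed

lemma energy_nonneg: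
  assumes d: "CARD('n) \<ge> 4" and ab: "a > 0" "b > 0"
    and L: "L_const CARD('n) (sobolev_const \<Omega>) \<le> a powr ((real CARD('n) - 4) / 2) * b"
    and u: "u \<in> H01 \<Omega>"
  shows "energy \<Omega> a b u \<ge> 0"
proof -
  let ?s = "(H01_norm \<Omega> u)\<^sup>2"
  have "2 / p * K > 0" using p_gt_2 sobolev_const_pos by simp
  moreover have "young_threshold CARD('n) (2 / p * K) \<le> a powr ((real CARD('n) - 4) / 2) * (b / 2)"
    using L by (simp add: L_const_eq[OF d sobolev_const_pos] p_def[symmetric])
  ultimately have "2 / p * K * ?s powr (2 / (real CARD('n) - 2)) \<le> a + b / 2 * ?s"
    using young_ge[OF d ab(1), of "b / 2" "2 / p * K" ?s] ab(2) by simp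
  then have "?s / 2 * (a + b / 2 * ?s - 2 / p * K * ?s powr (2 / (real CARD('n) - 2))) \<ge> 0"
    by (intro mult_nonneg_nonneg) auto
  with energy_lower_bound[OF u, of a b] show ?thesis by linarith
qed

text \<open>For d > 4 the quartic term has higher order than the critical one; for d = 4 the orders
  agree and the coefficients are compared. Sequences of bounded energy are therefore bounded in
  norm.\<close>

lemma energy_coercive:
  assumes d: "CARD('n) \<ge> 4" and ab: "a > 0" "b > 0" and 4: "CARD('n) = 4 \<longrightarrow> 2 / p * K \<le> b / 2"
  obtains R where "\<And>u. u \<in> H01 \<Omega> \<Longrightarrow> (H01_norm \<Omega> u)\<^sup>2 \<le> max R (2 / a * energy \<Omega> a b u)"
proof -
  obtain R where R: "R \<ge> 0" "\<And>s. s \<ge> R \<Longrightarrow> 2 / p * K * s powr (2 / (real CARD('n) - 2)) \<le> b / 2 * s"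
    using power_eventually_dominated[OF d, of "b / 2" "2 / p * K"] ab 4 by auto
  have "(H01_norm \<Omega> u)\<^sup>2 \<le> max R (2 / a * energy \<Omega> a b u)" if u: "u \<in> H01 \<Omega>" for u
  proof (cases "(H01_norm \<Omega> u)\<^sup>2 \<ge> R")
    case True
    let ?s = "(H01_norm \<Omega> u)\<^sup>2"
    have "?s / 2 * a \<le> ?s / 2 * (a + b / 2 * ?s - 2 / p * K * ?s powr (2 / (real CARD('n) - 2)))"
      using R(2)[OF True] by (intro mult_left_mono) auto
    also have "\<dots> \<le> energy \<Omega> a b u" by (rule energy_lower_bound[OF u])
    finally have "?s \<le> 2 / a * energy \<Omega> a b u" using ab by (simp add: field_simps)
    then show ?thesis by simp
  qed auto
  then show thesis by (rule that)
qed

lemma \<Phi>_bounded: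
  assumes "u \<in> H01 \<Omega>" "H01_norm \<Omega> u \<le> R"
  shows "\<Phi> u \<le> K * R powr p"
proof -
  have "\<Phi> u \<le> K * H01_norm \<Omega> u powr p" unfolding \<Phi>_def by (rule sobolev_inequality[OF assms(1)])
  also have "\<dots> \<le> K * R powr p"
    using assms(2) p_gt_2 H01_norm_nonneg[OF open_\<Omega>, of u] by (intro mult_left_mono powr_mono2) auto
  finally show ?thesis .
qed

lemma brezis_lieb_subsequence:
  assumes V: "\<And>n. V n \<in> H01 \<Omega>" and R: "\<And>n. H01_norm \<Omega> (V n) \<le> R" and u: "u \<in> H01 \<Omega>"
    and L2: "(\<lambda>n. L2_norm M (\<lambda>x. V n x - u x)) \<longlonglongrightarrow> 0"
  obtains r where "strict_mono (r :: nat \<Rightarrow> nat)" "AE x in M. (\<lambda>n. V (r n) x) \<longlonglongrightarrow> u x"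
    "(\<lambda>n. \<Phi> (V (r n)) - \<Phi> (\<lambda>x. V (r n) x - u x)) \<longlonglongrightarrow> \<Phi> u"
proof -
  have "\<exists>r::nat\<Rightarrow>nat. strict_mono r \<and> (AE x in M. (\<lambda>n. V (r n) x) \<longlonglongrightarrow> u x)"
    by (rule L2_tendsto_AE_subseq[OF H01_L2[OF open_\<Omega> V] H01_L2[OF open_\<Omega> u] L2])
  then obtain r :: "nat \<Rightarrow> nat" where r: "strict_mono r" "AE x in M. (\<lambda>n. V (r n) x) \<longlonglongrightarrow> u x" by blast
  have w: "(\<lambda>x. V n x - u x) \<in> H01 \<Omega>" for n by (intro H01_diff open_\<Omega> V u)
  have wR: "H01_norm \<Omega> (\<lambda>x. V n x - u x) \<le> R + H01_norm \<Omega> u" for n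
    using H01_norm_triangle_diff[OF open_\<Omega> V[of n] u] R[of n] by linarith
  have "(\<lambda>n. \<Phi> (V (r n)) - \<Phi> (\<lambda>x. V (r n) x - u x)) \<longlonglongrightarrow> \<Phi> u"
    unfolding \<Phi>_def
    by (rule brezis_lieb[OF _ H01_measurable[OF V] H01_measurable[OF u] H01_powr_integrable[OF w]
          H01_powr_integrable[OF u] H01_powr_integrable[OF V] \<Phi>_bounded[OF w wR, unfolded \<Phi>_def] r(2)])
      (use p_gt_2 in simp)
  with r that show thesis by blast
qed

text \<open>Argued by contradiction: a subsequence with energies at most c < E(u) is bounded by
  coercivity, and this bound turns weak convergence into L2 convergence and admits the Brezis-Lieb
  lemma.\<close>

theorem energy_weakly_lsc:
  assumes d: "CARD('n) \<ge> 4" and ab: "a > 0" "b > 0"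
    and L: "L_const CARD('n) (sobolev_const \<Omega>) \<le> a powr ((real CARD('n) - 4) / 2) * b"
  shows "seq_weakly_lsc \<Omega> (energy \<Omega> a b)"
  unfolding seq_weakly_lsc_def
proof (intro allI impI)
  let ?E = "energy \<Omega> a b"
  fix U u assume weak: "weakly_converges \<Omega> U u"
  then have U: "U n \<in> H01 \<Omega>" and u: "u \<in> H01 \<Omega>" for n by (auto simp: weakly_converges_def)
  have "CARD('n) = 4 \<longrightarrow> 2 / p * K \<le> b / 2"
    using L ab by (auto simp: L_const_eq[OF d sobolev_const_pos] p_def[symmetric] young_threshold_def)
  then obtain R where R: "\<And>u. u \<in> H01 \<Omega> \<Longrightarrow> (H01_norm \<Omega> u)\<^sup>2 \<le> max R (2 / a * ?E u)"
    using energy_coercive[OF d ab] by blast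
  show "ereal (?E u) \<le> liminf (\<lambda>n. ereal (?E (U n)))"
    unfolding le_Liminf_iff
  proof (intro allI impI, rule ccontr)
    fix y assume y: "y < ereal (?E u)" and "\<not> (\<forall>\<^sub>F n in sequentially. y < ereal (?E (U n)))"
    then obtain r where r: "strict_mono (r :: nat \<Rightarrow> nat)" "\<And>n. \<not> y < ereal (?E (U (r n)))"
      using not_eventually_sequentiallyD by blast
    obtain c where c: "y = ereal c" using y r(2)[of 0] by (cases y) auto
    have cE: "c < ?E u" using y c by simp
    have Er: "?E (U (r n)) \<le> c" for n using r(2)[of n] c by simp
    define B where "B = sqrt (max (max R (2 / a * c)) 0)"
    have B: "H01_norm \<Omega> (U (r n)) \<le> B" for n
    proof -
      have "2 / a * ?E (U (r n)) \<le> 2 / a * c" using Er[of n] ab by (intro mult_left_mono) auto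
      then have "(H01_norm \<Omega> (U (r n)))\<^sup>2 \<le> max (max R (2 / a * c)) 0" using R[OF U[of "r n"]] by linarith
      then show ?thesis unfolding B_def by (rule real_le_rsqrt)
    qed
    have weak': "weakly_converges \<Omega> (\<lambda>n. U (r n)) u"
      using weak LIMSEQ_subseq_LIMSEQ[OF _ r(1)] by (auto simp: weakly_converges_def o_def)
    obtain r' where r': "strict_mono (r' :: nat \<Rightarrow> nat)"
      "(\<lambda>n. \<Phi> (U (r (r' n))) - \<Phi> (\<lambda>x. U (r (r' n)) x - u x)) \<longlonglongrightarrow> \<Phi> u"
      by (rule brezis_lieb_subsequence[OF U B u weakly_converges_imp_L2[OF weak' B]]) blast
    define V where "V n = U (r (r' n))" for n
    define w where "w n x = V n x - u x" for n x
    have V: "V n \<in> H01 \<Omega>" for n by (simp add: V_def U)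
    have w: "w n \<in> H01 \<Omega>" for n unfolding w_def[abs_def] by (intro H01_diff open_\<Omega> V u)
    define A where "A n = (H01_norm \<Omega> (w n))\<^sup>2" for n
    define G where "G = (H01_norm \<Omega> u)\<^sup>2"
    define \<delta> where "\<delta> n = ip \<Omega> (w n) u" for n
    have \<delta>: "\<delta> \<longlonglongrightarrow> 0"
    proof -
      have "(\<lambda>n. ip \<Omega> (U (r n)) u) \<longlonglongrightarrow> ip \<Omega> u u"
        using bspec[OF conjunct2[OF conjunct2[OF weak'[unfolded weakly_converges_def]]] ip_dual[OF u]] by simp
      then have "(\<lambda>n. ip \<Omega> (V n) u - ip \<Omega> u u) \<longlonglongrightarrow> 0"
        using LIMSEQ_subseq_LIMSEQ[OF _ r'(1)] by (simp add: V_def o_def LIM_zero_iff)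
      moreover have "\<delta> = (\<lambda>n. ip \<Omega> (V n) u - ip \<Omega> u u)"
        unfolding \<delta>_def w_def[abs_def] by (rule ext) (rule ip_diff_left[OF open_\<Omega> V u u])
      ultimately show ?thesis by simp
    qed
    have A: "0 \<le> A n" "A n \<le> (B + H01_norm \<Omega> u)\<^sup>2" for n
    proof -
      have "H01_norm \<Omega> (w n) \<le> B + H01_norm \<Omega> u"
        unfolding w_def[abs_def] using H01_norm_triangle_diff[OF open_\<Omega> V[of n] u] B[of "r' n"]
        by (simp add: V_def)
      then show "0 \<le> A n" "A n \<le> (B + H01_norm \<Omega> u)\<^sup>2"
        unfolding A_def by (auto intro!: power_mono H01_norm_nonneg[OF open_\<Omega>])
    qed
    \<comment> \<open>A n is only known to be bounded; the product vanishes through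
      \<delta>.\<close>
    have A\<delta>: "(\<lambda>n. A n * \<delta> n) \<longlonglongrightarrow> 0"
    proof (rule Lim_null_comparison[OF _ tendsto_mult_right_zero[OF tendsto_rabs_zero[OF \<delta>], of "(B + H01_norm \<Omega> u)\<^sup>2"]])
      have "norm (A n * \<delta> n) \<le> (B + H01_norm \<Omega> u)\<^sup>2 * \<bar>\<delta> n\<bar>" for n
        using A[of n] by (simp add: abs_mult mult_right_mono)
      then show "\<forall>\<^sub>F n in sequentially. norm (A n * \<delta> n) \<le> (B + H01_norm \<Omega> u)\<^sup>2 * \<bar>\<delta> n\<bar>" by simp
    qed
    \<comment> \<open>Everything that vanishes in the expansion of E(u + w n): all terms containing
      the inner product \<delta>, and the Brezis-Lieb defect.\<close>
    define \<tau> where "\<tau> n = a * \<delta> n + b * (A n * \<delta> n) + b * G * \<delta> n + b * (\<delta> n)\<^sup>2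
      - 1 / p * (\<Phi> (V n) - \<Phi> (w n) - \<Phi> u)" for n
    have "\<tau> \<longlonglongrightarrow> a * 0 + b * 0 + b * G * 0 + b * 0\<^sup>2 - 1 / p * (\<Phi> u - \<Phi> u)"
      unfolding \<tau>_def using r'(2) by (intro tendsto_intros \<delta> A\<delta>) (simp add: V_def w_def[abs_def])
    then have \<tau>0: "\<tau> \<longlonglongrightarrow> 0" by simp
    have split: "?E (V n) \<ge> ?E u + \<tau> n" for n
    proof -
      have VA: "(H01_norm \<Omega> (V n))\<^sup>2 = A n + 2 * \<delta> n + G"
        using H01_norm_power2_add[OF open_\<Omega> w[of n] u] by (simp add: A_def \<delta>_def G_def w_def)
      have p4: "H01_norm \<Omega> z ^ 4 = ((H01_norm \<Omega> z)\<^sup>2)\<^sup>2" for z by (simp flip: power_mult)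
      \<comment> \<open>The last term is the coupling of w n and u in the fourth power of the norm;
        it may survive the limit, but with a favourable sign.\<close>
      have "?E (V n) = ?E u + ?E (w n) + \<tau> n + b / 2 * (A n * G)"
        unfolding energy_eq \<Phi>_def[symmetric] p4 VA A_def[symmetric] G_def[symmetric] \<tau>_def
        by (simp add: power2_eq_square algebra_simps diff_divide_distrib add_divide_distrib)
      moreover have "?E (w n) \<ge> 0" by (rule energy_nonneg[OF d ab L w])
      moreover have "b / 2 * (A n * G) \<ge> 0" using ab A by (simp add: G_def)
      ultimately show ?thesis by linarith
    qed
    have "?E u + \<tau> n \<le> c" for n using split[of n] Er[of "r' n"] by (simp add: V_def)
    then have "?E u + 0 \<le> c"
      by (intro LIMSEQ_le_const2[OF tendsto_add[OF tendsto_const \<tau>0]]) auto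
    with cE show False by simp
  qed
qed

section \<open>Failure of lower semicontinuity below the threshold\<close>

text \<open>By Bessel's inequality the values of a bounded functional on \<open>\<psi>\<close> are square summable.\<close>

lemma orthogonal_bounded_weakly_null:
  assumes \<psi>: "\<And>n. \<psi> n \<in> H01 \<Omega>" and orth: "\<And>m n. m \<noteq> n \<Longrightarrow> ip \<Omega> (\<psi> m) (\<psi> n) = 0"
    and s: "\<And>n. H01_norm \<Omega> (\<psi> n) \<le> s"
  shows "weakly_converges \<Omega> \<psi> (\<lambda>_. 0)"
  unfolding weakly_converges_def
proof (intro conjI allI ballI \<psi> H01_zero[OF open_\<Omega>])
  fix f assume f: "f \<in> H01_dual \<Omega>"
  then have f_add: "f (\<lambda>x. u x + v x) = f u + f v" if "u \<in> H01 \<Omega>" "v \<in> H01 \<Omega>" for u v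
    using that by (simp add: H01_dual_def)
  have f_cmult: "f (\<lambda>x. c * u x) = c * f u" if "u \<in> H01 \<Omega>" for u c
    using f that by (simp add: H01_dual_def)
  have "\<exists>C. \<forall>u\<in>H01 \<Omega>. \<bar>f u\<bar> \<le> C * H01_norm \<Omega> u" using f by (simp add: H01_dual_def)
  then obtain C where C: "\<And>u. u \<in> H01 \<Omega> \<Longrightarrow> \<bar>f u\<bar> \<le> C * H01_norm \<Omega> u" by blast
  define c where "c n = f (\<psi> n)" for n
  \<comment> \<open>With the values of f as coefficients, f (v N) is the sum T of the squares of the
    c n, while the squared norm of v N is at most s^2 T. Hence T <= |C| |s| sqrt T, which bounds T
    independently of N.\<close>
  define v where "v N x = (\<Sum>n<N. c n * \<psi> n x)" for N x
  have v: "v N \<in> H01 \<Omega>" for N unfolding v_def[abs_def] by (intro H01_sum[OF open_\<Omega>] \<psi>) simp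
  have v0: "v 0 = (\<lambda>_. 0)" and vS: "v (Suc N) = (\<lambda>x. v N x + c N * \<psi> N x)" for N by (auto simp: v_def)
  have fv: "f (v N) = (\<Sum>n<N. (c n)\<^sup>2)" for N
  proof (induction N)
    case 0
    show ?case using f_cmult[OF H01_zero[OF open_\<Omega>], of 0] by (simp add: v0)
  next
    case (Suc N)
    then show ?case
      by (simp add: vS f_add v H01_cmult[OF open_\<Omega>] \<psi> f_cmult c_def[symmetric] power2_eq_square)
  qed
  have ipv: "ip \<Omega> (v N) (\<psi> m) = 0" if "N \<le> m" for N m
    using that
  proof (induction N)
    case 0
    show ?case using ip_cmult_left[OF open_\<Omega> H01_zero[OF open_\<Omega>] \<psi>[of m], of 0] by (simp add: v0)
  next
    case (Suc N)
    then show ?case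
      using orth[of N m] by (simp add: vS ip_add_left[OF open_\<Omega>] v H01_cmult[OF open_\<Omega>] \<psi> ip_cmult_left[OF open_\<Omega>])
  qed
  have nv: "(H01_norm \<Omega> (v N))\<^sup>2 \<le> s\<^sup>2 * (\<Sum>n<N. (c n)\<^sup>2)" for N
  proof (induction N)
    case 0
    show ?case using H01_norm_cmult[OF open_\<Omega> H01_zero[OF open_\<Omega>], of 0] by (simp add: v0)
  next
    case (Suc N)
    have "(H01_norm \<Omega> (v (Suc N)))\<^sup>2 = (H01_norm \<Omega> (v N))\<^sup>2 + (c N)\<^sup>2 * (H01_norm \<Omega> (\<psi> N))\<^sup>2"
      unfolding vS
      by (subst H01_norm_power2_add[OF open_\<Omega> v H01_cmult[OF open_\<Omega> \<psi>]])
        (simp add: ip_cmult_right[OF open_\<Omega> \<psi> v] ipv H01_norm_cmult[OF open_\<Omega> \<psi>] power_mult_distrib)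
    also have "\<dots> \<le> s\<^sup>2 * (\<Sum>n<N. (c n)\<^sup>2) + (c N)\<^sup>2 * s\<^sup>2"
      using s H01_norm_nonneg[OF open_\<Omega>] by (intro add_mono Suc.IH mult_left_mono power_mono) auto
    finally show ?case by (simp add: algebra_simps)
  qed
  have bound: "(\<Sum>n<N. (c n)\<^sup>2) \<le> (\<bar>C\<bar> * \<bar>s\<bar>)\<^sup>2" for N
  proof -
    let ?T = "\<Sum>n<N. (c n)\<^sup>2"
    have T0: "?T \<ge> 0" by (simp add: sum_nonneg)
    have "?T \<le> C * H01_norm \<Omega> (v N)" using C[OF v[of N]] by (simp add: fv)
    also have "\<dots> \<le> \<bar>C\<bar> * H01_norm \<Omega> (v N)"
      by (intro mult_right_mono H01_norm_nonneg[OF open_\<Omega>]) simp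
    finally have "?T\<^sup>2 \<le> (\<bar>C\<bar> * H01_norm \<Omega> (v N))\<^sup>2" using T0 by (intro power_mono)
    also have "\<dots> \<le> \<bar>C\<bar>\<^sup>2 * (s\<^sup>2 * ?T)" using nv[of N] by (simp add: power_mult_distrib mult_left_mono)
    finally have "?T * ?T \<le> (\<bar>C\<bar> * \<bar>s\<bar>)\<^sup>2 * ?T" by (simp add: power2_eq_square[of ?T] power_mult_distrib mult.assoc)
    then show ?thesis using T0 by (cases "?T = 0") auto
  qed
  have "summable (\<lambda>n. (c n)\<^sup>2)"
    by (rule bounded_imp_summable[OF _ bound[of "Suc _", unfolded lessThan_Suc_atMost]]) simp
  then have "(\<lambda>n. (c n)\<^sup>2) \<longlonglongrightarrow> 0" by (rule summable_LIMSEQ_zero)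
  from tendsto_real_sqrt[OF this] have "c \<longlonglongrightarrow> 0" by (simp add: tendsto_rabs_zero_iff)
  moreover have "f (\<lambda>_. 0) = 0" using f_cmult[OF H01_zero[OF open_\<Omega>], of 0] by simp
  ultimately show "(\<lambda>n. f (\<psi> n)) \<longlonglongrightarrow> f (\<lambda>_. 0)" by (simp add: c_def[abs_def])
qed

text \<open>Copies of \<open>\<psi>\<close> concentrated in disjoint annuli shrinking to a point of \<open>\<Omega>\<close>; the scaling is
  the one that leaves both norms invariant.\<close>

lemma rescaled_copies:
  assumes \<psi>: "\<psi> \<in> test_functions \<Omega>"
  obtains \<Psi> where "\<And>n::nat. \<Psi> n \<in> test_functions \<Omega>" "\<And>n. H01_norm \<Omega> (\<Psi> n) = H01_norm \<Omega> \<psi>"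
    "\<And>n. \<Phi> (\<Psi> n) = \<Phi> \<psi>" "\<And>m n. m \<noteq> n \<Longrightarrow> ip \<Omega> (\<Psi> m) (\<Psi> n) = 0"
proof -
  define d where "d = real CARD('n)"
  obtain Ks where Ks: "compact Ks" "\<And>x. x \<notin> Ks \<Longrightarrow> \<psi> x = 0"
    using \<psi> by (rule test_functionE) blast
  obtain R0 where R0: "\<And>y. y \<in> Ks \<Longrightarrow> norm y \<le> R0"
    using compact_imp_bounded[OF Ks(1)] bounded_iff by metis
  define R where "R = \<bar>R0\<bar> + 1"
  have R: "R > 0" "\<And>y. y \<in> Ks \<Longrightarrow> norm y \<le> R" using R0 by (force simp: R_def)+
  obtain x0 where x0: "x0 \<in> \<Omega>" using nonempty_\<Omega> by blast
  obtain \<rho> where \<rho>: "\<rho> > 0" "ball x0 \<rho> \<subseteq> \<Omega>" using open_\<Omega> x0 openE by metis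
  define e :: "real ^ 'n" where "e = axis undefined 1"
  have e: "norm e = 1" by (simp add: e_def)
  define \<delta> where "\<delta> n = \<rho> * (1/2) ^ n" for n :: nat
  have \<delta>: "\<delta> n > 0" "\<delta> n \<le> \<rho>" for n
    using \<rho>(1) by (auto simp: \<delta>_def mult_left_le power_le_one)
  have \<delta>_less: "\<delta> n \<le> \<delta> m / 2" if "m < n" for m n
  proof -
    have "(1/2 :: real) ^ n \<le> (1/2) ^ Suc m" using that by (intro power_decreasing) auto
    then show ?thesis using \<rho>(1) by (simp add: \<delta>_def)
  qed
  \<comment> \<open>The copy is centred at distance \<delta>/2 from x0, and the scale l =
    8R/\<delta> shrinks a support inside radius R to radius \<delta>/8, so it lies between distances
    3/8 \<delta> and 5/8 \<delta> from x0. Halving \<delta> at each step separates the annuli, since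
    5/16 < 3/8.\<close>
  define c where "c n = x0 + (\<delta> n / 2) *\<^sub>R e" for n
  define l where "l n = 8 * R / \<delta> n" for n
  have l: "l n > 0" for n using R \<delta> by (simp add: l_def)
  define v where "v n = - (l n *\<^sub>R c n)" for n
  \<comment> \<open>The amplitude for which (g l)^2 and g^p both equal l^d, the Jacobian of the
    dilation.\<close>
  define g where "g n = l n powr ((d - 2) / 2)" for n
  define \<Psi> where "\<Psi> n x = g n * \<psi> (l n *\<^sub>R x + v n)" for n x
  define A where "A n = {x. 3 / 8 * \<delta> n \<le> norm (x - x0) \<and> norm (x - x0) \<le> 5 / 8 * \<delta> n}" for n
  have clA: "closed (A n)" for n
    unfolding A_def by (intro closed_Collect_conj closed_Collect_le continuous_intros)
  have A_ball: "A n \<subseteq> ball x0 \<rho>" for n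
    using \<delta>[of n] by (auto simp: A_def dist_norm norm_minus_commute)
  have coA: "compact (A n)" for n
    using clA[of n] bounded_subset[OF bounded_ball A_ball[of n]] by (simp add: compact_eq_bounded_closed)
  have off: "\<Psi> n x = 0" if "x \<notin> A n" for n x
  proof (rule ccontr)
    assume "\<Psi> n x \<noteq> 0"
    then have "l n *\<^sub>R x + v n \<in> Ks" using Ks(2) by (auto simp: \<Psi>_def)
    then have "norm (l n *\<^sub>R x + v n) \<le> R" by (rule R(2))
    moreover have "l n *\<^sub>R x + v n = l n *\<^sub>R (x - c n)" by (simp add: v_def scaleR_right_diff_distrib)
    ultimately have "l n * norm (x - c n) \<le> R" using l[of n] by simp
    then have 1: "norm (x - c n) \<le> \<delta> n / 8" using R \<delta>[of n] by (simp add: l_def field_simps)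
    have 2: "norm (c n - x0) = \<delta> n / 2" using \<delta>(1)[of n] e by (simp add: c_def)
    have "norm (x - x0) \<le> norm (x - c n) + norm (c n - x0)"
      using norm_triangle_ineq[of "x - c n" "c n - x0"] by simp
    moreover have "norm (c n - x0) \<le> norm (x - c n) + norm (x - x0)"
      using norm_triangle_ineq[of "c n - x" "x - x0"] by (simp add: norm_minus_commute)
    ultimately show False using that 1 2 by (simp add: A_def)
  qed
  have s\<Psi>: "smooth (\<Psi> n)" for n
    unfolding \<Psi>_def[abs_def] by (intro smooth_cmult smooth_affine test_function_smooth[OF \<psi>])
  have t\<Psi>: "\<Psi> n \<in> test_functions \<Omega>" for n
    by (rule test_functionI[OF s\<Psi> coA[of n]]) (use A_ball[of n] \<rho>(2) off in auto)
  have grad: "gradient (\<Psi> n) x = (g n * l n) *\<^sub>R gradient \<psi> (l n *\<^sub>R x + v n)" for n x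
    unfolding \<Psi>_def
    using smooth_differentiable[OF test_function_smooth[OF \<psi>]]
    by (subst gradient_cmult) (auto intro: differentiable_affine simp: gradient_affine)
  have pow: "l n powr d = l n ^ CARD('n)" for n using l by (simp add: d_def powr_realpow)
  have gl: "(g n * l n)\<^sup>2 = l n ^ CARD('n)" for n
  proof -
    have "g n * l n = l n powr (d / 2)"
      using l[of n] powr_add[of "l n" "(d - 2) / 2" 1] by (simp add: g_def diff_divide_distrib)
    then have "(g n * l n)\<^sup>2 = l n powr d" by (simp add: power2_eq_square flip: powr_add)
    then show ?thesis by (simp add: pow)
  qed
  have gp: "g n powr p = l n ^ CARD('n)" for n
  proof -
    have "(d - 2) / 2 * p = d" using d3 by (simp add: p_def crit_exp_def d_def)
    then have "g n powr p = l n powr d" by (simp only: g_def powr_powr)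
    then show ?thesis by (simp add: pow)
  qed
  note b\<psi> = test_function_borel[OF \<psi>] gradient_borel[OF \<psi>]
  have n1: "H01_norm \<Omega> (\<Psi> n) = H01_norm \<Omega> \<psi>" for n
  proof -
    have nn: "(norm ((g n * l n) *\<^sub>R y))\<^sup>2 = l n ^ CARD('n) * (norm y)\<^sup>2" for y :: "real ^ 'n"
      by (simp only: norm_scaleR power_mult_distrib[of "\<bar>g n * l n\<bar>"] power2_abs gl)
    have "(LINT x|lborel. (norm (gradient (\<Psi> n) x))\<^sup>2)
        = (LINT x|lborel. l n ^ CARD('n) * (norm (gradient \<psi> (l n *\<^sub>R x + v n)))\<^sup>2)"
      unfolding grad nn ..
    also have "\<dots> = (LINT x|lborel. (norm (gradient \<psi> x))\<^sup>2)"
      using b\<psi> lborel_integral_affine[of "\<lambda>x. (norm (gradient \<psi> x))\<^sup>2" "l n" "v n"] l[of n] by simp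
    finally show ?thesis by (simp add: H01_norm_test[OF open_\<Omega>] t\<Psi> \<psi> L2_norm_def)
  qed
  have n2: "\<Phi> (\<Psi> n) = \<Phi> \<psi>" for n
  proof -
    have "(LINT x|lborel. \<bar>\<Psi> n x\<bar> powr p)
        = (LINT x|lborel. l n ^ CARD('n) * \<bar>\<psi> (l n *\<^sub>R x + v n)\<bar> powr p)"
      by (simp add: \<Psi>_def abs_mult powr_mult gp[symmetric]) (simp add: g_def)
    also have "\<dots> = (LINT x|lborel. \<bar>\<psi> x\<bar> powr p)"
      using b\<psi> lborel_integral_affine[of "\<lambda>x. \<bar>\<psi> x\<bar> powr p" "l n" "v n"] l[of n] by simp
    finally show ?thesis by (simp add: \<Phi>_def test_powr_integral t\<Psi> \<psi>)
  qed
  have disj: "A m \<inter> A n = {}" if "m < n" for m n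
    using \<delta>_less[OF that] \<delta>(1)[of m] \<delta>(1)[of n] by (auto simp: A_def)
  then have disj': "A m \<inter> A n = {}" if "m \<noteq> n" for m n
    using that by (metis Int_commute linorder_neqE_nat)
  have "ip \<Omega> (\<Psi> m) (\<Psi> n) = 0" if "m \<noteq> n" for m n
  proof -
    have z: "gradient (\<Psi> k) x = 0" if "x \<notin> A k" for k x
      using gradient_eq_0_outside[OF clA off that] .
    have "gradient (\<Psi> m) x \<bullet> gradient (\<Psi> n) x = 0" for x
    proof -
      have "x \<notin> A m \<or> x \<notin> A n" using disj'[OF that] by auto
      then show ?thesis using z[of x m] z[of x n] by auto
    qed
    then show ?thesis
      using ip_eq[OF open_\<Omega> H01_gradient_test[OF open_\<Omega> t\<Psi>] H01_gradient_test[OF open_\<Omega> t\<Psi>]] by simp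
  qed
  with t\<Psi> n1 n2 that show thesis by blast
qed

text \<open>Strict failure of the scalar inequality leaves room to replace K by a smaller k, and
  hence a possibly unattained infimum by an actual test function.\<close>

theorem energy_not_weakly_lsc:
  assumes d: "CARD('n) \<ge> 4" and ab: "a > 0" "b > 0"
    and L: "a powr ((real CARD('n) - 4) / 2) * b < L_const CARD('n) (sobolev_const \<Omega>)"
  shows "\<not> seq_weakly_lsc \<Omega> (energy \<Omega> a b)"
proof
  assume lsc: "seq_weakly_lsc \<Omega> (energy \<Omega> a b)"
  let ?\<theta> = "2 / (real CARD('n) - 2)"
  have "2 / p * K > 0" using p_gt_2 sobolev_const_pos by simp
  moreover have "a powr ((real CARD('n) - 4) / 2) * (b / 2) < young_threshold CARD('n) (2 / p * K)"
    using L by (simp add: L_const_eq[OF d sobolev_const_pos] p_def[symmetric])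
  ultimately obtain s where s: "s > 0" "a + b / 2 * s < 2 / p * K * s powr ?\<theta>"
    using young_lt[OF d ab(1), of "b / 2" "2 / p * K"] ab(2) by auto
  \<comment> \<open>The constant for which the scalar inequality becomes an equality at s. It lies
    below K, so some test function has a Sobolev ratio above k.\<close>
  define k where "k = (a + b / 2 * s) / (2 / p * s powr ?\<theta>)"
  have q: "2 / p * s powr ?\<theta> > 0" using s p_gt_2 by simp
  have kK: "k < K" using s(2) q unfolding k_def by (subst pos_divide_less_eq) (simp_all add: mult_ac)
  have k: "a + b / 2 * s = 2 / p * k * s powr ?\<theta>" using q s p_gt_2 by (simp add: k_def)
  obtain \<phi> where \<phi>: "\<phi> \<in> test_functions \<Omega>" "H01_norm \<Omega> \<phi> > 0" "\<Phi> \<phi> > k * H01_norm \<Omega> \<phi> powr p"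
    using near_optimal_test_function[OF kK] unfolding \<Phi>_def by blast
  \<comment> \<open>Scales \<phi> to squared norm s; the ratio in the Sobolev inequality is
    invariant under scaling.\<close>
  define c where "c = sqrt s / H01_norm \<Omega> \<phi>"
  have c: "c > 0" using s \<phi> by (simp add: c_def)
  define \<psi> where "\<psi> x = c * \<phi> x" for x
  have \<psi>: "\<psi> \<in> test_functions \<Omega>" unfolding \<psi>_def[abs_def] by (rule test_function_cmult[OF \<phi>(1)])
  have "H01_norm \<Omega> \<psi> = \<bar>c\<bar> * H01_norm \<Omega> \<phi>"
    unfolding \<psi>_def[abs_def] by (rule H01_norm_cmult[OF open_\<Omega> H01_test[OF open_\<Omega> \<phi>(1)]])
  also have "\<dots> = c * H01_norm \<Omega> \<phi>" using c by simp
  also have "\<dots> = sqrt s" using \<phi>(2) by (simp add: c_def)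
  finally have n\<psi>: "(H01_norm \<Omega> \<psi>)\<^sup>2 = s" using s by simp
  have \<Phi>\<psi>: "\<Phi> \<psi> > k * (s * s powr ?\<theta>)"
  proof -
    have "k * (s * s powr ?\<theta>) = k * H01_norm \<Omega> \<psi> powr p" by (simp add: norm_p_split n\<psi>)
    also have "\<dots> = c powr p * (k * H01_norm \<Omega> \<phi> powr p)"
      unfolding \<psi>_def[abs_def] using c
      by (simp add: H01_norm_cmult[OF open_\<Omega> H01_test[OF open_\<Omega> \<phi>(1)]] powr_mult)
    also have "\<dots> < c powr p * \<Phi> \<phi>" using \<phi>(3) c by (intro mult_strict_left_mono) auto
    also have "\<dots> = \<Phi> \<psi>" using c by (simp add: \<Phi>_def \<psi>_def abs_mult powr_mult)
    finally show ?thesis .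
  qed
  have E: "energy \<Omega> a b \<psi> < 0"
  proof -
    have p4: "H01_norm \<Omega> \<psi> ^ 4 = s\<^sup>2" unfolding n\<psi>[symmetric] by (simp flip: power_mult)
    have "energy \<Omega> a b \<psi> = s / 2 * (a + b / 2 * s) - 1 / p * \<Phi> \<psi>"
      unfolding energy_eq n\<psi> p4 \<Phi>_def[symmetric] by (simp add: power2_eq_square algebra_simps)
    also have "s / 2 * (a + b / 2 * s) = 1 / p * (k * (s * s powr ?\<theta>))" unfolding k by simp
    also have "\<dots> < 1 / p * \<Phi> \<psi>" using \<Phi>\<psi> p_gt_2 by (intro mult_strict_left_mono) auto
    finally show ?thesis by simp
  qed
  obtain \<Psi> where \<Psi>: "\<And>n::nat. \<Psi> n \<in> test_functions \<Omega>" "\<And>n. H01_norm \<Omega> (\<Psi> n) = H01_norm \<Omega> \<psi>"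
    "\<And>n. \<Phi> (\<Psi> n) = \<Phi> \<psi>" "\<And>m n. m \<noteq> n \<Longrightarrow> ip \<Omega> (\<Psi> m) (\<Psi> n) = 0"
    using rescaled_copies[OF \<psi>] by blast
  have "weakly_converges \<Omega> \<Psi> (\<lambda>_. 0)"
    by (rule orthogonal_bounded_weakly_null[OF H01_test[OF open_\<Omega> \<Psi>(1)] \<Psi>(4), where s = "H01_norm \<Omega> \<psi>"])
      (simp_all add: \<Psi>(2))
  then have "ereal (energy \<Omega> a b (\<lambda>_. 0)) \<le> liminf (\<lambda>n. ereal (energy \<Omega> a b (\<Psi> n)))"
    using lsc unfolding seq_weakly_lsc_def by blast
  moreover have "energy \<Omega> a b (\<Psi> n) = energy \<Omega> a b \<psi>" for n
    using \<Psi>(3)[of n] by (simp add: energy_eq \<Psi>(2) \<Phi>_def)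
  moreover have "H01_norm \<Omega> (\<lambda>_. 0) = 0"
    using H01_norm_cmult[OF open_\<Omega> H01_zero[OF open_\<Omega>], of 0] by simp
  then have "energy \<Omega> a b (\<lambda>_. 0) = 0" by (simp add: energy_eq)
  ultimately have "ereal 0 \<le> ereal (energy \<Omega> a b \<psi>)" by (simp add: Liminf_const)
  with E show False by simp
qed

end

section \<open>The Palais--Smale condition\<close>

text \<open>Midpoints take the place of general convex combinations, since the parallelogram law needs
  no others.\<close>

inductive_set midpoint_hull :: "('a \<Rightarrow> real) set \<Rightarrow> ('a \<Rightarrow> real) set" for T where
  base: "u \<in> T \<Longrightarrow> u \<in> midpoint_hull T"
| mid: "u \<in> midpoint_hull T \<Longrightarrow> v \<in> midpoint_hull T \<Longrightarrow> (\<lambda>x. 1/2 * (u x + v x)) \<in> midpoint_hull T"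

lemma midpoint_hull_mono: "u \<in> midpoint_hull S \<Longrightarrow> S \<subseteq> T \<Longrightarrow> u \<in> midpoint_hull T"
  by (induction rule: midpoint_hull.induct) (blast intro: midpoint_hull.base midpoint_hull.mid)+

lemma smooth_gradient_component: "smooth f \<Longrightarrow> smooth (\<lambda>x. gradient f x $ i)"
  unfolding smooth_def using Ck.simps(2) by blast

lemma test_function_gradient_component:
  assumes "\<phi> \<in> test_functions \<Omega>"
  shows "(\<lambda>x. gradient \<phi> x $ i) \<in> test_functions \<Omega>"
proof -
  obtain K where "compact K" "K \<subseteq> \<Omega>" "\<And>x. x \<notin> K \<Longrightarrow> gradient \<phi> x = 0"
    using assms by (rule test_functionE) blast
  then show ?thesis
    by (intro test_functionI[OF smooth_gradient_component[OF test_function_smooth[OF assms]]]) auto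
qed

context critical_domain
begin

text \<open>Moving the derivative onto \<phi> gives minus the integral of u times the Laplacian of
  \<phi>, so pairing with a test function is continuous in L2.\<close>

lemma ip_test_eq:
  assumes u: "u \<in> H01 \<Omega>" and \<phi>: "\<phi> \<in> test_functions \<Omega>"
  shows "ip \<Omega> u \<phi> = - (\<Sum>i\<in>UNIV. LINT x|M. u x * gradient (\<lambda>x. gradient \<phi> x $ i) x $ i)"
proof -
  let ?D = "weak_gradient \<Omega> u"
  note t = test_function_gradient_component[OF \<phi>]
  note w = H01_weak_gradient[OF open_\<Omega> u]
  have "ip \<Omega> u \<phi> = (LINT x|M. ?D x \<bullet> gradient \<phi> x)"
    by (rule ip_eq[OF open_\<Omega> H01_gradient_weak_gradient[OF open_\<Omega> u] H01_gradient_test[OF open_\<Omega> \<phi>]])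
  also have "\<dots> = (LINT x|M. (\<Sum>i\<in>UNIV. ?D x $ i * gradient \<phi> x $ i))"
    by (simp add: inner_vec_def)
  also have "\<dots> = (\<Sum>i\<in>UNIV. LINT x|M. ?D x $ i * gradient \<phi> x $ i)"
    by (intro Bochner_Integration.integral_sum has_weak_gradient_integrable(2)[OF open_\<Omega> w t])
  also have "\<dots> = (\<Sum>i\<in>UNIV. - (LINT x|M. u x * gradient (\<lambda>x. gradient \<phi> x $ i) x $ i))"
  proof (intro sum.cong refl)
    fix i
    have "\<forall>\<psi>\<in>test_functions \<Omega>. \<forall>j. (LINT x|M. u x * gradient \<psi> x $ j) = - (LINT x|M. ?D x $ j * \<psi> x)"
      using w by (simp add: has_weak_gradient_def)
    from this[rule_format, OF t, of i i]
    show "(LINT x|M. ?D x $ i * gradient \<phi> x $ i) = - (LINT x|M. u x * gradient (\<lambda>x. gradient \<phi> x $ i) x $ i)"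
      by simp
  qed
  finally show ?thesis by (simp add: sum_negf)
qed

text \<open>Elements of almost minimal norm in the midpoint hulls of the tails form a Cauchy sequence.\<close>

lemma bounded_L2_limit_in_H01:
  assumes u: "\<And>n. u n \<in> H01 \<Omega>" and R: "\<And>n. H01_norm \<Omega> (u n) \<le> R" and v: "L2 M v"
    and L: "(\<lambda>n. L2_norm M (\<lambda>x. u n x - v x)) \<longlonglongrightarrow> 0"
  shows "v \<in> H01 \<Omega>"
proof -
  define T where "T N = midpoint_hull (u ` {N..})" for N
  have T_H01: "z \<in> H01 \<Omega>" if "z \<in> T N" for z N
    using that unfolding T_def
  proof (induction rule: midpoint_hull.induct)
    case (mid y z)
    show ?case by (intro H01_cmult H01_add open_\<Omega> mid.IH)
  qed (auto intro: u)
  \<comment> \<open>L2 balls around v are convex, so elements of the hull of a tail are as close to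
    v as the tail itself.\<close>
  have T_L2: "L2_norm M (\<lambda>x. z x - v x) \<le> e"
    if "z \<in> T N" and e: "\<And>n. n \<ge> N \<Longrightarrow> L2_norm M (\<lambda>x. u n x - v x) \<le> e" for z N e
    using that(1) unfolding T_def
  proof (induction rule: midpoint_hull.induct)
    case (base z)
    then show ?case using e by auto
  next
    case (mid y z)
    have yz: "L2 M (\<lambda>x. y x - v x)" "L2 M (\<lambda>x. z x - v x)"
      using mid.hyps T_H01[of y N] T_H01[of z N]
      by (intro L2_diff H01_L2 open_\<Omega> v; simp add: T_def)+
    have "L2_norm M (\<lambda>x. 1/2 * (y x + z x) - v x)
        = L2_norm M (\<lambda>x. (1/2) *\<^sub>R ((y x - v x) + (z x - v x)))"
      by (intro arg_cong[where f="L2_norm M"] ext) (simp add: field_simps)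
    also have "\<dots> = 1/2 * L2_norm M (\<lambda>x. (y x - v x) + (z x - v x))"
      by (subst L2_norm_cmult) simp
    also have "\<dots> \<le> 1/2 * (L2_norm M (\<lambda>x. y x - v x) + L2_norm M (\<lambda>x. z x - v x))"
      by (intro mult_left_mono L2_norm_triangle yz) simp
    also have "\<dots> \<le> e" using mid.IH by simp
    finally show ?case .
  qed
  define Q where "Q N = (\<lambda>z. (H01_norm \<Omega> z)\<^sup>2) ` T N" for N
  \<comment> \<open>The infima increase as the tails shrink and stay below R^2, hence converge; this
    makes near minimisers from different tails comparable.\<close>
  define a where "a N = Inf (Q N)" for N
  have uT: "u N \<in> T N" for N unfolding T_def by (intro midpoint_hull.base) simp
  have bdd: "bdd_below (Q N)" for N by (intro bdd_belowI[of _ 0]) (auto simp: Q_def)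
  have ne: "Q N \<noteq> {}" for N using uT by (auto simp: Q_def)
  have a_le: "a N \<le> (H01_norm \<Omega> z)\<^sup>2" if "z \<in> T N" for z N
    unfolding a_def using that by (intro cInf_lower bdd) (auto simp: Q_def)
  have T_mono: "T n \<subseteq> T N" if "N \<le> n" for N n
  proof -
    have "u ` {n..} \<subseteq> u ` {N..}" using that by auto
    then show ?thesis unfolding T_def using midpoint_hull_mono by blast
  qed
  have a_mono: "a N \<le> a n" if "N \<le> n" for N n
    unfolding a_def using T_mono[OF that] by (intro cInf_superset_mono ne bdd) (auto simp: Q_def)
  have a_bdd: "a n \<le> R\<^sup>2" for n
    using a_le[OF uT[of n]] power_mono[OF R[of n] H01_norm_nonneg[OF open_\<Omega>], of 2] by linarith
  have "incseq a" using a_mono by (simp add: incseq_def)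
  from incseq_convergent[OF this, of "R\<^sup>2"] a_bdd obtain \<alpha> where \<alpha>: "a \<longlonglongrightarrow> \<alpha>" "\<And>i. a i \<le> \<alpha>" by metis
  have "\<exists>z\<in>T N. (H01_norm \<Omega> z)\<^sup>2 < a N + inverse (real (Suc N))" for N
  proof -
    have "a N < a N + inverse (real (Suc N))" by simp
    then show ?thesis unfolding a_def using cInf_lessD[OF ne] by (force simp: Q_def)
  qed
  then obtain z where z: "\<And>N. z N \<in> T N" "\<And>N. (H01_norm \<Omega> (z N))\<^sup>2 < a N + inverse (real (Suc N))"
    by metis
  note zH = T_H01[OF z(1)]
  have dist: "(H01_norm \<Omega> (\<lambda>x. z m x - z n x))\<^sup>2 \<le> 4 * (\<alpha> - a N + inverse (real (Suc N)))"
    if "m \<ge> N" "n \<ge> N" for m n N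
  proof -
    have zN: "z k \<in> T N \<and> (H01_norm \<Omega> (z k))\<^sup>2 \<le> \<alpha> + inverse (real (Suc N))" if "k \<ge> N" for k
    proof -
      have "inverse (real (Suc k)) \<le> inverse (real (Suc N))" using that by (intro le_imp_inverse_le) auto
      then have "(H01_norm \<Omega> (z k))\<^sup>2 \<le> \<alpha> + inverse (real (Suc N))"
        using z(2)[of k] \<alpha>(2)[of k] by linarith
      then show ?thesis using z(1)[of k] T_mono[OF that] by blast
    qed
    let ?s = "\<lambda>x. z m x + z n x"
    have "(\<lambda>x. 1/2 * ?s x) \<in> T N"
      using zN[OF that(1)] zN[OF that(2)] unfolding T_def by (intro midpoint_hull.mid) auto
    then have "a N \<le> (H01_norm \<Omega> (\<lambda>x. 1/2 * ?s x))\<^sup>2" by (rule a_le)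
    also have "\<dots> = 1/4 * (H01_norm \<Omega> ?s)\<^sup>2"
      by (subst H01_norm_cmult[OF open_\<Omega> H01_add[OF open_\<Omega> zH zH]]) (simp add: power2_eq_square)
    \<comment> \<open>Parallelogram law: the midpoint of z m and z n has squared norm at least a N,
      so their squared distance is at most twice the sum of the squared norms minus 4 a N.\<close>
    finally have "4 * a N \<le> (H01_norm \<Omega> (z m))\<^sup>2 + 2 * ip \<Omega> (z m) (z n) + (H01_norm \<Omega> (z n))\<^sup>2"
      by (simp add: H01_norm_power2_add[OF open_\<Omega> zH zH])
    then show ?thesis
      using zN[OF that(1)] zN[OF that(2)] by (simp add: H01_norm_power2_diff[OF open_\<Omega> zH zH])
  qed
  show ?thesis
  proof (rule H01_closed(1)[OF open_\<Omega> zH v])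
    show "(\<lambda>N. L2_norm M (\<lambda>x. z N x - v x)) \<longlonglongrightarrow> 0"
    proof (rule LIMSEQ_I)
      fix e :: real assume e: "e > 0"
      obtain N where N: "\<And>n. n \<ge> N \<Longrightarrow> norm (L2_norm M (\<lambda>x. u n x - v x) - 0) < e / 2"
        using LIMSEQ_D[OF L, of "e / 2"] e by auto
      have "norm (L2_norm M (\<lambda>x. z n x - v x) - 0) < e" if "n \<ge> N" for n
      proof -
        have "L2_norm M (\<lambda>x. z n x - v x) \<le> e / 2"
          by (rule T_L2[OF z(1)]) (use N that in \<open>fastforce intro: less_imp_le\<close>)
        then show ?thesis using e by simp
      qed
      then show "\<exists>no. \<forall>n\<ge>no. norm (L2_norm M (\<lambda>x. z n x - v x) - 0) < e" by blast
    qed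
    fix e :: real assume e: "e > 0"
    have "(\<lambda>N. 4 * (\<alpha> - a N + inverse (real (Suc N)))) \<longlonglongrightarrow> 4 * (\<alpha> - \<alpha> + 0)"
      by (intro tendsto_intros \<alpha>(1) LIMSEQ_inverse_real_of_nat)
    then have "\<forall>\<^sub>F N in sequentially. 4 * (\<alpha> - a N + inverse (real (Suc N))) < e\<^sup>2"
      using e by (intro order_tendstoD(2)) auto
    then obtain N where N: "4 * (\<alpha> - a N + inverse (real (Suc N))) < e\<^sup>2"
      by (auto simp: eventually_sequentially)
    have "H01_norm \<Omega> (\<lambda>x. z m x - z n x) < e" if "m \<ge> N" "n \<ge> N" for m n
      using dist[OF that] N e by (intro power2_less_imp_less[of _ e]) auto
    then show "\<exists>N. \<forall>m\<ge>N. \<forall>n\<ge>N. H01_norm \<Omega> (\<lambda>x. z m x - z n x) < e" by blast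
  qed
qed

text \<open>Against test functions L2 convergence is enough, by integration by parts; general v
  follow by density and the bound R.\<close>

lemma bounded_L2_limit_weakly:
  assumes w: "\<And>n. w n \<in> H01 \<Omega>" and R: "\<And>n. H01_norm \<Omega> (w n) \<le> R"
    and L: "(\<lambda>n. L2_norm M (w n)) \<longlonglongrightarrow> 0" and v: "v \<in> H01 \<Omega>"
  shows "(\<lambda>n. ip \<Omega> (w n) v) \<longlonglongrightarrow> 0"
proof (rule LIMSEQ_I)
  fix e :: real assume e: "e > 0"
  have R0: "R \<ge> 0" using R[of 0] H01_norm_nonneg[OF open_\<Omega>, of "w 0"] by linarith
  define \<eta> where "\<eta> = e / (2 * (R + 1))"
  have \<eta>: "\<eta> > 0" "R * \<eta> < e / 2" using e R0 by (auto simp: \<eta>_def field_simps)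
  obtain \<phi> where \<phi>: "\<phi> \<in> test_functions \<Omega>" "H01_norm \<Omega> (\<lambda>x. v x - \<phi> x) < \<eta>"
    by (rule H01_approx_within[OF open_\<Omega> v \<eta>(1)]) blast
  note \<phi>H = H01_test[OF open_\<Omega> \<phi>(1)]
  have "(\<lambda>n. ip \<Omega> (w n) \<phi>) \<longlonglongrightarrow> - (\<Sum>i\<in>(UNIV :: 'n set). 0)"
    unfolding ip_test_eq[OF w \<phi>(1)]
  proof (intro tendsto_minus tendsto_sum)
    fix i :: 'n
    let ?g = "\<lambda>x. gradient (\<lambda>x. gradient \<phi> x $ i) x $ i"
    have g: "L2 M ?g"
      by (intro L2_component gradient_L2 open_\<Omega> test_function_gradient_component \<phi>)
    have z: "L2 M (\<lambda>_. 0 :: real)" using H01_L2[OF open_\<Omega> H01_zero[OF open_\<Omega>]] .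
    show "(\<lambda>n. LINT x|M. w n x * ?g x) \<longlonglongrightarrow> 0"
      using L2_inner_tendsto[OF H01_L2[OF open_\<Omega> w] z g] L by simp
  qed
  then have "(\<lambda>n. ip \<Omega> (w n) \<phi>) \<longlonglongrightarrow> 0" by simp
  then have "\<forall>\<^sub>F n in sequentially. \<bar>ip \<Omega> (w n) \<phi>\<bar> < e / 2"
    using e by (intro order_tendstoD(2)[OF tendsto_rabs_zero]) auto
  then obtain N where N: "\<And>n. n \<ge> N \<Longrightarrow> \<bar>ip \<Omega> (w n) \<phi>\<bar> < e / 2"
    by (auto simp: eventually_sequentially)
  have "norm (ip \<Omega> (w n) v - 0) < e" if "n \<ge> N" for n
  proof -
    have "\<bar>ip \<Omega> (w n) (\<lambda>x. v x - \<phi> x)\<bar> \<le> H01_norm \<Omega> (w n) * H01_norm \<Omega> (\<lambda>x. v x - \<phi> x)"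
      by (intro ip_Cauchy_Schwarz open_\<Omega> w H01_diff v \<phi>H)
    also have "\<dots> \<le> R * \<eta>" using R[of n] \<phi>(2) R0 H01_norm_nonneg[OF open_\<Omega>] by (intro mult_mono) auto
    finally have "\<bar>ip \<Omega> (w n) v - ip \<Omega> (w n) \<phi>\<bar> \<le> R * \<eta>"
      by (simp only: ip_diff_right[OF open_\<Omega> v \<phi>H w])
    then have "\<bar>ip \<Omega> (w n) v\<bar> < e" using N[OF that] \<eta>(2) by linarith
    then show ?thesis by simp
  qed
  then show "\<exists>no. \<forall>n\<ge>no. norm (ip \<Omega> (w n) v - 0) < e" by blast
qed

text \<open>The Palais-Smale condition speaks of some Frechet derivative D. Along the line u + s z
  it is the ordinary derivative at s = 0, which is unique and can be computed term by term.\<close>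

lemma energy_derivative_eq:
  assumes D: "H01_has_derivative \<Omega> (energy \<Omega> a b) D u" and u: "u \<in> H01 \<Omega>" and z: "z \<in> H01 \<Omega>"
  shows "D z = (a + b * (H01_norm \<Omega> u)\<^sup>2) * ip \<Omega> u z - (LINT x|M. sgn_powr (p - 1) (u x) * z x)"
proof -
  let ?E = "energy \<Omega> a b"
  define r where "r = (H01_norm \<Omega> z)\<^sup>2"
  define q where "q s = (H01_norm \<Omega> u)\<^sup>2 + 2 * s * ip \<Omega> u z + s\<^sup>2 * r" for s
  have q: "(H01_norm \<Omega> (\<lambda>x. u x + s * z x))\<^sup>2 = q s" for s
    using H01_norm_power2_add[OF open_\<Omega> u H01_cmult[OF open_\<Omega> z]] z u
    by (simp add: q_def r_def ip_cmult_right[OF open_\<Omega>] H01_norm_cmult[OF open_\<Omega>] power_mult_distrib)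
  have q4: "(H01_norm \<Omega> (\<lambda>x. u x + s * z x)) ^ 4 = (q s)\<^sup>2" for s
    unfolding q[symmetric] by (simp flip: power_mult)
  define I where "I = (LINT x|M. sgn_powr (p - 1) (u x) * z x)"
  have E: "(\<lambda>s. ?E (\<lambda>x. u x + s * z x)) = (\<lambda>s. a / 2 * q s + b / 4 * (q s)\<^sup>2 - 1 / p * \<Phi> (\<lambda>x. u x + s * z x))"
    by (simp add: energy_eq q q4 \<Phi>_def)
  have dq: "(q has_real_derivative 2 * ip \<Omega> u z) (at 0)"
    unfolding q_def by (auto intro!: derivative_eq_intros)
  have d\<Phi>: "((\<lambda>s. \<Phi> (\<lambda>x. u x + s * z x)) has_real_derivative p * I) (at 0)"
    using \<Phi>_derivatives(1)[OF u z, of 0] by (simp add: I_def)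
  have q0: "q 0 = (H01_norm \<Omega> u)\<^sup>2" by (simp add: q_def)
  have 1: "((\<lambda>s. ?E (\<lambda>x. u x + s * z x)) has_real_derivative (a + b * (H01_norm \<Omega> u)\<^sup>2) * ip \<Omega> u z - I) (at 0)"
    unfolding E using p_gt_2
    by (auto intro!: derivative_eq_intros dq d\<Phi> simp: q0 field_simps)
  have Dz: "D (\<lambda>x. s * z x) = s * D z" for s
    using D z by (simp add: H01_has_derivative_def H01_dual_def)
  have "((\<lambda>s. (?E (\<lambda>x. u x + s * z x) - ?E u) / s) \<longlongrightarrow> D z) (at 0)"
  proof (rule LIM_I)
    fix e :: real assume e: "e > 0"
    define h where "h = H01_norm \<Omega> z"
    have h: "h \<ge> 0" by (simp add: h_def H01_norm_nonneg[OF open_\<Omega>])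
    \<comment> \<open>Adding 1 to h covers directions z of norm 0.\<close>
    define \<epsilon> where "\<epsilon> = e / (2 * (h + 1))"
    have "e * h < e * (2 * (h + 1))" using e h by (intro mult_strict_left_mono) auto
    then have \<epsilon>: "\<epsilon> > 0" "\<epsilon> * h < e" using e h by (simp_all add: \<epsilon>_def pos_divide_less_eq)
    obtain \<delta> where \<delta>: "\<delta> > 0" "\<And>v. v \<in> H01 \<Omega> \<Longrightarrow> H01_norm \<Omega> v < \<delta> \<Longrightarrow>
        \<bar>?E (\<lambda>x. u x + v x) - ?E u - D v\<bar> \<le> \<epsilon> * H01_norm \<Omega> v"
      using D \<epsilon>(1) unfolding H01_has_derivative_def by blast
    show "\<exists>t>0. \<forall>s::real. s \<noteq> 0 \<and> norm (s - 0) < t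
        \<longrightarrow> norm ((?E (\<lambda>x. u x + s * z x) - ?E u) / s - D z) < e"
    proof (intro exI[of _ "\<delta> / (h + 1)"] conjI allI impI)
      show "\<delta> / (h + 1) > 0" using \<delta>(1) h by simp
      fix s :: real assume s: "s \<noteq> 0 \<and> norm (s - 0) < \<delta> / (h + 1)"
      have n: "H01_norm \<Omega> (\<lambda>x. s * z x) = \<bar>s\<bar> * h" by (simp add: h_def H01_norm_cmult[OF open_\<Omega> z])
      have "\<bar>s\<bar> * h \<le> \<bar>s\<bar> * (h + 1)" by (intro mult_left_mono) auto
      also have "\<dots> < \<delta>" using s h by (simp add: pos_less_divide_eq)
      finally have "\<bar>?E (\<lambda>x. u x + s * z x) - ?E u - s * D z\<bar> \<le> \<epsilon> * (\<bar>s\<bar> * h)"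
        using \<delta>(2)[OF H01_cmult[OF open_\<Omega> z, of s]] by (simp add: n Dz)
      moreover have "(?E (\<lambda>x. u x + s * z x) - ?E u) / s - D z = (?E (\<lambda>x. u x + s * z x) - ?E u - s * D z) / s"
        using s by (simp add: field_simps)
      ultimately have "norm ((?E (\<lambda>x. u x + s * z x) - ?E u) / s - D z) \<le> \<epsilon> * h"
        using s by (simp add: abs_divide divide_le_eq mult_ac)
      with \<epsilon>(2) show "norm ((?E (\<lambda>x. u x + s * z x) - ?E u) / s - D z) < e" by linarith
    qed
  qed
  then have 2: "((\<lambda>s. ?E (\<lambda>x. u x + s * z x)) has_real_derivative D z) (at 0)"
    by (simp add: DERIV_def)
  from DERIV_unique[OF 2 1] show ?thesis by (simp add: I_def)
qed

text \<open>Homogeneity reduces the claim to a vector of norm 1. Boundedness of f makes the supremum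
  that of a set bounded above, and settles the case of norm 0.\<close>

lemma dual_norm_bound:
  assumes f: "f \<in> H01_dual \<Omega>" and u: "u \<in> H01 \<Omega>"
  shows "\<bar>f u\<bar> \<le> dual_norm \<Omega> f * H01_norm \<Omega> u"
proof -
  have "\<exists>C. \<forall>u\<in>H01 \<Omega>. \<bar>f u\<bar> \<le> C * H01_norm \<Omega> u" using f by (simp add: H01_dual_def)
  then obtain C where C: "\<And>u. u \<in> H01 \<Omega> \<Longrightarrow> \<bar>f u\<bar> \<le> C * H01_norm \<Omega> u" by blast
  let ?n = "H01_norm \<Omega> u"
  show ?thesis
  proof (cases "?n = 0")
    case True
    then show ?thesis using C[OF u] by simp
  next
    case False
    then have n: "?n > 0" using H01_norm_nonneg[OF open_\<Omega>, of u] by linarith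
    let ?v = "\<lambda>x. (1 / ?n) * u x"
    have v: "?v \<in> H01 \<Omega>" by (intro H01_cmult open_\<Omega> u)
    have nv: "H01_norm \<Omega> ?v = 1" using n by (subst H01_norm_cmult[OF open_\<Omega> u]) simp
    have "f (\<lambda>x. c * u x) = c * f u" for c using f u by (simp add: H01_dual_def)
    from this[of "1 / ?n"] have fv: "f ?v = f u / ?n" by simp
    have "bdd_above {\<bar>f v\<bar> |v. v \<in> H01 \<Omega> \<and> H01_norm \<Omega> v \<le> 1}"
    proof (rule bdd_aboveI[of _ "\<bar>C\<bar>"])
      fix y assume "y \<in> {\<bar>f v\<bar> |v. v \<in> H01 \<Omega> \<and> H01_norm \<Omega> v \<le> 1}"
      then obtain v where v: "y = \<bar>f v\<bar>" "v \<in> H01 \<Omega>" "H01_norm \<Omega> v \<le> 1" by blast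
      have "\<bar>f v\<bar> \<le> C * H01_norm \<Omega> v" by (rule C[OF v(2)])
      also have "\<dots> \<le> \<bar>C\<bar> * 1" using v(3) H01_norm_nonneg[OF open_\<Omega>, of v] by (intro mult_mono) auto
      finally show "y \<le> \<bar>C\<bar>" using v(1) by simp
    qed
    then have "\<bar>f ?v\<bar> \<le> dual_norm \<Omega> f"
      unfolding dual_norm_def using v nv by (intro cSup_upper) auto
    then show ?thesis unfolding fv using n by (simp add: abs_divide divide_le_eq)
  qed
qed

text \<open>Coercivity bounds the sequence through its energies, and the limit v of a subsequence is
  found in L2 and then shown to lie in \<open>H01\<close>. The strict threshold enters through the
  gap \<epsilon>, which turns the final estimate into \<epsilon> ||w_n||^2 <= o(1).\<close>

theorem energy_palais_smale:
  assumes d: "CARD('n) \<ge> 4" and ab: "a > 0" "b > 0"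
    and PS: "PS_const CARD('n) (sobolev_const \<Omega>) < a powr ((real CARD('n) - 4) / 2) * b"
  shows "palais_smale \<Omega> (energy \<Omega> a b)"
  unfolding palais_smale_def
proof (intro allI impI, elim conjE)
  let ?E = "energy \<Omega> a b"
  fix U D c
  assume U': "\<forall>n. U n \<in> H01 \<Omega>" and EU: "(\<lambda>n. ?E (U n)) \<longlonglongrightarrow> c"
    and D': "\<forall>n. H01_has_derivative \<Omega> ?E (D n) (U n)" and D0: "(\<lambda>n. dual_norm \<Omega> (D n)) \<longlonglongrightarrow> 0"
  have U: "U n \<in> H01 \<Omega>" for n using U' by blast
  have D: "H01_has_derivative \<Omega> ?E (D n) (U n)" for n using D' by blast
  have K0: "K > 0" using sobolev_const_pos by simp
  have PS': "young_threshold CARD('n) K < a powr ((real CARD('n) - 4) / 2) * b"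
    using PS by (simp add: PS_const_eq[OF d sobolev_const_pos] p_def[symmetric])
  \<comment> \<open>In dimension 4 one has p = 4, so the claim reads K <= b, which the threshold
    contains.\<close>
  have "CARD('n) = 4 \<longrightarrow> 2 / p * K \<le> b / 2"
    using PS' ab by (auto simp: young_threshold_def p_def crit_exp_def)
  then obtain R where R: "\<And>u. u \<in> H01 \<Omega> \<Longrightarrow> (H01_norm \<Omega> u)\<^sup>2 \<le> max R (2 / a * ?E u)"
    using energy_coercive[OF d ab] by blast
  have "Bseq (\<lambda>n. ?E (U n))" using EU by (intro convergent_imp_Bseq convergentI)
  then obtain E0 where E0: "\<forall>n. norm (?E (U n)) \<le> E0" by (rule BseqE)
  define B where "B = sqrt (max (max R (2 / a * E0)) 0)"
  have B: "H01_norm \<Omega> (U n) \<le> B" for n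
  proof -
    have "2 / a * ?E (U n) \<le> 2 / a * E0" using spec[OF E0, of n] ab by (intro mult_left_mono) auto
    then have "(H01_norm \<Omega> (U n))\<^sup>2 \<le> max (max R (2 / a * E0)) 0" using R[OF U[of n]] by linarith
    then show ?thesis unfolding B_def by (rule real_le_rsqrt)
  qed
  obtain r v where r: "strict_mono (r :: nat \<Rightarrow> nat)" "L2 M v"
    "(\<lambda>n. L2_norm M (\<lambda>x. U (r n) x - v x)) \<longlonglongrightarrow> 0"
    by (rule rellich[of U, OF U B]) blast
  have v: "v \<in> H01 \<Omega>" by (rule bounded_L2_limit_in_H01[of "\<lambda>n. U (r n)", OF U B r(2,3)])
  obtain r' where r': "strict_mono (r' :: nat \<Rightarrow> nat)" "AE x in M. (\<lambda>n. U (r (r' n)) x) \<longlonglongrightarrow> v x"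
    "(\<lambda>n. \<Phi> (U (r (r' n))) - \<Phi> (\<lambda>x. U (r (r' n)) x - v x)) \<longlonglongrightarrow> \<Phi> v"
    by (rule brezis_lieb_subsequence[of "\<lambda>n. U (r n)", OF U B v r(3)]) blast
  define s where "s n = r (r' n)" for n
  have s: "strict_mono s" using strict_mono_o[OF r(1) r'(1)] by (simp add: s_def[abs_def] o_def)
  define V where "V n = U (s n)" for n
  define w where "w n x = V n x - v x" for n x
  have V: "V n \<in> H01 \<Omega>" and VB: "H01_norm \<Omega> (V n) \<le> B" for n by (simp_all add: V_def U B)
  have w: "w n \<in> H01 \<Omega>" for n unfolding w_def[abs_def] by (intro H01_diff open_\<Omega> V v)
  have wB: "H01_norm \<Omega> (w n) \<le> B + H01_norm \<Omega> v" for n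
    unfolding w_def[abs_def] using H01_norm_triangle_diff[OF open_\<Omega> V[of n] v] VB[of n] by linarith
  have wL: "(\<lambda>n. L2_norm M (w n)) \<longlonglongrightarrow> 0"
    using LIMSEQ_subseq_LIMSEQ[OF r(3) r'(1)] by (simp add: o_def w_def[abs_def] V_def s_def)
  define \<delta> where "\<delta> n = ip \<Omega> (w n) v" for n
  define A where "A n = (H01_norm \<Omega> (w n))\<^sup>2" for n
  define G where "G = (H01_norm \<Omega> v)\<^sup>2"
  define J where "J n = (LINT x|M. sgn_powr (p - 1) (V n x) * v x)" for n
  have \<delta>: "\<delta> \<longlonglongrightarrow> 0" unfolding \<delta>_def by (rule bounded_L2_limit_weakly[OF w wB wL v])
  have BL: "(\<lambda>n. \<Phi> (V n) - \<Phi> (w n)) \<longlonglongrightarrow> \<Phi> v"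
    using r'(3) by (simp add: V_def s_def w_def[abs_def])
  have J: "J \<longlonglongrightarrow> \<Phi> v"
    unfolding J_def[abs_def] \<Phi>_def
    by (rule sgn_powr_pairing_tendsto[OF p_gt_2 H01_measurable[OF V] H01_measurable[OF v]
          H01_powr_integrable[OF V] H01_powr_integrable[OF v] \<Phi>_bounded[OF V VB, unfolded \<Phi>_def]])
      (use r'(2) in \<open>simp add: V_def s_def\<close>)
  have A: "0 \<le> A n" "A n \<le> (B + H01_norm \<Omega> v)\<^sup>2" for n
    unfolding A_def using wB by (auto intro!: power_mono H01_norm_nonneg[OF open_\<Omega>])
  have A\<delta>: "(\<lambda>n. A n * \<delta> n) \<longlonglongrightarrow> 0"
  proof (rule Lim_null_comparison[OF _ tendsto_mult_right_zero[OF tendsto_rabs_zero[OF \<delta>], of "(B + H01_norm \<Omega> v)\<^sup>2"]])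
    have "norm (A n * \<delta> n) \<le> (B + H01_norm \<Omega> v)\<^sup>2 * \<bar>\<delta> n\<bar>" for n
      using A[of n] by (simp add: abs_mult mult_right_mono)
    then show "\<forall>\<^sub>F n in sequentially. norm (A n * \<delta> n) \<le> (B + H01_norm \<Omega> v)\<^sup>2 * \<bar>\<delta> n\<bar>" by simp
  qed
  have Dw: "(\<lambda>n. D (s n) (w n)) \<longlonglongrightarrow> 0"
  proof (rule Lim_null_comparison)
    show "(\<lambda>n. \<bar>dual_norm \<Omega> (D (s n))\<bar> * (B + H01_norm \<Omega> v)) \<longlonglongrightarrow> 0"
      using LIMSEQ_subseq_LIMSEQ[OF D0 s] by (intro tendsto_mult_left_zero tendsto_rabs_zero) (simp add: o_def)
    have "\<bar>D (s n) (w n)\<bar> \<le> \<bar>dual_norm \<Omega> (D (s n))\<bar> * (B + H01_norm \<Omega> v)" for n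
    proof -
      have "\<bar>D (s n) (w n)\<bar> \<le> dual_norm \<Omega> (D (s n)) * H01_norm \<Omega> (w n)"
        using D[of "s n"] w by (intro dual_norm_bound) (auto simp: H01_has_derivative_def)
      also have "\<dots> \<le> \<bar>dual_norm \<Omega> (D (s n))\<bar> * (B + H01_norm \<Omega> v)"
        using wB[of n] H01_norm_nonneg[OF open_\<Omega>, of "w n"] by (intro mult_mono) auto
      finally show ?thesis .
    qed
    then show "\<forall>\<^sub>F n in sequentially. norm (D (s n) (w n)) \<le> \<bar>dual_norm \<Omega> (D (s n))\<bar> * (B + H01_norm \<Omega> v)"
      by simp
  qed
  \<comment> \<open>The derivative at V n = w n + v in direction w n; the nonlinear pairing is the
    integral of |V n|^p minus the pairing J n with v.\<close>
  have Deq: "D (s n) (w n) = (a + b * (A n + 2 * \<delta> n + G)) * (A n + \<delta> n) - (\<Phi> (V n) - J n)" for n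
  proof -
    have VA: "(H01_norm \<Omega> (V n))\<^sup>2 = A n + 2 * \<delta> n + G"
      using H01_norm_power2_add[OF open_\<Omega> w[of n] v] by (simp add: A_def \<delta>_def G_def w_def)
    have "V n = (\<lambda>x. w n x + v x)" by (simp add: w_def)
    then have ipV: "ip \<Omega> (V n) (w n) = A n + \<delta> n"
      by (simp add: ip_add_left[OF open_\<Omega> w v w] ip_self[OF open_\<Omega>] A_def \<delta>_def ip_commute[OF open_\<Omega>, of v])
    have "(LINT x|M. sgn_powr (p - 1) (V n x) * w n x)
        = (LINT x|M. \<bar>V n x\<bar> powr p - sgn_powr (p - 1) (V n x) * v x)"
      by (simp add: w_def right_diff_distrib sgn_powr_mult_self)
    also have "\<dots> = \<Phi> (V n) - J n"
      unfolding \<Phi>_def J_def using p_gt_2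
      by (intro Bochner_Integration.integral_diff H01_powr_integrable V sgn_powr_mult_integrable
          H01_measurable v) auto
    finally show ?thesis
      using energy_derivative_eq[OF D U w, of "s n" n] by (simp add: V_def[symmetric] VA ipV)
  qed
  obtain \<epsilon> where \<epsilon>: "\<epsilon> > 0"
    "\<And>t. t \<ge> 0 \<Longrightarrow> K * t powr (2 / (real CARD('n) - 2)) + \<epsilon> \<le> a + b * t"
    using young_gt[OF d ab K0 PS'] by blast
  \<comment> \<open>Arranged so that \<tau> = (a + b A) A - \<Phi>(w n) + b G A holds identically:
    the vanishing cross terms are removed from the derivative, and \<Phi>(V n) - \<Phi>(w n) - J n,
    which tends to 0, is added.\<close>
  define \<tau> where "\<tau> n = D (s n) (w n) - 2 * b * (A n * \<delta> n) - (a + b * G) * \<delta> n - b * (A n * \<delta> n) - 2 * b * (\<delta> n)\<^sup>2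
      + ((\<Phi> (V n) - \<Phi> (w n)) - J n)" for n
  have "\<tau> \<longlonglongrightarrow> 0 - 2 * b * 0 - (a + b * G) * 0 - b * 0 - 2 * b * 0\<^sup>2 + (\<Phi> v - \<Phi> v)"
    unfolding \<tau>_def by (intro tendsto_intros Dw \<delta> A\<delta> BL J)
  then have \<tau>0: "\<tau> \<longlonglongrightarrow> 0" by simp
  have A\<tau>: "\<epsilon> * A n \<le> \<tau> n" for n
  proof -
    have "\<epsilon> * A n \<le> (a + b * A n - K * A n powr (2 / (real CARD('n) - 2))) * A n"
      using \<epsilon>(2)[OF A(1)[of n]] A(1)[of n] by (intro mult_right_mono) auto
    also have "\<dots> = (a + b * A n) * A n - K * H01_norm \<Omega> (w n) powr p"
      by (simp add: norm_p_split A_def[symmetric] algebra_simps)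
    also have "\<dots> \<le> (a + b * A n) * A n - \<Phi> (w n)"
      using sobolev_inequality[OF w] unfolding \<Phi>_def by simp
    \<comment> \<open>The nonnegative coupling of w n and v from the quartic term is restored, since
      \<tau> contains it.\<close>
    also have "\<dots> \<le> (a + b * A n) * A n - \<Phi> (w n) + b * (G * A n)" using ab A(1)[of n] by (simp add: G_def)
    also have "\<dots> = \<tau> n" unfolding \<tau>_def Deq by (simp add: algebra_simps power2_eq_square)
    finally show ?thesis .
  qed
  have "A \<longlonglongrightarrow> 0"
  proof (rule Lim_null_comparison[OF _ tendsto_divide_zero[OF \<tau>0, of \<epsilon>]])
    have "norm (A n) \<le> \<tau> n / \<epsilon>" for n
      using A\<tau>[of n] A(1)[of n] \<epsilon>(1) by (simp add: le_divide_eq mult.commute)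
    then show "\<forall>\<^sub>F n in sequentially. norm (A n) \<le> \<tau> n / \<epsilon>" by simp
  qed
  from tendsto_real_sqrt[OF this] have "(\<lambda>n. H01_norm \<Omega> (w n)) \<longlonglongrightarrow> 0"
    by (simp add: A_def H01_norm_nonneg[OF open_\<Omega>])
  then have "strongly_converges \<Omega> (\<lambda>k. U (s k)) v"
    using U v by (simp add: strongly_converges_def w_def[abs_def] V_def)
  with s show "\<exists>r u. strict_mono (r :: nat \<Rightarrow> nat) \<and> strongly_converges \<Omega> (\<lambda>k. U (r k)) u" by blast
qed

end

theorem theorem1p1:
  fixes \<Omega> :: "(real ^ 'n) set" and a b :: real
  assumes "CARD('n) \<ge> 4"
    and "open \<Omega>" and "bounded \<Omega>" and "connected \<Omega>" and "\<Omega> \<noteq> {}"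
    and "a > 0" and "b > 0"
  shows
    "(seq_weakly_lsc \<Omega> (energy \<Omega> a b) \<longleftrightarrow>
        a powr ((real CARD('n) - 4) / 2) * b \<ge> L_const CARD('n) (sobolev_const \<Omega>))
     \<and> (a powr ((real CARD('n) - 4) / 2) * b > PS_const CARD('n) (sobolev_const \<Omega>) \<longrightarrow>
        palais_smale \<Omega> (energy \<Omega> a b))
     \<and> (a powr ((real CARD('n) - 4) / 2) * b \<ge> C_const CARD('n) (sobolev_const \<Omega>) \<longrightarrow>
        convex_functional \<Omega> (energy \<Omega> a b))
     \<and> (a powr ((real CARD('n) - 4) / 2) * b > C_const CARD('n) (sobolev_const \<Omega>) \<longrightarrow>
        strictly_convex_functional \<Omega> (energy \<Omega> a b))"
proof -
  interpret critical_domain \<Omega> "crit_exp CARD('n)"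
    using assms by unfold_locales auto
  note * = assms(1,6,7)
  have "seq_weakly_lsc \<Omega> (energy \<Omega> a b) \<longleftrightarrow>
      L_const CARD('n) (sobolev_const \<Omega>) \<le> a powr ((real CARD('n) - 4) / 2) * b"
    using energy_weakly_lsc[OF *] energy_not_weakly_lsc[OF *] not_le by blast
  then show ?thesis
    using energy_palais_smale[OF *] energy_convex[OF *] energy_strictly_convex[OF *] by blast
qed

end
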